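(* Let $k\in\mathbb{N}$, $r\in\mathbb{N}_0$ and $1\le p\le\infty$. There exist positive constants $c_1,c_2$, depending only on $k$, $r$ and $p$, such that for every $f\in\mathbb{B}^r_p$ and all $0<t\le 2/k$, $$c_1\,K^\varphi_{k,r}(f^{(r)},t^k)_p\;\le\;\omega^{*\varphi}_{k,r}(f^{(r)},t)_p\;\le\;\omega^{\varphi}_{k,r}(f^{(r)},t)_p\;\le\; c_2\,K^\varphi_{k,r}(f^{(r)},t^k)_p .$$
   Context: Notation. $\mathbb{N}=\{1,2,\dots\}$, $\mathbb{N}_0=\mathbb{N}\cup\{0\}$, $\|\cdot\|_p=\|\cdot\|_{L_p[-1,1]}$, $\varphi(x)=\sqrt{1-x^2}$. Function classes: $\mathbb{B}_p^0=L_p[-1,1]$, and for $r\ge1$, $\mathbb{B}_p^r$ is the set of functions $f$ such that $f^{(r-1)}$ is locally absolutely continuous in $(-1,1)$ and $\|f^{(r)}\varphi^r\|_p<\infty$. Symmetric difference: for $h\ge0$, $\Delta_h^k(g,x)=\sum_{i=0}^k\binom{k}{i}(-1)^{k-i}g(x+(i-k/2)h)$ if $x\pm kh/2\in[-1,1]$, and $\Delta_h^k(g,x)=0$ otherwise. For $\delta>0$: $\mathfrak{D}_\delta=\{x: 1-\delta\varphi(x)/2\ge|x|\}\setminus\{\pm1\}=\{x:|x|\le (4-\delta^2)/(4+\delta^2)\}$ (empty if $\delta>2$), and $\mathcal{W}_\delta(x)=\bigl((1-x-\delta\varphi(x)/2)(1+x-\delta\varphi(x)/2)\bigr)^{1/2}$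 for $x\in\mathfrak{D}_\delta$. Modulus of smoothness: for $f\in\mathbb{B}_p^r$, $$\omega^\varphi_{k,r}(f^{(r)},t)_p=\sup_{0<h\le t}\bigl\|\mathcal{W}^r_{kh}(\cdot)\,\Delta^k_{h\varphi(\cdot)}(f^{(r)},\cdot)\bigr\|_{L_p(\mathfrak{D}_{kh})}.$$ Averaged modulus: for $1\le p<\infty$, $$\omega^{*\varphi}_{k,r}(f^{(r)},t)_p=\left(\frac1t\int_0^t\int_{\mathfrak{D}_{k\tau}}\bigl|\mathcal{W}^r_{k\tau}(x)\Delta^k_{\tau\varphi(x)}(f^{(r)},x)\bigr|^p\,dx\,d\tau\right)^{1/p},$$ and $\omega^{*\varphi}_{k,r}(f^{(r)},t)_\infty=\omega^{\varphi}_{k,r}(f^{(r)},t)_\infty$. $K$-functional: for $f\in\mathbb{B}_p^r$, $$K^\varphi_{k,r}(f^{(r)},t^k)_p=\inf_{g\in\mathbb{B}_p^{k+r}}\bigl(\|(f^{(r)}-g^{(r)})\varphi^r\|_p+t^k\|g^{(k+r)}\varphi^{k+r}\|_p\bigr).$$ *)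

theory Defs
  imports "HOL-Analysis.Analysis" "HOL-Probability.Essential_Supremum"
begin

text \<open>
  Functions on \<open>[-1,1]\<close> are represented by total functions of type \<^typ>\<open>real \<Rightarrow> real\<close>; values
  outside \<open>[-1,1]\<close> play no role (through \<^const>\<open>deriv\<close> they could only affect the points \<open>\<plusminus>1\<close>,
  a null set).  Norms, moduli and K-functionals take values in \<^typ>\<open>ennreal\<close>, and
  so does the exponent \<open>p\<close>, with \<open>p = \<infinity>\<close> allowed.  The derivative \<open>f\<^sup>(\<^sup>r\<^sup>)\<close> is \<open>(deriv ^^ r) f\<close>.
  If \<open>f\<^sup>(\<^sup>r\<^sup>-\<^sup>1\<^sup>)\<close> is only locally absolutely continuous, \<open>f\<^sup>(\<^sup>r\<^sup>)\<close> exists almost everywhere; at the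
  remaining points, which form a null set, \<^const>\<open>deriv\<close> returns an unspecified value.
\<close>

definition ennreal_powr :: "ennreal \<Rightarrow> real \<Rightarrow> ennreal" where
  "ennreal_powr x a = (if x = \<infinity> then \<infinity> else ennreal (enn2real x powr a))"

definition Lp_norm :: "ennreal \<Rightarrow> real set \<Rightarrow> (real \<Rightarrow> real) \<Rightarrow> ennreal" where
  "Lp_norm p A g =
     (if p = \<infinity> then esssup (lebesgue_on A) (\<lambda>x. ennreal \<bar>g x\<bar>)
      else ennreal_powr (\<integral>\<^sup>+x. ennreal (\<bar>g x\<bar> powr enn2real p) \<partial>lebesgue_on A) (1 / enn2real p))"

definition Lp_space :: "ennreal \<Rightarrow> real set \<Rightarrow> (real \<Rightarrow> real) set" where
  "Lp_space p A = {g \<in> borel_measurable (lebesgue_on A). Lp_norm p A g < \<infinity>}"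

definition abs_continuous_on :: "real \<Rightarrow> real \<Rightarrow> (real \<Rightarrow> real) \<Rightarrow> bool" where
  "abs_continuous_on a b F \<longleftrightarrow>
     (\<forall>\<epsilon>>0. \<exists>\<delta>>0. \<forall>(n::nat) (u::nat \<Rightarrow> real) (v::nat \<Rightarrow> real).
        (\<forall>i<n. a \<le> u i \<and> u i \<le> v i \<and> v i \<le> b) \<longrightarrow>
        disjoint_family_on (\<lambda>i. {u i<..<v i}) {..<n} \<longrightarrow>
        (\<Sum>i<n. v i - u i) < \<delta> \<longrightarrow>
        (\<Sum>i<n. \<bar>F (v i) - F (u i)\<bar>) < \<epsilon>)"

definition locally_abs_continuous :: "(real \<Rightarrow> real) \<Rightarrow> bool" where
  "locally_abs_continuous F \<longleftrightarrow> (\<forall>a b. -1 < a \<longrightarrow> a \<le> b \<longrightarrow> b < 1 \<longrightarrow> abs_continuous_on a b F)"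

definition \<phi> :: "real \<Rightarrow> real" where
  "\<phi> x = sqrt (1 - x\<^sup>2)"

text \<open>
  For \<open>r \<ge> 1\<close> the first conjunct says that \<open>f\<^sup>(\<^sup>r\<^sup>-\<^sup>1\<^sup>)\<close> genuinely exists throughout \<open>(-1,1)\<close>.
\<close>

definition B_class :: "ennreal \<Rightarrow> nat \<Rightarrow> (real \<Rightarrow> real) set" where
  "B_class p r =
     (if r = 0 then Lp_space p {-1..1}
      else {f. (\<forall>j < r - 1. \<forall>x\<in>{-1<..<1}. (deriv ^^ j) f field_differentiable at x) \<and>
               locally_abs_continuous ((deriv ^^ (r - 1)) f) \<and>
               (\<lambda>x. (deriv ^^ r) f x * \<phi> x ^ r) \<in> Lp_space p {-1..1}})"

definition sym_diff :: "nat \<Rightarrow> real \<Rightarrow> (real \<Rightarrow> real) \<Rightarrow> real \<Rightarrow> real" where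
  "sym_diff k h g x =
     (if x + real k * h / 2 \<in> {-1..1} \<and> x - real k * h / 2 \<in> {-1..1}
      then (\<Sum>i=0..k. real (k choose i) * (-1) ^ (k - i) * g (x + (real i - real k / 2) * h))
      else 0)"

text \<open>
  The restriction to \<open>[-1,1]\<close> is needed because \<^const>\<open>sqrt\<close> is total: \<^const>\<open>\<phi>\<close> is negative
  outside \<open>[-1,1]\<close>.
\<close>

definition D_set :: "real \<Rightarrow> real set" where
  "D_set \<delta> = {x \<in> {-1..1}. 1 - \<delta> * \<phi> x / 2 \<ge> \<bar>x\<bar>} - {-1, 1}"

lemma D_set_eq:
  assumes "\<delta> > 0"
  shows "D_set \<delta> = {x. \<bar>x\<bar> \<le> (4 - \<delta>\<^sup>2) / (4 + \<delta>\<^sup>2)}"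
proof -
  have pos: "4 + \<delta>\<^sup>2 > 0"
    using zero_le_power2[of \<delta>] by linarith
  have lt1: "(4 - \<delta>\<^sup>2) / (4 + \<delta>\<^sup>2) < 1"
    using pos assms by (simp add: divide_less_eq)
  have key: "1 - \<delta> * \<phi> x / 2 \<ge> \<bar>x\<bar> \<longleftrightarrow> \<bar>x\<bar> \<le> (4 - \<delta>\<^sup>2) / (4 + \<delta>\<^sup>2)" if x: "\<bar>x\<bar> < 1" for x
  proof -
    have sq: "1 - x\<^sup>2 = (1 - \<bar>x\<bar>) * (1 + \<bar>x\<bar>)"
      by (simp add: algebra_simps flip: power2_eq_square)
    have x2: "1 - x\<^sup>2 \<ge> 0"
      using x by (simp add: sq)
    have "1 - \<delta> * \<phi> x / 2 \<ge> \<bar>x\<bar> \<longleftrightarrow> \<delta> * \<phi> x \<le> 2 * (1 - \<bar>x\<bar>)"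
      by (auto simp: field_simps)
    also have "\<dots> \<longleftrightarrow> (\<delta> * \<phi> x)\<^sup>2 \<le> (2 * (1 - \<bar>x\<bar>))\<^sup>2"
      using x x2 assms by (subst power_mono_iff) (auto simp: \<phi>_def)
    also have "\<dots> \<longleftrightarrow> (1 - \<bar>x\<bar>) * (\<delta>\<^sup>2 * (1 + \<bar>x\<bar>)) \<le> (1 - \<bar>x\<bar>) * (4 * (1 - \<bar>x\<bar>))"
    proof -
      have "(\<delta> * \<phi> x)\<^sup>2 = (1 - \<bar>x\<bar>) * (\<delta>\<^sup>2 * (1 + \<bar>x\<bar>))"
        unfolding \<phi>_def power_mult_distrib real_sqrt_pow2[OF x2] unfolding sq by (simp only: ac_simps)
      moreover have "(2 * (1 - \<bar>x\<bar>))\<^sup>2 = (1 - \<bar>x\<bar>) * (4 * (1 - \<bar>x\<bar>))"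
        by algebra
      ultimately show ?thesis by simp
    qed
    also have "\<dots> \<longleftrightarrow> \<delta>\<^sup>2 * (1 + \<bar>x\<bar>) \<le> 4 * (1 - \<bar>x\<bar>)"
      using x by (subst mult_le_cancel_left_pos) auto
    also have "\<dots> \<longleftrightarrow> \<bar>x\<bar> \<le> (4 - \<delta>\<^sup>2) / (4 + \<delta>\<^sup>2)"
      using pos by (simp add: le_divide_eq algebra_simps)
    finally show ?thesis .
  qed
  have "x \<in> D_set \<delta> \<longleftrightarrow> \<bar>x\<bar> < 1 \<and> 1 - \<delta> * \<phi> x / 2 \<ge> \<bar>x\<bar>" for x
    unfolding D_set_def by auto
  then show ?thesis
    using key lt1 by force
qed

definition W :: "real \<Rightarrow> real \<Rightarrow> real" where
  "W \<delta> x = sqrt ((1 - x - \<delta> * \<phi> x / 2) * (1 + x - \<delta> * \<phi> x / 2))"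

text \<open>
  In the moduli and in the K-functional the argument \<open>F\<close> is the derivative \<open>f\<^sup>(\<^sup>r\<^sup>)\<close>, and the
  argument \<open>s\<close> of the K-functional is \<open>t\<^sup>k\<close>.
\<close>

definition modulus :: "nat \<Rightarrow> nat \<Rightarrow> ennreal \<Rightarrow> (real \<Rightarrow> real) \<Rightarrow> real \<Rightarrow> ennreal" where
  "modulus k r p F t =
     (SUP h\<in>{0<..t}. Lp_norm p (D_set (real k * h))
        (\<lambda>x. W (real k * h) x ^ r * sym_diff k (h * \<phi> x) F x))"

definition averaged_modulus :: "nat \<Rightarrow> nat \<Rightarrow> ennreal \<Rightarrow> (real \<Rightarrow> real) \<Rightarrow> real \<Rightarrow> ennreal" where
  "averaged_modulus k r p F t =
     (if p = \<infinity> then modulus k r \<infinity> F t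
      else ennreal_powr
        (ennreal (1 / t) *
           (\<integral>\<^sup>+\<tau>\<in>{0..t}.
              (\<integral>\<^sup>+x\<in>D_set (real k * \<tau>).
                 ennreal (\<bar>W (real k * \<tau>) x ^ r * sym_diff k (\<tau> * \<phi> x) F x\<bar> powr enn2real p)
               \<partial>lebesgue)
            \<partial>lebesgue))
        (1 / enn2real p))"

definition K_functional :: "nat \<Rightarrow> nat \<Rightarrow> ennreal \<Rightarrow> (real \<Rightarrow> real) \<Rightarrow> real \<Rightarrow> ennreal" where
  "K_functional k r p F s =
     (INF g\<in>B_class p (k + r).
        Lp_norm p {-1..1} (\<lambda>x. (F x - (deriv ^^ r) g x) * \<phi> x ^ r) +
        ennreal s * Lp_norm p {-1..1} (\<lambda>x. (deriv ^^ (k + r)) g x * \<phi> x ^ (k + r)))"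

end

theory Submission
  imports Defs
begin

text \<open>
  The norm estimates come from inequalities \<open>\<integral> \<theta> (|u| / C) \<le> C' \<integral> \<theta> (|v|)\<close> valid for all convex increasing
  \<open>\<theta>\<close> that vanish on the negative axis.  Taking \<open>\<theta> s = s\<^sup>q\<close> gives the \<open>L\<^sub>q\<close> estimate, taking
  \<open>\<theta> s = max 0 (s - a)\<close> the essential supremum estimate, so that one construction serves all \<open>p\<close>.

  Upper bound: differences of \<open>f\<^sup>(\<^sup>r\<^sup>) - g\<^sup>(\<^sup>r\<^sup>)\<close> are bounded by its values at the points
  \<open>x + c \<phi>(x)\<close>, \<open>|c| \<le> k h / 2\<close>, and by Taylor's formula those of \<open>g\<^sup>(\<^sup>r\<^sup>)\<close> by weighted averages of
  \<open>g\<^sup>(\<^sup>k\<^sup>+\<^sup>r\<^sup>)\<close> over such points.  There \<open>W(x) \<le> \<phi>(x + c \<phi>(x))\<close>, and the substitution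
  \<open>x \<mapsto> x + c \<phi>(x)\<close> has Jacobian at least \<open>1/2\<close> on \<open>D_set (k h)\<close>.

  Lower bound: \<open>[-1,1]\<close> is cut by the knots \<open>\<plusminus>(1 - (j/n)\<^sup>2)\<close>, \<open>1/n\<close> comparable to \<open>t\<close>, into cells of length
  comparable to \<open>\<phi>/n\<close>.  On each pair of neighbouring cells a polynomial of degree less than \<open>k\<close>
  approximates \<open>F = f\<^sup>(\<^sup>r\<^sup>)\<close> up to averages of differences.  The nodes of these differences lie on the side
  of the approximated point that faces away from the endpoint, so that the weight \<open>W\<close> at their centres is
  at least a multiple of \<open>\<phi>\<close> at that point.
  Blending neighbouring polynomials with a \<open>C\<^sup>k\<close> step gives a function whose \<open>r\<close>-fold antiderivative is
  admissible in the K-functional.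
\<close>

section \<open>Absolutely continuous functions\<close>

text \<open>The competitors in the K-functional only have a locally absolutely continuous derivative
  of order \<open>k + r - 1\<close>. Taylor's formula for them needs that absolutely continuous
  functions are differentiable almost everywhere and are integrals of their derivatives; both facts
  are drawn from Vitali coverings.

  In the lower bound, for finite p, no single difference is under control, only means over step and
  position. The local polynomial comes from an averaging identity: \<open>fdiff k u f y\<close> is
  integrated over the step u against a B-spline density. The node y itself contributes a multiple of
  f(y), and every other node contributes a k-th difference of a k-fold antiderivative of f, taken on
  one side of y. Such a difference is a polynomial of degree less than k plus a remainder made of
  k-th differences of f. All errors are thus means of differences, and Jensen's inequality and
  Fubini's theorem apply to them.\<close>

abbreviation disjoint_open :: "(real \<times> real) set \<Rightarrow> bool" where
  "disjoint_open \<equiv> pairwise (\<lambda>I J. disjnt {fst I<..<snd I} {fst J<..<snd J})"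

abbreviation disjoint_closed :: "(real \<times> real) set \<Rightarrow> bool" where
  "disjoint_closed \<equiv> pairwise (\<lambda>I J. disjnt {fst I..snd I} {fst J..snd J})"

text \<open>Vitali's theorem gives a countable disjoint subfamily that covers E up to a null set.
  Since E has finite measure, continuity from above shows that finitely many of its intervals leave
  less than e uncovered.\<close>

lemma finite_Vitali_cover:
  fixes E O' :: "real set" and P :: "real \<Rightarrow> real \<Rightarrow> bool"
  assumes E: "E \<in> lmeasurable" and "open O'" "E \<subseteq> O'" "e > 0"
    and cov: "\<And>x d. x \<in> E \<Longrightarrow> d > 0 \<Longrightarrow> \<exists>u v. u < v \<and> u \<le> x \<and> x \<le> v \<and> v - u < d \<and> P u v"
  shows "\<exists>D. finite D \<and> (\<forall>(u,v)\<in>D. u < v \<and> {u..v} \<subseteq> O' \<and> P u v) \<and>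
      disjoint_closed D \<and> measure lebesgue (E - (\<Union>I\<in>D. {fst I..snd I})) < e"
proof -
  define K where "K = {(u,v). u < v \<and> {u..v} \<subseteq> O' \<and> P u v}"
  \<comment> \<open>Intervals are encoded by midpoint and half-length because the covering theorem
    is about closed balls.\<close>
  define a where "a = (\<lambda>(u::real,v). (u+v)/2)"
  define r where "r = (\<lambda>(u::real,v). (v-u)/2)"
  have cb: "cball (a I) (r I) = {fst I..snd I}" for I
    by (cases I) (auto simp: a_def r_def cball_eq_atLeastAtMost field_simps)
  have r: "0 < r i" if "i \<in> K" for i using that by (auto simp: K_def r_def)
  have S: "\<exists>i. i \<in> K \<and> x \<in> cball (a i) (r i) \<and> r i < d" if "x \<in> E" and d0: "0 < d" for x d
  proof -
    obtain \<epsilon> where \<epsilon>: "\<epsilon> > 0" "ball x \<epsilon> \<subseteq> O'" using \<open>open O'\<close> \<open>E \<subseteq> O'\<close> \<open>x \<in> E\<close>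
      by (meson openE subsetD)
    obtain u v where uv: "u < v" "u \<le> x" "x \<le> v" "v - u < min d \<epsilon>" "P u v" using cov[OF \<open>x \<in> E\<close>, of "min d \<epsilon>"] \<epsilon> d0 by auto
    have "{u..v} \<subseteq> ball x \<epsilon>" using uv by (auto simp: dist_real_def)
    then have "(u,v) \<in> K" using uv \<epsilon> by (auto simp: K_def)
    moreover have "r (u,v) < d" using uv by (auto simp: r_def)
    moreover have "x \<in> cball (a (u,v)) (r (u,v))" unfolding cb using uv by auto
    ultimately show ?thesis by blast
  qed
  obtain C where C: "countable C" "C \<subseteq> K"
     "pairwise (\<lambda>i j. disjnt (cball (a i) (r i)) (cball (a j) (r j))) C"
     "negligible (E - (\<Union>i \<in> C. cball (a i) (r i)))"
    by (rule Vitali_covering_theorem_cballs[of K r E a, OF r S]) blast+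
  show ?thesis
  proof (cases "C = {}")
    case True
    then have "negligible E" using C(4) by simp
    then show ?thesis using \<open>e > 0\<close> by (intro exI[of _ "{}"]) (auto simp: negligible_imp_measure0)
  next
    case False
    define f where "f = from_nat_into C"
    have rf: "range f = C" unfolding f_def using C(1) False by (simp add: range_from_nat_into)
    define T where "T n = E - (\<Union>i\<in>f ` {..n}. {fst i..snd i})" for n :: nat
    have Tm: "T n \<in> lmeasurable" for n unfolding T_def using E by (intro fmeasurable_Diff) auto
    have "(\<Inter>n. T n) \<subseteq> E - (\<Union>i \<in> C. cball (a i) (r i))" unfolding T_def cb rf[symmetric] by (auto simp: image_iff)
    then have neg: "negligible (\<Inter>n. T n)" using C(4) negligible_subset by blast
    have "(\<lambda>n. measure lebesgue (T n)) \<longlonglongrightarrow> measure lebesgue (\<Inter>n. T n)"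
    proof (rule Lim_measure_decseq)
      show "range T \<subseteq> sets lebesgue" using Tm by (auto dest: fmeasurableD)
      show "decseq T" unfolding decseq_def T_def by (intro allI impI Diff_mono UN_mono image_mono) auto
      show "emeasure lebesgue (T i) \<noteq> \<infinity>" for i using Tm[of i] unfolding fmeasurable_def by auto
    qed
    then have "(\<lambda>n. measure lebesgue (T n)) \<longlonglongrightarrow> 0" using neg by (simp add: negligible_imp_measure0)
    then have "\<forall>\<^sub>F n in sequentially. measure lebesgue (T n) < e" using \<open>e > 0\<close> by (rule order_tendstoD)
    then obtain n where n: "measure lebesgue (T n) < e" by (auto simp: eventually_sequentially)
    have sub: "f ` {..n} \<subseteq> C" using rf by auto
    show ?thesis
    proof (intro exI[of _ "f ` {..n}"] conjI)
      show "\<forall>(u, v)\<in>f ` {..n}. u < v \<and> {u..v} \<subseteq> O' \<and> P u v" using sub C(2) unfolding K_def by blast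
      show "disjoint_closed (f ` {..n})"
        using C(3) sub unfolding cb by (rule pairwise_subset)
    qed (use n in \<open>auto simp: T_def\<close>)
  qed
qed


text \<open>Vitali coverings come as finite sets of intervals, while absolute continuity quantifies
  over indexed families; an enumeration of D translates between the two.\<close>

lemma abs_continuous_on_finite_set:
  assumes "abs_continuous_on a b F" "e > 0"
  shows "\<exists>d>0. \<forall>D. finite D \<longrightarrow> (\<forall>(u,v)\<in>D. a \<le> u \<and> u \<le> v \<and> v \<le> b) \<longrightarrow>
     disjoint_open D \<longrightarrow> (\<Sum>(u,v)\<in>D. v - u) < d \<longrightarrow>
     (\<Sum>(u,v)\<in>D. \<bar>F v - F u\<bar>) < e"
proof -
  from assms(1)[unfolded abs_continuous_on_def, rule_format, OF assms(2)]
  obtain d where d: "d > 0" and dd: "\<forall>(n::nat) (u::nat \<Rightarrow> real) (v::nat \<Rightarrow> real).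
        (\<forall>i<n. a \<le> u i \<and> u i \<le> v i \<and> v i \<le> b) \<longrightarrow>
        disjoint_family_on (\<lambda>i. {u i<..<v i}) {..<n} \<longrightarrow>
        (\<Sum>i<n. v i - u i) < d \<longrightarrow> (\<Sum>i<n. \<bar>F (v i) - F (u i)\<bar>) < e"
    by (elim exE conjE) (rule that)
  note * = dd[THEN spec, THEN spec, THEN spec, THEN mp, THEN mp, THEN mp]
  show ?thesis
  proof (intro exI conjI allI impI, rule d)
    fix D :: "(real \<times> real) set"
    assume D: "finite D" "\<forall>(u,v)\<in>D. a \<le> u \<and> u \<le> v \<and> v \<le> b"
     "disjoint_open D" "(\<Sum>(u,v)\<in>D. v - u) < d"
    obtain g where g: "bij_betw g {..<card D} D" using D(1) by (metis bij_betw_from_nat_into_finite)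
    have gD: "g i \<in> D" if "i < card D" for i using g that by (auto simp: bij_betw_def)
    have s: "(\<Sum>i<card D. h (g i)) = sum h D" for h :: "_ \<Rightarrow> real"
      using sum.reindex_bij_betw[OF g] by simp
    have "(\<Sum>i<card D. \<bar>F (snd (g i)) - F (fst (g i))\<bar>) < e"
    proof (rule *)
      show "\<forall>i<card D. a \<le> fst (g i) \<and> fst (g i) \<le> snd (g i) \<and> snd (g i) \<le> b"
        using D(2) gD by (auto simp: split_beta)
      show "disjoint_family_on (\<lambda>i. {fst (g i)<..<snd (g i)}) {..<card D}"
        unfolding disjoint_family_on_def
      proof (intro ballI impI)
        fix m n assume "m \<in> {..<card D}" "n \<in> {..<card D}" "m \<noteq> n"
        then have "g m \<noteq> g n" using g by (auto simp: bij_betw_def inj_on_def)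
        then show "{fst (g m)<..<snd (g m)} \<inter> {fst (g n)<..<snd (g n)} = {}"
          using D(3) gD \<open>m \<in> _\<close> \<open>n \<in> _\<close> by (auto simp: pairwise_def disjnt_def)
      qed
      show "(\<Sum>i<card D. snd (g i) - fst (g i)) < d" using D(4) s[of "\<lambda>(u,v). v - u"] by (simp add: split_beta)
    qed
    then show "(\<Sum>(u,v)\<in>D. \<bar>F v - F u\<bar>) < e" using s[of "\<lambda>(u,v). \<bar>F v - F u\<bar>"] by (simp add: split_beta)
  qed
qed

text \<open>Induction that removes the rightmost interval and adds the gap behind it. One family of
  gaps serves every F: applied to the identity it measures the gaps, applied to the function under
  study it accounts for the increments.\<close>

lemma complementary_intervals:
  fixes u v :: real
  assumes "finite D" "\<forall>(x,y)\<in>D. u \<le> x \<and> x < y \<and> y \<le> v" "u \<le> v"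
    "disjoint_closed D"
  shows "\<exists>G. finite G \<and> (\<forall>(x,y)\<in>G. u \<le> x \<and> x \<le> y \<and> y \<le> v) \<and>
     disjoint_open G \<and>
     (\<forall>F::real\<Rightarrow>real. F v - F u = (\<Sum>(x,y)\<in>D. F y - F x) + (\<Sum>(x,y)\<in>G. F y - F x))"
  using assms
proof (induction "card D" arbitrary: D v)
  case 0
  then show ?case by (intro exI[of _ "{(u,v)}"]) (auto simp: pairwise_def)
next
  case (Suc n)
  have ne: "fst ` D \<noteq> {}" using Suc.hyps(2) by auto
  define m where "m = Max (fst ` D)"
  have "m \<in> fst ` D" unfolding m_def using ne Suc.prems(1) by (intro Max_in) auto
  then obtain y where y: "(m,y) \<in> D" by force
  have m: "fst I \<le> m" if "I \<in> D" for I unfolding m_def using that Suc.prems(1) by auto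
  let ?D = "D - {(m,y)}"
  have below: "b \<le> m" if "(a,b) \<in> ?D" for a b
  proof (rule ccontr)
    assume "\<not> b \<le> m"
    have "a \<le> m" using m that by force
    then have "m \<in> {a..b} \<inter> {m..y}" using \<open>\<not> b \<le> m\<close> y Suc.prems(2) by auto
    moreover have "disjnt {a..b} {m..y}" using Suc.prems(4) y that unfolding pairwise_def by fastforce
    ultimately show False by (auto simp: disjnt_def)
  qed
  have my: "u \<le> m" "m < y" "y \<le> v" using y Suc.prems(2) by auto
  have "\<exists>G. finite G \<and> (\<forall>(x,y)\<in>G. u \<le> x \<and> x \<le> y \<and> y \<le> m) \<and>
     disjoint_open G \<and>
     (\<forall>F::real\<Rightarrow>real. F m - F u = (\<Sum>(x,y)\<in>?D. F y - F x) + (\<Sum>(x,y)\<in>G. F y - F x))"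
  proof (rule Suc.hyps(1))
    show "n = card ?D" using Suc.hyps(2) y Suc.prems(1) by simp
    show "\<forall>(x,y)\<in>?D. u \<le> x \<and> x < y \<and> y \<le> m" using Suc.prems(2) below by fastforce
    show "disjoint_closed ?D"
      using Suc.prems(4) by (rule pairwise_subset) auto
  qed (use Suc.prems my in auto)
  then obtain G where G: "finite G" "\<forall>(x,y)\<in>G. u \<le> x \<and> x \<le> y \<and> y \<le> m"
     "disjoint_open G"
     "\<forall>F::real\<Rightarrow>real. F m - F u = (\<Sum>(x,y)\<in>?D. F y - F x) + (\<Sum>(x,y)\<in>G. F y - F x)" by blast
  have yG: "(y,v) \<notin> G" using G(2) my by auto
  show ?case
  proof (intro exI[of _ "insert (y,v) G"] conjI allI)
    show "\<forall>(x, ya)\<in>insert (y, v) G. u \<le> x \<and> x \<le> ya \<and> ya \<le> v" using G(2) my by fastforce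
    show "disjoint_open (insert (y, v) G)"
      unfolding pairwise_insert using G(2,3) my by (fastforce simp: disjnt_def)
    fix F :: "real \<Rightarrow> real"
    have "(\<Sum>(x,y)\<in>D. F y - F x) = (F y - F m) + (\<Sum>(x,y)\<in>?D. F y - F x)"
      using sum.remove[OF Suc.prems(1) y, of "\<lambda>(x,y). F y - F x"] by simp
    moreover have "(\<Sum>(x,y)\<in>insert (y,v) G. F y - F x) = (F v - F y) + (\<Sum>(x,y)\<in>G. F y - F x)"
      using G(1) yG by simp
    ultimately show "F v - F u = (\<Sum>(x,y)\<in>D. F y - F x) + (\<Sum>(x,y)\<in>insert (y,v) G. F y - F x)"
      using G(4)[rule_format, of F] by simp
  qed (use G in auto)
qed

text \<open>
  The points at which, in every neighbourhood, \<open>F\<close> has a chord of slope greater than \<open>q\<close> across the point.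
  If \<open>F\<close> is not differentiable at \<open>x\<close>, then \<open>x\<close> lies in \<open>steep_set a b F q \<inter> steep_set a b (-F) (-p)\<close>
  for some rationals \<open>p < q\<close>, or in the steep sets of \<open>F\<close>, or of \<open>-F\<close>, for all slopes.
\<close>
definition steep_set :: "real \<Rightarrow> real \<Rightarrow> (real \<Rightarrow> real) \<Rightarrow> real \<Rightarrow> real set" where
  "steep_set a b F q = {x \<in> {a<..<b}. \<forall>d>0. \<exists>u v. a < u \<and> u < x \<and> x < v \<and> v < b \<and> v - u < d \<and> q * (v - u) < F v - F u}"

text \<open>The chords straddle the point strictly, so a small move of the point keeps them
  admissible: the set is the intersection of \<open>{a<..<b}\<close> with countably many open
  sets.\<close>

lemma steep_set_measurable: "steep_set a b F q \<in> lmeasurable"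
proof -
  define U where "U n = \<Union>{{u<..<v} | u v. a < u \<and> v < b \<and> v - u < 1 / Suc n \<and> q * (v - u) < F v - F u}" for n :: nat
  have "open (U n)" for n unfolding U_def by auto
  have "steep_set a b F q = {a<..<b} \<inter> (\<Inter>n. U n)"
  proof (intro equalityI subsetI)
    fix x assume x: "x \<in> steep_set a b F q"
    have "x \<in> U n" for n
    proof -
      have "1 / real (Suc n) > 0" by simp
      then obtain u v where "a < u" "u < x" "x < v" "v < b" "v - u < 1 / Suc n" "q * (v - u) < F v - F u"
        using x unfolding steep_set_def by blast
      then show ?thesis unfolding U_def by (intro UnionI[of "{u<..<v}"]) auto
    qed
    then show "x \<in> {a<..<b} \<inter> (\<Inter>n. U n)" using x by (auto simp: steep_set_def)
  next
    fix x assume x: "x \<in> {a<..<b} \<inter> (\<Inter>n. U n)"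
    have "\<exists>u v. a < u \<and> u < x \<and> x < v \<and> v < b \<and> v - u < d \<and> q * (v - u) < F v - F u" if "d > 0" for d
    proof -
      obtain n where n: "1 / Suc n < d" using \<open>d > 0\<close> nat_approx_posE by blast
      have "x \<in> U n" using x by auto
      then obtain u v where "a < u" "u < x" "x < v" "v < b" "v - u < 1 / Suc n" "q * (v - u) < F v - F u"
        unfolding U_def by auto
      then show ?thesis using n by (intro exI[of _ u] exI[of _ v]) auto
    qed
    then show "x \<in> steep_set a b F q" using x by (auto simp: steep_set_def)
  qed
  then have "steep_set a b F q \<in> sets lebesgue" using \<open>\<And>n. open (U n)\<close> by auto
  moreover have "bounded (steep_set a b F q)" by (rule bounded_subset[of "{a<..<b}"]) (auto simp: steep_set_def)
  ultimately show ?thesis by (rule bounded_set_imp_lmeasurable[rotated])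
qed

lemma steep_set_Vitali:
  assumes "E \<subseteq> steep_set a b F q" "E \<in> lmeasurable" "open O'" "E \<subseteq> O'" "e > 0"
  obtains D where "finite D" "\<forall>(u,v)\<in>D. u < v \<and> {u..v} \<subseteq> O' \<and> a < u \<and> v < b \<and> q * (v - u) < F v - F u"
    "disjoint_closed D"
    "measure lebesgue (E - (\<Union>I\<in>D. {fst I..snd I})) < e"
proof -
  have "\<exists>D. finite D \<and> (\<forall>(u,v)\<in>D. u < v \<and> {u..v} \<subseteq> O' \<and> (a < u \<and> v < b \<and> q * (v - u) < F v - F u)) \<and>
      disjoint_closed D \<and> measure lebesgue (E - (\<Union>I\<in>D. {fst I..snd I})) < e"
  proof (rule finite_Vitali_cover[OF assms(2-5)])
    fix x d :: real assume "x \<in> E" "d > 0"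
    then have "x \<in> steep_set a b F q" using assms(1) by auto
    then obtain u v where "a < u" "u < x" "x < v" "v < b" "v - u < d" "q * (v - u) < F v - F u"
      unfolding steep_set_def using \<open>d > 0\<close> by blast
    then show "\<exists>u v. u < v \<and> u \<le> x \<and> x \<le> v \<and> v - u < d \<and> a < u \<and> v < b \<and> q * (v - u) < F v - F u"
      by (intro exI[of _ u] exI[of _ v]) auto
  qed
  then show ?thesis using that by auto
qed

lemma measure_disjoint_intervals:
  fixes D :: "(real \<times> real) set"
  assumes "finite D" "\<forall>(u,v)\<in>D. u \<le> v" "disjoint_closed D"
  shows "measure lebesgue (\<Union>I\<in>D. {fst I..snd I}) = (\<Sum>(u,v)\<in>D. v - u)"
proof -
  have "measure lebesgue (\<Union>I\<in>D. {fst I..snd I}) = (\<Sum>I\<in>D. measure lebesgue {fst I..snd I})"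
    using assms by (intro measure_UNION') auto
  also have "\<dots> = (\<Sum>(u,v)\<in>D. v - u)" using assms(2) by (intro sum.cong) (auto simp: split_beta)
  finally show ?thesis .
qed

lemma measure_le_Int_Diff:
  assumes "E \<in> lmeasurable" "C \<in> lmeasurable"
  shows "measure lebesgue E \<le> measure lebesgue (E \<inter> C) + measure lebesgue (E - C)"
proof -
  have "E = (E \<inter> C) \<union> (E - C)" by auto
  then show ?thesis using measure_Un_le[of "E \<inter> C" lebesgue "E - C"] assms by (metis fmeasurable.Int fmeasurable.Diff fmeasurableD)
qed

text \<open>A nesting argument. E is covered by intervals D1 of slope below p inside an open set
  barely larger than E, then by intervals D2 of slope above q nested in D1. The gaps between them
  are short, so by absolute continuity F changes little there. Comparing total increments gives
  \<open>q * L2 \<le> p * L1 + \<epsilon>\<close> with L1 and L2 both close to the measure of E,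
  which is therefore 0.\<close>

lemma AC_steep_null:
  assumes AC: "abs_continuous_on a b F" and pq: "p < q"
  shows "negligible (steep_set a b F q \<inter> steep_set a b (\<lambda>x. - F x) (- p))"
proof -
  define E where "E = steep_set a b F q \<inter> steep_set a b (\<lambda>x. - F x) (- p)"
  have E: "E \<in> lmeasurable" unfolding E_def using steep_set_measurable by (intro fmeasurable.Int) auto
  have Eab: "E \<subseteq> {a<..<b}" unfolding E_def steep_set_def by auto
  have main: "(q - p) * measure lebesgue E \<le> (\<bar>q\<bar> + \<bar>p\<bar> + 1) * \<epsilon>" if "\<epsilon> > 0" for \<epsilon>
  proof -
    obtain d where d: "d > 0" and dAC: "\<And>D. finite D \<Longrightarrow> (\<forall>(u,v)\<in>D. a \<le> u \<and> u \<le> v \<and> v \<le> b) \<Longrightarrow>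
     disjoint_open D \<Longrightarrow> (\<Sum>(u,v)\<in>D. v - u) < d \<Longrightarrow>
     (\<Sum>(u,v)\<in>D. \<bar>F v - F u\<bar>) < \<epsilon>" using abs_continuous_on_finite_set[OF AC \<open>\<epsilon> > 0\<close>] by blast
    \<comment> \<open>The open superset and the two covers lose at most \<open>\<delta> / 4\<close>
      each. The gaps then have total length below d, and L1, L2 are within \<open>\<epsilon>\<close>
      of the measure of E.\<close>
    define \<delta> where "\<delta> = min d \<epsilon>"
    have \<delta>: "\<delta> > 0" "\<delta> \<le> d" "\<delta> \<le> \<epsilon>" using d that by (auto simp: \<delta>_def)
    obtain U where U: "open U" "E \<subseteq> U" "U - E \<in> lmeasurable" "emeasure lebesgue (U - E) < ennreal (\<delta>/4)"
      using sets_lebesgue_outer_open[of E "\<delta>/4"] E \<delta> by (metis divide_pos_pos zero_less_numeral fmeasurableD)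
    have "U = E \<union> (U - E)" using U by auto
    then have Um: "U \<in> lmeasurable" using E U(3) by (metis fmeasurable.Un)
    define O' where "O' = U \<inter> {a<..<b}"
    have O': "open O'" "E \<subseteq> O'" "O' \<in> lmeasurable" using U Um Eab by (auto simp: O'_def intro!: fmeasurable.Int)
    have mO: "measure lebesgue O' < measure lebesgue E + \<delta>/4"
    proof -
      have "measure lebesgue (U - E) < \<delta>/4" using U(4) \<delta> by (simp add: emeasure_eq_measure2[OF U(3)] ennreal_less_iff)
      moreover have "measure lebesgue (U - E) = measure lebesgue U - measure lebesgue E"
        using U E Um by (intro measurable_measure_Diff) (auto)
      moreover have "measure lebesgue O' \<le> measure lebesgue U" using Um O' by (intro measure_mono_fmeasurable) (auto simp: O'_def)
      ultimately show ?thesis by simp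
    qed
    obtain D1 where D1: "finite D1" "\<forall>(u,v)\<in>D1. u < v \<and> {u..v} \<subseteq> O' \<and> a < u \<and> v < b \<and> - p * (v - u) < - F v - - F u"
      "disjoint_closed D1"
      "measure lebesgue (E - (\<Union>I\<in>D1. {fst I..snd I})) < \<delta>/4"
      using steep_set_Vitali[of E a b "\<lambda>x. - F x" "-p" O' "\<delta>/4"] E O' \<delta> unfolding E_def by auto
    \<comment> \<open>The second cover must sit in the interiors of the first family, so that each
      of its intervals lies in exactly one member of D1; only finitely many endpoints are given
      up.\<close>
    define W where "W = (\<Union>I\<in>D1. {fst I<..<snd I})"
    have W: "open W" unfolding W_def by auto
    have Wm: "W \<in> lmeasurable" unfolding W_def using D1(1) by (intro fmeasurable.finite_UN) auto
    define E' where "E' = E \<inter> W"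
    have E': "E' \<in> lmeasurable" unfolding E'_def using E Wm by auto
    have EE': "measure lebesgue E \<le> measure lebesgue E' + \<delta>/4"
    proof -
      let ?C = "\<Union>I\<in>D1. {fst I..snd I}"
      have C: "?C \<in> lmeasurable" using D1(1) by (intro fmeasurable.finite_UN) auto
      have "negligible (\<Union>I\<in>D1. {fst I, snd I})" using D1(1) by (intro negligible_finite) auto
      moreover have "E' - E \<inter> ?C \<union> (E \<inter> ?C - E') \<subseteq> (\<Union>I\<in>D1. {fst I, snd I})"
        unfolding E'_def W_def by force
      ultimately have "negligible (E' - E \<inter> ?C \<union> (E \<inter> ?C - E'))" by (rule negligible_subset)
      then have "measure lebesgue (E \<inter> ?C) = measure lebesgue E'"
        by (rule measure_negligible_symdiff[OF E'])
      moreover have "measure lebesgue E \<le> measure lebesgue (E \<inter> ?C) + measure lebesgue (E - ?C)"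
        by (rule measure_le_Int_Diff[OF E C])
      ultimately show ?thesis using D1(4) by simp
    qed
    obtain D2 where D2: "finite D2" "\<forall>(u,v)\<in>D2. u < v \<and> {u..v} \<subseteq> W \<and> a < u \<and> v < b \<and> q * (v - u) < F v - F u"
      "disjoint_closed D2"
      "measure lebesgue (E' - (\<Union>I\<in>D2. {fst I..snd I})) < \<delta>/4"
      using steep_set_Vitali[of E' a b F q W "\<delta>/4"] E' W \<delta> unfolding E'_def E_def by auto
    define L1 where "L1 = (\<Sum>(u,v)\<in>D1. v - u)"
    define L2 where "L2 = (\<Sum>(u,v)\<in>D2. v - u)"
    have L1: "L1 \<le> measure lebesgue O'"
    proof -
      have "L1 = measure lebesgue (\<Union>I\<in>D1. {fst I..snd I})" unfolding L1_def
        using D1 by (subst measure_disjoint_intervals) (auto simp: less_imp_le split_beta)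
      also have "\<dots> \<le> measure lebesgue O'" using D1 O' by (intro measure_mono_fmeasurable) (auto simp: split_beta)
      finally show ?thesis .
    qed
    have L2: "measure lebesgue E' - \<delta>/4 \<le> L2"
    proof -
      let ?C = "\<Union>I\<in>D2. {fst I..snd I}"
      have C: "?C \<in> lmeasurable" using D2(1) by (intro fmeasurable.finite_UN) auto
      have "L2 = measure lebesgue ?C" unfolding L2_def
        using D2 by (subst measure_disjoint_intervals) (auto simp: less_imp_le split_beta)
      moreover have "measure lebesgue E' \<le> measure lebesgue (E' \<inter> ?C) + measure lebesgue (E' - ?C)"
        by (rule measure_le_Int_Diff[OF E' C])
      moreover have "measure lebesgue (E' \<inter> ?C) \<le> measure lebesgue ?C" using C E' by (intro measure_mono_fmeasurable) auto
      ultimately show ?thesis using D2(4) by simp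
    qed
    define DJ where "DJ J = {K \<in> D2. {fst K..snd K} \<subseteq> {fst J<..<snd J}}" for J :: "real \<times> real"
    have inJ: "\<exists>J\<in>D1. K \<in> DJ J" if "K \<in> D2" for K
    proof -
      obtain u v where K: "K = (u,v)" by (cases K)
      have uv: "u < v" "{u..v} \<subseteq> W" using D2(2) that K by auto
      then have "u \<in> W" by auto
      then obtain J where J: "J \<in> D1" "u \<in> {fst J<..<snd J}" unfolding W_def by auto
      \<comment> \<open>An interval leaving J would contain \<open>snd J\<close>, and that point
        would be interior to another member of D1, against disjointness.\<close>
      have "{u..v} \<subseteq> {fst J<..<snd J}"
      proof (rule ccontr)
        assume "\<not> ?thesis"
        then have "snd J \<le> v" using J by (auto simp: subset_iff not_le not_less)
        then have "snd J \<in> W" using uv J by auto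
        then obtain J' where J': "J' \<in> D1" "snd J \<in> {fst J'<..<snd J'}" unfolding W_def by auto
        then have "J' \<noteq> J" by auto
        then have "disjnt {fst J'..snd J'} {fst J..snd J}" using J' J D1(3) by (auto simp: pairwise_def)
        moreover have "snd J \<in> {fst J'..snd J'} \<inter> {fst J..snd J}" using J J' by auto
        ultimately show False by (auto simp: disjnt_def)
      qed
      then show ?thesis using J that K unfolding DJ_def by auto
    qed
    have D2eq: "D2 = (\<Union>J\<in>D1. DJ J)" using inJ by (auto simp: DJ_def)
    have disjDJ: "DJ I \<inter> DJ J = {}" if IJ: "I \<in> D1" "J \<in> D1" "I \<noteq> J" for I J
    proof -
      have False if "K \<in> DJ I" "K \<in> DJ J" for K
      proof -
        have "fst K \<in> {fst K..snd K}" using that D2(2) by (auto simp: DJ_def split_beta)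
        then have "fst K \<in> {fst I..snd I} \<inter> {fst J..snd J}" using that unfolding DJ_def by fastforce
        then show False using D1(3) IJ unfolding pairwise_def disjnt_def by blast
      qed
      then show ?thesis by blast
    qed
    have sumD2: "sum h D2 = (\<Sum>J\<in>D1. sum h (DJ J))" for h :: "_ \<Rightarrow> real"
      unfolding D2eq using D1(1) D2(1) disjDJ by (intro sum.UNION_disjoint) (auto simp: DJ_def)
    have "\<exists>G. finite G \<and> (\<forall>(x,y)\<in>G. fst J \<le> x \<and> x \<le> y \<and> y \<le> snd J) \<and>
     disjoint_open G \<and>
     (\<forall>F::real\<Rightarrow>real. F (snd J) - F (fst J) = (\<Sum>(x,y)\<in>DJ J. F y - F x) + (\<Sum>(x,y)\<in>G. F y - F x))" if "J \<in> D1" for J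
    proof (rule complementary_intervals)
      show "\<forall>(x,y)\<in>DJ J. fst J \<le> x \<and> x < y \<and> y \<le> snd J" using D2(2) by (fastforce simp: DJ_def)
      show "disjoint_closed (DJ J)" using D2(3) by (rule pairwise_subset) (auto simp: DJ_def)
      show "fst J \<le> snd J" using D1(2) that by (auto simp: split_beta)
    qed (use D2 in \<open>auto simp: DJ_def\<close>)
    then have "\<forall>J\<in>D1. \<exists>G. finite G \<and> (\<forall>(x,y)\<in>G. fst J \<le> x \<and> x \<le> y \<and> y \<le> snd J) \<and>
     disjoint_open G \<and>
     (\<forall>F::real\<Rightarrow>real. F (snd J) - F (fst J) = (\<Sum>(x,y)\<in>DJ J. F y - F x) + (\<Sum>(x,y)\<in>G. F y - F x))" by (rule ballI)
    from bchoice[OF this] obtain G where G0: "\<forall>J\<in>D1. finite (G J) \<and> (\<forall>(x,y)\<in>G J. fst J \<le> x \<and> x \<le> y \<and> y \<le> snd J) \<and>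
     disjoint_open (G J) \<and>
     (\<forall>F::real\<Rightarrow>real. F (snd J) - F (fst J) = (\<Sum>(x,y)\<in>DJ J. F y - F x) + (\<Sum>(x,y)\<in>G J. F y - F x))" by (rule exE)
    have G: "finite (G J)" "\<forall>(x,y)\<in>G J. fst J \<le> x \<and> x \<le> y \<and> y \<le> snd J"
     "disjoint_open (G J)" if "J \<in> D1" for J
      by (rule conjunct1[OF bspec[OF G0 that]], rule conjunct1[OF conjunct2[OF bspec[OF G0 that]]],
          rule conjunct1[OF conjunct2[OF conjunct2[OF bspec[OF G0 that]]]])
    have G4: "F (snd J) - F (fst J) = (\<Sum>(x,y)\<in>DJ J. F y - F x) + (\<Sum>(x,y)\<in>G J. F y - F x)" if "J \<in> D1" for J and F :: "real \<Rightarrow> real"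
      using bspec[OF G0 that] by (elim conjE) (erule spec)
    have disjG: "G I \<inter> G J = {}" "\<And>K K'. K \<in> G I \<Longrightarrow> K' \<in> G J \<Longrightarrow> disjnt {fst K<..<snd K} {fst K'<..<snd K'}"
      if IJ: "I \<in> D1" "J \<in> D1" "I \<noteq> J" for I J
    proof -
      have dj: "{fst I..snd I} \<inter> {fst J..snd J} = {}" using D1(3) IJ unfolding pairwise_def disjnt_def by blast
      have IK: "{fst K..snd K} \<subseteq> {fst I..snd I} \<and> fst K \<le> snd K" if "K \<in> G I" for K using G(2)[OF IJ(1)] that by (auto simp: split_beta)
      have JK: "{fst K..snd K} \<subseteq> {fst J..snd J}" if "K \<in> G J" for K using G(2)[OF IJ(2)] that by (auto simp: split_beta)
      show "disjnt {fst K<..<snd K} {fst K'<..<snd K'}" if "K \<in> G I" "K' \<in> G J" for K K'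
      proof -
        have "{fst K<..<snd K} \<subseteq> {fst I..snd I}" using IK[OF that(1)] by auto
        moreover have "{fst K'<..<snd K'} \<subseteq> {fst J..snd J}" using JK[OF that(2)] by auto
        ultimately show ?thesis using dj unfolding disjnt_def by blast
      qed
      have False if "K \<in> G I" "K \<in> G J" for K
      proof -
        have "fst K \<in> {fst K..snd K}" using IK[OF that(1)] by auto
        then show False using IK[OF that(1)] JK[OF that(2)] dj by blast
      qed
      then show "G I \<inter> G J = {}" by blast
    qed
    define GG where "GG = (\<Union>J\<in>D1. G J)"
    have sumG: "sum h GG = (\<Sum>J\<in>D1. sum h (G J))" for h :: "_ \<Rightarrow> real"
      unfolding GG_def using D1(1) G(1) disjG(1) by (intro sum.UNION_disjoint) auto
    have tot: "(\<Sum>(u,v)\<in>D1. H v - H u) = (\<Sum>(u,v)\<in>D2. H v - H u) + (\<Sum>(u,v)\<in>GG. H v - H u)" for H :: "real \<Rightarrow> real"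
    proof -
      have "(\<Sum>(u,v)\<in>D1. H v - H u) = (\<Sum>J\<in>D1. H (snd J) - H (fst J))" by (simp add: split_beta)
      also have "\<dots> = (\<Sum>J\<in>D1. (\<Sum>(x,y)\<in>DJ J. H y - H x) + (\<Sum>(x,y)\<in>G J. H y - H x))"
        using G4[of _ H] by (intro sum.cong) auto
      finally show ?thesis unfolding sumD2 sumG by (simp add: sum.distrib)
    qed
    have gl: "(\<Sum>(u,v)\<in>GG. v - u) < d"
    proof -
      have "(\<Sum>(u,v)\<in>GG. v - u) = L1 - L2" using tot[of "\<lambda>x. x"] unfolding L1_def L2_def by simp
      then show ?thesis using L1 L2 mO EE' \<delta> by linarith
    qed
    have "(\<Sum>(u,v)\<in>GG. \<bar>F v - F u\<bar>) < \<epsilon>"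
    proof (rule dAC)
      show "finite GG" unfolding GG_def using D1(1) G(1) by auto
      show "\<forall>(u,v)\<in>GG. a \<le> u \<and> u \<le> v \<and> v \<le> b"
      proof
        fix K assume "K \<in> GG"
        then obtain J where J: "J \<in> D1" "K \<in> G J" unfolding GG_def by auto
        have "fst J \<le> fst K" "fst K \<le> snd K" "snd K \<le> snd J" "a < fst J" "snd J < b"
          using bspec[OF G(2)[OF J(1)] J(2)] bspec[OF D1(2) J(1)] by (auto simp: split_beta)
        then show "case K of (u,v) \<Rightarrow> a \<le> u \<and> u \<le> v \<and> v \<le> b" by (auto simp: split_beta)
      qed
      show "disjoint_open GG"
        unfolding pairwise_def
      proof (intro ballI impI)
        fix K K' assume K: "K \<in> GG" "K' \<in> GG" "K \<noteq> K'"
        obtain I J where IJ: "I \<in> D1" "J \<in> D1" "K \<in> G I" "K' \<in> G J" using K unfolding GG_def by auto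
        show "disjnt {fst K<..<snd K} {fst K'<..<snd K'}"
        proof (cases "I = J")
          case True
          then show ?thesis using G(3)[OF IJ(1), unfolded pairwise_def] IJ(3,4) K(3) by blast
        next
          case False
          then show ?thesis using disjG(2)[OF IJ(1,2)] IJ(3,4) by blast
        qed
      qed
    qed (rule gl)
    moreover have "\<bar>\<Sum>(u,v)\<in>GG. F v - F u\<bar> \<le> (\<Sum>(u,v)\<in>GG. \<bar>F v - F u\<bar>)"
      by (rule order_trans[OF sum_abs]) (simp add: split_beta)
    ultimately have gF: "- (\<Sum>(u,v)\<in>GG. F v - F u) \<le> \<epsilon>" by linarith
    have "q * L2 \<le> (\<Sum>(u,v)\<in>D2. F v - F u)" unfolding L2_def sum_distrib_left
      using D2(2) by (intro sum_mono) (auto simp: split_beta less_imp_le)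
    also have "\<dots> \<le> (\<Sum>(u,v)\<in>D1. F v - F u) + \<epsilon>" using tot[of F] gF by linarith
    also have "(\<Sum>(u,v)\<in>D1. F v - F u) \<le> p * L1" unfolding L1_def sum_distrib_left
      using D1(2) by (intro sum_mono) (auto simp: split_beta less_imp_le)
    finally have *: "q * L2 \<le> p * L1 + \<epsilon>" by simp
    have L12: "L2 \<le> L1"
    proof -
      have "(\<Sum>(u,v)\<in>GG. v - u) \<ge> 0" using G(2) unfolding GG_def by (intro sum_nonneg) fastforce
      then show ?thesis using tot[of "\<lambda>x. x"] unfolding L1_def L2_def by simp
    qed
    \<comment> \<open>Replacing L1 and L2 by the measure of E costs \<open>\<epsilon>\<close> times
      the absolute value of the slope; this explains the factor
      \<open>\<bar>q\<bar> + \<bar>p\<bar> + 1\<close>.\<close>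
    have "\<bar>L1 - measure lebesgue E\<bar> \<le> \<delta>" "\<bar>L2 - measure lebesgue E\<bar> \<le> \<delta>" using L1 L2 L12 mO EE' \<delta> by linarith+
    then have "\<bar>p * (L1 - measure lebesgue E)\<bar> \<le> \<bar>p\<bar> * \<epsilon>" "\<bar>q * (L2 - measure lebesgue E)\<bar> \<le> \<bar>q\<bar> * \<epsilon>"
      using \<delta> by (auto simp: abs_mult intro!: mult_left_mono)
    then show ?thesis using * by (simp add: algebra_simps)
  qed
  have "measure lebesgue E = 0"
  proof (rule ccontr)
    assume "measure lebesgue E \<noteq> 0"
    then have m: "(q - p) * measure lebesgue E > 0" using pq by (simp add: zero_less_measure_iff)
    define X where "X = (q - p) * measure lebesgue E"
    define K where "K = \<bar>q\<bar> + \<bar>p\<bar> + 1"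
    have "X > 0" "K > 0" using m unfolding X_def K_def by auto
    then have "X \<le> K * (X / (2 * K))" using main[of "X / (2 * K)"] unfolding X_def[symmetric] K_def[symmetric] by simp
    also have "\<dots> = X / 2" using \<open>K > 0\<close> by (simp add: field_simps)
    finally show False using \<open>X > 0\<close> by simp
  qed
  then show ?thesis using E unfolding E_def[symmetric] by (simp add: negligible_iff_measure)
qed

lemma abs_continuous_on_imp_continuous_on:
  assumes "abs_continuous_on a b F"
  shows "continuous_on {a..b} F"
  unfolding continuous_on_iff
proof (intro ballI allI impI)
  fix x e :: real assume x: "x \<in> {a..b}" and e: "e > 0"
  obtain d where d: "d > 0" and dAC: "\<And>D. finite D \<Longrightarrow> (\<forall>(u,v)\<in>D. a \<le> u \<and> u \<le> v \<and> v \<le> b) \<Longrightarrow>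
     disjoint_open D \<Longrightarrow> (\<Sum>(u,v)\<in>D. v - u) < d \<Longrightarrow>
     (\<Sum>(u,v)\<in>D. \<bar>F v - F u\<bar>) < e" using abs_continuous_on_finite_set[OF assms e] by blast
  show "\<exists>d>0. \<forall>x'\<in>{a..b}. dist x' x < d \<longrightarrow> dist (F x') (F x) < e"
  proof (intro exI[of _ d] conjI ballI impI d)
    fix y assume y: "y \<in> {a..b}" "dist y x < d"
    then show "dist (F y) (F x) < e"
      using dAC[of "{(x,y)}"] dAC[of "{(y,x)}"] x by (cases "x \<le> y") (auto simp: dist_real_def)
  qed
qed

text \<open>Let d belong to the variation bound 1. In a window of length d/2 the set has an open
  superset of measure below d. If its part there had measure m > 0, intervals of slope above n with
  \<open>n * m > 2\<close> would cover half of that part and push the variation above 1. Countably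
  many windows cover the line.\<close>

lemma AC_infinitely_steep_null:
  assumes AC: "abs_continuous_on a b F"
  shows "negligible (\<Inter>n. steep_set a b F (real n))"
proof -
  define E where "E = (\<Inter>n. steep_set a b F (real n))"
  have "E \<subseteq> steep_set a b F 0" unfolding E_def by (metis INT_lower UNIV_I of_nat_0)
  moreover have "E \<in> sets lebesgue" unfolding E_def using fmeasurableD[OF steep_set_measurable] by auto
  ultimately have E: "E \<in> lmeasurable" using steep_set_measurable fmeasurableI2 by blast
  obtain d where d: "d > 0" and dAC: "\<And>D. finite D \<Longrightarrow> (\<forall>(u,v)\<in>D. a \<le> u \<and> u \<le> v \<and> v \<le> b) \<Longrightarrow>
     disjoint_open D \<Longrightarrow> (\<Sum>(u,v)\<in>D. v - u) < d \<Longrightarrow>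
     (\<Sum>(u,v)\<in>D. \<bar>F v - F u\<bar>) < 1" using abs_continuous_on_finite_set[OF AC zero_less_one] by blast
  have neg: "negligible (E \<inter> {c..c+d/2})" for c
  proof -
    define E' where "E' = E \<inter> {c..c+d/2}"
    have E': "E' \<in> lmeasurable" unfolding E'_def using E by (intro fmeasurable.Int) auto
    let ?m = "measure lebesgue E'"
    have "?m \<le> measure lebesgue {c..c+d/2}" using E' unfolding E'_def by (intro measure_mono_fmeasurable) auto
    then have m2: "?m \<le> d/2" using d by simp
    have "?m = 0"
    proof (rule ccontr)
      assume "?m \<noteq> 0"
      then have m: "?m > 0" by (simp add: zero_less_measure_iff)
      obtain U where U: "open U" "E' \<subseteq> U" "U - E' \<in> lmeasurable" "emeasure lebesgue (U - E') < ennreal (d/2)"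
        using sets_lebesgue_outer_open[of E' "d/2"] E' d by (metis half_gt_zero fmeasurableD)
      have "U = E' \<union> (U - E')" using U by auto
      then have Um: "U \<in> lmeasurable" using E' U(3) by (metis fmeasurable.Un)
      have "measure lebesgue (U - E') < d/2" using U(4) d by (simp add: emeasure_eq_measure2[OF U(3)] ennreal_less_iff)
      moreover have "measure lebesgue (U - E') = measure lebesgue U - measure lebesgue E'"
        using U E' Um by (intro measurable_measure_Diff) (auto)
      ultimately have mU: "measure lebesgue U < d" using m2 by simp
      obtain n :: nat where n: "real n * ?m / 2 > 1" using m reals_Archimedean3[OF m, rule_format, of 2] by (auto simp: field_simps)
      obtain D where D: "finite D" "\<forall>(u,v)\<in>D. u < v \<and> {u..v} \<subseteq> U \<and> a < u \<and> v < b \<and> real n * (v - u) < F v - F u"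
        "disjoint_closed D"
        "measure lebesgue (E' - (\<Union>I\<in>D. {fst I..snd I})) < ?m/2"
        using steep_set_Vitali[of E' a b F "real n" U "?m/2"] E' U m unfolding E'_def E_def by auto
      let ?C = "\<Union>I\<in>D. {fst I..snd I}"
      have C: "?C \<in> lmeasurable" using D(1) by (intro fmeasurable.finite_UN) auto
      have L: "measure lebesgue ?C = (\<Sum>(u,v)\<in>D. v - u)"
        using D by (subst measure_disjoint_intervals) (auto simp: less_imp_le split_beta)
      have "measure lebesgue (E' \<inter> ?C) \<le> measure lebesgue ?C" using C E' by (intro measure_mono_fmeasurable) auto
      then have L2: "?m / 2 \<le> (\<Sum>(u,v)\<in>D. v - u)" using measure_le_Int_Diff[OF E' C] D(4) L by simp
      have "measure lebesgue ?C \<le> measure lebesgue U" using D Um by (intro measure_mono_fmeasurable) (auto simp: split_beta)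
      then have "(\<Sum>(u,v)\<in>D. v - u) < d" using L mU by simp
      moreover have "disjoint_open D"
        using D(3) unfolding pairwise_def disjnt_def by (meson disjoint_iff greaterThanLessThan_subseteq_atLeastAtMost_iff order_refl subsetD)
      ultimately have "(\<Sum>(u,v)\<in>D. \<bar>F v - F u\<bar>) < 1" using D(1,2) by (intro dAC) (auto simp: split_beta less_imp_le)
      moreover have "real n * (\<Sum>(u,v)\<in>D. v - u) \<le> (\<Sum>(u,v)\<in>D. \<bar>F v - F u\<bar>)"
        unfolding sum_distrib_left using D(2) by (intro sum_mono) (auto simp: split_beta intro: order_trans[OF less_imp_le])
      moreover have "real n * (?m/2) \<le> real n * (\<Sum>(u,v)\<in>D. v - u)" using L2 by (intro mult_left_mono) auto
      ultimately show False using n by simp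
    qed
    then show ?thesis using E' unfolding E'_def[symmetric] by (simp add: negligible_iff_measure)
  qed
  have "E \<subseteq> (\<Union>i::int. E \<inter> {of_int i * (d/2)..of_int i * (d/2) + d/2})"
  proof
    fix x assume "x \<in> E"
    have "of_int \<lfloor>x/(d/2)\<rfloor> * (d/2) \<le> x" "x \<le> (of_int \<lfloor>x/(d/2)\<rfloor> + 1) * (d/2)"
      using d floor_divide_lower[of "d/2" x] floor_divide_upper[of "d/2" x] by (auto simp: less_imp_le)
    then show "x \<in> (\<Union>i::int. E \<inter> {of_int i * (d/2)..of_int i * (d/2) + d/2})" using \<open>x \<in> E\<close>
      by (auto simp: algebra_simps intro!: exI[of _ "\<lfloor>x/(d/2)\<rfloor>"])
  qed
  moreover have "negligible (\<Union>i::int. E \<inter> {of_int i * (d/2)..of_int i * (d/2) + d/2})"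
    using neg by (intro negligible_countable_Union) auto
  ultimately show ?thesis unfolding E_def[symmetric] by (rule negligible_subset[rotated])
qed

section \<open>Differentiability almost everywhere and the fundamental theorem of calculus\<close>

lemma abs_continuous_on_uminus: "abs_continuous_on a b F \<Longrightarrow> abs_continuous_on a b (\<lambda>x. - F x)"
  unfolding abs_continuous_on_def by (simp add: abs_minus_commute)

text \<open>Off the three null sets the derivative is the supremum D of the slopes q with x in
  \<open>steep_set a b F q\<close>. Chords across x have slope at most D + e. For rationals p < q in
  (D - e, D) the point is steep for q, hence not steep for \<open>-F\<close> and \<open>-p\<close>,
  so these chords also have slope at least p. Continuity passes from chords across x to chords
  ending at x.\<close>

theorem abs_continuous_on_imp_differentiable_ae:
  assumes AC: "abs_continuous_on a b F"
  shows "negligible {x \<in> {a<..<b}. \<not> F differentiable (at x)}"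
proof -
  define N where "N = (\<Union>(p,q)\<in>{(p,q). p \<in> \<rat> \<and> q \<in> \<rat> \<and> p < q}. steep_set a b F q \<inter> steep_set a b (\<lambda>x. - F x) (- p))"
  define N1 where "N1 = (\<Inter>n. steep_set a b F (real n))"
  define N2 where "N2 = (\<Inter>n. steep_set a b (\<lambda>x. - F x) (real n))"
  have "countable {(p::real,q). p \<in> \<rat> \<and> q \<in> \<rat> \<and> p < q}"
    by (rule countable_subset[of _ "\<rat> \<times> \<rat>"]) (auto intro: countable_rat)
  then have "negligible N" unfolding N_def using AC_steep_null[OF AC] by (intro negligible_countable_Union) auto
  moreover have "negligible N1" unfolding N1_def by (rule AC_infinitely_steep_null[OF AC])
  moreover have "negligible N2" unfolding N2_def by (rule AC_infinitely_steep_null[OF abs_continuous_on_uminus[OF AC]])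
  ultimately have neg: "negligible (N \<union> N1 \<union> N2)" by simp
  have "F differentiable (at x)" if x: "x \<in> {a<..<b}" "x \<notin> N" "x \<notin> N1" "x \<notin> N2" for x
  proof -
    have cont: "isCont F x" using abs_continuous_on_imp_continuous_on[OF AC] x(1)
      by (intro continuous_on_interior[of "{a..b}"]) auto
    define S where "S = {q. x \<in> steep_set a b F q}"
    have above: "\<exists>d>0. \<forall>u v. a < u \<and> u < x \<and> x < v \<and> v < b \<and> v - u < d \<longrightarrow> F v - F u \<le> q * (v - u)" if "q \<notin> S" for q
    proof (rule ccontr)
      assume "\<not> ?thesis"
      then have "\<forall>d>0. \<exists>u v. a < u \<and> u < x \<and> x < v \<and> v < b \<and> v - u < d \<and> q * (v - u) < F v - F u"
        by (meson not_le)
      then have "q \<in> S" using x(1) unfolding S_def steep_set_def by simp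
      then show False using that by simp
    qed
    have down: "q' \<in> S" if "q \<in> S" "q' \<le> q" for q q'
    proof -
      have "\<exists>u v. a < u \<and> u < x \<and> x < v \<and> v < b \<and> v - u < d \<and> q' * (v - u) < F v - F u" if "d > 0" for d
      proof -
        obtain u v where *: "a < u" "u < x" "x < v" "v < b" "v - u < d" "q * (v - u) < F v - F u"
          using \<open>q \<in> S\<close> \<open>d > 0\<close> unfolding S_def steep_set_def by blast
        have "q' * (v - u) \<le> q * (v - u)" using \<open>q' \<le> q\<close> * by (intro mult_right_mono) auto
        then show ?thesis using * by (intro exI[of _ u] exI[of _ v] conjI) linarith+
      qed
      then show ?thesis using x(1) unfolding S_def steep_set_def by auto
    qed
    obtain n where "real n \<notin> S" using x(3) unfolding N1_def S_def by auto
    then have up: "\<And>q. q \<in> S \<Longrightarrow> q \<le> real n" using down by (meson linear)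
    then have bdd: "bdd_above S" by (auto simp: bdd_above_def)
    obtain m where "x \<notin> steep_set a b (\<lambda>x. - F x) (real m)" using x(4) unfolding N2_def by auto
    then obtain d0 where d0: "d0 > 0" "\<And>u v. a < u \<Longrightarrow> u < x \<Longrightarrow> x < v \<Longrightarrow> v < b \<Longrightarrow> v - u < d0 \<Longrightarrow> - real m * (v - u) \<le> F v - F u"
      using x(1) unfolding steep_set_def by (force simp: not_less)
    \<comment> \<open>S is non-empty: otherwise a short symmetric chord would have slope at least -m
      and at most -m - 1.\<close>
    have "- real m - 1 \<in> S"
    proof (rule ccontr)
      assume "- real m - 1 \<notin> S"
      then obtain d1 where d1: "d1 > 0" "\<And>u v. a < u \<and> u < x \<and> x < v \<and> v < b \<and> v - u < d1 \<Longrightarrow> F v - F u \<le> (- real m - 1) * (v - u)"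
        using above by blast
      define h where "h = Min {d0, d1, x - a, b - x} / 4"
      have h: "h > 0" "h < d0 / 2" "h < d1 / 2" "h < x - a" "h < b - x" using x(1) d0(1) d1(1) by (auto simp: h_def)
      have "- real m * (2 * h) \<le> (- real m - 1) * (2 * h)"
        using d0(2)[of "x - h" "x + h"] d1(2)[of "x - h" "x + h"] h by (auto simp: algebra_simps)
      then show False using h by (simp add: algebra_simps)
    qed
    then have Sne: "S \<noteq> {}" by auto
    define D where "D = Sup S"
    have "(F has_real_derivative D) (at x)"
      unfolding has_field_derivative_def has_derivative_at_alt
    proof (intro conjI allI impI)
      show "bounded_linear ((*) D)" by (rule bounded_linear_mult_right)
      fix e :: real assume e: "e > 0"
      have "D + e \<notin> S" using cSup_upper[OF _ bdd, of "D+e"] e unfolding D_def by force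
      then obtain d1 where d1: "d1 > 0" "\<And>u v. a < u \<and> u < x \<and> x < v \<and> v < b \<and> v - u < d1 \<Longrightarrow> F v - F u \<le> (D+e) * (v - u)"
        using above by blast
      obtain q where q: "q \<in> \<rat>" "D - e / 2 < q" "q < D" using Rats_dense_in_real[of "D - e/2" D] e by auto
      obtain p where p: "p \<in> \<rat>" "D - e < p" "p < D - e / 2" using Rats_dense_in_real[of "D - e" "D - e/2"] e by auto
      obtain q' where "q' \<in> S" "q < q'" using less_cSup_iff[OF Sne bdd, of q] q unfolding D_def by auto
      then have "x \<in> steep_set a b F q" using down[of q' q] unfolding S_def by auto
      then have "x \<notin> steep_set a b (\<lambda>x. - F x) (- p)" using x(2) p q unfolding N_def by fastforce
      then obtain d2 where d2: "d2 > 0" "\<And>u v. a < u \<Longrightarrow> u < x \<Longrightarrow> x < v \<Longrightarrow> v < b \<Longrightarrow> v - u < d2 \<Longrightarrow> p * (v - u) \<le> F v - F u"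
        using x(1) unfolding steep_set_def by (force simp: not_less)
      define d where "d = Min {d1, d2, x - a, b - x} / 2"
      have d: "d > 0" "2 * d \<le> d1" "2 * d \<le> d2" "2 * d \<le> x - a" "2 * d \<le> b - x" using x(1) d1(1) d2(1) by (auto simp: d_def)
      have two: "\<bar>F v - F u - D * (v - u)\<bar> \<le> e * (v - u)" if uv: "x - d < u" "u < x" "x < v" "v < x + d" for u v
      proof -
        have "F v - F u \<le> (D+e) * (v - u)" using d1(2)[of u v] uv d by auto
        moreover have "p * (v - u) \<le> F v - F u" using d2(2)[of u v] uv d by auto
        moreover have "(D - e) * (v - u) \<le> p * (v - u)" using p uv by (intro mult_right_mono) auto
        ultimately show ?thesis by (auto simp: algebra_simps abs_le_iff)
      qed
      show "\<exists>d>0. \<forall>y. norm (y - x) < d \<longrightarrow> norm (F y - F x - D * (y - x)) \<le> e * norm (y - x)"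
      proof (intro exI[of _ d] conjI allI impI d(1))
        fix y assume y: "norm (y - x) < d"
        consider "y = x" | "y > x" | "y < x" by linarith
        then show "norm (F y - F x - D * (y - x)) \<le> e * norm (y - x)"
        proof cases
          case 2
          \<comment> \<open>The left end u of a straddling chord tends to x, which turns the
            estimate for chords across x into one for the chord from x to y.\<close>
          have "((\<lambda>u. \<bar>F y - F u - D * (y - u)\<bar> - e * (y - u)) \<longlongrightarrow> \<bar>F y - F x - D * (y - x)\<bar> - e * (y - x)) (at_left x)"
            using cont unfolding isCont_def by (intro tendsto_intros filterlim_at_split[THEN iffD1, THEN conjunct1])
          moreover have "\<forall>\<^sub>F u in at_left x. \<bar>F y - F u - D * (y - u)\<bar> - e * (y - u) \<le> 0"
            using two[of _ y] 2 y d(1) eventually_at_left_real[of "x - d" x] by (auto elim!: eventually_mono)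
          ultimately have "\<bar>F y - F x - D * (y - x)\<bar> - e * (y - x) \<le> 0"
            by (rule tendsto_upperbound) simp
          then show ?thesis using 2 by simp
        next
          case 3
          have "((\<lambda>v. \<bar>F v - F y - D * (v - y)\<bar> - e * (v - y)) \<longlongrightarrow> \<bar>F x - F y - D * (x - y)\<bar> - e * (x - y)) (at_right x)"
            using cont unfolding isCont_def by (intro tendsto_intros filterlim_at_split[THEN iffD1, THEN conjunct2])
          moreover have "\<forall>\<^sub>F v in at_right x. \<bar>F v - F y - D * (v - y)\<bar> - e * (v - y) \<le> 0"
            using two[of y] 3 y d(1) eventually_at_right_real[of x "x + d"] by (auto elim!: eventually_mono)
          ultimately have *: "\<bar>F x - F y - D * (x - y)\<bar> - e * (x - y) \<le> 0"
            by (rule tendsto_upperbound) simp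
          have "F y - F x - D * (y - x) = - (F x - F y - D * (x - y))" by (simp add: algebra_simps)
          then show ?thesis using * 3 by (simp only: real_norm_def abs_minus_cancel) simp
        qed simp
      qed
    qed
    then show ?thesis using real_differentiable_def by blast
  qed
  then have "{x \<in> {a<..<b}. \<not> F differentiable (at x)} \<subseteq> N \<union> N1 \<union> N2" by blast
  with neg show ?thesis by (rule negligible_subset)
qed

text \<open>With the gauge integral, integrability of f is part of the conclusion. Pieces tagged at
  regular points follow the derivative; pieces tagged in the exceptional null set are confined to an
  open set of small measure, where absolute continuity bounds the increments of F.\<close>

theorem abs_continuous_on_has_integral:
  assumes AC: "abs_continuous_on a b F" and "a \<le> b" and N: "negligible N"
    and f: "\<And>x. x \<in> {a<..<b} - N \<Longrightarrow> (F has_real_derivative f x) (at x)"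
  shows "(f has_integral (F b - F a)) {a..b}"
proof -
  define N' where "N' = N \<union> {a,b}"
  have N': "negligible N'" unfolding N'_def using N by auto
  define f0 where "f0 x = (if x \<in> N' then 0 else f x)" for x
  have "(f0 has_integral (F b - F a)) {a..b}"
    unfolding has_integral_real
  proof (intro allI impI)
    fix e :: real assume "e > 0"
    \<comment> \<open>Regular tags contribute \<open>\<epsilon> * (b - a)\<close>, exceptional tags
      one more \<open>\<epsilon>\<close>; the 2 makes the total strictly less than e.\<close>
    define \<epsilon> where "\<epsilon> = e / (b - a + 2)"
    have \<epsilon>0: "\<epsilon> > 0" using \<open>e > 0\<close> \<open>a \<le> b\<close> by (auto simp: \<epsilon>_def)
    moreover have "\<epsilon> * (b - a + 2) = e" using \<open>a \<le> b\<close> by (simp add: \<epsilon>_def)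
    ultimately have \<epsilon>: "\<epsilon> > 0" "\<epsilon> * (b - a) + \<epsilon> < e" by (auto simp: algebra_simps)
    obtain d where d: "d > 0" and dAC: "\<And>D. finite D \<Longrightarrow> (\<forall>(u,v)\<in>D. a \<le> u \<and> u \<le> v \<and> v \<le> b) \<Longrightarrow>
     disjoint_open D \<Longrightarrow> (\<Sum>(u,v)\<in>D. v - u) < d \<Longrightarrow>
     (\<Sum>(u,v)\<in>D. \<bar>F v - F u\<bar>) < \<epsilon>" using abs_continuous_on_finite_set[OF AC \<epsilon>(1)] by blast
    have N's: "N' \<in> sets lebesgue" using N' by (rule negligible_imp_sets)
    obtain U where U: "open U" "N' \<subseteq> U" "U - N' \<in> lmeasurable" "emeasure lebesgue (U - N') < ennreal d"
      using sets_lebesgue_outer_open[OF N's d] by metis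
    have Um: "U \<in> lmeasurable" "measure lebesgue U < d"
    proof -
      have "negligible (U - (U - N') \<union> ((U - N') - U))" by (rule negligible_subset[OF N']) auto
      then have *: "negligible ((U - N') - U \<union> (U - (U - N')))" by (simp add: Un_commute)
      show "U \<in> lmeasurable" using lmeasurable_negligible_symdiff[OF U(3) *] .
      show "measure lebesgue U < d" unfolding measure_negligible_symdiff[OF U(3) *]
        using U(4) d by (simp add: emeasure_eq_measure2[OF U(3)] ennreal_less_iff)
    qed
    have "\<exists>r>0. \<forall>u v. u \<le> x \<and> x \<le> v \<and> {u..v} \<subseteq> ball x r \<longrightarrow> \<bar>(v - u) * f x - (F v - F u)\<bar> \<le> \<epsilon> * (v - u)"
      if x: "x \<in> {a..b}" "x \<notin> N'" for x
    proof -
      have "(F has_real_derivative f x) (at x)" using x by (intro f) (auto simp: N'_def)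
      then obtain r where r: "r > 0" "\<And>y. \<bar>y - x\<bar> < r \<Longrightarrow> \<bar>F y - F x - f x * (y - x)\<bar> \<le> \<epsilon> * \<bar>y - x\<bar>"
        unfolding has_field_derivative_def has_derivative_at_alt using \<epsilon>(1) by (auto simp: real_norm_def)
      show ?thesis
      proof (intro exI[of _ r] conjI allI impI r(1))
        fix u v assume uv: "u \<le> x \<and> x \<le> v \<and> {u..v} \<subseteq> ball x r"
        then have "u \<in> {u..v}" "v \<in> {u..v}" by auto
        then have "u \<in> ball x r" "v \<in> ball x r" using uv by blast+
        then have "\<bar>F u - F x - f x * (u - x)\<bar> \<le> \<epsilon> * (x - u)" "\<bar>F v - F x - f x * (v - x)\<bar> \<le> \<epsilon> * (v - x)"
          using r(2)[of u] r(2)[of v] uv by (auto simp: dist_real_def)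
        then show "\<bar>(v - u) * f x - (F v - F u)\<bar> \<le> \<epsilon> * (v - u)" by (simp add: algebra_simps abs_le_iff)
      qed
    qed
    then obtain r where r: "\<And>x. x \<in> {a..b} \<Longrightarrow> x \<notin> N' \<Longrightarrow> r x > 0"
      "\<And>x u v. x \<in> {a..b} \<Longrightarrow> x \<notin> N' \<Longrightarrow> u \<le> x \<Longrightarrow> x \<le> v \<Longrightarrow> {u..v} \<subseteq> ball x (r x) \<Longrightarrow> \<bar>(v - u) * f x - (F v - F u)\<bar> \<le> \<epsilon> * (v - u)"
      by metis
    \<comment> \<open>Pieces tagged in N' must lie in the small set U; the others are so short that
      F follows its derivative up to \<open>\<epsilon>\<close> times the length.\<close>
    define \<gamma> where "\<gamma> x = (if x \<in> N' then U else if x \<in> {a..b} then ball x (r x) else ball x 1)" for x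
    have "gauge \<gamma>" unfolding gauge_def \<gamma>_def using U r(1) by auto
    moreover have "norm ((\<Sum>(x,k)\<in>p. measure lborel k *\<^sub>R f0 x) - (F b - F a)) < e"
      if p': "p tagged_division_of {a..b} \<and> \<gamma> fine p" for p
    proof -
      note p = conjunct1[OF p'] conjunct2[OF p']
      have fin: "finite p" using p(1) by auto
      have k: "\<exists>u v. K = {u..v} \<and> u \<le> x \<and> x \<le> v \<and> a \<le> u \<and> v \<le> b" if "(x,K) \<in> p" for x K
      proof -
        have "x \<in> K" "K \<subseteq> {a..b}" "\<exists>u v. K = cbox u v" using tagged_division_ofD(2-4)[OF p(1) that] by auto
        then obtain u v where "K = {u..v}" by auto
        then show ?thesis using \<open>x \<in> K\<close> \<open>K \<subseteq> {a..b}\<close> by (intro exI[of _ u] exI[of _ v]) auto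
      qed
      define B where "B = {(x,K) \<in> p. x \<in> N'}"
      have B: "B \<subseteq> p" "finite B" using fin unfolding B_def by (auto intro: finite_subset[of _ p])
      define h where "h = (\<lambda>(x::real,K::real set). (Inf K, Sup K))"
      \<comment> \<open>Passing from tagged pieces to pairs of endpoints may identify pieces, but
        only degenerate ones, since distinct pieces have disjoint interiors; these contribute 0 to
        the sums.\<close>
      have nontriv: "fst (h I) = snd (h I)" if "I \<in> B" "J \<in> B" "I \<noteq> J" "h I = h J" for I J
      proof -
        obtain x K y L where IJ: "I = (x,K)" "J = (y,L)" by (cases I, cases J)
        have p': "(x,K) \<in> p" "(y,L) \<in> p" using that B IJ by auto
        obtain u v where K: "K = {u..v}" "u \<le> v" using k[OF p'(1)] by auto
        obtain u' v' where L: "L = {u'..v'}" "u' \<le> v'" using k[OF p'(2)] by auto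
        have "K = L" using that(4) K L IJ by (simp add: h_def)
        have "interior K \<inter> interior L = {}" using tagged_division_ofD(5)[OF p(1) p'] IJ that(3) by auto
        then show ?thesis using K \<open>K = L\<close> IJ by (auto simp: h_def interior_atLeastAtMost_real)
      qed
      have sumh: "(\<Sum>I\<in>h ` B. g I) = (\<Sum>I\<in>B. g (h I))" if "\<And>u. g (u,u) = (0::real)" for g
      proof (rule sum.reindex_nontrivial[OF B(2), unfolded o_def])
        fix I J assume "I \<in> B" "J \<in> B" "I \<noteq> J" "h I = h J"
        from nontriv[OF this] show "g (h I) = 0" using that by (cases "h I") auto
      qed
      have pw: "disjoint_open (h ` B)"
        unfolding pairwise_def
      proof (intro ballI impI)
        fix I J assume IJ: "I \<in> h ` B" "J \<in> h ` B" "I \<noteq> J"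
        then obtain x K y L where xy: "(x,K) \<in> B" "(y,L) \<in> B" "I = h (x,K)" "J = h (y,L)" by auto
        have p': "(x,K) \<in> p" "(y,L) \<in> p" using xy B by auto
        obtain u v where K: "K = {u..v}" "u \<le> v" using k[OF p'(1)] by auto
        obtain u' v' where L: "L = {u'..v'}" "u' \<le> v'" using k[OF p'(2)] by auto
        have "interior K \<inter> interior L = {}" using tagged_division_ofD(5)[OF p(1) p'] xy IJ(3) by auto
        then show "disjnt {fst I<..<snd I} {fst J<..<snd J}"
          using K L xy by (simp add: h_def interior_atLeastAtMost_real disjnt_def)
      qed
      have BU: "{fst I..snd I} \<subseteq> U \<and> a \<le> fst I \<and> fst I \<le> snd I \<and> snd I \<le> b" if I: "I \<in> h ` B" for I
      proof -
        obtain x K where xK: "(x,K) \<in> p" "x \<in> N'" "I = h (x,K)" using I unfolding B_def by auto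
        obtain u v where K: "K = {u..v}" "u \<le> v" "a \<le> u" "v \<le> b" using k[OF xK(1)] by auto
        have "K \<subseteq> U" using fineD[OF p(2) xK(1)] xK(2) by (simp add: \<gamma>_def)
        then show ?thesis using K xK by (simp add: h_def)
      qed
      have "(\<Sum>(u,v)\<in>h ` B. v - u) = (\<Sum>I\<in>h ` B. measure lebesgue {fst I<..<snd I})"
        using BU by (intro sum.cong) (auto simp: split_beta)
      also have "\<dots> = measure lebesgue (\<Union>I\<in>h ` B. {fst I<..<snd I})"
        using pw B(2) by (intro measure_UNION'[symmetric]) auto
      also have "\<dots> \<le> measure lebesgue U"
      proof (rule measure_mono_fmeasurable)
        show "(\<Union>I\<in>h ` B. {fst I<..<snd I}) \<subseteq> U"
        proof (rule UN_least)
          fix I assume "I \<in> h ` B"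
          have "{fst I<..<snd I} \<subseteq> {fst I..snd I}" by auto
          also have "\<dots> \<subseteq> U" using BU[OF \<open>I \<in> h ` B\<close>] by simp
          finally show "{fst I<..<snd I} \<subseteq> U" .
        qed
        show "(\<Union>I\<in>h ` B. {fst I<..<snd I}) \<in> sets lebesgue" using B(2) by (intro sets.finite_UN) auto
      qed (use Um in auto)
      finally have "(\<Sum>(u,v)\<in>h ` B. v - u) < d" using Um(2) by linarith
      then have "(\<Sum>(u,v)\<in>h ` B. \<bar>F v - F u\<bar>) < \<epsilon>" using BU B(2) pw by (intro dAC) (auto simp: split_beta)
      then have bad: "(\<Sum>I\<in>B. \<bar>F (snd (h I)) - F (fst (h I))\<bar>) < \<epsilon>"
        using sumh[of "\<lambda>(u,v). \<bar>F v - F u\<bar>"] by (simp add: split_beta)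
      have tel: "(\<Sum>I\<in>p. F (snd (h I)) - F (fst (h I))) = F b - F a"
        using additive_tagged_division_1[OF \<open>a \<le> b\<close> p(1), of F] by (simp add: h_def split_beta)
      have cont1: "(\<Sum>I\<in>p. snd (h I) - fst (h I)) = b - a"
        using additive_tagged_division_1[OF \<open>a \<le> b\<close> p(1), of "\<lambda>x. x"] by (simp add: h_def split_beta)
      have "(\<Sum>(x,k)\<in>p. measure lborel k *\<^sub>R f0 x) - (F b - F a) = (\<Sum>I\<in>p. measure lborel (snd I) *\<^sub>R f0 (fst I) - (F (snd (h I)) - F (fst (h I))))"
        unfolding tel[symmetric] sum_subtractf[symmetric] by (simp add: split_beta)
      also have "norm \<dots> \<le> (\<Sum>I\<in>p. \<epsilon> * (snd (h I) - fst (h I)) + (if I \<in> B then \<bar>F (snd (h I)) - F (fst (h I))\<bar> else 0))"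
      proof (rule sum_norm_le)
        fix I assume I: "I \<in> p"
        obtain x K where xK: "I = (x,K)" by (cases I)
        obtain u v where K: "K = {u..v}" "u \<le> x" "x \<le> v" "a \<le> u" "v \<le> b" using k I xK by blast
        have h: "h I = (u,v)" using K xK by (simp add: h_def)
        show "norm (measure lborel (snd I) *\<^sub>R f0 (fst I) - (F (snd (h I)) - F (fst (h I)))) \<le>
            \<epsilon> * (snd (h I) - fst (h I)) + (if I \<in> B then \<bar>F (snd (h I)) - F (fst (h I))\<bar> else 0)"
        proof (cases "x \<in> N'")
          case True
          then have "I \<in> B" using I xK by (auto simp: B_def)
          moreover have "0 \<le> \<epsilon> * (v - u)" using \<epsilon>(1) K by auto
          ultimately show ?thesis using True h xK K by (simp add: f0_def)
        next
          case False
          then have "I \<notin> B" using xK by (auto simp: B_def)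
          have "K \<subseteq> ball x (r x)" using fineD[OF p(2), of x K] I xK K False by (simp add: \<gamma>_def)
          then have "\<bar>(v - u) * f x - (F v - F u)\<bar> \<le> \<epsilon> * (v - u)" using r(2)[of x u v] False K by auto
          then show ?thesis using False \<open>I \<notin> B\<close> h xK K by (simp add: f0_def)
        qed
      qed
      also have "\<dots> = \<epsilon> * (b - a) + (\<Sum>I\<in>B. \<bar>F (snd (h I)) - F (fst (h I))\<bar>)"
        unfolding sum.distrib sum_distrib_left[symmetric] cont1 using B fin by (simp add: sum.inter_restrict[symmetric] Int_absorb1)
      also have "\<dots> < e" using bad \<epsilon> by linarith
      finally show ?thesis .
    qed
    ultimately show "\<exists>\<gamma>. gauge \<gamma> \<and> (\<forall>\<D>. \<D> tagged_division_of {a..b} \<and> \<gamma> fine \<D> \<longrightarrow>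
           norm ((\<Sum>(x, k)\<in>\<D>. measure lborel k *\<^sub>R f0 x) - (F b - F a)) < e)"
      by (intro exI[of _ \<gamma>] conjI allI impI)
  qed
  moreover have "f x = f0 x" if "x \<in> {a..b} - N'" for x using that by (simp add: f0_def)
  ultimately show ?thesis using has_integral_spike[OF N', of "{a..b}" f f0 "F b - F a"] by blast
qed

section \<open>Operations on absolutely continuous functions and Taylor's formula\<close>

text \<open>Increments of sums, products and C1 functions all satisfy such a bound, so their
  absolute continuity reduces to this one epsilon-delta argument.\<close>

lemma abs_continuous_on_dominated:
  assumes F: "abs_continuous_on a b F" and G: "abs_continuous_on a b G"
    and R: "\<And>u v. a \<le> u \<Longrightarrow> u \<le> v \<Longrightarrow> v \<le> b \<Longrightarrow> \<bar>R v - R u\<bar> \<le> M * (\<bar>F v - F u\<bar> + \<bar>G v - G u\<bar>)"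
  shows "abs_continuous_on a b R"
  unfolding abs_continuous_on_def
proof (intro allI impI)
  fix e :: real assume e: "e > 0"
  define M' where "M' = \<bar>M\<bar> + 1"
  have M': "M' > 0" "M \<le> M'" by (auto simp: M'_def)
  have e': "e / (2 * M') > 0" using e M' by auto
  obtain d1 where d1: "d1 > 0" "\<forall>(n::nat) (u::nat \<Rightarrow> real) (v::nat \<Rightarrow> real).
        (\<forall>i<n. a \<le> u i \<and> u i \<le> v i \<and> v i \<le> b) \<longrightarrow> disjoint_family_on (\<lambda>i. {u i<..<v i}) {..<n} \<longrightarrow>
        (\<Sum>i<n. v i - u i) < d1 \<longrightarrow> (\<Sum>i<n. \<bar>F (v i) - F (u i)\<bar>) < e / (2 * M')"
    using F[unfolded abs_continuous_on_def, THEN spec, THEN mp, OF e'] by (elim exE conjE) (rule that)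
  obtain d2 where d2: "d2 > 0" "\<forall>(n::nat) (u::nat \<Rightarrow> real) (v::nat \<Rightarrow> real).
        (\<forall>i<n. a \<le> u i \<and> u i \<le> v i \<and> v i \<le> b) \<longrightarrow> disjoint_family_on (\<lambda>i. {u i<..<v i}) {..<n} \<longrightarrow>
        (\<Sum>i<n. v i - u i) < d2 \<longrightarrow> (\<Sum>i<n. \<bar>G (v i) - G (u i)\<bar>) < e / (2 * M')"
    using G[unfolded abs_continuous_on_def, THEN spec, THEN mp, OF e'] by (elim exE conjE) (rule that)
  show "\<exists>\<delta>>0. \<forall>(n::nat) (u::nat \<Rightarrow> real) (v::nat \<Rightarrow> real).
        (\<forall>i<n. a \<le> u i \<and> u i \<le> v i \<and> v i \<le> b) \<longrightarrow> disjoint_family_on (\<lambda>i. {u i<..<v i}) {..<n} \<longrightarrow>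
        (\<Sum>i<n. v i - u i) < \<delta> \<longrightarrow> (\<Sum>i<n. \<bar>R (v i) - R (u i)\<bar>) < e"
  proof (intro exI[of _ "min d1 d2"] conjI allI impI)
    fix n :: nat and u v :: "nat \<Rightarrow> real"
    assume uv: "\<forall>i<n. a \<le> u i \<and> u i \<le> v i \<and> v i \<le> b" and dj: "disjoint_family_on (\<lambda>i. {u i<..<v i}) {..<n}"
      and l: "(\<Sum>i<n. v i - u i) < min d1 d2"
    have 1: "(\<Sum>i<n. \<bar>F (v i) - F (u i)\<bar>) < e / (2 * M')"
      using d1(2)[THEN spec, THEN spec, THEN spec, THEN mp, THEN mp, THEN mp, OF uv dj] l by simp
    have 2: "(\<Sum>i<n. \<bar>G (v i) - G (u i)\<bar>) < e / (2 * M')"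
      using d2(2)[THEN spec, THEN spec, THEN spec, THEN mp, THEN mp, THEN mp, OF uv dj] l by simp
    have "(\<Sum>i<n. \<bar>R (v i) - R (u i)\<bar>) \<le> (\<Sum>i<n. M' * (\<bar>F (v i) - F (u i)\<bar> + \<bar>G (v i) - G (u i)\<bar>))"
      using uv M' by (intro sum_mono order_trans[OF R]) (auto intro!: mult_right_mono)
    also have "\<dots> = M' * ((\<Sum>i<n. \<bar>F (v i) - F (u i)\<bar>) + (\<Sum>i<n. \<bar>G (v i) - G (u i)\<bar>))"
      by (simp add: sum_distrib_left sum.distrib distrib_left)
    also have "\<dots> < M' * (e / (2 * M') + e / (2 * M'))" using 1 2 M' by (intro mult_strict_left_mono) auto
    also have "\<dots> = e" using M' by (simp add: field_simps)
    finally show "(\<Sum>i<n. \<bar>R (v i) - R (u i)\<bar>) < e" .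
  qed (use d1(1) d2(1) in auto)
qed

lemma abs_continuous_on_ident: "abs_continuous_on a b (\<lambda>x. x)"
  unfolding abs_continuous_on_def
proof (intro allI impI)
  fix e :: real assume "e > 0"
  show "\<exists>\<delta>>0. \<forall>(n::nat) (u::nat \<Rightarrow> real) (v::nat \<Rightarrow> real).
        (\<forall>i<n. a \<le> u i \<and> u i \<le> v i \<and> v i \<le> b) \<longrightarrow> disjoint_family_on (\<lambda>i. {u i<..<v i}) {..<n} \<longrightarrow>
        (\<Sum>i<n. v i - u i) < \<delta> \<longrightarrow> (\<Sum>i<n. \<bar>v i - u i\<bar>) < e"
  proof (intro exI[of _ e] conjI allI impI \<open>e > 0\<close>)
    fix n :: nat and u v :: "nat \<Rightarrow> real"
    assume uv: "\<forall>i<n. a \<le> u i \<and> u i \<le> v i \<and> v i \<le> b" and l: "(\<Sum>i<n. v i - u i) < e"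
    have "(\<Sum>i<n. \<bar>v i - u i\<bar>) = (\<Sum>i<n. v i - u i)" using uv by (intro sum.cong) auto
    then show "(\<Sum>i<n. \<bar>v i - u i\<bar>) < e" using l by simp
  qed
qed

lemma abs_continuous_on_C1:
  assumes "\<And>x. x \<in> {a..b} \<Longrightarrow> (g has_real_derivative g' x) (at x)" "continuous_on {a..b} g'"
  shows "abs_continuous_on a b g"
proof -
  have "bounded (g' ` {a..b})" using assms(2) compact_continuous_image compact_imp_bounded by blast
  then obtain M where "\<forall>y\<in>g' ` {a..b}. norm y \<le> M" unfolding bounded_iff by blast
  then have M: "\<bar>g' x\<bar> \<le> M" if "x \<in> {a..b}" for x using that by auto
  show ?thesis
  proof (rule abs_continuous_on_dominated[OF abs_continuous_on_ident abs_continuous_on_ident])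
    fix u v assume uv: "a \<le> u" "u \<le> v" "v \<le> b"
    have "norm (g v - g u) \<le> M * norm (v - u)"
    proof (rule field_differentiable_bound[of "{u..v}" g g'])
      fix x assume "x \<in> {u..v}"
      then have x: "x \<in> {a..b}" using uv by auto
      show "(g has_field_derivative g' x) (at x within {u..v})" using assms(1)[OF x] by (rule has_field_derivative_at_within)
      show "norm (g' x) \<le> M" using M[OF x] by simp
    qed (use uv in auto)
    also have "\<dots> \<le> M * (\<bar>v - u\<bar> + \<bar>v - u\<bar>)" using M[of u] uv by (intro mult_left_mono) auto
    finally show "\<bar>g v - g u\<bar> \<le> M * (\<bar>v - u\<bar> + \<bar>v - u\<bar>)" by simp
  qed
qed

lemma abs_continuous_on_mult:
  assumes F: "abs_continuous_on a b F" and G: "abs_continuous_on a b G"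
  shows "abs_continuous_on a b (\<lambda>x. F x * G x)"
proof -
  have "bounded (F ` {a..b})" "bounded (G ` {a..b})"
    using abs_continuous_on_imp_continuous_on[OF F] abs_continuous_on_imp_continuous_on[OF G]
    by (meson compact_Icc compact_continuous_image compact_imp_bounded)+
  then obtain M N where "\<forall>y\<in>F ` {a..b}. norm y \<le> M" "\<forall>y\<in>G ` {a..b}. norm y \<le> N" unfolding bounded_iff by blast
  then have M: "\<bar>F x\<bar> \<le> M" and N: "\<bar>G x\<bar> \<le> N" if "x \<in> {a..b}" for x using that by auto
  show ?thesis
  proof (rule abs_continuous_on_dominated[OF F G])
    fix u v assume uv: "a \<le> u" "u \<le> v" "v \<le> b"
    have "F v * G v - F u * G u = F v * (G v - G u) + G u * (F v - F u)" by (simp add: algebra_simps)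
    also have "\<bar>\<dots>\<bar> \<le> \<bar>F v\<bar> * \<bar>G v - G u\<bar> + \<bar>G u\<bar> * \<bar>F v - F u\<bar>" by (metis abs_mult abs_triangle_ineq)
    also have "\<dots> \<le> max M N * \<bar>G v - G u\<bar> + max M N * \<bar>F v - F u\<bar>"
      using M[of v] N[of u] uv by (intro add_mono mult_right_mono) auto
    finally show "\<bar>F v * G v - F u * G u\<bar> \<le> max M N * (\<bar>F v - F u\<bar> + \<bar>G v - G u\<bar>)" by (simp add: algebra_simps)
  qed
qed

lemma abs_continuous_on_sum:
  assumes "\<And>i. i \<in> I \<Longrightarrow> abs_continuous_on a b (F i)"
  shows "abs_continuous_on a b (\<lambda>x. \<Sum>i\<in>I. F i x)"
  using assms
proof (induction I rule: infinite_finite_induct)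
  case (insert i I)
  have "abs_continuous_on a b (\<lambda>x. F i x + (\<Sum>i\<in>I. F i x))"
    by (rule abs_continuous_on_dominated[of _ _ "F i" "\<lambda>x. \<Sum>i\<in>I. F i x" _ 1]) (use insert in auto)
  then show ?case using insert by simp
qed (auto simp: abs_continuous_on_def intro: exI[of _ 1])

text \<open>As a function of its base point v, the Taylor polynomial evaluated at y has the
  telescoping derivative \<open>H v * (y - v) ^ (k-1) / fact (k-1)\<close> wherever
  \<open>D (k-1)\<close> is differentiable. It is absolutely continuous in v, so the fundamental
  theorem applies. With y kept apart from a and b, both orders of point and base point are
  covered.\<close>

lemma Taylor_abs_continuous:
  fixes D :: "nat \<Rightarrow> real \<Rightarrow> real"
  assumes "k \<ge> 1" "a \<le> b"
    and D: "\<And>m x. m < k - 1 \<Longrightarrow> x \<in> {a..b} \<Longrightarrow> (D m has_real_derivative D (Suc m) x) (at x)"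
    and AC: "abs_continuous_on a b (D (k-1))"
    and H: "\<And>x. x \<in> {a<..<b} \<Longrightarrow> D (k-1) differentiable (at x) \<Longrightarrow> H x = deriv (D (k-1)) x"
  shows "((\<lambda>v. H v * (y - v) ^ (k-1) / fact (k-1)) has_integral
      ((\<Sum>m<k. D m b * (y - b) ^ m / fact m) - (\<Sum>m<k. D m a * (y - a) ^ m / fact m))) {a..b}"
proof -
  obtain k' where k': "k = Suc k'" using \<open>k \<ge> 1\<close> by (cases k) auto
  have contD: "continuous_on {a..b} (D m)" if "m < k - 1" for m
    using D[OF that] DERIV_isCont continuous_at_imp_continuous_on by blast
  have contD': "continuous_on {a..b} (D m)" if "m < k" for m
  proof (cases "m = k - 1")
    case True then show ?thesis using abs_continuous_on_imp_continuous_on[OF AC] by simp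
  next
    case False then show ?thesis using contD[of m] that by simp
  qed
  have ACm: "abs_continuous_on a b (D m)" if "m < k" for m
  proof (cases "m = k - 1")
    case False
    then have m: "m < k - 1" "Suc m < k" using that by auto
    show ?thesis using abs_continuous_on_C1[of a b "D m" "D (Suc m)"] D[OF m(1)] contD'[OF m(2)] by blast
  qed (use AC in simp)
  show ?thesis
  proof (rule abs_continuous_on_has_integral)
    show "abs_continuous_on a b (\<lambda>v. \<Sum>m<k. D m v * (y - v) ^ m / fact m)"
    proof (rule abs_continuous_on_sum)
      fix m assume m: "m \<in> {..<k}"
      have "abs_continuous_on a b (\<lambda>v. D m v * ((y - v) ^ m / fact m))"
        by (intro abs_continuous_on_mult ACm abs_continuous_on_C1[of a b _ "\<lambda>v. - (real m * (y - v) ^ (m-1)) / fact m"])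
          (use m in \<open>auto intro!: derivative_eq_intros continuous_intros\<close>)
      then show "abs_continuous_on a b (\<lambda>v. D m v * (y - v) ^ m / fact m)" by simp
    qed
    show "negligible {x \<in> {a<..<b}. \<not> D (k-1) differentiable (at x)}"
      by (rule abs_continuous_on_imp_differentiable_ae[OF AC])
    fix x assume x: "x \<in> {a<..<b} - {x \<in> {a<..<b}. \<not> D (k-1) differentiable (at x)}"
    then have "(D (k-1) has_real_derivative H x) (at x)"
      using H[of x] DERIV_deriv_iff_real_differentiable[of "D (k-1)" x] by auto
    then have D': "(D k' has_real_derivative H x) (at x)" using k' by simp
    have DD: "(D m has_real_derivative D (Suc m) x) (at x)" if "m < k'" for m using D[of m x] that x k' by auto
    have "((\<lambda>v. \<Sum>m<j. D m v * (y - v) ^ m / fact m) has_real_derivative D j x * (y - x) ^ (j-1) / fact (j-1)) (at x)" if "j \<ge> 1" "j \<le> k'" for j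
      using that
    proof (induction j rule: nat_induct_at_least)
      case base
      then show ?case using DD[of 0] by simp
    next
      case (Suc j)
      obtain i where i: "j = Suc i" using Suc by (cases j) auto
      have "((\<lambda>v. D j v * (y - v) ^ j / fact j) has_real_derivative
           (D (Suc j) x * (y - x) ^ j + D j x * (real j * (y - x) ^ (j - 1) * (0 - 1))) / fact j) (at x)"
        using Suc.prems by (auto intro!: derivative_eq_intros DD)
      from DERIV_add[OF Suc.IH this] Suc.prems
      show ?case by (simp add: i field_simps del: of_nat_Suc)
    qed
    note ind = this
    show "((\<lambda>v. \<Sum>m<k. D m v * (y - v) ^ m / fact m) has_real_derivative H x * (y - x) ^ (k-1) / fact (k-1)) (at x)"
    proof (cases "k' = 0")
      case True
      then show ?thesis using k' D' by simp
    next
      case False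
      then obtain i where i: "k' = Suc i" by (cases k') auto
      have "((\<lambda>v. D k' v * (y - v) ^ k' / fact k') has_real_derivative
           (H x * (y - x) ^ k' + D k' x * (real k' * (y - x) ^ (k' - 1) * (0 - 1))) / fact k') (at x)"
        by (auto intro!: derivative_eq_intros D')
      from DERIV_add[OF ind[of k'] this] i
      have *: "((\<lambda>v. (\<Sum>m<k'. D m v * (y - v) ^ m / fact m) + D k' v * (y - v) ^ k' / fact k') has_real_derivative
         D k' x * (y - x) ^ (k' - 1) / fact (k' - 1) +
         (H x * (y - x) ^ k' + D k' x * (real k' * (y - x) ^ (k' - 1) * (0 - 1))) / fact k') (at x)" by simp
      have "D k' x * (y - x) ^ (k' - 1) / fact (k' - 1) +
         (H x * (y - x) ^ k' + D k' x * (real k' * (y - x) ^ (k' - 1) * (0 - 1))) / fact k' = H x * (y - x) ^ (k-1) / fact (k-1)"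
        by (simp add: i k' field_simps del: of_nat_Suc)
      with * show ?thesis by (simp add: k')
    qed
  qed (rule \<open>a \<le> b\<close>)
qed

section \<open>Finite differences\<close>

text \<open>The forward counterpart of \<open>sym_diff\<close>: for h > 0 all nodes lie on one side
  of x, which is what the lower bound exploits.\<close>

definition fdiff :: "nat \<Rightarrow> real \<Rightarrow> (real \<Rightarrow> real) \<Rightarrow> real \<Rightarrow> real" where
  "fdiff k h f x = (\<Sum>i\<le>k. (-1) ^ (k - i) * real (k choose i) * f (x + real i * h))"

lemma fdiff_0 [simp]: "fdiff 0 h f x = f x" by (simp add: fdiff_def)

lemma fdiff_Suc: "fdiff (Suc k) h f x = fdiff k h (\<lambda>x. f (x + h) - f x) x"
proof -
  have "fdiff (Suc k) h f x = (\<Sum>i\<le>Suc k. (-1) ^ (Suc k - i) * real (Suc k choose i) * f (x + real i * h))"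
    by (simp add: fdiff_def)
  also have "\<dots> = (-1) ^ Suc k * f x + (\<Sum>i\<le>k. (-1) ^ (k - i) * real (Suc k choose Suc i) * f (x + real (Suc i) * h))"
    by (subst sum.atMost_Suc_shift) simp
  also have "(\<Sum>i\<le>k. (-1) ^ (k - i) * real (Suc k choose Suc i) * f (x + real (Suc i) * h)) =
     (\<Sum>i\<le>k. (-1) ^ (k - i) * real (k choose i) * f (x + h + real i * h)) +
     (\<Sum>i\<le>k. (-1) ^ (k - i) * real (k choose Suc i) * f (x + real (Suc i) * h))"
    by (simp add: sum.distrib[symmetric] algebra_simps)
  also have "(-1) ^ Suc k * f x + ((\<Sum>i\<le>k. (-1) ^ (k - i) * real (k choose i) * f (x + h + real i * h)) +
     (\<Sum>i\<le>k. (-1) ^ (k - i) * real (k choose Suc i) * f (x + real (Suc i) * h))) =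
     (\<Sum>i\<le>k. (-1) ^ (k - i) * real (k choose i) * f (x + h + real i * h)) +
     (\<Sum>i\<le>Suc k. (-1) ^ (Suc k - i) * real (k choose i) * f (x + real i * h))"
    by (subst sum.atMost_Suc_shift) simp
  also have "(\<Sum>i\<le>Suc k. (-1) ^ (Suc k - i) * real (k choose i) * f (x + real i * h)) =
     - (\<Sum>i\<le>k. (-1) ^ (k - i) * real (k choose i) * f (x + real i * h))"
    by (simp add: sum_negf[symmetric] Suc_diff_le)
  finally show ?thesis unfolding fdiff_def
    by (simp add: sum_subtractf[symmetric] algebra_simps)
qed

lemma fdiff_sum: "fdiff k h (\<lambda>x. \<Sum>j\<in>J. c j * f j x) x = (\<Sum>j\<in>J. c j * fdiff k h (f j) x)"
  unfolding fdiff_def sum_distrib_left by (subst sum.swap) (intro sum.cong refl; simp add: mult_ac)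

text \<open>A first difference lowers the degree of a polynomial by one and multiplies the leading
  coefficient by the degree and by h. The shift c allows powers centred at any point.\<close>

lemma fdiff_power:
  assumes "m \<le> k"
  shows "fdiff k h (\<lambda>x. (c + x) ^ m) x = (if m = k then fact k * h ^ k else 0)"
  using assms
proof (induction k arbitrary: m x)
  case (Suc k)
  have "fdiff (Suc k) h (\<lambda>x. (c + x) ^ m) x = fdiff k h (\<lambda>x. (c + (x + h)) ^ m - (c + x) ^ m) x" by (rule fdiff_Suc)
  also have "(\<lambda>x. (c + (x + h)) ^ m - (c + x) ^ m) = (\<lambda>x. \<Sum>j<m. (real (m choose j) * h ^ (m - j)) * (c + x) ^ j)"
  proof
    fix x
    have "(c + (x + h)) ^ m = ((c + x) + h) ^ m" by (simp add: add.assoc)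
    also have "\<dots> = (\<Sum>j\<le>m. real (m choose j) * (c + x) ^ j * h ^ (m - j))" by (simp add: binomial_ring)
    also have "\<dots> = (\<Sum>j<m. real (m choose j) * (c + x) ^ j * h ^ (m - j)) + (c + x) ^ m"
      by (simp add: lessThan_Suc_atMost[symmetric])
    finally show "(c + (x + h)) ^ m - (c + x) ^ m = (\<Sum>j<m. (real (m choose j) * h ^ (m - j)) * (c + x) ^ j)"
      by (simp add: mult_ac)
  qed
  also have "fdiff k h (\<lambda>x. \<Sum>j<m. (real (m choose j) * h ^ (m - j)) * (c + x) ^ j) x =
      (\<Sum>j<m. (real (m choose j) * h ^ (m - j)) * (if j = k then fact k * h ^ k else 0))"
    unfolding fdiff_sum using Suc.prems by (intro sum.cong) (auto simp: Suc.IH)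
  also have "\<dots> = (if m = Suc k then fact (Suc k) * h ^ Suc k else 0)"
    using Suc.prems by (cases "m = Suc k") (auto simp: if_distrib cong: if_cong)
  finally show ?case .
qed auto

section \<open>Convex gauges and norms\<close>

text \<open>Young functions, extended by 0 to the negative axis: convexity on the whole line then
  provides continuity, hence measurability, and a supporting line at every point.\<close>

definition modular :: "(real \<Rightarrow> real) \<Rightarrow> bool" where
  "modular \<theta> \<longleftrightarrow> convex_on UNIV \<theta> \<and> mono \<theta> \<and> (\<forall>x\<le>0. \<theta> x = 0)"

lemma modular_nonneg: "modular \<theta> \<Longrightarrow> 0 \<le> \<theta> x"
  unfolding modular_def mono_def by (metis linear)

lemma modular_mono: "modular \<theta> \<Longrightarrow> x \<le> y \<Longrightarrow> \<theta> x \<le> \<theta> y"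
  unfolding modular_def mono_def by blast

lemma modular_measurable: "modular \<theta> \<Longrightarrow> \<theta> \<in> borel_measurable borel"
  unfolding modular_def by (intro borel_measurable_continuous_onI convex_on_continuous) auto

lemma modular_average:
  assumes "modular \<theta>" "finite I" "I \<noteq> {}"
  shows "\<theta> ((\<Sum>i\<in>I. a i) / real (card I)) \<le> (\<Sum>i\<in>I. \<theta> (a i)) / real (card I)"
proof -
  have "card I > 0" using assms by (simp add: card_gt_0_iff)
  have "\<theta> (\<Sum>i\<in>I. (1 / real (card I)) *\<^sub>R a i) \<le> (\<Sum>i\<in>I. (1 / real (card I)) * \<theta> (a i))"
    using assms \<open>card I > 0\<close> unfolding modular_def by (intro convex_on_sum[where C=UNIV]) auto
  then show ?thesis by (simp add: sum_divide_distrib)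
qed

lemma modular_half_add: "modular \<theta> \<Longrightarrow> \<theta> ((a + b) / 2) \<le> (\<theta> a + \<theta> b) / 2"
  using modular_average[of \<theta> "{0,1::nat}" "\<lambda>i. if i = 0 then a else b"] by simp

text \<open>The supporting line of \<open>\<theta>\<close> at X is integrated against the
  probability density w. The average may be infinite and X is only a lower bound for it, so the
  inequality is arranged with nonnegative terms on both sides; this uses that the slope m is
  nonnegative by monotonicity.\<close>

lemma modular_Jensen:
  fixes w :: "'a \<Rightarrow> ennreal" and g :: "'a \<Rightarrow> real"
  assumes \<theta>: "modular \<theta>" and [measurable]: "w \<in> borel_measurable M" "g \<in> borel_measurable M"
    and w: "(\<integral>\<^sup>+x. w x \<partial>M) = 1" and g: "\<And>x. x \<in> space M \<Longrightarrow> 0 \<le> g x"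
    and X: "ennreal X \<le> (\<integral>\<^sup>+x. w x * ennreal (g x) \<partial>M)"
  shows "ennreal (\<theta> X) \<le> (\<integral>\<^sup>+x. w x * ennreal (\<theta> (g x)) \<partial>M)"
proof (cases "X \<le> 0")
  case True
  then show ?thesis using \<theta> by (simp add: modular_def)
next
  case False
  then have X0: "X > 0" by simp
  note [measurable] = modular_measurable[OF \<theta>]
  obtain m where m: "\<And>y. \<theta> y \<ge> \<theta> X + m * (y - X)"
    using convex_le_Inf_differential[of UNIV \<theta> X] \<theta> unfolding modular_def by auto
  have m0: "m \<ge> 0"
  proof (rule ccontr)
    assume "\<not> m \<ge> 0"
    then have "0 < m * ((X - 1) - X)" by simp
    moreover have "\<theta> (X - 1) \<le> \<theta> X" by (rule modular_mono[OF \<theta>]) simp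
    ultimately show False using m[of "X - 1"] by linarith
  qed
  have pw: "w x * ennreal (\<theta> X) + ennreal m * (w x * ennreal (g x)) \<le> w x * ennreal (\<theta> (g x)) + ennreal (m * X) * w x" if "x \<in> space M" for x
  proof -
    have "ennreal (\<theta> X) + ennreal m * ennreal (g x) = ennreal (\<theta> X + m * g x)"
      using m0 g[OF that] modular_nonneg[OF \<theta>] by (simp add: ennreal_mult)
    also have "\<dots> \<le> ennreal (\<theta> (g x) + m * X)" using m[of "g x"] by (intro ennreal_leI) (simp add: algebra_simps)
    also have "\<dots> = ennreal (\<theta> (g x)) + ennreal (m * X)" using m0 X0 modular_nonneg[OF \<theta>] by simp
    finally have "w x * (ennreal (\<theta> X) + ennreal m * ennreal (g x)) \<le> w x * (ennreal (\<theta> (g x)) + ennreal (m * X))"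
      by (rule mult_left_mono) simp
    then show ?thesis by (simp add: distrib_left mult_ac)
  qed
  have "ennreal (\<theta> X) + ennreal (m * X) \<le> ennreal (\<theta> X) + ennreal m * (\<integral>\<^sup>+x. w x * ennreal (g x) \<partial>M)"
    using X m0 X0 by (intro add_left_mono) (simp add: ennreal_mult mult_left_mono)
  also have "\<dots> = (\<integral>\<^sup>+x. w x * ennreal (\<theta> X) + ennreal m * (w x * ennreal (g x)) \<partial>M)"
    by (simp add: nn_integral_add nn_integral_cmult nn_integral_multc w)
  also have "\<dots> \<le> (\<integral>\<^sup>+x. w x * ennreal (\<theta> (g x)) + ennreal (m * X) * w x \<partial>M)"
    using pw by (rule nn_integral_mono)
  also have "\<dots> = (\<integral>\<^sup>+x. w x * ennreal (\<theta> (g x)) \<partial>M) + ennreal (m * X)"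
    by (simp add: nn_integral_add nn_integral_cmult w)
  finally show ?thesis by (simp add: ennreal_add_left_cancel_le add.commute)
qed

section \<open>From gauge inequalities to norm inequalities\<close>

definition \<theta>pow :: "real \<Rightarrow> real \<Rightarrow> real" where "\<theta>pow q s = max 0 s powr q"
definition \<theta>pos :: "real \<Rightarrow> real \<Rightarrow> real" where "\<theta>pos a s = max 0 (s - a)"

lemma modular_\<theta>pow:
  assumes "q \<ge> 1" shows "modular (\<theta>pow q)"
proof -
  have conv: "convex_on {0..} (\<lambda>x::real. x powr q)"
  proof (rule convex_onI)
    fix t x y :: real assume t: "0 < t" "t < 1" and xy: "x \<in> {0..}" "y \<in> {0..}"
    \<comment> \<open>If one of the two points is 0, convexity reduces to this inequality; pairs of
      positive points are covered by \<open>powr_convex\<close>.\<close>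
    have *: "(s * z) powr q \<le> s * z powr q" if "0 < s" "s < 1" "0 \<le> z" for s z :: real
    proof -
      have "s powr q \<le> s powr 1" using that assms by (intro powr_mono') auto
      then show ?thesis using that by (simp add: powr_mult mult_right_mono)
    qed
    consider "x = 0" | "y = 0" | "x > 0" "y > 0" using xy by force
    then show "((1 - t) *\<^sub>R x + t *\<^sub>R y) powr q \<le> (1 - t) * x powr q + t * y powr q"
    proof cases
      case 3
      then show ?thesis using convex_onD[OF powr_convex[OF assms], of t x y] t by auto
    qed (use * t xy in auto)
  qed (simp add: convex_real_interval)
  have "convex_on UNIV (\<theta>pow q)"
  proof (rule convex_onI)
    fix t x y :: real assume t: "0 < t" "t < 1"
    have "max 0 ((1 - t) *\<^sub>R x + t *\<^sub>R y) \<le> (1 - t) * max 0 x + t * max 0 y"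
      using t by (intro max.boundedI add_mono) (auto intro!: mult_left_mono add_nonneg_nonneg)
    then have "\<theta>pow q ((1 - t) *\<^sub>R x + t *\<^sub>R y) \<le> ((1 - t) * max 0 x + t * max 0 y) powr q"
      unfolding \<theta>pow_def using assms by (intro powr_mono2) auto
    also have "\<dots> \<le> (1 - t) * \<theta>pow q x + t * \<theta>pow q y"
      unfolding \<theta>pow_def using convex_onD[OF conv, of t "max 0 x" "max 0 y"] t by auto
    finally show "\<theta>pow q ((1 - t) *\<^sub>R x + t *\<^sub>R y) \<le> (1 - t) * \<theta>pow q x + t * \<theta>pow q y" .
  qed auto
  moreover have "mono (\<theta>pow q)" unfolding mono_def \<theta>pow_def using assms by (auto intro!: powr_mono2)
  ultimately show ?thesis unfolding modular_def \<theta>pow_def by (auto simp: max_def)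
qed

lemma modular_\<theta>pos:
  assumes "a \<ge> 0" shows "modular (\<theta>pos a)"
proof -
  have "convex_on UNIV (\<theta>pos a)"
  proof (rule convex_onI)
    fix t x y :: real assume t: "0 < t" "t < 1"
    have 1: "(1 - t) * (x - a) \<le> (1 - t) * max 0 (x - a)" "t * (y - a) \<le> t * max 0 (y - a)"
      using t by (intro mult_left_mono; auto)+
    have 2: "0 \<le> (1 - t) * max 0 (x - a)" "0 \<le> t * max 0 (y - a)" using t by auto
    show "\<theta>pos a ((1 - t) *\<^sub>R x + t *\<^sub>R y) \<le> (1 - t) * \<theta>pos a x + t * \<theta>pos a y"
      unfolding \<theta>pos_def using 1 2 by (intro max.boundedI) (auto simp: algebra_simps)
  qed auto
  then show ?thesis using assms unfolding modular_def \<theta>pos_def mono_def by auto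
qed

lemma ennreal_powr_mono: "a \<ge> 0 \<Longrightarrow> x \<le> y \<Longrightarrow> ennreal_powr x a \<le> ennreal_powr y a"
  unfolding ennreal_powr_def
  by (auto simp: top_unique intro!: ennreal_leI powr_mono2 enn2real_mono simp: less_top)

lemma ennreal_powr_cmult: "c > 0 \<Longrightarrow> ennreal_powr (ennreal c * x) a = ennreal (c powr a) * ennreal_powr x a"
  unfolding ennreal_powr_def
  by (cases x) (auto simp: ennreal_mult[symmetric] powr_mult ennreal_mult_top)

text \<open>Since \<open>C' \<ge> 1\<close>, its power with exponent 1/q is at most C', so the
  constant \<open>C * C'\<close> is free of p. Z is kept arbitrary because the bound is used both
  with a norm and with the averaged modulus on the right.\<close>

lemma Lp_norm_le_of_modular_pow:
  assumes p: "p \<noteq> \<infinity>" "1 \<le> enn2real p" and u: "u \<in> borel_measurable (lebesgue_on A)" and C: "C > 0" "C' \<ge> 1"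
    and le: "(\<integral>\<^sup>+x. ennreal (\<theta>pow (enn2real p) (\<bar>u x\<bar> / C)) \<partial>lebesgue_on A) \<le> ennreal C' * Z"
  shows "Lp_norm p A u \<le> ennreal (C * C') * ennreal_powr Z (1 / enn2real p)"
proof -
  define q where "q = enn2real p"
  have q: "q \<ge> 1" using p by (simp add: q_def)
  note [measurable] = u modular_measurable[OF modular_\<theta>pow[OF q]]
  have "(\<integral>\<^sup>+x. ennreal (\<bar>u x\<bar> powr q) \<partial>lebesgue_on A) = (\<integral>\<^sup>+x. ennreal (C powr q) * ennreal (\<theta>pow q (\<bar>u x\<bar> / C)) \<partial>lebesgue_on A)"
    using C by (intro nn_integral_cong) (auto simp: \<theta>pow_def powr_divide ennreal_mult[symmetric])
  also have "\<dots> \<le> ennreal (C powr q) * (\<integral>\<^sup>+x. ennreal (\<theta>pow q (\<bar>u x\<bar> / C)) \<partial>lebesgue_on A)"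
    by (subst nn_integral_cmult) auto
  also have "\<dots> \<le> ennreal (C powr q) * (ennreal C' * Z)"
    using le by (intro mult_left_mono) (auto simp: q_def)
  also have "\<dots> = ennreal (C powr q * C') * Z" using C by (simp add: ennreal_mult mult.assoc)
  finally have "ennreal_powr (\<integral>\<^sup>+x. ennreal (\<bar>u x\<bar> powr q) \<partial>lebesgue_on A) (1/q) \<le> ennreal_powr (ennreal (C powr q * C') * Z) (1/q)"
    using q by (intro ennreal_powr_mono) auto
  also have "\<dots> = ennreal ((C powr q * C') powr (1/q)) * ennreal_powr Z (1/q)"
    using C by (intro ennreal_powr_cmult) auto
  also have "\<dots> \<le> ennreal (C * C') * ennreal_powr Z (1/q)"
  proof (intro mult_right_mono ennreal_leI)
    have "(C powr q * C') powr (1/q) = C * C' powr (1/q)" using C q by (simp add: powr_mult powr_powr)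
    also have "\<dots> \<le> C * C' powr 1" using C q by (intro mult_left_mono powr_mono) auto
    finally show "(C powr q * C') powr (1/q) \<le> C * C'" using C by simp
  qed simp
  finally show ?thesis using p by (simp add: Lp_norm_def q_def)
qed

lemma Lp_norm_le_of_modular_pos:
  assumes u: "u \<in> borel_measurable (lebesgue_on A)" and C: "C > 0" "a \<ge> 0"
    and le: "(\<integral>\<^sup>+x. ennreal (\<theta>pos a (\<bar>u x\<bar> / C)) \<partial>lebesgue_on A) = 0"
  shows "Lp_norm \<infinity> A u \<le> ennreal (C * a)"
proof -
  note [measurable] = u modular_measurable[OF modular_\<theta>pos[OF C(2)]]
  have "AE x in lebesgue_on A. ennreal (\<theta>pos a (\<bar>u x\<bar> / C)) = 0"
    using le by (subst (asm) nn_integral_0_iff_AE) auto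
  then have "AE x in lebesgue_on A. ennreal \<bar>u x\<bar> \<le> ennreal (C * a)"
    by (rule AE_mp) (use C in \<open>auto intro!: AE_I2 ennreal_leI simp: \<theta>pos_def max_def field_simps split: if_splits\<close>)
  then show ?thesis unfolding Lp_norm_def by (auto intro!: esssup_I)
qed

text \<open>For \<open>p = \<infinity>\<close> the gauge is \<open>\<theta>pos a\<close> with a the
  essential supremum of v: the right-hand integral vanishes, hence so does the left-hand one, and
  this says that u is bounded by \<open>C * a\<close> almost everywhere.\<close>

lemma Lp_norm_le_modular:
  assumes p: "1 \<le> p" and u: "u \<in> borel_measurable (lebesgue_on A)" and v: "v \<in> borel_measurable (lebesgue_on B)"
    and C: "C > 0" "C' \<ge> 1"
    and le: "\<And>\<theta>. modular \<theta> \<Longrightarrow> (\<integral>\<^sup>+x. ennreal (\<theta> (\<bar>u x\<bar> / C)) \<partial>lebesgue_on A) \<le>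
       ennreal C' * (\<integral>\<^sup>+x. ennreal (\<theta> \<bar>v x\<bar>) \<partial>lebesgue_on B)"
  shows "Lp_norm p A u \<le> ennreal (C * C') * Lp_norm p B v"
proof (cases "p = \<infinity>")
  case False
  then have q: "1 \<le> enn2real p" using p by (cases p) auto
  have "Lp_norm p B v = ennreal_powr (\<integral>\<^sup>+x. ennreal (\<theta>pow (enn2real p) \<bar>v x\<bar>) \<partial>lebesgue_on B) (1 / enn2real p)"
    using False by (simp add: Lp_norm_def \<theta>pow_def)
  then show ?thesis using Lp_norm_le_of_modular_pow[OF False q u C le[OF modular_\<theta>pow[OF q]]] by simp
next
  case True
  show ?thesis
  proof (cases "Lp_norm p B v")
    case top
    then show ?thesis using C by (simp add: ennreal_mult_top)
  next
    case (real a)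
    have a: "a \<ge> 0" by (rule real)
    have "AE x in lebesgue_on B. ennreal \<bar>v x\<bar> \<le> ennreal a"
      using esssup_AE[of "\<lambda>x. ennreal \<bar>v x\<bar>" "lebesgue_on B"] real True by (simp add: Lp_norm_def)
    then have "AE x in lebesgue_on B. ennreal (\<theta>pos a \<bar>v x\<bar>) = 0"
      by (rule AE_mp) (use a in \<open>auto intro!: AE_I2 simp: \<theta>pos_def\<close>)
    then have "(\<integral>\<^sup>+x. ennreal (\<theta>pos a \<bar>v x\<bar>) \<partial>lebesgue_on B) = 0"
      by (subst nn_integral_cong_AE[where v="\<lambda>_. 0"]) auto
    then have "(\<integral>\<^sup>+x. ennreal (\<theta>pos a (\<bar>u x\<bar> / C)) \<partial>lebesgue_on A) = 0"
      using le[OF modular_\<theta>pos[OF a]] by simp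
    from Lp_norm_le_of_modular_pos[OF u C(1) a this]
    have "Lp_norm p A u \<le> ennreal (C * a)" using True by simp
    also have "\<dots> \<le> ennreal (C * C') * ennreal a"
      using C a by (simp add: ennreal_mult[symmetric] mult_right_mono)
    finally show ?thesis using real by simp
  qed
qed

lemma Lp_norm_cong_AE:
  assumes A: "A \<in> sets lebesgue" and ae: "AE x in lebesgue_on A. u x = v x"
    and u: "u \<in> borel_measurable (lebesgue_on A)"
  shows "v \<in> borel_measurable (lebesgue_on A)" "Lp_norm p A u = Lp_norm p A v"
proof -
  have "AE x in lebesgue. (if x \<in> A then u x else 0) = (if x \<in> A then v x else 0)"
    using ae A by (auto simp: AE_restrict_space_iff elim: eventually_mono)
  moreover have "(\<lambda>x. if x \<in> A then u x else 0) \<in> borel_measurable lebesgue"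
    using u A by (simp add: borel_measurable_if)
  ultimately have "(\<lambda>x. if x \<in> A then v x else 0) \<in> borel_measurable lebesgue" by (rule borel_measurable_AE[rotated])
  then show v: "v \<in> borel_measurable (lebesgue_on A)" using A by (simp add: borel_measurable_if)
  show "Lp_norm p A u = Lp_norm p A v"
  proof (cases "p = \<infinity>")
    case True
    have "esssup (lebesgue_on A) (\<lambda>x. ennreal \<bar>u x\<bar>) = esssup (lebesgue_on A) (\<lambda>x. ennreal \<bar>v x\<bar>)"
      by (rule esssup_AE_cong) (use u v ae in \<open>auto elim: eventually_mono\<close>)
    then show ?thesis using True by (simp add: Lp_norm_def)
  next
    case False
    have "(\<integral>\<^sup>+x. ennreal (\<bar>u x\<bar> powr enn2real p) \<partial>lebesgue_on A) = (\<integral>\<^sup>+x. ennreal (\<bar>v x\<bar> powr enn2real p) \<partial>lebesgue_on A)"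
      by (rule nn_integral_cong_AE) (use ae in \<open>auto elim: eventually_mono\<close>)
    then show ?thesis using False by (simp add: Lp_norm_def)
  qed
qed

section \<open>The modulus is bounded by the K-functional\<close>

lemma \<phi>_measurable [measurable]: "\<phi> \<in> borel_measurable borel"
  unfolding \<phi>_def[abs_def] by measurable

lemma \<phi>_nonneg: "\<bar>x\<bar> \<le> 1 \<Longrightarrow> 0 \<le> \<phi> x"
  unfolding \<phi>_def by (simp add: abs_square_le_1)

lemma \<phi>_pos: "\<bar>x\<bar> < 1 \<Longrightarrow> 0 < \<phi> x"
  unfolding \<phi>_def by (simp add: abs_square_less_1)

lemma \<phi>_sq: "\<bar>x\<bar> \<le> 1 \<Longrightarrow> \<phi> x ^ 2 = 1 - x\<^sup>2"
  unfolding \<phi>_def by (simp add: abs_square_le_1)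

lemma \<phi>_minus [simp]: "\<phi> (- x) = \<phi> x"
  by (simp add: \<phi>_def)

lemma DERIV_\<phi>: "\<bar>x\<bar> < 1 \<Longrightarrow> (\<phi> has_real_derivative (- x / \<phi> x)) (at x)"
  unfolding \<phi>_def[abs_def] using abs_square_less_1[of x]
  by (auto intro!: derivative_eq_intros simp: field_simps)

lemma D_setD:
  assumes "x \<in> D_set \<delta>"
  shows "\<bar>x\<bar> < 1" "\<delta> * \<phi> x / 2 \<le> 1 - \<bar>x\<bar>"
  using assms by (auto simp: D_set_def abs_less_iff abs_le_iff)

lemma D_set_interval: "\<delta> > 0 \<Longrightarrow> D_set \<delta> = {- ((4 - \<delta>\<^sup>2) / (4 + \<delta>\<^sup>2)) .. (4 - \<delta>\<^sup>2) / (4 + \<delta>\<^sup>2)}"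
  by (auto simp: D_set_eq abs_le_iff)

lemma D_set_borel [measurable]: "\<delta> > 0 \<Longrightarrow> D_set \<delta> \<in> sets borel"
  by (simp add: D_set_interval)

text \<open>On \<open>D_set \<delta>\<close> the shift satisfies
  \<open>\<bar>c * \<phi> x\<bar> \<le> 1 - \<bar>x\<bar>\<close>. As
  \<open>\<phi> x ^ 2 = (1 - \<bar>x\<bar>) * (1 + \<bar>x\<bar>)\<close>, the term
  \<open>c * x / \<phi> x\<close> of the Jacobian is at most
  \<open>\<bar>x\<bar> / (1 + \<bar>x\<bar>) \<le> 1/2\<close> in absolute value. The factor 2 is
  the inverse of the remaining 1/2.\<close>

lemma nn_integral_shift_\<phi>:
  fixes g :: "real \<Rightarrow> ennreal"
  assumes \<delta>: "\<delta> > 0" and c: "\<bar>c\<bar> \<le> \<delta> / 2" and g[measurable]: "g \<in> borel_measurable borel"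
  shows "(\<integral>\<^sup>+x. g (x + c * \<phi> x) * indicator (D_set \<delta>) x \<partial>lborel) \<le> 2 * (\<integral>\<^sup>+x. g x * indicator {-1..1} x \<partial>lborel)"
proof -
  define m where "m = (4 - \<delta>\<^sup>2) / (4 + \<delta>\<^sup>2)"
  have D: "D_set \<delta> = {-m..m}" using D_set_interval[OF \<delta>] by (simp add: m_def)
  show ?thesis
  proof (cases "m > 0")
    case False
    \<comment> \<open>For \<open>m \<le> 0\<close> the set \<open>D_set \<delta>\<close> has at most
      one point, and the left-hand integral is 0.\<close>
    then have "{-m..m} \<subseteq> {0}" by auto
    then have "(\<integral>\<^sup>+x. g (x + c * \<phi> x) * indicator {-m..m} x \<partial>lborel) \<le> (\<integral>\<^sup>+x. g (x + c * \<phi> x) * indicator {0} x \<partial>lborel)"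
      by (intro nn_integral_mono mult_left_mono) (auto split: split_indicator)
    also have "\<dots> = 0"
      by (simp add: nn_integral_0_iff_AE)
    finally show ?thesis by (simp add: D)
  next
    case True
    define T where "T x = x + c * \<phi> x" for x
    define T' where "T' x = 1 + c * (- x / \<phi> x)" for x
    have in1: "\<bar>x\<bar> < 1" "\<delta> * \<phi> x / 2 \<le> 1 - \<bar>x\<bar>" if "x \<in> {-m..m}" for x using D_setD[of x \<delta>] that D by auto
    have cphi: "\<bar>c * \<phi> x\<bar> \<le> 1 - \<bar>x\<bar>" if "x \<in> {-m..m}" for x
    proof -
      have "\<bar>c * \<phi> x\<bar> = \<bar>c\<bar> * \<phi> x" using \<phi>_nonneg[of x] in1(1)[OF that] by (simp add: abs_mult)
      also have "\<dots> \<le> \<delta> / 2 * \<phi> x" using c \<phi>_nonneg[of x] in1(1)[OF that] by (intro mult_right_mono) auto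
      finally show ?thesis using in1(2)[OF that] by simp
    qed
    have T': "1/2 \<le> T' x" if "x \<in> {-m..m}" for x
    proof -
      have p: "\<phi> x > 0" using \<phi>_pos in1(1)[OF that] by auto
      have sq: "\<phi> x * \<phi> x = (1 - \<bar>x\<bar>) * (1 + \<bar>x\<bar>)"
        using \<phi>_sq[of x] in1(1)[OF that] by (simp add: power2_eq_square algebra_simps)
      have "\<bar>c * (- x / \<phi> x)\<bar> = \<bar>c * \<phi> x\<bar> * \<bar>x\<bar> / (\<phi> x * \<phi> x)" using p by (simp add: abs_mult field_simps)
      also have "\<dots> \<le> (1 - \<bar>x\<bar>) * \<bar>x\<bar> / (\<phi> x * \<phi> x)" using cphi[OF that] by (intro divide_right_mono mult_right_mono) auto
      also have "\<dots> = \<bar>x\<bar> / (1 + \<bar>x\<bar>)" unfolding sq using in1(1)[OF that] by simp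
      also have "\<dots> \<le> 1/2" using in1(1)[OF that] by (simp add: field_simps)
      finally have "- (c * (- x / \<phi> x)) \<le> 1/2" by (meson abs_le_D2)
      then show ?thesis unfolding T'_def by linarith
    qed
    have "(\<integral>\<^sup>+x. g (x + c * \<phi> x) * indicator (D_set \<delta>) x \<partial>lborel) \<le> (\<integral>\<^sup>+x. 2 * (g (T x) * ennreal (T' x) * indicator {-m..m} x) \<partial>lborel)"
    proof (intro nn_integral_mono)
      fix x
      show "g (x + c * \<phi> x) * indicator (D_set \<delta>) x \<le> 2 * (g (T x) * ennreal (T' x) * indicator {-m..m} x)"
      proof (cases "x \<in> {-m..m}")
        case True
        have "1 \<le> ennreal (2 * T' x)" using T'[OF True] by (simp add: ennreal_le_iff2 flip: ennreal_1)
        also have "\<dots> = 2 * ennreal (T' x)" using T'[OF True] by (simp add: ennreal_mult)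
        finally have "g (T x) * 1 \<le> g (T x) * (2 * ennreal (T' x))" by (rule mult_left_mono) simp
        then show ?thesis using True D by (simp add: T_def mult_ac)
      qed (simp add: D)
    qed
    also have "\<dots> = 2 * (\<integral>\<^sup>+x. g (T x) * ennreal (T' x) * indicator {-m..m} x \<partial>lborel)"
      unfolding T_def T'_def by (intro nn_integral_cmult) measurable
    also have "(\<integral>\<^sup>+x. g (T x) * ennreal (T' x) * indicator {-m..m} x \<partial>lborel) = (\<integral>\<^sup>+x. g x * indicator {T (-m)..T m} x \<partial>lborel)"
    proof (rule nn_integral_substitution_aux[symmetric])
      show "(T has_real_derivative T' x) (at x)" if "x \<in> {-m..m}" for x
        unfolding T_def[abs_def] T'_def using in1(1)[OF that] by (auto intro!: derivative_eq_intros DERIV_\<phi>)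
      show "continuous_on {-m..m} T'" unfolding T'_def[abs_def] \<phi>_def
        using in1(1) by (intro continuous_intros) (auto simp: power2_eq_1_iff dest!: in1(1))
      show "0 \<le> T' x" if "x \<in> {-m..m}" for x using T'[OF that] by simp
    qed (use True in auto)
    also have "\<dots> \<le> (\<integral>\<^sup>+x. g x * indicator {-1..1} x \<partial>lborel)"
    proof (intro nn_integral_mono mult_left_mono)
      have "-1 \<le> T (-m)" "T m \<le> 1" unfolding T_def using cphi[of m] cphi[of "-m"] True by auto
      then show "indicator {T (-m)..T m} x \<le> (indicator {-1..1} x :: ennreal)" for x by (auto split: split_indicator)
    qed simp
    finally show ?thesis by (simp add: mult_left_mono)
  qed
qed

text \<open>The integral inequality for the indicator of a null set shows that its preimage under
  the shift is null as well.\<close>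

lemma AE_shift_\<phi>:
  assumes \<delta>: "\<delta> > 0" and c: "\<bar>c\<bar> \<le> \<delta> / 2" and P: "AE x in lborel. x \<in> {-1..1} \<longrightarrow> P x"
  shows "AE x in lborel. x \<in> D_set \<delta> \<longrightarrow> P (x + c * \<phi> x)"
proof -
  obtain N where N': "{x \<in> space lborel. \<not> (x \<in> {-1..1} \<longrightarrow> P x)} \<subseteq> N" "emeasure lborel N = 0" "N \<in> sets lborel"
    by (rule AE_E[OF P])
  then have N: "{x. \<not> (x \<in> {-1..1} \<longrightarrow> P x)} \<subseteq> N" "N \<in> sets borel" "emeasure lborel N = 0" by auto
  have "(\<integral>\<^sup>+x. indicator N (x + c * \<phi> x) * indicator (D_set \<delta>) x \<partial>lborel) \<le> 2 * (\<integral>\<^sup>+x. indicator N x * indicator {-1..1} x \<partial>lborel)"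
    using N by (intro nn_integral_shift_\<phi> \<delta> c) auto
  also have "(\<integral>\<^sup>+x. indicator N x * indicator {-1..1} x \<partial>lborel) \<le> (\<integral>\<^sup>+x. indicator N x \<partial>lborel)"
    by (intro nn_integral_mono) (auto split: split_indicator)
  also have "\<dots> = 0" using N by simp
  finally have "(\<integral>\<^sup>+x. indicator N (x + c * \<phi> x) * indicator (D_set \<delta>) x \<partial>lborel) = 0" by (simp add: mult_left_mono)
  moreover have [measurable]: "N \<in> sets borel" "D_set \<delta> \<in> sets borel" using N(2) D_set_borel[OF \<delta>] by auto
  ultimately have "AE x in lborel. indicator N (x + c * \<phi> x) * indicator (D_set \<delta>) x = (0::ennreal)"
    by (subst (asm) nn_integral_0_iff_AE) auto
  then show ?thesis
  proof (rule AE_mp, intro AE_I2 impI)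
    fix x assume *: "indicator N (x + c * \<phi> x) * indicator (D_set \<delta>) x = (0::ennreal)" and x: "x \<in> D_set \<delta>"
    then have "x + c * \<phi> x \<notin> N" by (auto split: split_indicator_asm)
    moreover have "x + c * \<phi> x \<in> {-1..1}"
    proof -
      have "\<bar>c * \<phi> x\<bar> = \<bar>c\<bar> * \<phi> x" using \<phi>_nonneg[of x] D_setD(1)[OF x] by (simp add: abs_mult)
      also have "\<dots> \<le> \<delta> / 2 * \<phi> x" using c \<phi>_nonneg[of x] D_setD(1)[OF x] by (intro mult_right_mono) auto
      finally have "\<bar>c * \<phi> x\<bar> \<le> 1 - \<bar>x\<bar>" using D_setD(2)[OF x] by simp
      then show ?thesis by (auto simp: abs_le_iff)
    qed
    ultimately show "P (x + c * \<phi> x)" using N(1) by auto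
  qed
qed

text \<open>\<open>W \<delta> x ^ 2\<close> is the distance of the rightmost node from 1 times the
  distance of the leftmost node from -1, and for every point between the nodes both factors only
  grow.\<close>

lemma W_le_\<phi>:
  assumes x: "x \<in> D_set \<delta>" and s: "\<bar>s\<bar> \<le> \<delta> * \<phi> x / 2"
  shows "0 \<le> W \<delta> x" "W \<delta> x \<le> \<phi> (x + s)" "\<bar>x + s\<bar> \<le> 1"
proof -
  note D = D_setD[OF x]
  have "(1 - x - \<delta> * \<phi> x / 2) * (1 + x - \<delta> * \<phi> x / 2) \<le> (1 - (x + s)) * (1 + (x + s))"
    using D s by (intro mult_mono) (auto simp: abs_le_iff)
  also have "\<dots> = 1 - (x + s)\<^sup>2" by (simp add: power2_eq_square algebra_simps)
  finally show "W \<delta> x \<le> \<phi> (x + s)" unfolding W_def \<phi>_def[of "x + s"] by (rule real_sqrt_le_mono)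
  show "0 \<le> W \<delta> x" unfolding W_def using D by (intro real_sqrt_ge_zero mult_nonneg_nonneg) (auto simp: abs_le_iff)
  show "\<bar>x + s\<bar> \<le> 1" using D s by (auto simp: abs_le_iff)
qed

text \<open>\<open>\<phi>\<^sup>2\<close> is concave: compare with the chord from x to the point at
  distance d on the side of u, where \<open>\<phi>\<^sup>2\<close> is still nonnegative.\<close>

lemma \<phi>_concave:
  assumes "\<bar>x\<bar> + d \<le> 1" "0 \<le> d" "\<bar>u\<bar> \<le> 1"
  shows "\<phi> x ^ 2 * (1 - \<bar>u\<bar>) \<le> \<phi> (x + u * d) ^ 2" "\<bar>x + u * d\<bar> \<le> 1"
proof -
  have ud: "\<bar>u * d\<bar> \<le> d" using assms mult_right_mono[of "\<bar>u\<bar>" 1 d] by (simp add: abs_mult)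
  then show 1: "\<bar>x + u * d\<bar> \<le> 1" using assms by (auto simp: abs_le_iff)
  define e where "e = (if u \<ge> 0 then d else - d)"
  have e: "u * d = \<bar>u\<bar> * e" by (simp add: e_def)
  have "\<bar>x + e\<bar> \<le> 1" using assms by (auto simp: e_def)
  then have "0 \<le> 1 - (x + e)^2" by (simp add: abs_square_le_1)
  then have "0 \<le> \<bar>u\<bar> * (1 - (x + e)^2) + \<bar>u\<bar> * (1 - \<bar>u\<bar>) * e^2" using assms by (intro add_nonneg_nonneg mult_nonneg_nonneg) auto
  also have "\<dots> = 1 - (x + \<bar>u\<bar> * e)^2 - (1 - x^2) * (1 - \<bar>u\<bar>)" by (simp add: power2_eq_square algebra_simps)
  finally show "\<phi> x ^ 2 * (1 - \<bar>u\<bar>) \<le> \<phi> (x + u * d) ^ 2"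
    using \<phi>_sq[OF 1] \<phi>_sq[of x] assms by (simp add: e)
qed

lemma W_measurable [measurable]: "W \<delta> \<in> borel_measurable borel"
  unfolding W_def[abs_def] by measurable

lemma sym_diff_on_D_set:
  assumes x: "x \<in> D_set (real k * h)" and h: "h \<ge> 0"
  shows "sym_diff k (h * \<phi> x) g x = (\<Sum>i\<le>k. (-1) ^ (k - i) * real (k choose i) * g (x + ((real i - real k / 2) * h) * \<phi> x))"
proof -
  define d where "d = real k * (h * \<phi> x) / 2"
  have "0 \<le> d" "\<bar>x\<bar> < 1" "d \<le> 1 - \<bar>x\<bar>" using D_setD[OF x] \<phi>_nonneg[of x] h by (auto simp: d_def mult.assoc)
  then have "x + d \<in> {-1..1}" "x - d \<in> {-1..1}" by auto
  then show ?thesis unfolding sym_diff_def d_def by (auto simp: atLeast0AtMost algebra_simps intro!: sum.cong)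
qed

text \<open>\<open>W\<close> is at most \<open>\<phi>\<close> at each node and each binomial
  coefficient is at most \<open>2 ^ k\<close>, so after division by \<open>2 ^ k * (k + 1)\<close>
  convexity applies to the average over the k + 1 nodes. Each node then costs the factor 2 of the
  shift.\<close>

lemma modular_weighted_diff_le:
  fixes F :: "real \<Rightarrow> real"
  assumes \<theta>: "modular \<theta>" and k: "k \<ge> 1" and h: "h > 0" and F[measurable]: "F \<in> borel_measurable borel"
  shows "(\<integral>\<^sup>+x. ennreal (\<theta> (\<bar>W (real k * h) x ^ r * sym_diff k (h * \<phi> x) F x\<bar> / (2 ^ k * real (k+1)))) * indicator (D_set (real k * h)) x \<partial>lborel)
     \<le> ennreal (2 * real (k+1)) * (\<integral>\<^sup>+x. ennreal (\<theta> \<bar>F x * \<phi> x ^ r\<bar>) * indicator {-1..1} x \<partial>lborel)"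
proof -
  note [measurable] = modular_measurable[OF \<theta>]
  let ?D = "D_set (real k * h)"
  define c where "c i = (real i - real k / 2) * h" for i :: nat
  have kh: "real k * h > 0" using k h by auto
  have c: "\<bar>c i\<bar> \<le> real k * h / 2" if "i \<le> k" for i
  proof -
    have "real i \<le> real k" using that by simp
    then have "\<bar>real i - real k / 2\<bar> \<le> real k / 2" by (intro abs_leI) linarith+
    then have "\<bar>real i - real k / 2\<bar> * h \<le> real k / 2 * h" using h by (intro mult_right_mono) auto
    then show ?thesis unfolding c_def using h by (simp add: abs_mult)
  qed
  have [measurable]: "?D \<in> sets borel" using D_set_borel[OF kh] .
  have pw: "ennreal (\<theta> (\<bar>W (real k * h) x ^ r * sym_diff k (h * \<phi> x) F x\<bar> / (2 ^ k * real (k+1)))) * indicator ?D x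
     \<le> (\<Sum>i\<le>k. ennreal (\<theta> \<bar>F (x + c i * \<phi> x) * \<phi> (x + c i * \<phi> x) ^ r\<bar>) * indicator ?D x)" for x
  proof (cases "x \<in> ?D")
    case True
    have Wi: "0 \<le> W (real k * h) x" "W (real k * h) x \<le> \<phi> (x + c i * \<phi> x)" if "i \<le> k" for i
    proof -
      have "\<bar>c i * \<phi> x\<bar> \<le> real k * h / 2 * \<phi> x" using mult_right_mono[OF c[OF that], of "\<phi> x"] \<phi>_nonneg[of x] D_setD(1)[OF True]
        by (simp add: abs_mult)
      then show "0 \<le> W (real k * h) x" "W (real k * h) x \<le> \<phi> (x + c i * \<phi> x)"
        using W_le_\<phi>[OF True, of "c i * \<phi> x"] by auto
    qed
    define b where "b i = \<bar>F (x + c i * \<phi> x) * \<phi> (x + c i * \<phi> x) ^ r\<bar>" for i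
    have "\<bar>W (real k * h) x ^ r * sym_diff k (h * \<phi> x) F x\<bar> = \<bar>\<Sum>i\<le>k. W (real k * h) x ^ r * ((-1) ^ (k - i) * real (k choose i) * F (x + c i * \<phi> x))\<bar>"
      unfolding sym_diff_on_D_set[OF True less_imp_le[OF h]] c_def sum_distrib_left ..
    also have "\<dots> \<le> (\<Sum>i\<le>k. \<bar>W (real k * h) x ^ r * ((-1) ^ (k - i) * real (k choose i) * F (x + c i * \<phi> x))\<bar>)" by (rule sum_abs)
    also have "\<dots> \<le> (\<Sum>i\<le>k. 2 ^ k * b i)"
    proof (rule sum_mono)
      fix i assume i: "i \<in> {..k}"
      have "W (real k * h) x ^ r \<le> \<phi> (x + c i * \<phi> x) ^ r" using Wi[of i] i by (intro power_mono) auto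
      moreover have "real (k choose i) \<le> 2 ^ k" by (metis binomial_le_pow2 numeral_power_eq_of_nat_cancel_iff of_nat_le_iff of_nat_numeral of_nat_power)
      ultimately have "real (k choose i) * (W (real k * h) x ^ r * \<bar>F (x + c i * \<phi> x)\<bar>) \<le> 2 ^ k * (\<phi> (x + c i * \<phi> x) ^ r * \<bar>F (x + c i * \<phi> x)\<bar>)"
        using Wi(1)[of i] i by (intro mult_mono mult_right_mono) auto
      moreover have "0 \<le> \<phi> (x + c i * \<phi> x)" using Wi[of i] i by auto
      ultimately show "\<bar>W (real k * h) x ^ r * ((-1) ^ (k - i) * real (k choose i) * F (x + c i * \<phi> x))\<bar> \<le> 2 ^ k * b i"
        using Wi(1)[of i] i by (simp add: b_def abs_mult power_abs mult_ac)
    qed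
    finally have "\<bar>W (real k * h) x ^ r * sym_diff k (h * \<phi> x) F x\<bar> / (2 ^ k * real (k+1)) \<le> (\<Sum>i\<le>k. 2 ^ k * b i) / (2 ^ k * real (k+1))"
      by (intro divide_right_mono) auto
    also have "\<dots> = (\<Sum>i\<le>k. b i) / real (card {..k})" by (simp add: sum_distrib_left[symmetric])
    finally have "\<theta> (\<bar>W (real k * h) x ^ r * sym_diff k (h * \<phi> x) F x\<bar> / (2 ^ k * real (k+1))) \<le> \<theta> ((\<Sum>i\<le>k. b i) / real (card {..k}))"
      by (rule modular_mono[OF \<theta>])
    also have "\<dots> \<le> (\<Sum>i\<le>k. \<theta> (b i)) / real (card {..k})" by (rule modular_average[OF \<theta>]) auto
    also have "\<dots> \<le> (\<Sum>i\<le>k. \<theta> (b i)) / 1" using sum_nonneg[of "{..k}" "\<lambda>i. \<theta> (b i)"] modular_nonneg[OF \<theta>]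
      by (intro divide_left_mono) auto
    finally show ?thesis using True modular_nonneg[OF \<theta>] by (simp add: b_def[symmetric] sum_ennreal ennreal_leI)
  qed simp
  have "(\<integral>\<^sup>+x. ennreal (\<theta> (\<bar>W (real k * h) x ^ r * sym_diff k (h * \<phi> x) F x\<bar> / (2 ^ k * real (k+1)))) * indicator ?D x \<partial>lborel)
     \<le> (\<integral>\<^sup>+x. (\<Sum>i\<le>k. ennreal (\<theta> \<bar>F (x + c i * \<phi> x) * \<phi> (x + c i * \<phi> x) ^ r\<bar>) * indicator ?D x) \<partial>lborel)"
    by (intro nn_integral_mono pw)
  also have "\<dots> = (\<Sum>i\<le>k. (\<integral>\<^sup>+x. ennreal (\<theta> \<bar>F (x + c i * \<phi> x) * \<phi> (x + c i * \<phi> x) ^ r\<bar>) * indicator ?D x \<partial>lborel))"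
    by (rule nn_integral_sum) measurable
  also have "\<dots> \<le> (\<Sum>i\<le>k. 2 * (\<integral>\<^sup>+x. ennreal (\<theta> \<bar>F x * \<phi> x ^ r\<bar>) * indicator {-1..1} x \<partial>lborel))"
    using c by (intro sum_mono nn_integral_shift_\<phi>[OF kh, where g="\<lambda>x. ennreal (\<theta> \<bar>F x * \<phi> x ^ r\<bar>)"]) auto
  also have "\<dots> = ennreal (2 * real (k+1)) * (\<integral>\<^sup>+x. ennreal (\<theta> \<bar>F x * \<phi> x ^ r\<bar>) * indicator {-1..1} x \<partial>lborel)"
  proof -
    have "ennreal (2 * real (k+1)) = of_nat (k+1) * 2"
      unfolding ennreal_of_nat_eq_real_of_nat by (subst mult.commute, subst ennreal_mult) auto
    then show ?thesis by (simp only: sum_constant card_atMost Suc_eq_plus1 mult.assoc)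
  qed
  finally show ?thesis .
qed

section \<open>Differences of smooth functions through a weighted Taylor remainder\<close>

text \<open>Taylor's formula yields a gauge integral, the estimates need a Lebesgue integral. Where
  the right-hand side is finite the two agree; otherwise there is nothing to prove.\<close>

lemma has_integral_abs_le_nn_integral:
  fixes f :: "real \<Rightarrow> real"
  assumes I: "(f has_integral I) {a..b}" and [measurable]: "f \<in> borel_measurable borel"
  shows "ennreal \<bar>I\<bar> \<le> (\<integral>\<^sup>+x. ennreal \<bar>f x\<bar> * indicator {a..b} x \<partial>lborel)"
proof (cases "(\<integral>\<^sup>+x. ennreal \<bar>f x\<bar> * indicator {a..b} x \<partial>lborel) = \<infinity>")
  case False
  have eq: "(\<integral>\<^sup>+x. ennreal (norm (f x * indicator {a..b} x)) \<partial>lborel) = (\<integral>\<^sup>+x. ennreal \<bar>f x\<bar> * indicator {a..b} x \<partial>lborel)"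
    by (intro nn_integral_cong) (auto split: split_indicator)
  have int: "integrable lborel (\<lambda>x. f x * indicator {a..b} x)"
  proof (rule integrableI_bounded)
    show "(\<integral>\<^sup>+x. ennreal (norm (f x * indicator {a..b} x)) \<partial>lborel) < \<infinity>"
      unfolding eq using False by (simp add: less_top)
  qed measurable
  have "((\<lambda>x. f x * indicator {a..b} x) has_integral (integral\<^sup>L lborel (\<lambda>x. f x * indicator {a..b} x))) UNIV"
    by (rule has_integral_integral_lborel[OF int])
  then have "((\<lambda>x. if x \<in> {a..b} then f x else 0) has_integral (integral\<^sup>L lborel (\<lambda>x. f x * indicator {a..b} x))) UNIV"
    by (rule has_integral_eq[rotated]) (auto split: split_indicator)
  then have "(f has_integral (integral\<^sup>L lborel (\<lambda>x. f x * indicator {a..b} x))) {a..b}"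
    unfolding has_integral_restrict_UNIV .
  then have "I = integral\<^sup>L lborel (\<lambda>x. f x * indicator {a..b} x)" using I has_integral_unique by blast
  then show ?thesis using integral_norm_bound_ennreal[OF int] eq by simp
qed simp

lemma Taylor_remainder_bound:
  fixes D :: "nat \<Rightarrow> real \<Rightarrow> real"
  assumes k: "k \<ge> 1"
    and D: "\<And>m x. m < k - 1 \<Longrightarrow> \<bar>x\<bar> < 1 \<Longrightarrow> (D m has_real_derivative D (Suc m) x) (at x)"
    and AC: "locally_abs_continuous (D (k-1))"
    and H[measurable]: "H \<in> borel_measurable borel"
    and ae: "AE x in lborel. \<bar>x\<bar> < 1 \<longrightarrow> H x = deriv (D (k-1)) x"
    and xy: "\<bar>x\<bar> < 1" "\<bar>y\<bar> < 1"
  shows "ennreal \<bar>D 0 y - (\<Sum>m<k. D m x * (y - x) ^ m / fact m)\<bar> \<le>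
    (\<integral>\<^sup>+v. ennreal \<bar>H v * (y - v) ^ (k-1) / fact (k-1)\<bar> * indicator {min x y..max x y} v \<partial>lborel)"
proof -
  define a b where "a = min x y" and "b = max x y"
  have ab: "-1 < a" "a \<le> b" "b < 1" using xy by (auto simp: a_def b_def)
  \<comment> \<open>The Taylor polynomial at y as a function of its base point: it equals
    \<open>D 0 y\<close> at v = y and the full expansion at v = x, so its increment is the remainder
    whichever of x and y is larger.\<close>
  define R where "R v = (\<Sum>m<k. D m v * (y - v) ^ m / fact m)" for v
  have Ry: "R y = D 0 y"
  proof -
    have "R y = (\<Sum>m<k. if m = 0 then D m y else 0)" unfolding R_def by (intro sum.cong) auto
    then show ?thesis using k by simp
  qed
  have "((\<lambda>v. deriv (D (k-1)) v * (y - v) ^ (k-1) / fact (k-1)) has_integral (R b - R a)) {a..b}"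
    unfolding R_def
  proof (rule Taylor_abs_continuous[OF k ab(2)])
    show "abs_continuous_on a b (D (k-1))" using AC ab unfolding locally_abs_continuous_def by blast
  qed (use D ab in auto)
  note hI = this
  obtain N where N: "{x \<in> space lborel. \<not> (\<bar>x\<bar> < 1 \<longrightarrow> H x = deriv (D (k-1)) x)} \<subseteq> N" "emeasure lborel N = 0" "N \<in> sets lborel"
    by (rule AE_E[OF ae])
  have hN: "negligible N" using N(2,3) by (simp add: negligible_iff_null_sets null_sets_def emeasure_completion)
  have hEq: "H v * (y - v) ^ (k-1) / fact (k-1) = deriv (D (k-1)) v * (y - v) ^ (k-1) / fact (k-1)"
    if "v \<in> {a..b} - N" for v
  proof -
    have "\<bar>v\<bar> < 1" using that ab by auto
    then have "H v = deriv (D (k-1)) v" using that N(1) by auto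
    then show ?thesis by simp
  qed
  have "((\<lambda>v. H v * (y - v) ^ (k-1) / fact (k-1)) has_integral (R b - R a)) {a..b}"
    by (rule has_integral_spike[OF hN _ hI], rule hEq)
  from has_integral_abs_le_nn_integral[OF this]
  have "ennreal \<bar>R b - R a\<bar> \<le> (\<integral>\<^sup>+v. ennreal \<bar>H v * (y - v) ^ (k-1) / fact (k-1)\<bar> * indicator {a..b} v \<partial>lborel)" by simp
  moreover have "\<bar>R b - R a\<bar> = \<bar>R y - R x\<bar>" by (auto simp: a_def b_def min_def max_def)
  ultimately show ?thesis unfolding Ry by (simp add: R_def a_def b_def)
qed

text \<open>
  Up to a constant, a bound for the Taylor kernel times \<open>W\<^sup>r(x)\<close> divided by \<open>\<phi>\<^sup>k\<^sup>+\<^sup>r\<close> at the point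
  \<open>x + u k h \<phi>(x) / 2\<close>.
\<close>
definition edge_weight :: "real \<Rightarrow> real" where
  "edge_weight u = (if \<bar>u\<bar> < 1 then 1 / (4 * sqrt (1 - \<bar>u\<bar>)) else 0)"

lemma edge_weight_measurable [measurable]: "edge_weight \<in> borel_measurable borel"
  unfolding edge_weight_def[abs_def] by measurable

lemma edge_weight_nonneg: "0 \<le> edge_weight u"
  by (simp add: edge_weight_def)

text \<open>The factor 4 in \<open>edge_weight\<close> makes it a probability density, as Jensen's
  inequality requires; its singularities at -1 and 1 are those of an inverse square root.\<close>

lemma edge_weight_integral: "(\<integral>\<^sup>+u. ennreal (edge_weight u) \<partial>lborel) = 1"
proof -
  have 1: "((\<lambda>u. 1 / (4 * sqrt (1 - u))) has_integral ((- sqrt (1 - 1) / 2) - (- sqrt (1 - 0) / 2))) {0..1}"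
    by (rule fundamental_theorem_of_calculus_interior)
      (auto intro!: continuous_intros derivative_eq_intros simp: has_real_derivative_iff_has_vector_derivative[symmetric] field_simps)
  have 2: "((\<lambda>u. 1 / (4 * sqrt (1 + u))) has_integral ((sqrt (1 + 0) / 2) - (sqrt (1 + -1) / 2))) {-1..0}"
    by (rule fundamental_theorem_of_calculus_interior)
      (auto intro!: continuous_intros derivative_eq_intros simp: has_real_derivative_iff_has_vector_derivative[symmetric] field_simps)
  have neg: "negligible {1::real,-1}" by auto
  have "(edge_weight has_integral (1/2)) {0..1}"
    by (rule has_integral_spike[OF neg _ 1[simplified]]) (auto simp: edge_weight_def)
  moreover have "(edge_weight has_integral (1/2)) {-1..0}"
    by (rule has_integral_spike[OF neg _ 2[simplified]]) (auto simp: edge_weight_def)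
  ultimately have "(edge_weight has_integral (1/2 + 1/2)) {-1..1}"
    by (intro has_integral_combine[of "-1" 0 1]) auto
  then have "(\<integral>\<^sup>+u. ennreal (indicator {-1..1} u * edge_weight u) \<partial>lborel) = ennreal 1"
    by (intro nn_integral_has_integral_lebesgue) (simp_all add: edge_weight_nonneg)
  moreover have "indicator {-1..1} u * edge_weight u = edge_weight u" for u
    by (auto simp: edge_weight_def split: split_indicator)
  ultimately show ?thesis by simp
qed

text \<open>The Taylor polynomial of degree k - 1 at x is annihilated by the k-th difference, so
  only remainders at the nodes count. After the substitution \<open>v = x + u * d\<close> the kernel
  is \<open>(1 - \<bar>u\<bar>) ^ (k-1)\<close>; concavity of \<open>\<phi>\<^sup>2\<close> trades
  \<open>\<phi> x\<close> for \<open>\<phi>\<close> at the integration point. The strict inequality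
  keeps all nodes inside the open interval, where Taylor's formula holds.\<close>

lemma weighted_diff_pointwise:
  fixes D :: "nat \<Rightarrow> real \<Rightarrow> real"
  assumes k: "k \<ge> 1"
    and D: "\<And>m x. m < k - 1 \<Longrightarrow> \<bar>x\<bar> < 1 \<Longrightarrow> (D m has_real_derivative D (Suc m) x) (at x)"
    and AC: "locally_abs_continuous (D (k-1))"
    and H[measurable]: "H \<in> borel_measurable borel"
    and ae: "AE x in lborel. \<bar>x\<bar> < 1 \<longrightarrow> H x = deriv (D (k-1)) x"
    and h: "h > 0" and x: "x \<in> D_set (real k * h)" and strict: "\<bar>x\<bar> + real k * h * \<phi> x / 2 < 1"
  shows "ennreal \<bar>W (real k * h) x ^ r * sym_diff k (h * \<phi> x) (D 0) x\<bar> \<le>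
    ennreal (4 * real (k+1) * (real k) ^ k * h ^ k) *
     (\<integral>\<^sup>+u. ennreal (edge_weight u) * ennreal \<bar>H (x + u * (real k * h * \<phi> x / 2)) * \<phi> (x + u * (real k * h * \<phi> x / 2)) ^ (k + r)\<bar> \<partial>lborel)"
proof -
  define d where "d = real k * h * \<phi> x / 2"
  have x1: "\<bar>x\<bar> < 1" using D_setD(1)[OF x] .
  have \<phi>x: "\<phi> x > 0" using \<phi>_pos[OF x1] .
  have d: "d > 0" "\<bar>x\<bar> + d < 1" using k h \<phi>x strict by (auto simp: d_def)
  define c where "c i = (real i - real k / 2) * h" for i :: nat
  define P where "P y = (\<Sum>m<k. D m x * (y - x) ^ m / fact m)" for y
  define Wx where "Wx = W (real k * h) x ^ r"
  have Wx: "Wx \<ge> 0" unfolding Wx_def using W_le_\<phi>(1)[OF x, of 0] h \<phi>x by simp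
  have cd: "\<bar>c i * \<phi> x\<bar> \<le> d" if "i \<le> k" for i
  proof -
    have "real i \<le> real k" using that by simp
    then have "\<bar>real i - real k / 2\<bar> \<le> real k / 2" by (intro abs_leI) linarith+
    then have "\<bar>real i - real k / 2\<bar> * (h * \<phi> x) \<le> real k / 2 * (h * \<phi> x)" using h \<phi>x by (intro mult_right_mono) auto
    then show ?thesis unfolding c_def d_def using h \<phi>x by (simp add: abs_mult mult_ac)
  qed
  have P0: "(\<Sum>i\<le>k. (-1) ^ (k - i) * real (k choose i) * P (x + c i * \<phi> x)) = 0"
  proof -
    have "fdiff k (h * \<phi> x) P (x - real k / 2 * (h * \<phi> x)) = 0"
    proof -
      have "P = (\<lambda>y. \<Sum>m<k. (D m x / fact m) * (- x + y) ^ m)" by (auto simp: P_def fun_eq_iff)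
      moreover have "(\<Sum>m<k. (D m x / fact m) * fdiff k (h * \<phi> x) (\<lambda>y. (- x + y) ^ m) (x - real k / 2 * (h * \<phi> x))) = 0"
        by (intro sum.neutral ballI) (subst fdiff_power, auto)
      ultimately show ?thesis by (simp only: fdiff_sum)
    qed
    then show ?thesis unfolding fdiff_def c_def by (simp add: algebra_simps)
  qed
  \<comment> \<open>One majorant for the remainders at all nodes: a node at distance at most d from
    x is no farther from v than \<open>d - \<bar>v - x\<bar>\<close> when v lies between x and the
    node.\<close>
  define J where "J = (\<integral>\<^sup>+v. ennreal (\<bar>H v\<bar> * (d - \<bar>v - x\<bar>) ^ (k-1)) * indicator {x-d..x+d} v \<partial>lborel)"
  have rem: "ennreal \<bar>D 0 y - P y\<bar> \<le> J" if y: "\<bar>y - x\<bar> \<le> d" for y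
  proof -
    have "\<bar>y\<bar> < 1" using y d by auto
    from Taylor_remainder_bound[OF k D AC H ae x1 this]
    have "ennreal \<bar>D 0 y - P y\<bar> \<le> (\<integral>\<^sup>+v. ennreal \<bar>H v * (y - v) ^ (k-1) / fact (k-1)\<bar> * indicator {min x y..max x y} v \<partial>lborel)"
      unfolding P_def by simp
    also have "\<dots> \<le> J" unfolding J_def
    proof (intro nn_integral_mono)
      fix v
      show "ennreal \<bar>H v * (y - v) ^ (k-1) / fact (k-1)\<bar> * indicator {min x y..max x y} v \<le> ennreal (\<bar>H v\<bar> * (d - \<bar>v - x\<bar>) ^ (k-1)) * indicator {x-d..x+d} v"
      proof (cases "v \<in> {min x y..max x y}")
        case True
        then have v: "\<bar>y - v\<bar> \<le> d - \<bar>v - x\<bar>" "v \<in> {x-d..x+d}" using y by (auto simp: min_def max_def split: if_splits)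
        have "\<bar>H v * (y - v) ^ (k-1) / fact (k-1)\<bar> = \<bar>H v\<bar> * \<bar>y - v\<bar> ^ (k-1) / fact (k-1)" by (simp add: abs_mult power_abs)
        also have "\<dots> \<le> \<bar>H v\<bar> * \<bar>y - v\<bar> ^ (k-1) / 1" by (intro divide_left_mono) auto
        also have "\<dots> \<le> \<bar>H v\<bar> * (d - \<bar>v - x\<bar>) ^ (k-1)" using v by (auto intro!: mult_left_mono power_mono)
        finally show ?thesis using True v by (simp add: ennreal_leI)
      qed simp
    qed
    finally show ?thesis .
  qed
  have "\<bar>Wx * sym_diff k (h * \<phi> x) (D 0) x\<bar> = Wx * \<bar>\<Sum>i\<le>k. (-1) ^ (k - i) * real (k choose i) * (D 0 (x + c i * \<phi> x) - P (x + c i * \<phi> x))\<bar>"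
    unfolding sym_diff_on_D_set[OF x less_imp_le[OF h]] c_def[symmetric] right_diff_distrib sum_subtractf P0 using Wx by (simp add: abs_mult)
  also have "\<dots> \<le> Wx * (\<Sum>i\<le>k. \<bar>(-1) ^ (k - i) * real (k choose i) * (D 0 (x + c i * \<phi> x) - P (x + c i * \<phi> x))\<bar>)"
    using Wx by (intro mult_left_mono sum_abs)
  also have "\<dots> \<le> Wx * (\<Sum>i\<le>k. 2 ^ k * \<bar>D 0 (x + c i * \<phi> x) - P (x + c i * \<phi> x)\<bar>)"
  proof (intro mult_left_mono[OF _ Wx] sum_mono)
    fix i
    have "real (k choose i) \<le> 2 ^ k" by (metis binomial_le_pow2 numeral_power_eq_of_nat_cancel_iff of_nat_le_iff of_nat_numeral of_nat_power)
    then show "\<bar>(-1) ^ (k - i) * real (k choose i) * (D 0 (x + c i * \<phi> x) - P (x + c i * \<phi> x))\<bar> \<le> 2 ^ k * \<bar>D 0 (x + c i * \<phi> x) - P (x + c i * \<phi> x)\<bar>"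
      by (simp add: abs_mult power_abs mult_right_mono)
  qed
  finally have "ennreal \<bar>Wx * sym_diff k (h * \<phi> x) (D 0) x\<bar> \<le> ennreal (Wx * (\<Sum>i\<le>k. 2 ^ k * \<bar>D 0 (x + c i * \<phi> x) - P (x + c i * \<phi> x)\<bar>))"
    by (rule ennreal_leI)
  also have "\<dots> = ennreal Wx * (\<Sum>i\<le>k. ennreal (2 ^ k) * ennreal \<bar>D 0 (x + c i * \<phi> x) - P (x + c i * \<phi> x)\<bar>)"
    using Wx by (simp add: ennreal_mult sum_nonneg sum_ennreal[symmetric])
  also have "\<dots> \<le> ennreal Wx * (\<Sum>i\<le>k. ennreal (2 ^ k) * J)"
    using cd by (intro mult_left_mono sum_mono rem) auto
  also have "\<dots> = ennreal Wx * (ennreal (real (k+1) * 2 ^ k) * J)"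
    by (simp add: ennreal_mult ennreal_of_nat_eq_real_of_nat mult_ac)
  also have "J = (\<integral>\<^sup>+u. ennreal d * (ennreal (\<bar>H (x + d * u)\<bar> * (d - \<bar>d * u\<bar>) ^ (k-1)) * indicator {x-d..x+d} (x + d * u)) \<partial>lborel)"
    unfolding J_def using d(1) by (subst nn_integral_real_affine[where c=d and t=x]) (auto simp: nn_integral_cmult)
  also have "ennreal Wx * (ennreal (real (k+1) * 2 ^ k) * \<dots>) =
     (\<integral>\<^sup>+u. ennreal Wx * (ennreal (real (k+1) * 2 ^ k) * (ennreal d * (ennreal (\<bar>H (x + d * u)\<bar> * (d - \<bar>d * u\<bar>) ^ (k-1)) * indicator {x-d..x+d} (x + d * u)))) \<partial>lborel)"
    by (simp add: nn_integral_cmult)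
  also have "\<dots> \<le> (\<integral>\<^sup>+u. ennreal (4 * real (k+1) * (real k) ^ k * h ^ k) *
      (ennreal (edge_weight u) * ennreal \<bar>H (x + u * d) * \<phi> (x + u * d) ^ (k + r)\<bar>) \<partial>lborel)"
  \<comment> \<open>The points u = 1 and u = -1 are left out because \<open>edge_weight\<close> has
    the value 0 there, while the kernel need not vanish for k = 1.\<close>
  proof (rule nn_integral_mono_AE, rule AE_mp[OF AE_lborel_singleton[of 1]], rule AE_mp[OF AE_lborel_singleton[of "-1"]], intro AE_I2 impI)
    fix u :: real assume u: "u \<noteq> 1" "u \<noteq> -1"
    show "ennreal Wx * (ennreal (real (k+1) * 2 ^ k) * (ennreal d * (ennreal (\<bar>H (x + d * u)\<bar> * (d - \<bar>d * u\<bar>) ^ (k-1)) * indicator {x-d..x+d} (x + d * u))))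
      \<le> ennreal (4 * real (k+1) * (real k) ^ k * h ^ k) *
      (ennreal (edge_weight u) * ennreal \<bar>H (x + u * d) * \<phi> (x + u * d) ^ (k + r)\<bar>)"
    proof (cases "\<bar>u\<bar> < 1")
      case False
      then have "\<bar>u\<bar> > 1" using u by auto
      then have "d * \<bar>u\<bar> > d" using d by simp
      then have "x + d * u \<notin> {x-d..x+d}" by (cases "u \<ge> 0") (auto simp: abs_if)
      then show ?thesis by simp
    next
      case True
      define s where "s = sqrt (1 - \<bar>u\<bar>)"
      have s: "s > 0" "s \<le> 1" "s ^ 2 = 1 - \<bar>u\<bar>" using True by (auto simp: s_def real_sqrt_le_iff)
      define y where "y = x + u * d"
      have conc: "\<phi> x ^ 2 * (1 - \<bar>u\<bar>) \<le> \<phi> y ^ 2" "\<bar>y\<bar> \<le> 1"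
        unfolding y_def using \<phi>_concave[of x d u] d True by auto
      have \<phi>y: "\<phi> y \<ge> 0" using \<phi>_nonneg conc(2) by auto
      have "(\<phi> x * s) ^ 2 \<le> \<phi> y ^ 2" using conc(1) by (simp add: power_mult_distrib s(3))
      then have \<phi>s: "\<phi> x * s \<le> \<phi> y" using \<phi>y by (rule power2_le_imp_le)
      have "\<bar>u * d\<bar> \<le> real k * h * \<phi> x / 2" using True d unfolding d_def[symmetric] by (simp add: abs_mult mult_left_le_one_le)
      then have "W (real k * h) x \<le> \<phi> y" "0 \<le> W (real k * h) x" unfolding y_def using W_le_\<phi>[OF x, of "u * d"] by auto
      then have Wr: "Wx \<le> \<phi> y ^ r" unfolding Wx_def by (intro power_mono)
      obtain k' where k': "k = Suc k'" using k by (cases k) auto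
      have du: "d - \<bar>d * u\<bar> = d * s ^ 2" using d(1) by (simp add: s(3) abs_mult algebra_simps)
      have "d * (d - \<bar>d * u\<bar>) ^ (k-1) = (real k * h / 2) ^ k * (\<phi> x ^ k * s ^ (2 * k'))"
      proof -
        have "d * (d - \<bar>d * u\<bar>) ^ (k-1) = d ^ k * s ^ (2 * k')"
          unfolding du by (simp add: k' power_mult_distrib power_mult)
        moreover have "d = (real k * h / 2) * \<phi> x" by (simp add: d_def)
        ultimately show ?thesis by (simp only: power_mult_distrib mult.assoc)
      qed
      also have "\<dots> \<le> (real k * h / 2) ^ k * (\<phi> y ^ k / s)"
      proof (intro mult_left_mono)
        \<comment> \<open>One more factor s raises the exponent 2 k' to k + k'. The first k factors
          join \<open>\<phi> x\<close> and are absorbed by \<open>\<phi> y\<close>, the others are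
          at most 1. The price is a single 1/s whatever k is, and that is the density
          \<open>edge_weight\<close>.\<close>
        have "s * (\<phi> x ^ k * s ^ (2 * k')) = (\<phi> x * s) ^ k * s ^ k'"
          by (simp add: k' power_mult_distrib mult_2 power_add)
        also have "\<dots> \<le> \<phi> y ^ k * 1" using \<phi>s s \<phi>x \<phi>y by (intro mult_mono power_mono power_le_one) auto
        finally show "\<phi> x ^ k * s ^ (2 * k') \<le> \<phi> y ^ k / s" using s(1) by (simp add: field_simps)
      qed (use h in auto)
      finally have "d * (d - \<bar>d * u\<bar>) ^ (k-1) \<le> (real k * h / 2) ^ k * (\<phi> y ^ k / s)" .
      then have "Wx * (d * (d - \<bar>d * u\<bar>) ^ (k-1)) \<le> \<phi> y ^ r * ((real k * h / 2) ^ k * (\<phi> y ^ k / s))"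
        by (rule mult_mono[OF Wr]) (use \<phi>y d(1) in \<open>auto simp: du\<close>)
      then have "\<bar>H y\<bar> * (real (k+1) * 2 ^ k) * (Wx * (d * (d - \<bar>d * u\<bar>) ^ (k-1))) \<le> \<bar>H y\<bar> * (real (k+1) * 2 ^ k) * (\<phi> y ^ r * ((real k * h / 2) ^ k * (\<phi> y ^ k / s)))"
        by (intro mult_left_mono) auto
      also have "\<dots> = 4 * real (k+1) * (real k) ^ k * h ^ k * (edge_weight u * \<bar>H y * \<phi> y ^ (k + r)\<bar>)"
        using True \<phi>y s by (simp add: edge_weight_def s_def[symmetric] abs_mult power_abs power_divide power_mult_distrib power_add field_simps)
      finally have le: "Wx * (real (k+1) * 2 ^ k * (d * (\<bar>H y\<bar> * (d - \<bar>d * u\<bar>) ^ (k-1)))) \<le> 4 * real (k+1) * (real k) ^ k * h ^ k * (edge_weight u * \<bar>H y * \<phi> y ^ (k + r)\<bar>)"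
        by (simp add: mult_ac)
      have "(d - \<bar>d * u\<bar>) ^ (k-1) \<ge> 0" "edge_weight u \<ge> 0" using d(1) True by (auto simp: du edge_weight_def)
      then have "ennreal Wx * (ennreal (real (k+1) * 2 ^ k) * (ennreal d * (ennreal (\<bar>H y\<bar> * (d - \<bar>d * u\<bar>) ^ (k-1)))))
         \<le> ennreal (4 * real (k+1) * (real k) ^ k * h ^ k) * (ennreal (edge_weight u) * ennreal \<bar>H y * \<phi> y ^ (k + r)\<bar>)"
        using ennreal_leI[OF le] Wx d(1) h by (simp only: ennreal_mult[symmetric] zero_le_mult_iff abs_ge_zero) (simp add: ennreal_mult[symmetric])
      then show ?thesis unfolding y_def by (auto simp: mult.commute[of u d] split: split_indicator)
    qed
  qed
  also have "\<dots> = ennreal (4 * real (k+1) * (real k) ^ k * h ^ k) * (\<integral>\<^sup>+u. ennreal (edge_weight u) * ennreal \<bar>H (x + u * d) * \<phi> (x + u * d) ^ (k + r)\<bar> \<partial>lborel)"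
    by (rule nn_integral_cmult) measurable
  finally show ?thesis unfolding Wx_def d_def .
qed

text \<open>Jensen's inequality with the density \<open>edge_weight\<close> brings
  \<open>\<theta>\<close> under the integral over u. After Fubini's theorem every fixed u is a shift
  by a multiple of \<open>\<phi>\<close>, to which \<open>nn_integral_shift_\<phi>\<close> applies;
  the total mass over u is 1.\<close>

lemma modular_weighted_diff_smooth_le:
  fixes D :: "nat \<Rightarrow> real \<Rightarrow> real"
  assumes \<theta>: "modular \<theta>" and k: "k \<ge> 1"
    and D: "\<And>m x. m < k - 1 \<Longrightarrow> \<bar>x\<bar> < 1 \<Longrightarrow> (D m has_real_derivative D (Suc m) x) (at x)"
    and AC: "locally_abs_continuous (D (k-1))"
    and H[measurable]: "H \<in> borel_measurable borel"
    and ae: "AE x in lborel. \<bar>x\<bar> < 1 \<longrightarrow> H x = deriv (D (k-1)) x"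
    and h: "h > 0"
  shows "(\<integral>\<^sup>+x. ennreal (\<theta> (\<bar>W (real k * h) x ^ r * sym_diff k (h * \<phi> x) (D 0) x\<bar> / (4 * real (k+1) * (real k) ^ k * h ^ k))) * indicator (D_set (real k * h)) x \<partial>lborel)
     \<le> 2 * (\<integral>\<^sup>+x. ennreal (\<theta> \<bar>H x * \<phi> x ^ (k + r)\<bar>) * indicator {-1..1} x \<partial>lborel)"
proof -
  note [measurable] = modular_measurable[OF \<theta>]
  define \<delta> where "\<delta> = real k * h"
  have \<delta>: "\<delta> > 0" using k h by (simp add: \<delta>_def)
  define C where "C = 4 * real (k+1) * (real k) ^ k * h ^ k"
  have C: "C > 0" using k h by (simp add: C_def)
  define Q where "Q x = \<bar>H x * \<phi> x ^ (k + r)\<bar>" for x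
  have [measurable]: "Q \<in> borel_measurable borel" unfolding Q_def[abs_def] by measurable
  have [measurable]: "D_set \<delta> \<in> sets borel" using D_set_borel[OF \<delta>] .
  define m where "m = (4 - \<delta>\<^sup>2) / (4 + \<delta>\<^sup>2)"
  \<comment> \<open>The pointwise bound excludes points whose outermost node hits an endpoint. These
    are only the two boundary points of \<open>D_set \<delta>\<close>, a null set.\<close>
  have bd: "x = m \<or> x = - m" if x: "x \<in> D_set \<delta>" and ns: "\<not> \<bar>x\<bar> + \<delta> * \<phi> x / 2 < 1" for x
  proof -
    have eq: "\<delta> * \<phi> x = 2 * (1 - \<bar>x\<bar>)" and x1: "\<bar>x\<bar> < 1" using D_setD[OF x] ns by auto
    have "\<delta>^2 * \<phi> x ^ 2 = 2^2 * (1 - \<bar>x\<bar>)^2" using arg_cong[OF eq, of "\<lambda>z. z^2"] by (simp only: power_mult_distrib)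
    then have "\<delta>^2 * (1 - x^2) = 4 * (1 - \<bar>x\<bar>)^2" using \<phi>_sq[of x] x1 by simp
    moreover have "1 - x^2 = (1 - \<bar>x\<bar>) * (1 + \<bar>x\<bar>)" by (simp add: power2_eq_square algebra_simps)
    ultimately have "(1 - \<bar>x\<bar>) * (\<delta>^2 * (1 + \<bar>x\<bar>)) = (1 - \<bar>x\<bar>) * (4 * (1 - \<bar>x\<bar>))" by (simp add: power2_eq_square mult_ac)
    then have "\<delta>^2 * (1 + \<bar>x\<bar>) = 4 * (1 - \<bar>x\<bar>)" using x1 by simp
    then have "\<bar>x\<bar> * (4 + \<delta>^2) = 4 - \<delta>^2" by (simp add: algebra_simps)
    moreover have "4 + \<delta>^2 > 0" by (simp add: add_pos_nonneg)
    ultimately have "\<bar>x\<bar> = m" unfolding m_def by (simp add: field_simps)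
    then show ?thesis by auto
  qed
  have pw: "ennreal (\<theta> (\<bar>W \<delta> x ^ r * sym_diff k (h * \<phi> x) (D 0) x\<bar> / C)) * indicator (D_set \<delta>) x
    \<le> (\<integral>\<^sup>+u. ennreal (edge_weight u) * ennreal (\<theta> (Q (x + u * (\<delta> * \<phi> x / 2)))) * indicator (D_set \<delta>) x \<partial>lborel)" if "x \<noteq> m" "x \<noteq> - m" for x
  proof (cases "x \<in> D_set \<delta>")
    case True
    then have "\<bar>x\<bar> + real k * h * \<phi> x / 2 < 1" using bd[OF True] that unfolding \<delta>_def by blast
    from weighted_diff_pointwise[OF k D AC H ae h True[unfolded \<delta>_def] this, of r]
    have 1: "ennreal \<bar>W \<delta> x ^ r * sym_diff k (h * \<phi> x) (D 0) x\<bar> \<le> ennreal C *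
     (\<integral>\<^sup>+u. ennreal (edge_weight u) * ennreal (Q (x + u * (\<delta> * \<phi> x / 2))) \<partial>lborel)" unfolding C_def Q_def \<delta>_def by simp
    have "ennreal (\<bar>W \<delta> x ^ r * sym_diff k (h * \<phi> x) (D 0) x\<bar> / C) \<le> (\<integral>\<^sup>+u. ennreal (edge_weight u) * ennreal (Q (x + u * (\<delta> * \<phi> x / 2))) \<partial>lborel)"
    proof -
      have "ennreal (\<bar>W \<delta> x ^ r * sym_diff k (h * \<phi> x) (D 0) x\<bar> / C) = ennreal (1 / C) * ennreal \<bar>W \<delta> x ^ r * sym_diff k (h * \<phi> x) (D 0) x\<bar>"
        using C by (simp add: ennreal_mult[symmetric])
      also have "\<dots> \<le> ennreal (1 / C) * (ennreal C * (\<integral>\<^sup>+u. ennreal (edge_weight u) * ennreal (Q (x + u * (\<delta> * \<phi> x / 2))) \<partial>lborel))"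
        by (rule mult_left_mono[OF 1]) simp
      also have "\<dots> = (\<integral>\<^sup>+u. ennreal (edge_weight u) * ennreal (Q (x + u * (\<delta> * \<phi> x / 2))) \<partial>lborel)"
        using C by (simp add: mult.assoc[symmetric] ennreal_mult[symmetric])
      finally show ?thesis .
    qed
    then have "ennreal (\<theta> (\<bar>W \<delta> x ^ r * sym_diff k (h * \<phi> x) (D 0) x\<bar> / C)) \<le> (\<integral>\<^sup>+u. ennreal (edge_weight u) * ennreal (\<theta> (Q (x + u * (\<delta> * \<phi> x / 2)))) \<partial>lborel)"
      by (intro modular_Jensen[OF \<theta> _ _ edge_weight_integral]) (auto simp: Q_def)
    then show ?thesis using True by simp
  qed simp
  have "(\<integral>\<^sup>+x. ennreal (\<theta> (\<bar>W \<delta> x ^ r * sym_diff k (h * \<phi> x) (D 0) x\<bar> / C)) * indicator (D_set \<delta>) x \<partial>lborel)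
     \<le> (\<integral>\<^sup>+x. (\<integral>\<^sup>+u. ennreal (edge_weight u) * ennreal (\<theta> (Q (x + u * (\<delta> * \<phi> x / 2)))) * indicator (D_set \<delta>) x \<partial>lborel) \<partial>lborel)"
    by (rule nn_integral_mono_AE, rule AE_mp[OF AE_lborel_singleton[of m]], rule AE_mp[OF AE_lborel_singleton[of "-m"]], intro AE_I2 impI, rule pw)
  also have "\<dots> = (\<integral>\<^sup>+u. (\<integral>\<^sup>+x. ennreal (edge_weight u) * ennreal (\<theta> (Q (x + u * (\<delta> * \<phi> x / 2)))) * indicator (D_set \<delta>) x \<partial>lborel) \<partial>lborel)"
    by (rule lborel_pair.Fubini') measurable
  also have "\<dots> \<le> (\<integral>\<^sup>+u. ennreal (edge_weight u) * (2 * (\<integral>\<^sup>+x. ennreal (\<theta> (Q x)) * indicator {-1..1} x \<partial>lborel)) \<partial>lborel)"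
  proof (rule nn_integral_mono)
    fix u :: real
    show "(\<integral>\<^sup>+x. ennreal (edge_weight u) * ennreal (\<theta> (Q (x + u * (\<delta> * \<phi> x / 2)))) * indicator (D_set \<delta>) x \<partial>lborel)
       \<le> ennreal (edge_weight u) * (2 * (\<integral>\<^sup>+x. ennreal (\<theta> (Q x)) * indicator {-1..1} x \<partial>lborel))"
    proof (cases "\<bar>u\<bar> < 1")
      case True
      then have "\<bar>u * (\<delta> / 2)\<bar> \<le> \<delta> / 2" using \<delta> by (simp add: abs_mult mult_left_le_one_le)
      from nn_integral_shift_\<phi>[OF \<delta> this, of "\<lambda>x. ennreal (\<theta> (Q x))"]
      have "(\<integral>\<^sup>+x. ennreal (\<theta> (Q (x + u * (\<delta> * \<phi> x / 2)))) * indicator (D_set \<delta>) x \<partial>lborel) \<le> 2 * (\<integral>\<^sup>+x. ennreal (\<theta> (Q x)) * indicator {-1..1} x \<partial>lborel)"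
        by (simp add: mult.assoc)
      then have "ennreal (edge_weight u) * (\<integral>\<^sup>+x. ennreal (\<theta> (Q (x + u * (\<delta> * \<phi> x / 2)))) * indicator (D_set \<delta>) x \<partial>lborel) \<le> ennreal (edge_weight u) * (2 * (\<integral>\<^sup>+x. ennreal (\<theta> (Q x)) * indicator {-1..1} x \<partial>lborel))"
        by (rule mult_left_mono) simp
      then show ?thesis by (subst (asm) nn_integral_cmult[symmetric]) (auto simp: mult.assoc)
    qed (simp add: edge_weight_def)
  qed
  also have "\<dots> = 2 * (\<integral>\<^sup>+x. ennreal (\<theta> (Q x)) * indicator {-1..1} x \<partial>lborel)"
    by (simp add: nn_integral_multc edge_weight_integral)
  finally show ?thesis unfolding Q_def C_def \<delta>_def .
qed

section \<open>Borel representatives and the upper estimate in norm\<close>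

lemma nn_integral_lebesgue_on: "A \<in> sets lebesgue \<Longrightarrow> (\<integral>\<^sup>+x. g x \<partial>lebesgue_on A) = (\<integral>\<^sup>+x. g x * indicator A x \<partial>lborel)"
  by (simp add: nn_integral_restrict_space nn_integral_completion)

text \<open>Composition with \<open>x + c * \<phi> x\<close> and Fubini's theorem call for Borel
  functions, whereas membership in \<open>Lp_space\<close> gives Lebesgue measurability of the
  weighted function. The weight can be divided out because it vanishes on [-1,1] only at the
  endpoints.\<close>

lemma Borel_representative:
  fixes F :: "real \<Rightarrow> real"
  assumes "(\<lambda>x. F x * \<phi> x ^ r) \<in> borel_measurable (lebesgue_on {-1..1})"
  obtains F' where "F' \<in> borel_measurable borel" "AE x in lborel. x \<in> {-1..1} \<longrightarrow> F x = F' x"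
proof -
  define v where "v x = (if x \<in> {-1..1} then F x * \<phi> x ^ r else 0)" for x
  have "v \<in> borel_measurable lebesgue" unfolding v_def by (subst borel_measurable_if) (use assms in auto)
  then obtain v' where v': "v' \<in> borel_measurable lborel" "AE x in lborel. v x = v' x"
    using completion_ex_borel_measurable_real by blast
  define F' where "F' x = v' x / \<phi> x ^ r" for x
  have [measurable]: "v' \<in> borel_measurable borel" using v'(1) by simp
  show ?thesis
  proof
    show "F' \<in> borel_measurable borel" unfolding F'_def[abs_def] by measurable
    show "AE x in lborel. x \<in> {-1..1} \<longrightarrow> F x = F' x"
    proof (rule AE_mp[OF v'(2)], rule AE_mp[OF AE_lborel_singleton[of 1]], rule AE_mp[OF AE_lborel_singleton[of "-1"]], intro AE_I2 impI)
      fix x :: real assume x: "x \<noteq> 1" "x \<noteq> -1" "v x = v' x" "x \<in> {-1..1}"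
      then have "\<phi> x > 0" by (intro \<phi>_pos) (auto simp: abs_less_iff)
      then show "F x = F' x" using x(3,4) by (simp add: F'_def v_def[symmetric] flip: x(3)) (simp add: v_def)
    qed
  qed
qed

lemma B_class_weighted: "f \<in> B_class p r \<Longrightarrow> (\<lambda>x. (deriv ^^ r) f x * \<phi> x ^ r) \<in> Lp_space p {-1..1}"
  by (auto simp: B_class_def split: if_splits)

text \<open>A crude triangle inequality suffices: \<open>(a + b) ^ q\<close> is at most
  \<open>2 ^ q\<close> times the larger of the two powers, the sum of two integrals is at most twice
  the larger, and 2 to the power 1/q is at most 2. Hence the 4.\<close>

lemma Lp_norm_add:
  assumes p: "1 \<le> p" and u[measurable]: "u \<in> borel_measurable (lebesgue_on A)" and v[measurable]: "v \<in> borel_measurable (lebesgue_on A)"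
  shows "Lp_norm p A (\<lambda>x. u x + v x) \<le> 4 * (Lp_norm p A u + Lp_norm p A v)"
proof (cases "p = \<infinity>")
  case True
  have "Lp_norm p A (\<lambda>x. u x + v x) \<le> Lp_norm p A u + Lp_norm p A v"
  proof -
    have "AE x in lebesgue_on A. ennreal \<bar>u x + v x\<bar> \<le> Lp_norm p A u + Lp_norm p A v"
    proof (rule AE_mp[OF esssup_AE[of "\<lambda>x. ennreal \<bar>u x\<bar>"]], rule AE_mp[OF esssup_AE[of "\<lambda>x. ennreal \<bar>v x\<bar>"]], intro AE_I2 impI)
      fix x assume *: "ennreal \<bar>v x\<bar> \<le> esssup (lebesgue_on A) (\<lambda>x. ennreal \<bar>v x\<bar>)" "ennreal \<bar>u x\<bar> \<le> esssup (lebesgue_on A) (\<lambda>x. ennreal \<bar>u x\<bar>)"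
      have "ennreal \<bar>u x + v x\<bar> \<le> ennreal \<bar>u x\<bar> + ennreal \<bar>v x\<bar>" by (simp add: ennreal_plus[symmetric] ennreal_leI del: ennreal_plus)
      also have "\<dots> \<le> Lp_norm p A u + Lp_norm p A v" unfolding Lp_norm_def using True * by (auto intro: add_mono)
      finally show "ennreal \<bar>u x + v x\<bar> \<le> Lp_norm p A u + Lp_norm p A v" .
    qed
    moreover have "Lp_norm p A (\<lambda>x. u x + v x) = esssup (lebesgue_on A) (\<lambda>x. ennreal \<bar>u x + v x\<bar>)" by (simp add: Lp_norm_def True)
    ultimately show ?thesis by (auto intro!: esssup_I)
  qed
  also have "\<dots> = 1 * (Lp_norm p A u + Lp_norm p A v)" by simp
  also have "\<dots> \<le> 4 * (Lp_norm p A u + Lp_norm p A v)" by (intro mult_right_mono) auto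
  finally show ?thesis .
next
  case False
  define q where "q = enn2real p"
  have q: "q \<ge> 1" unfolding q_def using p False by (cases p) auto
  define X where "X g = (\<integral>\<^sup>+x. ennreal (\<bar>g x\<bar> powr q) \<partial>lebesgue_on A)" for g :: "real \<Rightarrow> real"
  have Lp: "Lp_norm p A g = ennreal_powr (X g) (1/q)" for g using False by (simp add: Lp_norm_def X_def q_def)
  have "X (\<lambda>x. u x + v x) \<le> (\<integral>\<^sup>+x. ennreal (2 powr q) * (ennreal (\<bar>u x\<bar> powr q) + ennreal (\<bar>v x\<bar> powr q)) \<partial>lebesgue_on A)"
    unfolding X_def
  proof (rule nn_integral_mono)
    fix x
    have "\<bar>u x + v x\<bar> powr q \<le> (2 * max \<bar>u x\<bar> \<bar>v x\<bar>) powr q" using q by (intro powr_mono2) auto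
    also have "\<dots> = 2 powr q * max \<bar>u x\<bar> \<bar>v x\<bar> powr q" by (simp add: powr_mult)
    also have "\<dots> \<le> 2 powr q * (\<bar>u x\<bar> powr q + \<bar>v x\<bar> powr q)" by (intro mult_left_mono) (auto simp: max_def)
    finally show "ennreal (\<bar>u x + v x\<bar> powr q) \<le> ennreal (2 powr q) * (ennreal (\<bar>u x\<bar> powr q) + ennreal (\<bar>v x\<bar> powr q))"
      by (simp add: ennreal_plus[symmetric] ennreal_mult[symmetric] ennreal_leI del: ennreal_plus)
  qed
  also have "\<dots> = ennreal (2 powr q) * (X u + X v)" unfolding X_def by (simp add: nn_integral_cmult nn_integral_add)
  also have "\<dots> \<le> ennreal (2 powr q) * (ennreal 2 * max (X u) (X v))"
    by (intro mult_left_mono) (auto simp: mult_2 add_mono max_def)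
  also have "\<dots> = ennreal (2 powr q * 2) * max (X u) (X v)" by (simp add: ennreal_mult mult.assoc)
  finally have "Lp_norm p A (\<lambda>x. u x + v x) \<le> ennreal_powr (ennreal (2 powr q * 2) * max (X u) (X v)) (1/q)"
    unfolding Lp using q by (intro ennreal_powr_mono) auto
  also have "\<dots> = ennreal ((2 powr q * 2) powr (1/q)) * ennreal_powr (max (X u) (X v)) (1/q)" by (rule ennreal_powr_cmult) simp
  also have "\<dots> \<le> ennreal 4 * (ennreal_powr (X u) (1/q) + ennreal_powr (X v) (1/q))"
  proof (intro mult_mono ennreal_leI)
    have "(2 powr q * 2) powr (1/q) = 2 * 2 powr (1/q)" using q by (simp add: powr_mult powr_powr)
    also have "\<dots> \<le> 2 * 2 powr 1" using q by (intro mult_left_mono powr_mono) auto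
    finally show "(2 powr q * 2) powr (1/q) \<le> 4" by simp
    show "ennreal_powr (max (X u) (X v)) (1/q) \<le> ennreal_powr (X u) (1/q) + ennreal_powr (X v) (1/q)"
      by (auto simp: max_def)
  qed auto
  finally show ?thesis by (simp add: Lp)
qed

text \<open>Each of the finitely many nodes is a shift by a multiple of \<open>\<phi>\<close> and so
  avoids the exceptional null set for almost every x.\<close>

lemma sym_diff_cong_AE:
  assumes k: "k \<ge> 1" and h: "h > 0" and ae: "AE x in lborel. x \<in> {-1..1} \<longrightarrow> F x = F' x"
  shows "AE x in lborel. x \<in> D_set (real k * h) \<longrightarrow> sym_diff k (h * \<phi> x) F x = sym_diff k (h * \<phi> x) F' x"
proof -
  have "AE x in lborel. \<forall>i\<in>{..k}. x \<in> D_set (real k * h) \<longrightarrow>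
     F (x + ((real i - real k / 2) * h) * \<phi> x) = F' (x + ((real i - real k / 2) * h) * \<phi> x)"
  proof (intro AE_finite_allI)
    fix i assume "i \<in> {..k}"
    then have "real i \<le> real k" by simp
    then have "\<bar>real i - real k / 2\<bar> \<le> real k / 2" by (intro abs_leI) linarith+
    then have "\<bar>real i - real k / 2\<bar> * h \<le> real k / 2 * h" using h by (intro mult_right_mono) auto
    then have "\<bar>(real i - real k / 2) * h\<bar> \<le> real k * h / 2" using h by (simp add: abs_mult)
    from AE_shift_\<phi>[OF _ this ae] k h
    show "AE x in lborel. x \<in> D_set (real k * h) \<longrightarrow> F (x + ((real i - real k / 2) * h) * \<phi> x) = F' (x + ((real i - real k / 2) * h) * \<phi> x)"
      by auto
  qed simp
  then show ?thesis
    by (rule AE_mp) (auto intro!: AE_I2 sum.cong simp: sym_diff_on_D_set[OF _ less_imp_le[OF h]])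
qed

lemma weighted_diff_measurable:
  assumes [measurable]: "F \<in> borel_measurable borel"
  shows "(\<lambda>x. W \<delta> x ^ r * sym_diff k (h * \<phi> x) F x) \<in> borel_measurable borel"
  unfolding sym_diff_def by measurable

lemma borel_imp_lebesgue_on: "f \<in> borel_measurable borel \<Longrightarrow> f \<in> borel_measurable (lebesgue_on A)"
  by (intro measurable_restrict_space1 measurable_completion) auto

lemma B_class_continuous:
  assumes "g \<in> B_class p (k + r)" "k \<ge> 1" "j < k + r"
  shows "continuous_on {-1<..<1} ((deriv ^^ j) g)"
proof (cases "j < k + r - 1")
  case True
  then have "\<forall>x\<in>{-1<..<1}. (deriv ^^ j) g field_differentiable at x" using assms by (auto simp: B_class_def)
  then show ?thesis by (intro continuous_at_imp_continuous_on ballI) (auto simp: field_differentiable_imp_continuous_at)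
next
  case False
  then have j: "j = k + r - 1" using assms by simp
  have lac: "locally_abs_continuous ((deriv ^^ j) g)" using assms j by (auto simp: B_class_def)
  show ?thesis
  proof (intro continuous_at_imp_continuous_on ballI)
    fix x :: real assume x: "x \<in> {-1<..<1}"
    obtain a where a: "-1 < a" "a < x" using dense[of "-1" x] x by auto
    obtain b where b: "x < b" "b < 1" using dense[of x 1] x by auto
    have "continuous_on {a..b} ((deriv ^^ j) g)"
      using lac a b unfolding locally_abs_continuous_def by (intro abs_continuous_on_imp_continuous_on) auto
    then show "isCont ((deriv ^^ j) g) x" using a b by (intro continuous_on_interior[of "{a..b}"]) auto
  qed
qed

text \<open>The difference of \<open>f\<^sup>(\<^sup>r\<^sup>)\<close> splits into that of
  \<open>f\<^sup>(\<^sup>r\<^sup>) - g\<^sup>(\<^sup>r\<^sup>)\<close>, bounded by node values, and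
  that of \<open>g\<^sup>(\<^sup>r\<^sup>)\<close>, bounded through its k-th derivative.\<close>

theorem modulus_le_K_functional_term:
  assumes k: "k \<ge> 1" and p: "1 \<le> p" and h: "h > 0" and f: "f \<in> B_class p r" and g: "g \<in> B_class p (k + r)"
  shows "Lp_norm p (D_set (real k * h)) (\<lambda>x. W (real k * h) x ^ r * sym_diff k (h * \<phi> x) ((deriv ^^ r) f) x) \<le>
    ennreal (32 * real (k+1) ^ 2 * (2 * real k) ^ k) *
    (Lp_norm p {-1..1} (\<lambda>x. ((deriv ^^ r) f x - (deriv ^^ r) g x) * \<phi> x ^ r) +
     ennreal (h ^ k) * Lp_norm p {-1..1} (\<lambda>x. (deriv ^^ (k + r)) g x * \<phi> x ^ (k + r)))"
proof -
  define \<delta> where "\<delta> = real k * h"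
  have \<delta>: "\<delta> > 0" using k h by (simp add: \<delta>_def)
  define A where "A = D_set \<delta>"
  have Ab: "A \<in> sets borel" unfolding A_def by (rule D_set_borel[OF \<delta>])
  then have A: "A \<in> sets lebesgue" by auto
  have I: "{-1..1::real} \<in> sets lebesgue" by auto
  obtain F' where F'[measurable]: "F' \<in> borel_measurable borel" and F: "AE x in lborel. x \<in> {-1..1} \<longrightarrow> (deriv ^^ r) f x = F' x"
    using Borel_representative[of "(deriv ^^ r) f" r] B_class_weighted[OF f] unfolding Lp_space_def by blast
  obtain H where H[measurable]: "H \<in> borel_measurable borel" and Hae: "AE x in lborel. x \<in> {-1..1} \<longrightarrow> (deriv ^^ (k + r)) g x = H x"
    using Borel_representative[of "(deriv ^^ (k + r)) g" "k + r"] B_class_weighted[OF g] unfolding Lp_space_def by blast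
  define G where "G = (deriv ^^ r) g"
  \<comment> \<open>\<open>G\<close> is continuous on the open interval only; cutting it off outside
    makes it Borel and changes the differences on a null set at most.\<close>
  define G' where "G' x = (if x \<in> {-1<..<1} then G x else 0)" for x
  have "continuous_on {-1<..<1} G" unfolding G_def using k by (intro B_class_continuous[OF g]) auto
  then have G'[measurable]: "G' \<in> borel_measurable borel" unfolding G'_def
    by (intro borel_measurable_continuous_on_if) auto
  have GG': "AE x in lborel. x \<in> {-1..1} \<longrightarrow> G x = G' x"
    by (rule AE_mp[OF AE_lborel_singleton[of 1]], rule AE_mp[OF AE_lborel_singleton[of "-1"]]) (auto simp: G'_def)
  define D where "D m = (deriv ^^ (r + m)) g" for m
  have D: "(D m has_real_derivative D (Suc m) x) (at x)" if "m < k - 1" "\<bar>x\<bar> < 1" for m x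
  proof -
    have "D m field_differentiable at x" using g that k unfolding B_class_def D_def by (auto simp: abs_less_iff)
    then show ?thesis using field_differentiable_derivI[of "D m" x] by (simp add: D_def)
  qed
  have AC: "locally_abs_continuous (D (k-1))" using g k unfolding B_class_def D_def by (auto simp: add.commute)
  have dD: "deriv (D (k-1)) = (deriv ^^ (k + r)) g"
  proof -
    have "deriv (D (k-1)) = (deriv ^^ Suc (r + (k - 1))) g" by (simp add: D_def)
    also have "Suc (r + (k - 1)) = k + r" using k by simp
    finally show ?thesis .
  qed
  have ae: "AE x in lborel. \<bar>x\<bar> < 1 \<longrightarrow> H x = deriv (D (k-1)) x"
    unfolding dD using Hae by (rule AE_mp) (auto intro!: AE_I2 simp: abs_less_iff)
  \<comment> \<open>The two parts are formed from Borel representatives so that both are Borel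
    functions; they agree almost everywhere with the parts formed from f and g.\<close>
  define u1 where "u1 x = W \<delta> x ^ r * sym_diff k (h * \<phi> x) (\<lambda>x. F' x - G' x) x" for x
  define u2 where "u2 x = W \<delta> x ^ r * sym_diff k (h * \<phi> x) G' x" for x
  have u1m: "u1 \<in> borel_measurable borel" unfolding u1_def[abs_def] by (rule weighted_diff_measurable) measurable
  have u2m: "u2 \<in> borel_measurable borel" unfolding u2_def[abs_def] by (rule weighted_diff_measurable) measurable
  have add: "sym_diff k (h * \<phi> x) F' x = sym_diff k (h * \<phi> x) (\<lambda>x. F' x - G' x) x + sym_diff k (h * \<phi> x) G' x" for x
    unfolding sym_diff_def by (simp add: sum.distrib[symmetric] algebra_simps)
  have "AE x in lebesgue_on A. u1 x + u2 x = W \<delta> x ^ r * sym_diff k (h * \<phi> x) ((deriv ^^ r) f) x"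
    using AE_completion[OF sym_diff_cong_AE[OF k h F]] A
    by (auto simp: AE_restrict_space_iff A_def[symmetric] \<delta>_def[symmetric] u1_def u2_def add distrib_left elim!: eventually_mono)
  from Lp_norm_cong_AE(2)[OF A this borel_imp_lebesgue_on[OF borel_measurable_add[OF u1m u2m]]]
  have "Lp_norm p A (\<lambda>x. W \<delta> x ^ r * sym_diff k (h * \<phi> x) ((deriv ^^ r) f) x) = Lp_norm p A (\<lambda>x. u1 x + u2 x)" by simp
  also have "\<dots> \<le> 4 * (Lp_norm p A u1 + Lp_norm p A u2)"
    by (intro Lp_norm_add p borel_imp_lebesgue_on u1m u2m)
  also have "Lp_norm p A u1 \<le> ennreal (2 ^ k * real (k+1) * (2 * real (k+1))) * Lp_norm p {-1..1} (\<lambda>x. (F' x - G' x) * \<phi> x ^ r)"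
  proof (rule Lp_norm_le_modular[OF p borel_imp_lebesgue_on[OF u1m]])
    show "(\<lambda>x. (F' x - G' x) * \<phi> x ^ r) \<in> borel_measurable (lebesgue_on {-1..1})" by (intro borel_imp_lebesgue_on) measurable
    fix \<theta> assume \<theta>: "modular \<theta>"
    show "(\<integral>\<^sup>+x. ennreal (\<theta> (\<bar>u1 x\<bar> / (2 ^ k * real (k+1)))) \<partial>lebesgue_on A) \<le> ennreal (2 * real (k+1)) * (\<integral>\<^sup>+x. ennreal (\<theta> \<bar>(F' x - G' x) * \<phi> x ^ r\<bar>) \<partial>lebesgue_on {-1..1})"
      unfolding nn_integral_lebesgue_on[OF A] nn_integral_lebesgue_on[OF I]
      using modular_weighted_diff_le[OF \<theta> k h, of "\<lambda>x. F' x - G' x" r] by (simp add: u1_def A_def \<delta>_def)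
  qed auto
  also have "Lp_norm p {-1..1} (\<lambda>x. (F' x - G' x) * \<phi> x ^ r) = Lp_norm p {-1..1} (\<lambda>x. ((deriv ^^ r) f x - (deriv ^^ r) g x) * \<phi> x ^ r)"
  proof (rule Lp_norm_cong_AE(2)[OF I])
    show "(\<lambda>x. (F' x - G' x) * \<phi> x ^ r) \<in> borel_measurable (lebesgue_on {-1..1})" by (intro borel_imp_lebesgue_on) measurable
    have "AE x in lebesgue. x \<in> {-1..1} \<longrightarrow> (F' x - G' x) * \<phi> x ^ r = ((deriv ^^ r) f x - (deriv ^^ r) g x) * \<phi> x ^ r"
      using AE_completion[OF F] AE_completion[OF GG'] by eventually_elim (simp add: G_def)
    then show "AE x in lebesgue_on {-1..1}. (F' x - G' x) * \<phi> x ^ r = ((deriv ^^ r) f x - (deriv ^^ r) g x) * \<phi> x ^ r"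
      using I by (simp add: AE_restrict_space_iff)
  qed
  also have "Lp_norm p A u2 \<le> ennreal (4 * real (k+1) * (real k) ^ k * h ^ k * 2) * Lp_norm p {-1..1} (\<lambda>x. H x * \<phi> x ^ (k + r))"
  proof (rule Lp_norm_le_modular[OF p borel_imp_lebesgue_on[OF u2m]])
    show "(\<lambda>x. H x * \<phi> x ^ (k + r)) \<in> borel_measurable (lebesgue_on {-1..1})" by (intro borel_imp_lebesgue_on) measurable
    fix \<theta> assume \<theta>: "modular \<theta>"
    have "(\<integral>\<^sup>+x. ennreal (\<theta> (\<bar>u2 x\<bar> / (4 * real (k+1) * (real k) ^ k * h ^ k))) * indicator A x \<partial>lborel)
       = (\<integral>\<^sup>+x. ennreal (\<theta> (\<bar>W \<delta> x ^ r * sym_diff k (h * \<phi> x) (D 0) x\<bar> / (4 * real (k+1) * (real k) ^ k * h ^ k))) * indicator A x \<partial>lborel)"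
    proof (rule nn_integral_cong_AE, rule AE_mp[OF sym_diff_cong_AE[OF k h GG']], intro AE_I2 impI)
      fix x assume *: "x \<in> D_set (real k * h) \<longrightarrow> sym_diff k (h * \<phi> x) G x = sym_diff k (h * \<phi> x) G' x"
      show "ennreal (\<theta> (\<bar>u2 x\<bar> / (4 * real (k+1) * (real k) ^ k * h ^ k))) * indicator A x = ennreal (\<theta> (\<bar>W \<delta> x ^ r * sym_diff k (h * \<phi> x) (D 0) x\<bar> / (4 * real (k+1) * (real k) ^ k * h ^ k))) * indicator A x"
        using * by (cases "x \<in> A") (auto simp: u2_def A_def \<delta>_def D_def G_def)
    qed
    then show "(\<integral>\<^sup>+x. ennreal (\<theta> (\<bar>u2 x\<bar> / (4 * real (k+1) * (real k) ^ k * h ^ k))) \<partial>lebesgue_on A) \<le> ennreal 2 * (\<integral>\<^sup>+x. ennreal (\<theta> \<bar>H x * \<phi> x ^ (k + r)\<bar>) \<partial>lebesgue_on {-1..1})"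
      unfolding nn_integral_lebesgue_on[OF A] nn_integral_lebesgue_on[OF I]
      using modular_weighted_diff_smooth_le[OF \<theta> k D AC H ae h, of r] by (simp add: A_def \<delta>_def)
  qed (use k h in auto)
  also have "Lp_norm p {-1..1} (\<lambda>x. H x * \<phi> x ^ (k + r)) = Lp_norm p {-1..1} (\<lambda>x. (deriv ^^ (k + r)) g x * \<phi> x ^ (k + r))"
  proof (rule Lp_norm_cong_AE(2)[OF I])
    show "(\<lambda>x. H x * \<phi> x ^ (k + r)) \<in> borel_measurable (lebesgue_on {-1..1})" by (intro borel_imp_lebesgue_on) measurable
    show "AE x in lebesgue_on {-1..1}. H x * \<phi> x ^ (k + r) = (deriv ^^ (k + r)) g x * \<phi> x ^ (k + r)"
      using AE_completion[OF Hae] I by (auto simp: AE_restrict_space_iff elim!: eventually_mono)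
  qed
  \<comment> \<open>Both constants are enlarged to the common value
    \<open>8 * (k+1) ^ 2 * (2 * k) ^ k\<close>; the triangle inequality contributes the factor 4
    that makes it 32.\<close>
  also have "4 * (ennreal (2 ^ k * real (k+1) * (2 * real (k+1))) * Lp_norm p {-1..1} (\<lambda>x. ((deriv ^^ r) f x - (deriv ^^ r) g x) * \<phi> x ^ r) +
      ennreal (4 * real (k+1) * (real k) ^ k * h ^ k * 2) * Lp_norm p {-1..1} (\<lambda>x. (deriv ^^ (k + r)) g x * \<phi> x ^ (k + r)))
    \<le> 4 * (ennreal (8 * real (k+1) ^ 2 * (2 * real k) ^ k) * Lp_norm p {-1..1} (\<lambda>x. ((deriv ^^ r) f x - (deriv ^^ r) g x) * \<phi> x ^ r) +
      ennreal (8 * real (k+1) ^ 2 * (2 * real k) ^ k) * (ennreal (h ^ k) * Lp_norm p {-1..1} (\<lambda>x. (deriv ^^ (k + r)) g x * \<phi> x ^ (k + r))))"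
  proof (intro mult_left_mono add_mono)
    have "2 ^ k * 1 ^ k \<le> (2::real) ^ k * real k ^ k" using k by (intro mult_left_mono power_mono) auto
    then have "2 * real (k+1) ^ 2 * 2 ^ k \<le> 8 * real (k+1) ^ 2 * (2 * real k) ^ k"
      by (intro mult_mono) (auto simp: power_mult_distrib)
    then show "ennreal (2 ^ k * real (k+1) * (2 * real (k+1))) * Lp_norm p {-1..1} (\<lambda>x. ((deriv ^^ r) f x - (deriv ^^ r) g x) * \<phi> x ^ r)
      \<le> ennreal (8 * real (k+1) ^ 2 * (2 * real k) ^ k) * Lp_norm p {-1..1} (\<lambda>x. ((deriv ^^ r) f x - (deriv ^^ r) g x) * \<phi> x ^ r)"
      by (intro mult_right_mono ennreal_leI) (auto simp: power2_eq_square mult_ac)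
    have "real (k+1) * 1 \<le> real (k+1) * real (k+1)" by (intro mult_left_mono) auto
    moreover have "1 * real k ^ k \<le> 2 ^ k * real k ^ k" by (intro mult_right_mono) auto
    ultimately have "8 * real (k+1) * real k ^ k \<le> 8 * real (k+1) ^ 2 * (2 * real k) ^ k"
      by (intro mult_mono) (auto simp: power_mult_distrib power2_eq_square)
    then have "8 * real (k+1) * real k ^ k * h ^ k \<le> 8 * real (k+1) ^ 2 * (2 * real k) ^ k * h ^ k"
      using h by (intro mult_right_mono) auto
    then have "ennreal (4 * real (k+1) * (real k) ^ k * h ^ k * 2) \<le> ennreal (8 * real (k+1) ^ 2 * (2 * real k) ^ k) * ennreal (h ^ k)"
    proof -
      assume le: "8 * real (k+1) * real k ^ k * h ^ k \<le> 8 * real (k+1) ^ 2 * (2 * real k) ^ k * h ^ k"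
      have "4 * real (k+1) * (real k) ^ k * h ^ k * 2 = 8 * real (k+1) * real k ^ k * h ^ k" by simp
      then show ?thesis using ennreal_leI[OF le] h by (simp only:) (subst ennreal_mult[symmetric], auto)
    qed
    then show "ennreal (4 * real (k+1) * (real k) ^ k * h ^ k * 2) * Lp_norm p {-1..1} (\<lambda>x. (deriv ^^ (k + r)) g x * \<phi> x ^ (k + r))
      \<le> ennreal (8 * real (k+1) ^ 2 * (2 * real k) ^ k) * (ennreal (h ^ k) * Lp_norm p {-1..1} (\<lambda>x. (deriv ^^ (k + r)) g x * \<phi> x ^ (k + r)))"
      unfolding mult.assoc[symmetric] by (rule mult_right_mono) simp
  qed auto
  also have "\<dots> = ennreal (32 * real (k+1) ^ 2 * (2 * real k) ^ k) * (Lp_norm p {-1..1} (\<lambda>x. ((deriv ^^ r) f x - (deriv ^^ r) g x) * \<phi> x ^ r) +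
     ennreal (h ^ k) * Lp_norm p {-1..1} (\<lambda>x. (deriv ^^ (k + r)) g x * \<phi> x ^ (k + r)))"
  proof -
    have "ennreal (32 * real (k+1) ^ 2 * (2 * real k) ^ k) = 4 * ennreal (8 * real (k+1) ^ 2 * (2 * real k) ^ k)"
      by (subst ennreal_numeral[symmetric], subst ennreal_mult[symmetric]) auto
    then show ?thesis by (simp only: distrib_left mult.assoc)
  qed
  finally show ?thesis unfolding A_def \<delta>_def by (simp add: mult_left_mono add_mono)
qed

section \<open>Local approximation by polynomials\<close>

text \<open>The truncated power, valid for exponent 0 too, where it is the indicator of the positive
  axis; \<open>max 0 x ^ n\<close> would be constant there.\<close>

definition tpow :: "nat \<Rightarrow> real \<Rightarrow> real" where "tpow n x = (if x > 0 then x ^ n else 0)"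

lemma tpow_measurable [measurable]: "tpow n \<in> borel_measurable borel"
  unfolding tpow_def[abs_def] by measurable

lemma tpow_scale: "c > 0 \<Longrightarrow> tpow n (c * x) = c ^ n * tpow n x"
  by (auto simp: tpow_def power_mult_distrib zero_less_mult_iff)

lemma tpow_bounds: "0 \<le> tpow n x" "x \<le> B \<Longrightarrow> 0 \<le> B \<Longrightarrow> tpow n x \<le> B ^ n"
  by (auto simp: tpow_def intro: power_mono)

lemma DERIV_tpow: "x \<noteq> 0 \<Longrightarrow> (tpow (Suc n) has_real_derivative (real (Suc n) * tpow n x)) (at x)"
proof (cases "x > 0")
  case True
  have "((\<lambda>x. x ^ Suc n) has_real_derivative (real (Suc n) * x ^ n)) (at x)"
    using DERIV_pow[of "Suc n" x] by simp
  then have "(tpow (Suc n) has_real_derivative (real (Suc n) * x ^ n)) (at x)"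
    by (rule has_field_derivative_transform_within_open[of _ _ _ "{0<..}"]) (use True in \<open>auto simp: tpow_def\<close>)
  then show ?thesis using True by (simp add: tpow_def)
next
  case False
  assume "x \<noteq> 0"
  then have "x < 0" using False by simp
  have "((\<lambda>x. 0) has_real_derivative 0) (at x)" by simp
  then have "(tpow (Suc n) has_real_derivative 0) (at x)"
    by (rule has_field_derivative_transform_within_open[of _ _ _ "{..<0}"]) (use \<open>x < 0\<close> in \<open>auto simp: tpow_def\<close>)
  then show ?thesis using \<open>x < 0\<close> by (simp add: tpow_def)
qed

lemma tpow_Suc_eq: "tpow (Suc n) x = max 0 x ^ Suc n"
  by (auto simp: tpow_def max_def)

lemma continuous_on_tpow: "continuous_on S (tpow (Suc n))"
  unfolding tpow_Suc_eq[abs_def] by (intro continuous_intros)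

text \<open>The B-spline with knots \<open>0, \<dots>, k\<close>, the Peano kernel of \<open>fdiff k 1\<close>.\<close>
definition bspline :: "nat \<Rightarrow> real \<Rightarrow> real" where
  "bspline k s = (\<Sum>j\<le>k. (-1) ^ (k - j) * real (k choose j) * tpow (k - 1) (real j - s)) / fact (k - 1)"

lemma bspline_measurable [measurable]: "bspline k \<in> borel_measurable borel"
  unfolding bspline_def[abs_def] by measurable

text \<open>For s < 0 no power is truncated, and the k-th difference annihilates a polynomial of
  degree k - 1; for s > k every truncated power vanishes.\<close>

lemma bspline_support:
  assumes "k \<ge> 1" "s \<notin> {0..real k}"
  shows "bspline k s = 0"
proof (cases "s < 0")
  case True
  have "(\<Sum>j\<le>k. (-1) ^ (k - j) * real (k choose j) * tpow (k - 1) (real j - s)) = fdiff k 1 (\<lambda>x. (- s + x) ^ (k - 1)) 0"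
    unfolding fdiff_def using True by (intro sum.cong) (auto simp: tpow_def)
  also have "\<dots> = 0" using assms by (subst fdiff_power) auto
  finally show ?thesis by (simp add: bspline_def)
next
  case False
  then have "s > real k" using assms by auto
  have "(\<Sum>j\<le>k. (-1) ^ (k - j) * real (k choose j) * tpow (k - 1) (real j - s)) = 0"
  proof (intro sum.neutral ballI)
    fix j assume "j \<in> {..k}"
    then have "real j \<le> real k" by simp
    then have "real j - s \<le> 0" using \<open>s > real k\<close> by linarith
    then show "(-1) ^ (k - j) * real (k choose j) * tpow (k - 1) (real j - s) = 0" by (simp add: tpow_def)
  qed
  then show ?thesis by (simp add: bspline_def)
qed

lemma bspline_bound:
  assumes k: "k \<ge> 1"
  shows "\<bar>bspline k s\<bar> \<le> real (k + 1) * 2 ^ k * real k ^ (k - 1)"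
proof (cases "s \<in> {0..real k}")
  case False then show ?thesis using bspline_support[OF k False] by simp
next
  case True
  have "\<bar>\<Sum>j\<le>k. (-1) ^ (k - j) * real (k choose j) * tpow (k - 1) (real j - s)\<bar> \<le> (\<Sum>j\<le>k. 2 ^ k * real k ^ (k - 1))"
  proof (rule order_trans[OF sum_abs sum_mono])
    fix j assume "j \<in> {..k}"
    then have "real j - s \<le> real k" using True by (auto intro: order_trans[of _ "real j"])
    then have "tpow (k - 1) (real j - s) \<le> real k ^ (k - 1)" by (intro tpow_bounds(2)) auto
    moreover have "real (k choose j) \<le> 2 ^ k" by (metis binomial_le_pow2 numeral_power_eq_of_nat_cancel_iff of_nat_le_iff of_nat_numeral of_nat_power)
    ultimately show "\<bar>(-1) ^ (k - j) * real (k choose j) * tpow (k - 1) (real j - s)\<bar> \<le> 2 ^ k * real k ^ (k - 1)"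
      using tpow_bounds(1)[of "k-1" "real j - s"] by (auto simp: abs_mult power_abs intro!: mult_mono)
  qed
  then have 1: "\<bar>\<Sum>j\<le>k. (-1) ^ (k - j) * real (k choose j) * tpow (k - 1) (real j - s)\<bar> \<le> real (k + 1) * 2 ^ k * real k ^ (k - 1)" by simp
  have "\<bar>bspline k s\<bar> \<le> \<bar>\<Sum>j\<le>k. (-1) ^ (k - j) * real (k choose j) * tpow (k - 1) (real j - s)\<bar> / 1"
    unfolding bspline_def abs_divide by (intro divide_left_mono) auto
  then show ?thesis using 1 by simp
qed

text \<open>The truncated power with knot j integrates to \<open>j ^ k / k\<close>, so the sum is
  the k-th difference of \<open>x ^ k\<close> at 0, which is \<open>fact k\<close>.\<close>

lemma bspline_integral:
  assumes k: "k \<ge> 1"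
  shows "integrable lborel (bspline k)" "(\<integral>s. bspline k s \<partial>lborel) = 1"
proof -
  obtain n where n: "k = Suc n" using k by (cases k) auto
  have ind: "bspline k = (\<lambda>s. indicator {0..real k} s *\<^sub>R bspline k s)"
    using bspline_support[OF k] by (auto simp: fun_eq_iff split: split_indicator)
  have "integrable lborel (\<lambda>s. indicator {0..real k} s *\<^sub>R bspline k s)"
  proof (rule integrableI_bounded_set_indicator[where B="real (k + 1) * 2 ^ k * real k ^ (k - 1)"])
    show "AE x in lborel. x \<in> {0..real k} \<longrightarrow> norm (bspline k x) \<le> real (k + 1) * 2 ^ k * real k ^ (k - 1)"
      using bspline_bound[OF k] by auto
  qed auto
  then show int: "integrable lborel (bspline k)" using ind by simp
  have "((\<lambda>s. tpow n (real j - s)) has_integral (real j ^ k / real k)) {0..real k}" if j: "j \<le> k" for j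
  proof -
    have "((\<lambda>s. tpow n (real j - s)) has_integral (- tpow (Suc n) (real j - real k) / real k - - tpow (Suc n) (real j - 0) / real k)) {0..real k}"
    proof (rule fundamental_theorem_of_calculus_interior_strong[of "{real j}"])
      show "continuous_on {0..real k} (\<lambda>s. - tpow (Suc n) (real j - s) / real k)"
        using k by (intro continuous_intros continuous_on_compose2[OF continuous_on_tpow]) auto
      fix s assume s: "s \<in> {0<..<real k} - {real j}"
      have "((\<lambda>s. tpow (Suc n) (real j - s)) has_real_derivative ((real (Suc n) * tpow n (real j - s)) * (0 - 1))) (at s)"
        by (rule DERIV_chain2[OF DERIV_tpow]) (use s in \<open>auto intro!: derivative_eq_intros\<close>)
      then have "((\<lambda>s. - tpow (Suc n) (real j - s) / real k) has_real_derivative - ((real (Suc n) * tpow n (real j - s)) * (0 - 1)) / real k) (at s)"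
        by (rule DERIV_cdivide[OF DERIV_minus])
      then show "((\<lambda>s. - tpow (Suc n) (real j - s) / real k) has_vector_derivative tpow n (real j - s)) (at s)"
        unfolding has_real_derivative_iff_has_vector_derivative[symmetric] by (rule DERIV_cong) (simp add: n del: of_nat_Suc)
    qed auto
    moreover have "tpow (Suc n) (real j - real k) = 0" using j by (simp add: tpow_def)
    moreover have "tpow (Suc n) (real j - 0) = real j ^ k" by (simp add: tpow_def n)
    ultimately show ?thesis by simp
  qed
  then have "(bspline k has_integral ((\<Sum>j\<le>k. (-1) ^ (k - j) * real (k choose j) * (real j ^ k / real k)) / fact (k - 1))) {0..real k}"
    unfolding bspline_def[abs_def] n by (intro has_integral_divide has_integral_sum has_integral_mult_right) (auto simp: n)
  moreover have "(\<Sum>j\<le>k. (-1) ^ (k - j) * real (k choose j) * (real j ^ k / real k)) / fact (k - 1) = 1"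
  proof -
    have "(\<Sum>j\<le>k. (-1) ^ (k - j) * real (k choose j) * (real j ^ k / real k)) / fact (k - 1) = fdiff k 1 (\<lambda>x. (0 + x) ^ k) 0 / (real k * fact (k - 1))"
      by (simp add: fdiff_def sum_divide_distrib)
    also have "\<dots> = 1" by (subst fdiff_power) (auto simp: n)
    finally show ?thesis .
  qed
  ultimately have 1: "(bspline k has_integral 1) {0..real k}" by (simp only:)
  have "(bspline k has_integral (\<integral>s. bspline k s \<partial>lborel)) UNIV" by (rule has_integral_integral_lborel[OF int])
  then have "((\<lambda>s. if s \<in> {0..real k} then bspline k s else 0) has_integral (\<integral>s. bspline k s \<partial>lborel)) UNIV"
    by (rule has_integral_eq[rotated]) (use bspline_support[OF k] in auto)
  then have "(bspline k has_integral (\<integral>s. bspline k s \<partial>lborel)) {0..real k}"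
    unfolding has_integral_restrict_UNIV .
  then show "(\<integral>s. bspline k s \<partial>lborel) = 1" using 1 has_integral_unique by blast
qed

section \<open>Repeated integrals and their k-th differences\<close>

lemma integrable_mult_bounded_on_support:
  fixes f g :: "real \<Rightarrow> real"
  assumes f: "integrable lborel f" and [measurable]: "g \<in> borel_measurable borel"
    and B: "\<And>z. f z \<noteq> 0 \<Longrightarrow> \<bar>g z\<bar> \<le> B"
  shows "integrable lborel (\<lambda>z. f z * g z)"
proof (rule Bochner_Integration.integrable_bound[of lborel "\<lambda>z. \<bar>B\<bar> * f z"])
  show "integrable lborel (\<lambda>z. \<bar>B\<bar> * f z)" using f by simp
  have [measurable]: "f \<in> borel_measurable borel" using borel_measurable_integrable[OF f] by simp
  show "(\<lambda>z. f z * g z) \<in> borel_measurable lborel" by measurable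
  show "AE x in lborel. norm (f x * g x) \<le> norm (\<bar>B\<bar> * f x)"
  proof (rule AE_I2)
    fix x
    show "norm (f x * g x) \<le> norm (\<bar>B\<bar> * f x)"
    proof (cases "f x = 0")
      case False
      then have "\<bar>g x\<bar> \<le> \<bar>B\<bar>" using B[OF False] by linarith
      from mult_left_mono[OF this, of "\<bar>f x\<bar>"] show ?thesis by (simp add: abs_mult mult.commute)
    qed simp
  qed
qed

text \<open>Binomial expansion in x; the coefficients are moments of g, finite because g has bounded
  support. This describes the part of a repeated integral on which the truncation is
  inactive.\<close>

lemma moment_polynomial:
  fixes g :: "real \<Rightarrow> real"
  assumes g: "integrable lborel g" and supp: "\<And>z. g z \<noteq> 0 \<Longrightarrow> \<bar>z\<bar> \<le> B"
  shows "\<exists>Q. degree Q \<le> n \<and> (\<forall>x. (\<integral>z. g z * (x - z) ^ n \<partial>lborel) = poly Q x)"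
proof -
  define Q where "Q = (\<Sum>m\<le>n. monom (real (n choose m) * (\<integral>z. g z * (- z) ^ (n - m) \<partial>lborel)) m)"
  have "degree Q \<le> n" unfolding Q_def by (intro degree_sum_le) (auto intro: order_trans[OF degree_monom_le])
  moreover have "(\<integral>z. g z * (x - z) ^ n \<partial>lborel) = poly Q x" for x
  proof -
    have int: "integrable lborel (\<lambda>z. g z * (- z) ^ (n - m))" for m
      by (rule integrable_mult_bounded_on_support[OF g, where B="B ^ (n - m)"]) (auto simp: power_abs intro!: power_mono supp)
    have "(\<integral>z. g z * (x - z) ^ n \<partial>lborel) = (\<integral>z. (\<Sum>m\<le>n. (real (n choose m) * x ^ m) * (g z * (- z) ^ (n - m))) \<partial>lborel)"
    proof (rule Bochner_Integration.integral_cong[OF refl])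
      fix z
      have "(x - z) ^ n = (x + (- z)) ^ n" by simp
      also have "\<dots> = (\<Sum>m\<le>n. real (n choose m) * x ^ m * (- z) ^ (n - m))" by (rule binomial_ring)
      finally show "g z * (x - z) ^ n = (\<Sum>m\<le>n. (real (n choose m) * x ^ m) * (g z * (- z) ^ (n - m)))"
        by (simp add: sum_distrib_left mult_ac)
    qed
    also have "\<dots> = (\<Sum>m\<le>n. (real (n choose m) * x ^ m) * (\<integral>z. g z * (- z) ^ (n - m) \<partial>lborel))"
      using int by simp
    also have "\<dots> = poly Q x" unfolding Q_def by (simp add: poly_sum poly_monom mult_ac)
    finally show ?thesis .
  qed
  ultimately show ?thesis by blast
qed

text \<open>Cauchy's formula for the k-fold repeated integral of f from minus infinity.\<close>

definition kfold :: "nat \<Rightarrow> (real \<Rightarrow> real) \<Rightarrow> real \<Rightarrow> real" where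
  "kfold k f x = (\<integral>z. f z * tpow (k - 1) (x - z) \<partial>lborel) / fact (k - 1)"

lemma kfold_integrable:
  assumes f: "integrable lborel f" and supp: "\<And>z. f z \<noteq> 0 \<Longrightarrow> \<bar>z\<bar> \<le> B"
  shows "integrable lborel (\<lambda>z. f z * tpow n (x - z))"
proof (rule integrable_mult_bounded_on_support[OF f, where B="(\<bar>x\<bar> + B) ^ n"])
  fix z assume "f z \<noteq> 0"
  then have "\<bar>z\<bar> \<le> B" by (rule supp)
  then have "x - z \<le> \<bar>x\<bar> + B" "0 \<le> \<bar>x\<bar> + B" by linarith+
  then show "\<bar>tpow n (x - z)\<bar> \<le> (\<bar>x\<bar> + B) ^ n" using tpow_bounds(1)[of n "x - z"] tpow_bounds(2)[of "x - z" "\<bar>x\<bar> + B" n] by simp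
qed measurable

text \<open>The k-th difference of the truncated-power kernel is, after scaling by
  \<open>\<eta>\<close>, the B-spline; so the difference of a k-fold antiderivative is
  \<open>\<eta> ^ k\<close> times a local average of f.\<close>

lemma fdiff_kfold_bspline:
  assumes k: "k \<ge> 1" and f: "integrable lborel f" and supp: "\<And>z. f z \<noteq> 0 \<Longrightarrow> \<bar>z\<bar> \<le> B" and \<eta>: "\<eta> > 0"
  shows "fdiff k \<eta> (kfold k f) x = \<eta> ^ k * (\<integral>s. f (x + \<eta> * s) * bspline k s \<partial>lborel)"
    "integrable lborel (\<lambda>s. f (x + \<eta> * s) * bspline k s)"
proof -
  note int = kfold_integrable[OF f supp]
  define g where "g z = (\<Sum>j\<le>k. (-1) ^ (k - j) * real (k choose j) * (f z * tpow (k - 1) (x + real j * \<eta> - z))) / fact (k - 1)" for z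
  have g: "integrable lborel g" unfolding g_def[abs_def] by (intro integrable_divide_zero Bochner_Integration.integrable_sum integrable_mult_right int)
  have gx: "g (x + \<eta> * s) = \<eta> ^ (k - 1) * (f (x + \<eta> * s) * bspline k s)" for s
  proof -
    have "tpow (k - 1) (x + real j * \<eta> - (x + \<eta> * s)) = \<eta> ^ (k - 1) * tpow (k - 1) (real j - s)" for j
      using tpow_scale[OF \<eta>, of "k-1" "real j - s"] by (simp add: algebra_simps)
    then show ?thesis unfolding g_def bspline_def by (simp add: sum_distrib_left mult_ac)
  qed
  have "fdiff k \<eta> (kfold k f) x = (\<integral>z. g z \<partial>lborel)"
    unfolding fdiff_def kfold_def g_def using int by (simp add: sum_divide_distrib)
  also have "\<dots> = \<eta> * (\<integral>s. g (x + \<eta> * s) \<partial>lborel)"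
    using lborel_integral_real_affine[of \<eta> g x] \<eta> by simp
  also have "\<dots> = \<eta> * (\<integral>s. \<eta> ^ (k - 1) * (f (x + \<eta> * s) * bspline k s) \<partial>lborel)" by (simp only: gx)
  also have "\<eta> * (\<integral>s. \<eta> ^ (k - 1) * (f (x + \<eta> * s) * bspline k s) \<partial>lborel) = \<eta> ^ k * (\<integral>s. f (x + \<eta> * s) * bspline k s \<partial>lborel)"
    using k by (cases k) auto
  finally show "fdiff k \<eta> (kfold k f) x = \<eta> ^ k * (\<integral>s. f (x + \<eta> * s) * bspline k s \<partial>lborel)" .
  have "integrable lborel (\<lambda>s. g (x + \<eta> * s))" using lborel_integrable_real_affine[OF g, of \<eta> x] \<eta> by simp
  then have "integrable lborel (\<lambda>s. (1 / \<eta> ^ (k - 1)) * g (x + \<eta> * s))" by simp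
  then show "integrable lborel (\<lambda>s. f (x + \<eta> * s) * bspline k s)" using \<eta> by (simp add: gx)
qed

text \<open>Differences commute with repeated integration. In the integral over z, the part z < 1
  meets the full power \<open>(x - z) ^ (k - 1)\<close> for every \<open>x \<ge> 1\<close> and
  yields the polynomial Q; the part from 1 to x only contains
  \<open>fdiff k \<eta> f z\<close>.\<close>

lemma fdiff_kfold_remainder:
  assumes k: "k \<ge> 1" and f: "integrable lborel f" and supp: "\<And>z. f z \<noteq> 0 \<Longrightarrow> \<bar>z\<bar> \<le> B" and \<eta>: "\<eta> > 0"
    and low: "\<And>z. z < 1 \<Longrightarrow> f z = 0"
  shows "\<exists>Q. degree Q < k \<and> (\<forall>x\<ge>1. ennreal \<bar>fdiff k \<eta> (kfold k f) x - poly Q x\<bar> \<le>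
      ennreal (x ^ (k - 1)) * (\<integral>\<^sup>+z. ennreal \<bar>fdiff k \<eta> f z\<bar> * indicator {1..x} z \<partial>lborel))"
proof -
  have [measurable]: "f \<in> borel_measurable borel" using borel_measurable_integrable[OF f] by simp
  define fj where "fj j z = f (z + real j * \<eta>)" for j z
  have fjm[measurable]: "fj j \<in> borel_measurable borel" for j unfolding fj_def[abs_def] by measurable
  have fj: "integrable lborel (fj j)" for j
    using lborel_integrable_real_affine[OF f, of 1 "real j * \<eta>"] by (simp add: fj_def[abs_def] add.commute)
  have fjs: "\<bar>z\<bar> \<le> B + real k * \<eta>" if "fj j z \<noteq> 0" "j \<le> k" for j z
  proof -
    have "\<bar>z + real j * \<eta>\<bar> \<le> B" using that supp by (auto simp: fj_def)
    moreover have "real j * \<eta> \<le> real k * \<eta>" "0 \<le> real j * \<eta>" using that \<eta> by (auto intro: mult_right_mono)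
    ultimately show ?thesis by linarith
  qed
  have kf: "kfold k f (x + real j * \<eta>) = (\<integral>z. fj j z * tpow (k - 1) (x - z) \<partial>lborel) / fact (k - 1)" for x j
    unfolding kfold_def fj_def
    by (subst lborel_integral_real_affine[where c=1 and t="real j * \<eta>"]) (auto simp: add.commute algebra_simps)
  \<comment> \<open>The shifted copies are cut at 1 separately for each j, since every copy
    contributes its own polynomial to Q.\<close>
  define lo where "lo j z = fj j z * indicator {..<1} z" for j z
  define hi where "hi j z = fj j z * indicator {1..} z" for j z
  have lo: "integrable lborel (lo j)" for j unfolding lo_def[abs_def]
    by (rule integrable_mult_bounded_on_support[OF fj, where B=1]) (auto split: split_indicator)
  have hi: "integrable lborel (hi j)" for j unfolding hi_def[abs_def]
    by (rule integrable_mult_bounded_on_support[OF fj, where B=1]) (auto split: split_indicator)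
  have los: "\<bar>z\<bar> \<le> B + real k * \<eta>" if "lo j z \<noteq> 0" "j \<le> k" for j z using fjs that by (auto simp: lo_def)
  have his: "\<bar>z\<bar> \<le> B + real k * \<eta>" if "hi j z \<noteq> 0" "j \<le> k" for j z using fjs that by (auto simp: hi_def)
  have "\<exists>Q. degree Q \<le> k - 1 \<and> (\<forall>x. (\<integral>z. lo j z * (x - z) ^ (k - 1) \<partial>lborel) = poly Q x)" if "j \<le> k" for j
    by (rule moment_polynomial[OF lo, where B="B + real k * \<eta>"]) (use los that in blast)
  then have "\<forall>j\<in>{..k}. \<exists>Q. degree Q \<le> k - 1 \<and> (\<forall>x. (\<integral>z. lo j z * (x - z) ^ (k - 1) \<partial>lborel) = poly Q x)" by blast
  from bchoice[OF this] obtain q where q: "\<And>j. j \<le> k \<Longrightarrow> degree (q j) \<le> k - 1" "\<And>j x. j \<le> k \<Longrightarrow> (\<integral>z. lo j z * (x - z) ^ (k - 1) \<partial>lborel) = poly (q j) x"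
    by auto
  define Q where "Q = smult (1 / fact (k - 1)) (\<Sum>j\<le>k. smult ((-1) ^ (k - j) * real (k choose j)) (q j))"
  have "degree Q \<le> k - 1" unfolding Q_def
  proof (rule order_trans[OF degree_smult_le], rule degree_sum_le)
    fix p assume "p \<in> {..k}"
    then show "degree (smult ((-1) ^ (k - p) * real (k choose p)) (q p)) \<le> k - 1"
      by (intro order_trans[OF degree_smult_le q(1)]) simp
  qed simp
  then have "degree Q < k" using k by simp
  moreover have "ennreal \<bar>fdiff k \<eta> (kfold k f) x - poly Q x\<bar> \<le>
      ennreal (x ^ (k - 1)) * (\<integral>\<^sup>+z. ennreal \<bar>fdiff k \<eta> f z\<bar> * indicator {1..x} z \<partial>lborel)" if x: "x \<ge> 1" for x
  proof -
    have split: "(\<integral>z. fj j z * tpow (k - 1) (x - z) \<partial>lborel) = poly (q j) x + (\<integral>z. hi j z * tpow (k - 1) (x - z) \<partial>lborel)" if j: "j \<le> k" for j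
    proof -
      have "(\<integral>z. fj j z * tpow (k - 1) (x - z) \<partial>lborel) = (\<integral>z. lo j z * tpow (k - 1) (x - z) + hi j z * tpow (k - 1) (x - z) \<partial>lborel)"
        by (intro Bochner_Integration.integral_cong) (auto simp: lo_def hi_def split: split_indicator)
      also have "\<dots> = (\<integral>z. lo j z * tpow (k - 1) (x - z) \<partial>lborel) + (\<integral>z. hi j z * tpow (k - 1) (x - z) \<partial>lborel)"
        using kfold_integrable[OF lo los[OF _ j]] kfold_integrable[OF hi his[OF _ j]] by (intro Bochner_Integration.integral_add) blast+
      also have "(\<integral>z. lo j z * tpow (k - 1) (x - z) \<partial>lborel) = (\<integral>z. lo j z * (x - z) ^ (k - 1) \<partial>lborel)"
        using x by (intro Bochner_Integration.integral_cong) (auto simp: lo_def tpow_def split: split_indicator)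
      finally show ?thesis using q(2)[OF j] by simp
    qed
    define R where "R z = (\<Sum>j\<le>k. (-1) ^ (k - j) * real (k choose j) * (hi j z * tpow (k - 1) (x - z))) / fact (k - 1)" for z
    have "integrable lborel (\<lambda>z. hi j z * tpow (k - 1) (x - z))" if "j \<le> k" for j
      using kfold_integrable[OF hi his[OF _ that]] by blast
    then have hint: "integrable lborel (\<lambda>z. (-1) ^ (k - j) * real (k choose j) * (hi j z * tpow (k - 1) (x - z)))" if "j \<in> {..k}" for j
      using that by simp
    have Rint: "integrable lborel R" unfolding R_def[abs_def]
      by (intro integrable_divide_zero Bochner_Integration.integrable_sum hint)
    have "fdiff k \<eta> (kfold k f) x = (\<Sum>j\<le>k. (-1) ^ (k - j) * real (k choose j) * ((poly (q j) x + (\<integral>z. hi j z * tpow (k - 1) (x - z) \<partial>lborel)) / fact (k - 1)))"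
      unfolding fdiff_def kf by (rule sum.cong[OF refl]) (simp only: atMost_iff split)
    also have "\<dots> = poly Q x + (\<Sum>j\<le>k. (-1) ^ (k - j) * real (k choose j) * (\<integral>z. hi j z * tpow (k - 1) (x - z) \<partial>lborel)) / fact (k - 1)"
      unfolding Q_def by (simp add: poly_sum sum_divide_distrib sum.distrib[symmetric] add_divide_distrib distrib_left)
    also have "(\<Sum>j\<le>k. (-1) ^ (k - j) * real (k choose j) * (\<integral>z. hi j z * tpow (k - 1) (x - z) \<partial>lborel)) / fact (k - 1) = (\<integral>z. R z \<partial>lborel)"
      unfolding R_def using hint by (subst integral_divide_zero, subst Bochner_Integration.integral_sum) auto
    finally have "\<bar>fdiff k \<eta> (kfold k f) x - poly Q x\<bar> = norm (\<integral>z. R z \<partial>lborel)" by simp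
    then have "ennreal \<bar>fdiff k \<eta> (kfold k f) x - poly Q x\<bar> \<le> (\<integral>\<^sup>+z. ennreal (norm (R z)) \<partial>lborel)"
      using integral_norm_bound_ennreal[OF Rint] by simp
    also have "\<dots> \<le> (\<integral>\<^sup>+z. ennreal (x ^ (k - 1)) * (ennreal \<bar>fdiff k \<eta> f z\<bar> * indicator {1..x} z) \<partial>lborel)"
    proof (rule nn_integral_mono)
      fix z
      have Rz: "R z = fdiff k \<eta> f z * indicator {1..} z * tpow (k - 1) (x - z) / fact (k - 1)"
        unfolding R_def hi_def fj_def fdiff_def by (cases "z \<ge> 1") (simp_all add: sum_distrib_left sum_distrib_right mult_ac)
      show "ennreal (norm (R z)) \<le> ennreal (x ^ (k - 1)) * (ennreal \<bar>fdiff k \<eta> f z\<bar> * indicator {1..x} z)"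
      proof (cases "z \<in> {1..x}")
        case True
        have t: "tpow (k - 1) (x - z) \<le> x ^ (k - 1)" using True by (intro tpow_bounds) auto
        have "\<bar>R z\<bar> = \<bar>fdiff k \<eta> f z\<bar> * tpow (k - 1) (x - z) / fact (k - 1)" using True tpow_bounds(1) by (simp add: Rz abs_mult)
        also have "\<dots> \<le> \<bar>fdiff k \<eta> f z\<bar> * tpow (k - 1) (x - z) / 1" using tpow_bounds(1) by (intro divide_left_mono) auto
        also have "\<dots> \<le> \<bar>fdiff k \<eta> f z\<bar> * x ^ (k - 1)" using t by (auto intro: mult_left_mono)
        finally have "ennreal (norm (R z)) \<le> ennreal (x ^ (k - 1) * \<bar>fdiff k \<eta> f z\<bar>)" by (intro ennreal_leI) (simp add: mult.commute)
        then show ?thesis using True x by (simp add: ennreal_mult)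
      next
        case False
        then have "R z = 0" by (cases "z < 1") (auto simp: Rz tpow_def)
        then show ?thesis by simp
      qed
    qed
    also have "\<dots> = ennreal (x ^ (k - 1)) * (\<integral>\<^sup>+z. ennreal \<bar>fdiff k \<eta> f z\<bar> * indicator {1..x} z \<partial>lborel)"
      by (intro nn_integral_cmult) (simp add: fdiff_def)
    finally show ?thesis .
  qed
  ultimately show ?thesis by blast
qed

section \<open>Polynomial approximation at unit scale\<close>

text \<open>The interval from 1 to 4 contains all steps \<open>H + H / k * s\<close> with H between
  1 and 2 and s in the support of the B-spline.\<close>

abbreviation near_integral :: "(real \<Rightarrow> real \<Rightarrow> real) \<Rightarrow> real \<Rightarrow> ennreal" where
  "near_integral G y \<equiv> \<integral>\<^sup>+u. ennreal (G u y) * indicator {1..4} u \<partial>lborel"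

text \<open>The rectangle contains the steps \<open>i * H / k\<close> and the base points from 1 up
  to \<open>y + i * H\<close>, for y at most 1, H at most 2 and i from 1 to k.\<close>

abbreviation strip_integral :: "nat \<Rightarrow> (real \<Rightarrow> real \<Rightarrow> real) \<Rightarrow> ennreal" where
  "strip_integral k G \<equiv> \<integral>\<^sup>+\<eta>. (\<integral>\<^sup>+z. ennreal (G \<eta> z) * indicator {1..1 + 2 * real k} z \<partial>lborel) * indicator {1 / real k..2} \<eta> \<partial>lborel"

lemma fdiff_measurable [measurable]:
  assumes [measurable]: "f \<in> borel_measurable borel" "g \<in> borel_measurable M" "h \<in> borel_measurable M"
  shows "(\<lambda>x. fdiff k (g x) f (h x)) \<in> borel_measurable M"
  unfolding fdiff_def by measurable

text \<open>With the step \<open>H + H / k * s\<close> the i-th node is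
  \<open>y + i * H + \<eta> i * s\<close>, where \<open>\<eta> i = i * H / k\<close>. Integration
  over s against the B-spline leaves a multiple of \<open>f y\<close> for i = 0, because the spline
  has integral 1, and turns every other term into a k-th difference of the repeated integral at
  \<open>y + i * H\<close>. By \<open>fdiff_kfold_remainder\<close> these differences are
  polynomials in y up to differences of f.\<close>

lemma local_approximation_step:
  fixes f :: "real \<Rightarrow> real"
  assumes k: "k \<ge> 1" and f[measurable]: "f \<in> borel_measurable borel"
    and fin: "(\<integral>\<^sup>+z. ennreal \<bar>f z\<bar> * indicator {1..1 + 4 * real k} z \<partial>lborel) < \<infinity>"
    and H: "H \<in> {1..2}"
  shows "\<exists>Q. degree Q < k \<and> (\<forall>y\<in>{0..1}. ennreal \<bar>f y - poly Q y\<bar> \<le>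
     ennreal (real k * (real (k + 1) * 2 ^ k * real k ^ (k - 1))) * near_integral (\<lambda>u y. \<bar>fdiff k u f y\<bar>) y +
     ennreal (2 ^ k * real k ^ k * (1 + 2 * real k) ^ (k - 1)) *
       (\<Sum>i=1..k. \<integral>\<^sup>+z. ennreal \<bar>fdiff k (real i * H / real k) f z\<bar> * indicator {1..1 + 2 * real k} z \<partial>lborel))"
proof -
  define N where "N = 1 + 4 * real k"
  \<comment> \<open>The truncation makes f integrable. It is harmless for the nodes with i at least
    1: they are at least \<open>y + H \<ge> 1\<close> and at most
    \<open>y + 4 * k \<le> N\<close>.\<close>
  define f0 where "f0 z = f z * indicator {1..N} z" for z
  have [measurable]: "f0 \<in> borel_measurable borel" unfolding f0_def[abs_def] by measurable
  have f0: "integrable lborel f0"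
  proof (rule integrableI_bounded)
    have "(\<integral>\<^sup>+z. ennreal (norm (f0 z)) \<partial>lborel) = (\<integral>\<^sup>+z. ennreal \<bar>f z\<bar> * indicator {1..1 + 4 * real k} z \<partial>lborel)"
      by (intro nn_integral_cong) (auto simp: f0_def N_def split: split_indicator)
    then show "(\<integral>\<^sup>+z. ennreal (norm (f0 z)) \<partial>lborel) < \<infinity>" using fin by simp
  qed measurable
  have supp: "\<bar>z\<bar> \<le> N" if "f0 z \<noteq> 0" for z using that by (auto simp: f0_def split: split_indicator_asm)
  have low: "f0 z = 0" if "z < 1" for z using that by (auto simp: f0_def)
  have f0f: "f0 z = f z" if "1 \<le> z" "z \<le> N" for z using that by (auto simp: f0_def)
  define \<eta> where "\<eta> i = real i * H / real k" for i :: nat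
  have k0: "real k \<ge> 1" using k by simp
  have \<eta>: "\<eta> i > 0" "1 / real k \<le> \<eta> i" "real k * \<eta> i \<le> 2 * real k" "real k * \<eta> i = real i * H" if "i \<in> {1..k}" for i
  proof -
    have i: "1 \<le> real i" "real i \<le> real k" using that by auto
    have iH: "1 * 1 \<le> real i * H" using i H by (intro mult_mono) auto
    have "real i * H \<le> real k * 2" using i H by (intro mult_mono) auto
    then show "\<eta> i > 0" "1 / real k \<le> \<eta> i" "real k * \<eta> i \<le> 2 * real k" "real k * \<eta> i = real i * H"
      using iH k0 unfolding \<eta>_def by (auto intro!: divide_right_mono)
  qed
  have "\<forall>i\<in>{1..k}. \<exists>Q. degree Q < k \<and> (\<forall>x\<ge>1. ennreal \<bar>fdiff k (\<eta> i) (kfold k f0) x - poly Q x\<bar> \<le>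
      ennreal (x ^ (k - 1)) * (\<integral>\<^sup>+z. ennreal \<bar>fdiff k (\<eta> i) f0 z\<bar> * indicator {1..x} z \<partial>lborel))"
    using fdiff_kfold_remainder[OF k f0 supp _ low] \<eta>(1) by blast
  from bchoice[OF this] obtain q where q1: "\<And>i. i \<in> {1..k} \<Longrightarrow> degree (q i) < k"
    and q2: "\<And>i x. i \<in> {1..k} \<Longrightarrow> 1 \<le> x \<Longrightarrow> ennreal \<bar>fdiff k (\<eta> i) (kfold k f0) x - poly (q i) x\<bar> \<le>
      ennreal (x ^ (k - 1)) * (\<integral>\<^sup>+z. ennreal \<bar>fdiff k (\<eta> i) f0 z\<bar> * indicator {1..x} z \<partial>lborel)" by blast
  define c where "c i = (-1) ^ (k - i) * real (k choose i)" for i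
  have c2: "\<bar>c i\<bar> \<le> 2 ^ k" for i
  proof -
    have "real (k choose i) \<le> 2 ^ k" by (metis binomial_le_pow2 numeral_power_eq_of_nat_cancel_iff of_nat_le_iff of_nat_numeral of_nat_power)
    then show ?thesis by (simp add: c_def abs_mult power_abs)
  qed
  have c0: "c 0 = (-1) ^ k" by (simp add: c_def)
  have sgn: "(-1) ^ k * (-1) ^ k = (1::real)" by (simp flip: power_mult_distrib)
  \<comment> \<open>The outer sign comes from solving for \<open>f y\<close>, whose coefficient is
    \<open>c 0 = (-1) ^ k\<close>; composition with \<open>[:i * H, 1:]\<close> moves the argument
    from \<open>y + i * H\<close> back to y.\<close>
  define Q where "Q = smult (- ((-1) ^ k)) (\<Sum>i\<in>{1..k}. smult (c i / \<eta> i ^ k) (pcompose (q i) [:real i * H, 1:]))"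
  have "degree Q \<le> k - 1" unfolding Q_def
  proof (rule order_trans[OF degree_smult_le], rule degree_sum_le)
    fix p assume "p \<in> {1..k}"
    then have "degree (pcompose (q p) [:real p * H, 1:]) \<le> k - 1" using q1[of p] by (simp add: degree_pcompose)
    then show "degree (smult (c p / \<eta> p ^ k) (pcompose (q p) [:real p * H, 1:])) \<le> k - 1"
      by (rule order_trans[OF degree_smult_le])
  qed simp
  then have dQ: "degree Q < k" using k by simp
  define B where "B = real (k + 1) * 2 ^ k * real k ^ (k - 1)"
  have B: "B \<ge> 0" by (simp add: B_def)
  have main: "ennreal \<bar>f y - poly Q y\<bar> \<le>
     ennreal (real k * B) * near_integral (\<lambda>u y. \<bar>fdiff k u f y\<bar>) y +
     ennreal (2 ^ k * real k ^ k * (1 + 2 * real k) ^ (k - 1)) *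
       (\<Sum>i=1..k. \<integral>\<^sup>+z. ennreal \<bar>fdiff k (\<eta> i) f z\<bar> * indicator {1..1 + 2 * real k} z \<partial>lborel)" if y: "y \<in> {0..1}" for y
  proof -
    define A where "A i = (\<integral>s. f0 (y + real i * H + \<eta> i * s) * bspline k s \<partial>lborel)" for i
    have A: "fdiff k (\<eta> i) (kfold k f0) (y + real i * H) = \<eta> i ^ k * A i"
      and Aint: "integrable lborel (\<lambda>s. f0 (y + real i * H + \<eta> i * s) * bspline k s)" if "i \<in> {1..k}" for i
      unfolding A_def using fdiff_kfold_bspline[OF k f0 supp \<eta>(1)[OF that]] by auto
    \<comment> \<open>Letting the step grow linearly in s gives every node with i at least 1 a
      spread proportional to \<open>\<eta> i\<close>, while the node y stays fixed.\<close>
    define g where "g s = fdiff k (H + H / real k * s) f y * bspline k s" for s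
    have gs: "g s = c 0 * f y * bspline k s + (\<Sum>i\<in>{1..k}. c i * (f0 (y + real i * H + \<eta> i * s) * bspline k s))" for s
    proof (cases "s \<in> {0..real k}")
      case False
      then show ?thesis using bspline_support[OF k False] by (simp add: g_def)
    next
      case True
      have arg: "y + real i * (H + H / real k * s) = y + real i * H + \<eta> i * s" for i
        by (simp add: \<eta>_def algebra_simps)
      have eq: "f0 (y + real i * H + \<eta> i * s) = f (y + real i * (H + H / real k * s))" if i: "i \<in> {1..k}" for i
      proof -
        have "1 * 1 \<le> real i * H" using i H by (intro mult_mono) auto
        moreover have "0 \<le> \<eta> i * s" using \<eta>(1)[OF i] True by simp
        ultimately have 1: "1 \<le> y + real i * H + \<eta> i * s" using y by auto
        have "\<eta> i * s \<le> \<eta> i * real k" using \<eta>(1)[OF i] True by (intro mult_left_mono) auto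
        then have "y + real i * H + \<eta> i * s \<le> N" using y \<eta>(3,4)[OF i] by (auto simp: N_def mult.commute)
        then show ?thesis unfolding arg using 1 by (intro f0f)
      qed
      have "fdiff k (H + H / real k * s) f y = c 0 * f y + (\<Sum>i\<in>{1..k}. c i * f (y + real i * (H + H / real k * s)))"
        unfolding fdiff_def c_def by (simp add: atMost_atLeast0 sum.atLeast_Suc_atMost)
      then show ?thesis unfolding g_def using eq by (simp add: distrib_right sum_distrib_right mult.assoc)
    qed
    have gint: "integrable lborel g" and gval: "(\<integral>s. g s \<partial>lborel) = c 0 * f y + (\<Sum>i\<in>{1..k}. c i * A i)"
    proof -
      have *: "integrable lborel (\<lambda>s. c 0 * f y * bspline k s)" using bspline_integral(1)[OF k] by simp
      have **: "integrable lborel (\<lambda>s. \<Sum>i\<in>{1..k}. c i * (f0 (y + real i * H + \<eta> i * s) * bspline k s))"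
        by (intro Bochner_Integration.integrable_sum integrable_mult_right Aint)
      show "integrable lborel g" unfolding gs[abs_def] using * ** by (rule Bochner_Integration.integrable_add)
      show "(\<integral>s. g s \<partial>lborel) = c 0 * f y + (\<Sum>i\<in>{1..k}. c i * A i)"
        unfolding gs Bochner_Integration.integral_add[OF * **] A_def
        using bspline_integral(2)[OF k] Aint by (simp add: Bochner_Integration.integral_sum)
    qed
    have "poly Q y = - ((-1) ^ k) * (\<Sum>i\<in>{1..k}. c i / \<eta> i ^ k * poly (q i) (y + real i * H))"
      unfolding Q_def by (simp add: poly_sum poly_pcompose add.commute)
    then have "(-1) ^ k * (f y - poly Q y) = (-1) ^ k * f y + ((-1) ^ k * (-1) ^ k) * (\<Sum>i\<in>{1..k}. c i / \<eta> i ^ k * poly (q i) (y + real i * H))"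
      by (simp add: algebra_simps)
    also have "\<dots> = (\<integral>s. g s \<partial>lborel) - (\<Sum>i\<in>{1..k}. c i / \<eta> i ^ k * (fdiff k (\<eta> i) (kfold k f0) (y + real i * H) - poly (q i) (y + real i * H)))"
    proof -
      have "c i / \<eta> i ^ k * (fdiff k (\<eta> i) (kfold k f0) (y + real i * H) - poly (q i) (y + real i * H)) = c i * A i - c i / \<eta> i ^ k * poly (q i) (y + real i * H)" if "i \<in> {1..k}" for i
        using \<eta>(1)[OF that] by (simp add: A[OF that] right_diff_distrib)
      then have "(\<Sum>i\<in>{1..k}. c i / \<eta> i ^ k * (fdiff k (\<eta> i) (kfold k f0) (y + real i * H) - poly (q i) (y + real i * H))) =
         (\<Sum>i\<in>{1..k}. c i * A i) - (\<Sum>i\<in>{1..k}. c i / \<eta> i ^ k * poly (q i) (y + real i * H))"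
        by (simp add: sum_subtractf)
      then show ?thesis unfolding gval c0 sgn by simp
    qed
    finally have eq: "(-1) ^ k * (f y - poly Q y) = \<dots>" .
    have "\<bar>f y - poly Q y\<bar> = \<bar>(-1) ^ k * (f y - poly Q y)\<bar>" by (simp add: abs_mult power_abs)
    also have "\<dots> \<le> \<bar>\<integral>s. g s \<partial>lborel\<bar> + (\<Sum>i\<in>{1..k}. \<bar>c i / \<eta> i ^ k * (fdiff k (\<eta> i) (kfold k f0) (y + real i * H) - poly (q i) (y + real i * H))\<bar>)"
      unfolding eq by (rule order_trans[OF abs_triangle_ineq4 add_left_mono[OF sum_abs]])
    also have "\<dots> \<le> \<bar>\<integral>s. g s \<partial>lborel\<bar> + (\<Sum>i\<in>{1..k}. 2 ^ k * real k ^ k * \<bar>fdiff k (\<eta> i) (kfold k f0) (y + real i * H) - poly (q i) (y + real i * H)\<bar>)"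
    proof (intro add_left_mono sum_mono)
      fix i assume i: "i \<in> {1..k}"
      \<comment> \<open>The factor \<open>k ^ k\<close> of the constant stems from
        \<open>\<eta> i \<ge> 1 / k\<close>.\<close>
      have "(1 / real k) ^ k \<le> \<eta> i ^ k" using \<eta>(2)[OF i] k0 by (intro power_mono) auto
      then have "1 / \<eta> i ^ k \<le> real k ^ k" using \<eta>(1)[OF i] k0 by (simp add: field_simps)
      then have "\<bar>c i\<bar> * (1 / \<eta> i ^ k) \<le> 2 ^ k * real k ^ k" using c2 \<eta>(1)[OF i] by (intro mult_mono) auto
      then have "\<bar>c i / \<eta> i ^ k\<bar> \<le> 2 ^ k * real k ^ k" using \<eta>(1)[OF i] by simp
      then show "\<bar>c i / \<eta> i ^ k * (fdiff k (\<eta> i) (kfold k f0) (y + real i * H) - poly (q i) (y + real i * H))\<bar> \<le> 2 ^ k * real k ^ k * \<bar>fdiff k (\<eta> i) (kfold k f0) (y + real i * H) - poly (q i) (y + real i * H)\<bar>"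
        unfolding abs_mult[of "c i / \<eta> i ^ k"] by (rule mult_right_mono) simp
    qed
    finally have "ennreal \<bar>f y - poly Q y\<bar> \<le> ennreal (norm (\<integral>s. g s \<partial>lborel)) + (\<Sum>i\<in>{1..k}. ennreal (2 ^ k * real k ^ k) * ennreal \<bar>fdiff k (\<eta> i) (kfold k f0) (y + real i * H) - poly (q i) (y + real i * H)\<bar>)"
      by (simp add: ennreal_mult[symmetric] sum_ennreal sum_nonneg ennreal_plus[symmetric] ennreal_leI del: ennreal_plus)
    also have "\<dots> \<le> ennreal (real k * B) * near_integral (\<lambda>u y. \<bar>fdiff k u f y\<bar>) y +
      (\<Sum>i\<in>{1..k}. ennreal (2 ^ k * real k ^ k) * (ennreal ((1 + 2 * real k) ^ (k - 1)) * (\<integral>\<^sup>+z. ennreal \<bar>fdiff k (\<eta> i) f z\<bar> * indicator {1..1 + 2 * real k} z \<partial>lborel)))"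
    proof (intro add_mono sum_mono mult_left_mono)
      have "ennreal (norm (\<integral>s. g s \<partial>lborel)) \<le> (\<integral>\<^sup>+s. ennreal (norm (g s)) \<partial>lborel)" by (rule integral_norm_bound_ennreal[OF gint])
      also have "\<dots> \<le> (\<integral>\<^sup>+s. ennreal B * (ennreal \<bar>fdiff k (H + H / real k * s) f y\<bar> * indicator {1..4} (H + H / real k * s)) \<partial>lborel)"
      proof (rule nn_integral_mono)
        fix s
        show "ennreal (norm (g s)) \<le> ennreal B * (ennreal \<bar>fdiff k (H + H / real k * s) f y\<bar> * indicator {1..4} (H + H / real k * s))"
        proof (cases "s \<in> {0..real k}")
          case True
          have "0 \<le> H / real k * s" using H True by auto
          moreover have "H / real k * s \<le> H / real k * real k" using H True by (intro mult_left_mono) auto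
          ultimately have "H + H / real k * s \<in> {1..4}" using H k0 by auto
          moreover have "\<bar>g s\<bar> \<le> B * \<bar>fdiff k (H + H / real k * s) f y\<bar>"
            using mult_left_mono[OF bspline_bound[OF k, of s], of "\<bar>fdiff k (H + H / real k * s) f y\<bar>"] by (simp add: g_def B_def abs_mult mult.commute)
          ultimately show ?thesis using B by (simp add: ennreal_mult[symmetric] ennreal_leI)
        qed (use bspline_support[OF k] in \<open>simp add: g_def\<close>)
      qed
      also have "\<dots> = ennreal B * (\<integral>\<^sup>+s. (ennreal \<bar>fdiff k (H + H / real k * s) f y\<bar> * indicator {1..4} (H + H / real k * s)) \<partial>lborel)"
        by (intro nn_integral_cmult) measurable
      also have "\<dots> \<le> ennreal B * (ennreal (real k) * near_integral (\<lambda>u y. \<bar>fdiff k u f y\<bar>) y)"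
      proof (intro mult_left_mono)
        let ?I = "\<integral>\<^sup>+s. (ennreal \<bar>fdiff k (H + H / real k * s) f y\<bar> * indicator {1..4} (H + H / real k * s)) \<partial>lborel"
        have Hk: "H / real k > 0" using H k0 by auto
        have *: "near_integral (\<lambda>u y. \<bar>fdiff k u f y\<bar>) y = ennreal (H / real k) * ?I"
          using Hk H k by (subst nn_integral_real_affine[where c="H / real k" and t=H]) auto
        have "?I = ennreal 1 * ?I" by simp
        also have "\<dots> \<le> ennreal (real k * (H / real k)) * ?I" using H k0 by (intro mult_right_mono ennreal_leI) auto
        also have "\<dots> = ennreal (real k) * (ennreal (H / real k) * ?I)" using Hk
          by (subst ennreal_mult) (auto simp only: mult.assoc of_nat_0_le_iff less_imp_le)
        finally show "?I \<le> ennreal (real k) * near_integral (\<lambda>u y. \<bar>fdiff k u f y\<bar>) y" unfolding * .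
      qed simp
      also have "\<dots> = ennreal (real k * B) * near_integral (\<lambda>u y. \<bar>fdiff k u f y\<bar>) y"
        using B by (simp add: ennreal_mult mult_ac)
      finally show "ennreal (norm (\<integral>s. g s \<partial>lborel)) \<le> ennreal (real k * B) * near_integral (\<lambda>u y. \<bar>fdiff k u f y\<bar>) y" .
    next
      fix i assume i: "i \<in> {1..k}"
      define x where "x = y + real i * H"
      have "1 * 1 \<le> real i * H" using i H by (intro mult_mono) auto
      then have x: "1 \<le> x" "x \<le> 1 + 2 * real k" using y \<eta>(3,4)[OF i] by (auto simp: x_def)
      have "ennreal \<bar>fdiff k (\<eta> i) (kfold k f0) x - poly (q i) x\<bar> \<le>
         ennreal (x ^ (k - 1)) * (\<integral>\<^sup>+z. ennreal \<bar>fdiff k (\<eta> i) f0 z\<bar> * indicator {1..x} z \<partial>lborel)" by (rule q2[OF i x(1)])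
      also have "\<dots> \<le> ennreal ((1 + 2 * real k) ^ (k - 1)) * (\<integral>\<^sup>+z. ennreal \<bar>fdiff k (\<eta> i) f z\<bar> * indicator {1..1 + 2 * real k} z \<partial>lborel)"
      proof (rule mult_mono[OF ennreal_leI nn_integral_mono])
        show "x ^ (k - 1) \<le> (1 + 2 * real k) ^ (k - 1)" using x by (intro power_mono) auto
        fix z
        show "ennreal \<bar>fdiff k (\<eta> i) f0 z\<bar> * indicator {1..x} z \<le> ennreal \<bar>fdiff k (\<eta> i) f z\<bar> * indicator {1..1 + 2 * real k} z"
        proof (cases "z \<in> {1..x}")
          case True
          have "fdiff k (\<eta> i) f0 z = fdiff k (\<eta> i) f z"
            unfolding fdiff_def
          proof (intro sum.cong refl arg_cong2[where f="(*)"] f0f)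
            fix j assume "j \<in> {..k}"
            then have "real j * \<eta> i \<le> real k * \<eta> i" "0 \<le> real j * \<eta> i" using \<eta>(1)[OF i] by (auto intro: mult_right_mono)
            then show "1 \<le> z + real j * \<eta> i" "z + real j * \<eta> i \<le> N" using True x \<eta>(3)[OF i] by (auto simp: N_def)
          qed
          then show ?thesis using True x by simp
        qed simp
      qed auto
      finally show "ennreal \<bar>fdiff k (\<eta> i) (kfold k f0) (y + real i * H) - poly (q i) (y + real i * H)\<bar> \<le>
        ennreal ((1 + 2 * real k) ^ (k - 1)) * (\<integral>\<^sup>+z. ennreal \<bar>fdiff k (\<eta> i) f z\<bar> * indicator {1..1 + 2 * real k} z \<partial>lborel)" unfolding x_def .
    qed simp
    also have "(\<Sum>i\<in>{1..k}. ennreal (2 ^ k * real k ^ k) * (ennreal ((1 + 2 * real k) ^ (k - 1)) * (\<integral>\<^sup>+z. ennreal \<bar>fdiff k (\<eta> i) f z\<bar> * indicator {1..1 + 2 * real k} z \<partial>lborel)))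
       = ennreal (2 ^ k * real k ^ k * (1 + 2 * real k) ^ (k - 1)) * (\<Sum>i\<in>{1..k}. \<integral>\<^sup>+z. ennreal \<bar>fdiff k (\<eta> i) f z\<bar> * indicator {1..1 + 2 * real k} z \<partial>lborel)"
      by (simp add: sum_distrib_left ennreal_mult mult.assoc)
    finally show ?thesis .
  qed
  show ?thesis using dQ main unfolding B_def \<eta>_def by blast
qed

text \<open>The step length \<open>H\<close> is chosen by an \<open>L\<^sub>1\<close>-average, so that the polynomial does not depend
  on the exponent \<open>p\<close>.\<close>
theorem local_approximation:
  fixes f :: "real \<Rightarrow> real"
  assumes k: "k \<ge> 1" and f[measurable]: "f \<in> borel_measurable borel"
    and fin: "(\<integral>\<^sup>+z. ennreal \<bar>f z\<bar> * indicator {1..1 + 4 * real k} z \<partial>lborel) < \<infinity>"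
  shows "\<exists>Q. degree Q < k \<and> (\<forall>y\<in>{0..1}. ennreal \<bar>f y - poly Q y\<bar> \<le>
     ennreal (real k * (real (k + 1) * 2 ^ k * real k ^ (k - 1))) * near_integral (\<lambda>u y. \<bar>fdiff k u f y\<bar>) y +
     ennreal (2 ^ k * real k ^ k * (1 + 2 * real k) ^ (k - 1) * real k ^ 2) *
       strip_integral k (\<lambda>\<eta> z. \<bar>fdiff k \<eta> f z\<bar>))"
proof -
  have k0: "real k \<ge> 1" using k by simp
  define J where "J \<eta> = (\<integral>\<^sup>+z. ennreal \<bar>fdiff k \<eta> f z\<bar> * indicator {1..1 + 2 * real k} z \<partial>lborel)" for \<eta>
  have J[measurable]: "J \<in> borel_measurable borel" unfolding J_def[abs_def] by measurable
  define X where "X H = (\<Sum>i=1..k. J (real i * H / real k))" for H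
  have X[measurable]: "X \<in> borel_measurable borel" unfolding X_def[abs_def] by measurable
  define T where "T = (\<integral>\<^sup>+\<eta>. J \<eta> * indicator {1 / real k..2} \<eta> \<partial>lborel)"
  \<comment> \<open>For fixed i the substitution \<open>\<eta> = i * H / k\<close> maps the range of
    H into the range of \<open>\<eta>\<close> with Jacobian i/k. Its inverse is at most k and there
    are k terms, whence \<open>k ^ 2\<close>.\<close>
  have avg: "(\<integral>\<^sup>+H. X H * indicator {1..2} H \<partial>lborel) \<le> ennreal (real k ^ 2) * T"
  proof -
    have "(\<integral>\<^sup>+H. X H * indicator {1..2} H \<partial>lborel) = (\<Sum>i=1..k. \<integral>\<^sup>+H. J (real i * H / real k) * indicator {1..2} H \<partial>lborel)"
      unfolding X_def sum_distrib_right by (intro nn_integral_sum) measurable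
    also have "\<dots> \<le> (\<Sum>i=1..k. ennreal (real k) * T)"
    proof (rule sum_mono)
      fix i assume i: "i \<in> {1..k}"
      then have i': "1 \<le> real i" "real i \<le> real k" by auto
      define a where "a = real i / real k"
      have a: "a > 0" "1 \<le> real k * a" "1 / real k \<le> a" "a \<le> 1" using i' k0 by (auto simp: a_def divide_right_mono)
      let ?I = "\<integral>\<^sup>+H. J (0 + a * H) * indicator {1 / real k..2} (0 + a * H) \<partial>lborel"
      have T: "T = ennreal a * ?I" unfolding T_def
        using a by (subst nn_integral_real_affine[where c=a and t=0]) auto
      have "(\<integral>\<^sup>+H. J (real i * H / real k) * indicator {1..2} H \<partial>lborel) \<le> ?I"
      proof (rule nn_integral_mono)
        fix H
        show "J (real i * H / real k) * indicator {1..2} H \<le> J (0 + a * H) * indicator {1 / real k..2} (0 + a * H)"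
        proof (cases "H \<in> {1..2}")
          case True
          have "a * 1 \<le> a * H" using True a by (intro mult_left_mono) auto
          moreover have "a * H \<le> 1 * 2" using True a by (intro mult_mono) auto
          moreover have "1 / real k \<le> a * H" using calculation(1) a by linarith
          ultimately have "a * H \<in> {1 / real k..2}" by simp
          moreover have "real i * H / real k = a * H" by (simp add: a_def)
          ultimately show ?thesis using True by simp
        qed simp
      qed
      also have "?I = ennreal 1 * ?I" by simp
      also have "\<dots> \<le> ennreal (real k * a) * ?I" using a by (intro mult_right_mono ennreal_leI) auto
      also have "\<dots> = ennreal (real k) * T" using a by (simp add: T ennreal_mult mult.assoc)
      finally show "(\<integral>\<^sup>+H. J (real i * H / real k) * indicator {1..2} H \<partial>lborel) \<le> ennreal (real k) * T" .
    qed
    also have "\<dots> = ennreal (real k ^ 2) * T" by (simp add: power2_eq_square ennreal_mult ennreal_of_nat_eq_real_of_nat mult.assoc)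
    finally show ?thesis .
  qed
  \<comment> \<open>The range of H has length 1, so some value of X does not exceed the bound for
    its integral.\<close>
  have "\<exists>H\<in>{1..2}. X H \<le> ennreal (real k ^ 2) * T"
  proof (cases "ennreal (real k ^ 2) * T = \<infinity>")
    case True then show ?thesis by (intro bexI[of _ 1]) auto
  next
    case False
    let ?c = "ennreal (real k ^ 2) * T"
    show ?thesis
    proof (rule ccontr)
      assume "\<not> ?thesis"
      then have gt: "?c < X H" if "H \<in> {1..2}" for H using that by (auto simp: not_le)
      have "(\<integral>\<^sup>+H. ?c * indicator {1..2::real} H \<partial>lborel) < (\<integral>\<^sup>+H. X H * indicator {1..2} H \<partial>lborel)"
      proof (rule nn_integral_less)
        show "(\<integral>\<^sup>+H. ?c * indicator {1..2::real} H \<partial>lborel) \<noteq> \<infinity>" using False by (simp add: nn_integral_cmult_indicator)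
        show "AE H in lborel. ?c * indicator {1..2::real} H \<le> X H * indicator {1..2} H"
          using gt by (intro AE_I2) (auto split: split_indicator intro: less_imp_le)
        show "\<not> (AE H in lborel. X H * indicator {1..2::real} H \<le> ?c * indicator {1..2} H)"
        proof
          assume "AE H in lborel. X H * indicator {1..2::real} H \<le> ?c * indicator {1..2} H"
          then have "AE H in lborel. H \<notin> {1..2::real}"
            by (rule AE_mp) (use gt in \<open>auto intro!: AE_I2 simp: not_le[symmetric] split: split_indicator_asm\<close>)
          then have "emeasure lborel {1..2::real} = 0" by (subst (asm) AE_iff_measurable[of "{1..2}"]) auto
          then show False by simp
        qed
      qed measurable
      then show False using avg by (simp add: nn_integral_cmult_indicator)
    qed
  qed
  then obtain H where H: "H \<in> {1..2}" "X H \<le> ennreal (real k ^ 2) * T" by blast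
  obtain Q where Q: "degree Q < k" "\<And>y. y \<in> {0..1} \<Longrightarrow> ennreal \<bar>f y - poly Q y\<bar> \<le>
     ennreal (real k * (real (k + 1) * 2 ^ k * real k ^ (k - 1))) * near_integral (\<lambda>u y. \<bar>fdiff k u f y\<bar>) y +
     ennreal (2 ^ k * real k ^ k * (1 + 2 * real k) ^ (k - 1)) * X H"
    using local_approximation_step[OF k f fin H(1)] unfolding X_def J_def by blast
  show ?thesis
  proof (intro exI[of _ Q] conjI ballI Q(1))
    fix y :: real assume y: "y \<in> {0..1}"
    note Q(2)[OF y]
    also have "ennreal (2 ^ k * real k ^ k * (1 + 2 * real k) ^ (k - 1)) * X H \<le> ennreal (2 ^ k * real k ^ k * (1 + 2 * real k) ^ (k - 1)) * (ennreal (real k ^ 2) * T)"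
      by (rule mult_left_mono[OF H(2)]) simp
    also have "\<dots> = ennreal (2 ^ k * real k ^ k * (1 + 2 * real k) ^ (k - 1) * real k ^ 2) * T" by (simp add: ennreal_mult mult.assoc)
    finally show "ennreal \<bar>f y - poly Q y\<bar> \<le>
     ennreal (real k * (real (k + 1) * 2 ^ k * real k ^ (k - 1))) * near_integral (\<lambda>u y. \<bar>fdiff k u f y\<bar>) y +
     ennreal (2 ^ k * real k ^ k * (1 + 2 * real k) ^ (k - 1) * real k ^ 2) *
       strip_integral k (\<lambda>\<eta> z. \<bar>fdiff k \<eta> f z\<bar>)"
      by (simp add: add_left_mono T_def J_def)
  qed
qed

section \<open>Approximation on one cell\<close>

text \<open>Membership in \<open>D_set\<close> is written out as inequalities and the value 0 is
  taken elsewhere, which makes the function jointly Borel in x and \<open>\<tau>\<close> and ready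
  for Fubini's theorem.\<close>

definition wdiff :: "nat \<Rightarrow> nat \<Rightarrow> (real \<Rightarrow> real) \<Rightarrow> real \<Rightarrow> real \<Rightarrow> real" where
  "wdiff k r F x \<tau> = (if \<bar>x\<bar> < 1 \<and> real k * \<tau> * \<phi> x / 2 \<le> 1 - \<bar>x\<bar>
     then \<bar>W (real k * \<tau>) x ^ r * sym_diff k (\<tau> * \<phi> x) F x\<bar> else 0)"

abbreviation diff_integral :: "(real \<Rightarrow> real) \<Rightarrow> nat \<Rightarrow> nat \<Rightarrow> (real \<Rightarrow> real) \<Rightarrow> real \<Rightarrow> real \<Rightarrow> ennreal" where
  "diff_integral \<theta> k r F t x \<equiv> \<integral>\<^sup>+\<tau>. ennreal (\<theta> (wdiff k r F x \<tau>)) * indicator {0<..t} \<tau> \<partial>lborel"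

text \<open>For finite p and \<open>\<theta>pow p\<close> this is the p-th power of the averaged
  modulus.\<close>

abbreviation diff_mean :: "(real \<Rightarrow> real) \<Rightarrow> nat \<Rightarrow> nat \<Rightarrow> (real \<Rightarrow> real) \<Rightarrow> real \<Rightarrow> ennreal" where
  "diff_mean \<theta> k r F t \<equiv> ennreal (1 / t) * (\<integral>\<^sup>+x. diff_integral \<theta> k r F t x * indicator {-1<..<1} x \<partial>lborel)"

lemma one_minus_square: "1 - x\<^sup>2 = (1 - x) * (1 + x)" for x :: real
  by (simp add: power2_eq_square algebra_simps)

lemma D_set_iff: "x \<in> D_set \<delta> \<longleftrightarrow> \<bar>x\<bar> < 1 \<and> \<delta> * \<phi> x / 2 \<le> 1 - \<bar>x\<bar>"
  by (auto simp: D_set_def abs_less_iff abs_le_iff)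

lemma wdiff_eq: "wdiff k r F x \<tau> = \<bar>W (real k * \<tau>) x ^ r * sym_diff k (\<tau> * \<phi> x) F x\<bar> * indicator (D_set (real k * \<tau>)) x"
  by (simp add: wdiff_def D_set_iff indicator_def)

lemma wdiff_nonneg: "0 \<le> wdiff k r F x \<tau>"
  by (simp add: wdiff_def)

lemma wdiff_measurable [measurable]:
  assumes [measurable]: "F \<in> borel_measurable borel" "g \<in> borel_measurable M" "h \<in> borel_measurable M"
  shows "(\<lambda>x. wdiff k r F (g x) (h x)) \<in> borel_measurable M"
  unfolding wdiff_def sym_diff_def W_def by measurable

text \<open>The cell parametrisation reverses orientation, so the nodes are traversed backwards and
  the sign \<open>(-1) ^ k\<close> appears; hence the absolute values.\<close>

lemma fdiff_eq_sym_diff: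
  assumes "x + real k * (l * u) / 2 \<in> {-1..1}" "x - real k * (l * u) / 2 \<in> {-1..1}" "x = a - l * (y + real k * u / 2)"
  shows "\<bar>fdiff k u (\<lambda>s. F (a - l * s)) y\<bar> = \<bar>sym_diff k (l * u) F x\<bar>"
proof -
  have "fdiff k u (\<lambda>s. F (a - l * s)) y = (\<Sum>i\<le>k. (-1) ^ (k - i) * real (k choose i) * F (x + (real k / 2 - real i) * (l * u)))"
    unfolding fdiff_def by (intro sum.cong) (auto simp: assms(3) algebra_simps)
  also have "\<dots> = (\<Sum>i\<le>k. (-1) ^ i * real (k choose i) * F (x + (real i - real k / 2) * (l * u)))"
  proof (rule sum.reindex_bij_witness[of _ "\<lambda>i. k - i" "\<lambda>i. k - i"])
    fix i assume "i \<in> {..k}"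
    then have i: "i \<le> k" by simp
    have "real (k - i) - real k / 2 = real k / 2 - real i" using i by (simp add: of_nat_diff)
    then show "(-1) ^ (k - i) * real (k choose (k - i)) * F (x + (real (k - i) - real k / 2) * (l * u)) =
      (-1) ^ (k - i) * real (k choose i) * F (x + (real k / 2 - real i) * (l * u))"
      using binomial_symmetric[OF i] by simp
  qed auto
  also have "\<dots> = (-1) ^ k * (\<Sum>i\<le>k. (-1) ^ (k - i) * real (k choose i) * F (x + (real i - real k / 2) * (l * u)))"
  proof -
    have "(-1::real) ^ i = (-1) ^ k * (-1) ^ (k - i)" if "i \<le> k" for i
    proof -
      have "(-1::real) ^ k * (-1) ^ (k - i) = (-1) ^ (i + (k - i)) * (-1) ^ (k - i)" using that by simp
      also have "\<dots> = (-1) ^ i * ((-1) * (-1)) ^ (k - i)" by (simp only: power_add power_mult_distrib mult.assoc)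
      finally show ?thesis by simp
    qed
    note sg = this
    show ?thesis unfolding sum_distrib_left
    proof (rule sum.cong[OF refl])
      fix i assume "i \<in> {..k}"
      then have "(-1::real) ^ i = (-1) ^ k * (-1) ^ (k - i)" by (intro sg) simp
      then show "(-1) ^ i * real (k choose i) * F (x + (real i - real k / 2) * (l * u)) =
        (-1) ^ k * ((-1) ^ (k - i) * real (k choose i) * F (x + (real i - real k / 2) * (l * u)))"
        by (simp only: mult.assoc)
    qed
  qed
  finally have "fdiff k u (\<lambda>s. F (a - l * s)) y = (-1) ^ k * sym_diff k (l * u) F x"
    unfolding sym_diff_def using assms(1,2) by (simp add: atMost_atLeast0 mult_ac)
  then show ?thesis by (simp add: abs_mult power_abs)
qed

text \<open>
  The cell is \<open>[a - l, a]\<close>, of length \<open>l\<close>, at distance \<open>(b - \<delta>)\<^sup>2\<close> from the endpoint \<open>1\<close>.  It is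
  parametrised by \<open>s \<mapsto> a - l s\<close>, so that \<open>s\<close> increases away from the endpoint.
\<close>
locale cell =
  fixes k :: nat and r :: nat and N b \<delta> t a l :: real and F :: "real \<Rightarrow> real"
  assumes k: "k \<ge> 1" and N: "N = 1 + 4 * real k" and \<delta>: "0 < \<delta>" "\<delta> \<le> b" "b \<le> 1" "\<delta> \<le> 1 / (8 * N)"
    and t: "24 * \<delta> \<le> t" and a: "a = 1 - (b - \<delta>)\<^sup>2" and l: "l = 4 * \<delta> * b"
    and F[measurable]: "F \<in> borel_measurable borel"
    and finF: "(\<integral>\<^sup>+x. ennreal \<bar>F x * \<phi> x ^ r\<bar> * indicator {-1..1} x \<partial>lborel) < \<infinity>"
begin

lemma b0: "b > 0" and N5: "N \<ge> 5" and l0: "l > 0"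
  using k \<delta> by (auto simp: N l)

text \<open>\<open>4 * \<delta> * b\<close> is the difference of the squares of
  \<open>b + \<delta>\<close> and \<open>b - \<delta>\<close>: s = 0 and s = 1 are the ends of the
  cell, and s = 1/2 is at distance \<open>b\<^sup>2 + \<delta>\<^sup>2\<close> from 1.\<close>

lemma one_minus: "1 - (a - l * s) = (b - \<delta>)\<^sup>2 + 4 * \<delta> * b * s"
  by (simp add: a l)

text \<open>\<open>\<delta> \<le> 1 / (8 * N)\<close> keeps every point with parameter up to N at or
  above -1/2. There 1 + x lies between 1/2 and 2, so \<open>\<phi>\<^sup>2\<close> and the distance
  to the endpoint 1 agree up to a factor 2.\<close>

lemma point_bounds:
  assumes "0 \<le> s" "s \<le> N"
  shows "-1/2 \<le> a - l * s" "a - l * s \<le> 1" "1 - (a - l * s) \<le> b^2 * (1 + 4 * s)" "\<phi> (a - l * s) ^ 2 \<le> 2 * (1 - (a - l * s))"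
    "(1 - (a - l * s)) / 2 \<le> \<phi> (a - l * s) ^ 2"
proof -
  have db: "(b - \<delta>)\<^sup>2 \<le> b\<^sup>2" using \<delta> by (intro power_mono) auto
  have "b\<^sup>2 \<le> 1" using \<delta> b0 by (simp add: power_le_one)
  have "4 * \<delta> * b * s \<le> 4 * (1 / (8 * N)) * 1 * N" using \<delta> assms N5 b0 by (intro mult_mono) auto
  also have "\<dots> = 1/2" using N5 by simp
  finally have 1: "4 * \<delta> * b * s \<le> 1/2" .
  show x1: "-1/2 \<le> a - l * s" using one_minus[of s] 1 db \<open>b\<^sup>2 \<le> 1\<close> by linarith
  have "0 \<le> 4 * \<delta> * b * s" using \<delta> b0 assms by auto
  then show x2: "a - l * s \<le> 1" using one_minus[of s] zero_le_power2[of "b - \<delta>"] by linarith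
  have "\<delta> * (b * s) \<le> b * (b * s)" using \<delta> b0 assms by (intro mult_right_mono) auto
  then show "1 - (a - l * s) \<le> b^2 * (1 + 4 * s)" using one_minus[of s] db by (simp add: power2_eq_square algebra_simps)
  have "\<bar>a - l * s\<bar> \<le> 1" using x1 x2 by (simp add: abs_le_iff)
  then have ph: "\<phi> (a - l * s) ^ 2 = (1 - (a - l * s)) * (1 + (a - l * s))" by (simp only: \<phi>_sq one_minus_square)
  show "\<phi> (a - l * s) ^ 2 \<le> 2 * (1 - (a - l * s))" unfolding ph using x1 x2
    by (subst mult.commute) (intro mult_right_mono, auto)
  show "(1 - (a - l * s)) / 2 \<le> \<phi> (a - l * s) ^ 2"
    unfolding ph using mult_left_mono[of "1/2" "1 + (a - l * s)" "1 - (a - l * s)"] x1 x2 by simp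
qed

text \<open>The cell itself may touch the endpoint, when \<open>b = \<delta>\<close>. From s = 1/2
  on the distance is at least \<open>b\<^sup>2\<close>, and \<open>\<phi>\<close> is comparable to
  b; all centres of the differences lie there. The factor 7/10 is a rational number below the square
  root of 1/2.\<close>

lemma far_bounds:
  assumes "1/2 \<le> s" "s \<le> N"
  shows "b\<^sup>2 \<le> 1 - (a - l * s)" "\<bar>a - l * s\<bar> < 1" "b / 2 \<le> \<phi> (a - l * s)" "\<phi> (a - l * s) \<le> (2 + 4 * N) * b" "7/10 * b \<le> \<phi> (a - l * s)"
proof -
  note pb = point_bounds[of s]
  have "4 * \<delta> * b * (1/2) \<le> 4 * \<delta> * b * s" using assms \<delta> b0 by (intro mult_left_mono) auto
  then have "(b - \<delta>)\<^sup>2 + 2 * \<delta> * b \<le> 1 - (a - l * s)" using one_minus[of s] by simp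
  moreover have "(b - \<delta>)\<^sup>2 + 2 * \<delta> * b = b\<^sup>2 + \<delta>\<^sup>2" by (simp add: power2_eq_square algebra_simps)
  ultimately show 1: "b\<^sup>2 \<le> 1 - (a - l * s)" using zero_le_power2[of \<delta>] by linarith
  moreover have "b\<^sup>2 > 0" using b0 by simp
  ultimately have "a - l * s < 1" by linarith
  moreover have "-1/2 \<le> a - l * s" using pb(1) assms by simp
  ultimately show x: "\<bar>a - l * s\<bar> < 1" by (simp add: abs_less_iff)
  have p0: "\<phi> (a - l * s) \<ge> 0" using \<phi>_pos[OF x] by simp
  have low: "b\<^sup>2 / 2 \<le> \<phi> (a - l * s) ^ 2" using pb(5) 1 assms by auto
  have "(7/10 * b)\<^sup>2 \<le> b\<^sup>2 / 2" by (simp add: power_mult_distrib power2_eq_square)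
  then have "(7/10 * b)\<^sup>2 \<le> \<phi> (a - l * s) ^ 2" using low by linarith
  then show p7: "7/10 * b \<le> \<phi> (a - l * s)" using p0 by (rule power2_le_imp_le)
  then show "b / 2 \<le> \<phi> (a - l * s)" using b0 by simp
  have "\<phi> (a - l * s) ^ 2 \<le> 2 * (b^2 * (1 + 4 * s))" using pb(3,4) assms by auto
  also have "\<dots> \<le> 2 * (b^2 * (1 + 4 * N))" using assms by (intro mult_left_mono) auto
  also have "\<dots> \<le> ((2 + 4 * N) * b)\<^sup>2"
  proof -
    have "2 * (1 + 4 * N) \<le> (2 + 4 * N)\<^sup>2" using N5 by (simp add: power2_eq_square algebra_simps)
    from mult_right_mono[OF this, of "b\<^sup>2"]
    have "(2 * (1 + 4 * N)) * b\<^sup>2 \<le> ((2 + 4 * N) * b)\<^sup>2" by (simp only: power_mult_distrib zero_le_power2)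
    then show ?thesis by (simp only: mult_ac)
  qed
  finally show "\<phi> (a - l * s) \<le> (2 + 4 * N) * b" using N5 b0 by (intro power2_le_imp_le[of "\<phi> (a - l * s)"]) auto
qed

text \<open>The node nearest to the endpoint has parameter y, and \<open>W\<^sup>2\<close> at the
  centre is its distance from 1 times a factor at least 1/2. This distance controls the weight at Y:
  either the node is the point at Y, or \<open>Y \<le> 1 \<le> y\<close>, when the distance is at
  least \<open>b\<^sup>2\<close> while \<open>\<phi>\<^sup>2\<close> at Y is at most
  \<open>10 * b\<^sup>2\<close>. In total \<open>\<phi>\<^sup>2 \<le> 20 * W\<^sup>2\<close>,
  rounded up to the square 25.\<close>

lemma fdiff_le_wdiff:
  assumes y: "0 \<le> y" "y + real k * u \<le> N" and u: "0 < u" "u \<le> 4" and s: "s = y + real k * u / 2" "1/2 \<le> s"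
    and Y: "0 \<le> Y" "Y \<le> 1" "Y = y \<or> 1 \<le> y"
  shows "\<phi> (a - l * Y) ^ r * \<bar>fdiff k u (\<lambda>s. F (a - l * s)) y\<bar> \<le> 5 ^ r * wdiff k r F (a - l * s) (l * u / \<phi> (a - l * s))"
proof -
  define x where "x = a - l * s"
  define \<tau> where "\<tau> = l * u / \<phi> x"
  have k0: "real k \<ge> 1" using k by simp
  have "real k * u > 0" using k0 u by auto
  then have sN: "s \<le> N" "y \<le> N" using y s by auto
  have fb: "b\<^sup>2 \<le> 1 - x" "\<bar>x\<bar> < 1" "b / 2 \<le> \<phi> x" using far_bounds[OF s(2) sN(1)] by (auto simp: x_def)
  have \<phi>x: "\<phi> x > 0" using fb b0 by linarith
  have \<tau>\<phi>: "\<tau> * \<phi> x = l * u" using \<phi>x by (simp add: \<tau>_def)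
  define top where "top = x + real k * (l * u) / 2"
  define bot where "bot = x - real k * (l * u) / 2"
  have top: "top = a - l * y" by (simp add: top_def x_def s algebra_simps)
  have bot: "bot = a - l * (y + real k * u)" by (simp add: bot_def x_def s algebra_simps)
  have tb: "top \<le> 1" "-1/2 \<le> top" using point_bounds[of y] y sN by (auto simp: top)
  have bb: "bot \<le> 1" "-1/2 \<le> bot" using point_bounds[of "y + real k * u"] y \<open>real k * u > 0\<close> by (auto simp: bot)
  have inD: "\<bar>x\<bar> < 1 \<and> real k * \<tau> * \<phi> x / 2 \<le> 1 - \<bar>x\<bar>"
    using fb tb bb by (auto simp: mult.assoc \<tau>\<phi> top_def bot_def abs_if)
  have W2: "W (real k * \<tau>) x = sqrt ((1 - top) * (1 + bot))"
  proof -
    have e: "real k * \<tau> * \<phi> x / 2 = real k * (l * u) / 2" by (simp only: mult.assoc \<tau>\<phi>)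
    show ?thesis unfolding W_def e top_def bot_def by (simp only: diff_diff_eq add_diff_eq)
  qed
  have W2': "W (real k * \<tau>) x ^ 2 = (1 - top) * (1 + bot)" unfolding W2 using tb bb by (intro real_sqrt_pow2) auto
  have W0: "W (real k * \<tau>) x \<ge> 0" unfolding W2 using tb bb by auto
  have Wlow: "(1 - top) / 2 \<le> W (real k * \<tau>) x ^ 2"
    unfolding W2' using mult_left_mono[of "1/2" "1 + bot" "1 - top"] tb bb by simp
  have "\<phi> (a - l * Y) ^ 2 \<le> 10 * (1 - top)"
  proof (cases "Y = y")
    case True
    have "\<phi> (a - l * Y) ^ 2 \<le> 2 * (1 - top)" using point_bounds(4)[of Y] y sN True by (simp add: top)
    also have "\<dots> \<le> 10 * (1 - top)" using tb by simp
    finally show ?thesis .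
  next
    case False
    then have y1: "1 \<le> y" using Y by auto
    have "\<phi> (a - l * Y) ^ 2 \<le> 2 * (1 - (a - l * Y))" using point_bounds(4)[of Y] Y N5 by simp
    also have "\<dots> \<le> 2 * (b^2 * (1 + 4 * Y))" using point_bounds(3)[of Y] Y N5 by simp
    also have "\<dots> \<le> 2 * (b^2 * (1 + 4 * 1))" using Y by (intro mult_left_mono) auto
    also have "\<dots> \<le> 10 * (1 - top)" using far_bounds(1)[of y] y1 sN by (simp add: top)
    finally show ?thesis .
  qed
  also have "\<dots> \<le> 25 * W (real k * \<tau>) x ^ 2" using Wlow tb by simp
  also have "\<dots> = (5 * W (real k * \<tau>) x) ^ 2" by (simp add: power_mult_distrib)
  finally have "\<phi> (a - l * Y) \<le> 5 * W (real k * \<tau>) x" using W0 by (intro power2_le_imp_le[of "\<phi> (a - l * Y)"]) auto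
  moreover have "0 \<le> \<phi> (a - l * Y)" using point_bounds(1,2)[of Y] Y N5 by (intro \<phi>_nonneg) (auto simp: abs_le_iff)
  ultimately have \<phi>W: "\<phi> (a - l * Y) ^ r \<le> 5 ^ r * W (real k * \<tau>) x ^ r"
    using power_mono[of "\<phi> (a - l * Y)" "5 * W (real k * \<tau>) x" r] by (simp add: power_mult_distrib)
  have "\<bar>fdiff k u (\<lambda>s. F (a - l * s)) y\<bar> = \<bar>sym_diff k (\<tau> * \<phi> x) F x\<bar>"
    unfolding \<tau>\<phi> using tb bb by (intro fdiff_eq_sym_diff) (auto simp: top_def bot_def x_def s)
  then have "\<phi> (a - l * Y) ^ r * \<bar>fdiff k u (\<lambda>s. F (a - l * s)) y\<bar> \<le> 5 ^ r * W (real k * \<tau>) x ^ r * \<bar>sym_diff k (\<tau> * \<phi> x) F x\<bar>"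
    using \<phi>W by (simp add: mult_right_mono)
  also have "\<dots> = 5 ^ r * wdiff k r F x \<tau>" using inD W0 by (simp add: wdiff_def abs_mult)
  finally show ?thesis unfolding x_def \<tau>_def .
qed

text \<open>The weighted difference in cell coordinates, with centre s and step u;
  \<open>l * u / \<phi> x\<close> is the corresponding step of the modulus. The cutoff lets
  integrals run over the whole plane.\<close>

definition \<Xi> :: "real \<Rightarrow> real \<Rightarrow> real" where
  "\<Xi> s u = (if 1/2 \<le> s \<and> s \<le> N \<and> 0 < u \<and> u \<le> 4 then wdiff k r F (a - l * s) (l * u / \<phi> (a - l * s)) else 0)"

lemma \<Xi>_measurable [measurable]:
  assumes [measurable]: "g \<in> borel_measurable M" "h \<in> borel_measurable M"
  shows "(\<lambda>x. \<Xi> (g x) (h x)) \<in> borel_measurable M"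
  unfolding \<Xi>_def by measurable

lemma \<Xi>_nonneg: "0 \<le> \<Xi> s u"
  by (simp add: \<Xi>_def wdiff_nonneg)

text \<open>\<open>C1\<close> and \<open>C2\<close> are the constants of \<open>local_approximation\<close>.\<close>
definition C1 where "C1 = real k * (real (k + 1) * 2 ^ k * real k ^ (k - 1))"
definition C2 where "C2 = 2 ^ k * real k ^ k * (1 + 2 * real k) ^ (k - 1) * real k ^ 2"
text \<open>3 is the length of the interval from 1 to 4, and
  \<open>4 * k - 2 = (2 - 1 / k) * (2 * k)\<close> is the area of the rectangle of
  \<open>strip_integral\<close>; they normalise the two integrals to averages.\<close>

definition K where "K = 5 ^ r * (3 * C1 + (4 * real k - 2) * C2)"

lemma C_pos: "C1 > 0" "C2 > 0" "K > 0"
proof -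
  have k0: "real k \<ge> 1" using k by simp
  show 1: "C1 > 0" "C2 > 0" unfolding C1_def C2_def using k0 by (auto intro!: mult_pos_pos)
  show "K > 0" unfolding K_def using 1 k0 by (intro mult_pos_pos add_pos_pos) auto
qed

text \<open>\<open>local_approximation\<close> is applied in cell coordinates and multiplied by the
  weight at Y. In the first integral the differences start at Y, in the second at some point z not
  below 1; these are the two cases of \<open>fdiff_le_wdiff\<close>.\<close>

lemma approx_pointwise:
  "\<exists>P. degree P < k \<and> (\<forall>Y\<in>{0..1}. ennreal (\<phi> (a - l * Y) ^ r * \<bar>F (a - l * Y) - poly P (a - l * Y)\<bar>) \<le>
     ennreal (5 ^ r * C1) * (\<integral>\<^sup>+u. ennreal (\<Xi> (Y + real k * u / 2) u) * indicator {1..4} u \<partial>lborel) +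
     ennreal (5 ^ r * C2) * strip_integral k (\<lambda>\<eta> z. \<Xi> (z + real k * \<eta> / 2) \<eta>))"
proof -
  have k0: "real k \<ge> 1" using k by simp
  define f where "f s = F (a - l * s)" for s
  have fm[measurable]: "f \<in> borel_measurable borel" unfolding f_def[abs_def] by measurable
  \<comment> \<open>From parameter 1 to N the weight is bounded below by \<open>(b / 2) ^ r\<close>,
    so integrability of the weighted F gives that of f.\<close>
  have fin: "(\<integral>\<^sup>+z. ennreal \<bar>f z\<bar> * indicator {1..1 + 4 * real k} z \<partial>lborel) < \<infinity>"
  proof -
    let ?c = "(2 / b) ^ r"
    have "(\<integral>\<^sup>+z. ennreal \<bar>f z\<bar> * indicator {1..1 + 4 * real k} z \<partial>lborel) \<le>
      (\<integral>\<^sup>+z. ennreal ?c * (ennreal \<bar>F (a + (- l) * z) * \<phi> (a + (- l) * z) ^ r\<bar> * indicator {-1..1} (a + (- l) * z)) \<partial>lborel)"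
    proof (rule nn_integral_mono)
      fix z
      show "ennreal \<bar>f z\<bar> * indicator {1..1 + 4 * real k} z \<le> ennreal ?c * (ennreal \<bar>F (a + (- l) * z) * \<phi> (a + (- l) * z) ^ r\<bar> * indicator {-1..1} (a + (- l) * z))"
      proof (cases "z \<in> {1..1 + 4 * real k}")
        case True
        then have z: "1/2 \<le> z" "z \<le> N" by (auto simp: N)
        note fb = far_bounds[OF z]
        have "1 \<le> (2 / b * \<phi> (a - l * z)) ^ r" using fb(3) b0 by (intro one_le_power) (simp add: field_simps)
        then have "\<bar>F (a - l * z)\<bar> * 1 \<le> \<bar>F (a - l * z)\<bar> * (2 / b * \<phi> (a - l * z)) ^ r" by (intro mult_left_mono) auto
        also have "\<dots> = ?c * \<bar>F (a - l * z) * \<phi> (a - l * z) ^ r\<bar>"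
          unfolding power_mult_distrib[of "2/b"] using fb(3) b0 by (simp add: abs_mult power_abs mult_ac)
        finally have "ennreal \<bar>f z\<bar> \<le> ennreal ?c * ennreal \<bar>F (a - l * z) * \<phi> (a - l * z) ^ r\<bar>"
          using b0 by (simp add: f_def ennreal_mult[symmetric] ennreal_leI)
        moreover have "a + (- l) * z \<in> {-1..1}" using fb(2) by (auto simp: abs_less_iff)
        ultimately show ?thesis using True by simp
      qed simp
    qed
    also have "\<dots> = ennreal ?c * (\<integral>\<^sup>+z. (ennreal \<bar>F (a + (- l) * z) * \<phi> (a + (- l) * z) ^ r\<bar> * indicator {-1..1} (a + (- l) * z)) \<partial>lborel)"
      by (intro nn_integral_cmult) measurable
    also have "\<dots> < \<infinity>"
    proof -
      have "(\<integral>\<^sup>+x. ennreal \<bar>F x * \<phi> x ^ r\<bar> * indicator {-1..1} x \<partial>lborel) = ennreal l * (\<integral>\<^sup>+z. (ennreal \<bar>F (a + (- l) * z) * \<phi> (a + (- l) * z) ^ r\<bar> * indicator {-1..1} (a + (- l) * z)) \<partial>lborel)"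
        using l0 by (subst nn_integral_real_affine[where c="-l" and t=a]) auto
      then have "(\<integral>\<^sup>+z. (ennreal \<bar>F (a + (- l) * z) * \<phi> (a + (- l) * z) ^ r\<bar> * indicator {-1..1} (a + (- l) * z)) \<partial>lborel) < \<infinity>"
        using finF l0 by (auto simp: ennreal_mult_less_top)
      then show ?thesis by (simp add: ennreal_mult_less_top)
    qed
    finally show ?thesis .
  qed
  obtain Q where Q: "degree Q < k" "\<And>y. y \<in> {0..1} \<Longrightarrow> ennreal \<bar>f y - poly Q y\<bar> \<le>
     ennreal C1 * near_integral (\<lambda>u y. \<bar>fdiff k u f y\<bar>) y +
     ennreal C2 * strip_integral k (\<lambda>\<eta> z. \<bar>fdiff k \<eta> f z\<bar>)"
    using local_approximation[OF k fm fin] unfolding C1_def C2_def by blast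
  define P where "P = pcompose Q [:a / l, - 1 / l:]"
  have P: "poly P (a - l * Y) = poly Q Y" for Y
    using l0 by (simp add: P_def poly_pcompose field_simps)
  have "degree P \<le> degree Q" unfolding P_def using l0 by (simp add: degree_pcompose)
  then have dP: "degree P < k" using Q(1) by simp
  show ?thesis
  proof (intro exI[of _ P] conjI ballI dP)
    fix Y :: real assume Y: "Y \<in> {0..1}"
    define w where "w = \<phi> (a - l * Y) ^ r"
    have w: "w \<ge> 0" unfolding w_def using point_bounds(1,2)[of Y] Y N5 by (intro zero_le_power \<phi>_nonneg) (auto simp: abs_le_iff)
    have "ennreal (w * \<bar>F (a - l * Y) - poly P (a - l * Y)\<bar>) = ennreal w * ennreal \<bar>f Y - poly Q Y\<bar>"
      using w by (simp add: P f_def ennreal_mult)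
    also have "\<dots> \<le> ennreal w * (ennreal C1 * (\<integral>\<^sup>+u. ennreal \<bar>fdiff k u f Y\<bar> * indicator {1..4} u \<partial>lborel) +
     ennreal C2 * strip_integral k (\<lambda>\<eta> z. \<bar>fdiff k \<eta> f z\<bar>))"
      by (rule mult_left_mono[OF Q(2)[OF Y]]) simp
    also have "\<dots> = ennreal C1 * (ennreal w * (\<integral>\<^sup>+u. ennreal \<bar>fdiff k u f Y\<bar> * indicator {1..4} u \<partial>lborel)) +
     ennreal C2 * (ennreal w * strip_integral k (\<lambda>\<eta> z. \<bar>fdiff k \<eta> f z\<bar>))"
      by (simp add: distrib_left mult_ac)
    finally have bound: "ennreal (w * \<bar>F (a - l * Y) - poly P (a - l * Y)\<bar>) \<le>
     ennreal C1 * (ennreal w * (\<integral>\<^sup>+u. ennreal \<bar>fdiff k u f Y\<bar> * indicator {1..4} u \<partial>lborel)) +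
     ennreal C2 * (ennreal w * strip_integral k (\<lambda>\<eta> z. \<bar>fdiff k \<eta> f z\<bar>))" .
    have "ennreal w * (\<integral>\<^sup>+u. ennreal \<bar>fdiff k u f Y\<bar> * indicator {1..4} u \<partial>lborel) = (\<integral>\<^sup>+u. ennreal w * (ennreal \<bar>fdiff k u f Y\<bar> * indicator {1..4} u) \<partial>lborel)"
      by (rule nn_integral_cmult[symmetric]) measurable
    also have "\<dots> \<le> (\<integral>\<^sup>+u. ennreal (5 ^ r) * (ennreal (\<Xi> (Y + real k * u / 2) u) * indicator {1..4} u) \<partial>lborel)"
    proof (rule nn_integral_mono)
      fix u
      show "ennreal w * (ennreal \<bar>fdiff k u f Y\<bar> * indicator {1..4} u) \<le> ennreal (5 ^ r) * (ennreal (\<Xi> (Y + real k * u / 2) u) * indicator {1..4} u)"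
      proof (cases "u \<in> {1..4}")
        case True
        have ku: "1 \<le> real k * u" "real k * u \<le> real k * 4"
          using mult_mono[of 1 "real k" 1 u] mult_left_mono[of u 4 "real k"] True k0 by simp_all
        have "w * \<bar>fdiff k u f Y\<bar> \<le> 5 ^ r * \<Xi> (Y + real k * u / 2) u"
          using fdiff_le_wdiff[of Y u "Y + real k * u / 2" Y] True Y ku unfolding w_def f_def \<Xi>_def by (auto simp: N)
        then show ?thesis using True w \<Xi>_nonneg by (simp add: ennreal_mult[symmetric] ennreal_leI)
      qed simp
    qed
    also have "\<dots> = ennreal (5 ^ r) * (\<integral>\<^sup>+u. (ennreal (\<Xi> (Y + real k * u / 2) u) * indicator {1..4} u) \<partial>lborel)"
      by (rule nn_integral_cmult) measurable
    finally have T1: "ennreal w * (\<integral>\<^sup>+u. ennreal \<bar>fdiff k u f Y\<bar> * indicator {1..4} u \<partial>lborel) \<le>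
      ennreal (5 ^ r) * (\<integral>\<^sup>+u. (ennreal (\<Xi> (Y + real k * u / 2) u) * indicator {1..4} u) \<partial>lborel)" .
    have "ennreal w * strip_integral k (\<lambda>\<eta> z. \<bar>fdiff k \<eta> f z\<bar>)
      = (\<integral>\<^sup>+\<eta>. (\<integral>\<^sup>+z. ennreal w * (ennreal \<bar>fdiff k \<eta> f z\<bar> * indicator {1..1 + 2 * real k} z) \<partial>lborel) * indicator {1 / real k..2} \<eta> \<partial>lborel)"
      by (simp add: nn_integral_cmult nn_integral_cmult[symmetric] mult.assoc[symmetric])
    also have "\<dots> \<le> (\<integral>\<^sup>+\<eta>. (\<integral>\<^sup>+z. ennreal (5 ^ r) * (ennreal (\<Xi> (z + real k * \<eta> / 2) \<eta>) * indicator {1..1 + 2 * real k} z) \<partial>lborel) * indicator {1 / real k..2} \<eta> \<partial>lborel)"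
    proof (rule nn_integral_mono)
      fix \<eta>
      show "(\<integral>\<^sup>+z. ennreal w * (ennreal \<bar>fdiff k \<eta> f z\<bar> * indicator {1..1 + 2 * real k} z) \<partial>lborel) * indicator {1 / real k..2} \<eta>
         \<le> (\<integral>\<^sup>+z. ennreal (5 ^ r) * (ennreal (\<Xi> (z + real k * \<eta> / 2) \<eta>) * indicator {1..1 + 2 * real k} z) \<partial>lborel) * indicator {1 / real k..2} \<eta>"
      proof (cases "\<eta> \<in> {1 / real k..2}")
        case True
        have \<eta>: "\<eta> > 0" "\<eta> \<le> 2" using True k0 by (auto intro: less_le_trans[of 0 "1 / real k"])
        have k\<eta>: "0 < real k * \<eta>" "real k * \<eta> \<le> real k * 2" using \<eta> k0 by (auto intro!: mult_left_mono)
        have "(\<integral>\<^sup>+z. ennreal w * (ennreal \<bar>fdiff k \<eta> f z\<bar> * indicator {1..1 + 2 * real k} z) \<partial>lborel) \<le> (\<integral>\<^sup>+z. ennreal (5 ^ r) * (ennreal (\<Xi> (z + real k * \<eta> / 2) \<eta>) * indicator {1..1 + 2 * real k} z) \<partial>lborel)"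
        proof (rule nn_integral_mono)
          fix z
          show "ennreal w * (ennreal \<bar>fdiff k \<eta> f z\<bar> * indicator {1..1 + 2 * real k} z) \<le> ennreal (5 ^ r) * (ennreal (\<Xi> (z + real k * \<eta> / 2) \<eta>) * indicator {1..1 + 2 * real k} z)"
          proof (cases "z \<in> {1..1 + 2 * real k}")
            case True
            have "w * \<bar>fdiff k \<eta> f z\<bar> \<le> 5 ^ r * \<Xi> (z + real k * \<eta> / 2) \<eta>"
              using fdiff_le_wdiff[of z \<eta> "z + real k * \<eta> / 2" Y] True Y \<eta> k\<eta> unfolding w_def f_def \<Xi>_def by (auto simp: N)
            then show ?thesis using True w \<Xi>_nonneg by (simp add: ennreal_mult[symmetric] ennreal_leI)
          qed simp
        qed
        then show ?thesis using True by simp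
      qed simp
    qed
    also have "\<dots> = ennreal (5 ^ r) * (\<integral>\<^sup>+\<eta>. (\<integral>\<^sup>+z. (ennreal (\<Xi> (z + real k * \<eta> / 2) \<eta>) * indicator {1..1 + 2 * real k} z) \<partial>lborel) * indicator {1 / real k..2} \<eta> \<partial>lborel)"
      by (simp add: nn_integral_cmult nn_integral_cmult[symmetric] mult.assoc[symmetric])
    finally have T2: "ennreal w * strip_integral k (\<lambda>\<eta> z. \<bar>fdiff k \<eta> f z\<bar>) \<le>
      ennreal (5 ^ r) * (\<integral>\<^sup>+\<eta>. (\<integral>\<^sup>+z. (ennreal (\<Xi> (z + real k * \<eta> / 2) \<eta>) * indicator {1..1 + 2 * real k} z) \<partial>lborel) * indicator {1 / real k..2} \<eta> \<partial>lborel)" .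
    note bound
    also have "ennreal C1 * (ennreal w * (\<integral>\<^sup>+u. ennreal \<bar>fdiff k u f Y\<bar> * indicator {1..4} u \<partial>lborel)) +
     ennreal C2 * (ennreal w * strip_integral k (\<lambda>\<eta> z. \<bar>fdiff k \<eta> f z\<bar>))
     \<le> ennreal C1 * (ennreal (5 ^ r) * (\<integral>\<^sup>+u. (ennreal (\<Xi> (Y + real k * u / 2) u) * indicator {1..4} u) \<partial>lborel)) +
      ennreal C2 * (ennreal (5 ^ r) * (\<integral>\<^sup>+\<eta>. (\<integral>\<^sup>+z. (ennreal (\<Xi> (z + real k * \<eta> / 2) \<eta>) * indicator {1..1 + 2 * real k} z) \<partial>lborel) * indicator {1 / real k..2} \<eta> \<partial>lborel))"
      by (intro add_mono mult_left_mono T1 T2) auto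
    also have "\<dots> = ennreal (5 ^ r * C1) * (\<integral>\<^sup>+u. ennreal (\<Xi> (Y + real k * u / 2) u) * indicator {1..4} u \<partial>lborel) +
     ennreal (5 ^ r * C2) * strip_integral k (\<lambda>\<eta> z. \<Xi> (z + real k * \<eta> / 2) \<eta>)"
      using C_pos by (simp add: ennreal_mult mult_ac)
    finally show "ennreal (w * \<bar>F (a - l * Y) - poly P (a - l * Y)\<bar>) \<le>
     ennreal (5 ^ r * C1) * (\<integral>\<^sup>+u. ennreal (\<Xi> (Y + real k * u / 2) u) * indicator {1..4} u \<partial>lborel) +
     ennreal (5 ^ r * C2) * strip_integral k (\<lambda>\<eta> z. \<Xi> (z + real k * \<eta> / 2) \<eta>)" .
  qed
qed

end

section \<open>From the pointwise bound to gauge inequalities on a cell\<close>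

lemma lborel_mass_Icc_weight: "a < b \<Longrightarrow> (\<integral>\<^sup>+u. ennreal (indicator {a..b} u / (b - a)) \<partial>lborel) = 1"
proof -
  assume ab: "a < b"
  have "(\<integral>\<^sup>+u. ennreal (indicator {a..b} u / (b - a)) \<partial>lborel) = (\<integral>\<^sup>+u. ennreal (1 / (b - a)) * indicator {a..b} u \<partial>lborel)"
    by (intro nn_integral_cong) (auto split: split_indicator)
  also have "\<dots> = ennreal (1 / (b - a)) * ennreal (b - a)" using ab by (simp add: nn_integral_cmult_indicator)
  also have "\<dots> = 1" using ab by (simp add: ennreal_mult[symmetric])
  finally show ?thesis .
qed

lemma borel_measurable_poly [measurable]: "poly (P :: real poly) \<in> borel_measurable borel"
  by (intro borel_measurable_continuous_onI continuous_intros)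

context cell
begin

text \<open>For fixed s the step u is exchanged for \<open>\<tau> = l * u / \<phi> x\<close>, then s
  for \<open>x = a - l * s\<close>. The first Jacobian \<open>\<phi> x / l\<close> is bounded
  through \<open>\<phi> x \<le> (2 + 4 * N) * b\<close> and \<open>l = 4 * \<delta> * b\<close>, the
  second is 1/l.\<close>

lemma \<Xi>_modular_integral:
  assumes \<theta>: "modular \<theta>"
  shows "(\<integral>\<^sup>+u. (\<integral>\<^sup>+s. ennreal (\<theta> (\<Xi> s u)) \<partial>lborel) \<partial>lborel) \<le>
    ennreal ((2 + 4 * N) / (4 * \<delta> * l)) * (\<integral>\<^sup>+x. diff_integral \<theta> k r F t x * indicator {a - l * N..a - l / 2} x \<partial>lborel)"
proof -
  note [measurable] = modular_measurable[OF \<theta>]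
  have \<theta>0: "\<theta> 0 = 0" using \<theta> by (simp add: modular_def)
  define V where "V x = diff_integral \<theta> k r F t x" for x
  have V[measurable]: "V \<in> borel_measurable borel" unfolding V_def[abs_def] by measurable
  have inner: "(\<integral>\<^sup>+u. ennreal (\<theta> (\<Xi> s u)) \<partial>lborel) \<le> ennreal ((2 + 4 * N) / (4 * \<delta>)) * (V (a + (- l) * s) * indicator {a - l * N..a - l / 2} (a + (- l) * s))" for s
  proof (cases "1/2 \<le> s \<and> s \<le> N")
    case False
    then have "\<Xi> s u = 0" for u by (auto simp: \<Xi>_def)
    then show ?thesis by (simp add: \<theta>0)
  next
    case True
    define x where "x = a - l * s"
    note fb = far_bounds[OF conjunct1[OF True] conjunct2[OF True], folded x_def]
    have \<phi>x: "\<phi> x > 0" using fb(3) b0 by linarith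
    define c where "c = \<phi> x / l"
    have c: "c > 0" using \<phi>x l0 by (simp add: c_def)
    have cle: "c \<le> (2 + 4 * N) / (4 * \<delta>)"
    proof -
      have "c \<le> ((2 + 4 * N) * b) / l" unfolding c_def using fb(4) l0 by (intro divide_right_mono) auto
      also have "\<dots> = (2 + 4 * N) / (4 * \<delta>)" using b0 \<delta> by (simp add: l)
      finally show ?thesis .
    qed
    have "(\<integral>\<^sup>+u. ennreal (\<theta> (\<Xi> s u)) \<partial>lborel) \<le> (\<integral>\<^sup>+u. ennreal (\<theta> (wdiff k r F x (l * u / \<phi> x))) * indicator {0<..t} (l * u / \<phi> x) \<partial>lborel)"
    proof (rule nn_integral_mono)
      fix u
      show "ennreal (\<theta> (\<Xi> s u)) \<le> ennreal (\<theta> (wdiff k r F x (l * u / \<phi> x))) * indicator {0<..t} (l * u / \<phi> x)"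
      proof (cases "0 < u \<and> u \<le> 4")
        case u: True
        \<comment> \<open>Steps u up to 4 must give \<open>\<tau> \<le> t\<close>. This is why the
          locale asks for \<open>24 * \<delta> \<le> t\<close> and \<open>far_bounds\<close> for
          7/10: their product 16.8 exceeds 16.\<close>
        have "l * u \<le> 16 * \<delta> * b" using u \<delta> b0 by (simp add: l)
        also have "\<dots> \<le> 24 * \<delta> * (7/10 * b)" using \<delta> b0 by simp
        also have "\<dots> \<le> t * \<phi> x" using t fb(5) \<delta> b0 by (intro mult_mono) auto
        finally have "l * u / \<phi> x \<le> t" using \<phi>x by (simp add: divide_le_eq)
        moreover have "0 < l * u / \<phi> x" using u l0 \<phi>x by simp
        ultimately show ?thesis using True u by (simp add: \<Xi>_def x_def)
      qed (auto simp: \<Xi>_def \<theta>0)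
    qed
    also have "\<dots> = ennreal c * (\<integral>\<^sup>+\<tau>. ennreal (\<theta> (wdiff k r F x (l * (0 + c * \<tau>) / \<phi> x))) * indicator {0<..t} (l * (0 + c * \<tau>) / \<phi> x) \<partial>lborel)"
      using c by (subst nn_integral_real_affine[where c=c and t=0]) auto
    also have "\<dots> = ennreal c * V x"
      using \<phi>x l0 by (simp add: V_def c_def)
    also have "\<dots> \<le> ennreal ((2 + 4 * N) / (4 * \<delta>)) * V x" using cle by (intro mult_right_mono ennreal_leI) auto
    finally have 1: "(\<integral>\<^sup>+u. ennreal (\<theta> (\<Xi> s u)) \<partial>lborel) \<le> ennreal ((2 + 4 * N) / (4 * \<delta>)) * V x" .
    have "l * (1/2) \<le> l * s" "l * s \<le> l * N" using True l0 by (auto intro!: mult_left_mono)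
    then have "x \<in> {a - l * N..a - l / 2}" by (auto simp: x_def)
    then show ?thesis using 1 by (simp add: x_def)
  qed
  have "(\<integral>\<^sup>+u. (\<integral>\<^sup>+s. ennreal (\<theta> (\<Xi> s u)) \<partial>lborel) \<partial>lborel) = (\<integral>\<^sup>+s. (\<integral>\<^sup>+u. ennreal (\<theta> (\<Xi> s u)) \<partial>lborel) \<partial>lborel)"
    by (rule lborel_pair.Fubini') measurable
  also have "\<dots> \<le> (\<integral>\<^sup>+s. ennreal ((2 + 4 * N) / (4 * \<delta>)) * (V (a + (- l) * s) * indicator {a - l * N..a - l / 2} (a + (- l) * s)) \<partial>lborel)"
    by (intro nn_integral_mono inner)
  also have "\<dots> = ennreal ((2 + 4 * N) / (4 * \<delta>)) * (\<integral>\<^sup>+s. (V (a + (- l) * s) * indicator {a - l * N..a - l / 2} (a + (- l) * s)) \<partial>lborel)"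
    by (rule nn_integral_cmult) measurable
  also have "(\<integral>\<^sup>+s. (V (a + (- l) * s) * indicator {a - l * N..a - l / 2} (a + (- l) * s)) \<partial>lborel) = ennreal (1 / l) * (\<integral>\<^sup>+x. V x * indicator {a - l * N..a - l / 2} x \<partial>lborel)"
  proof -
    have "(\<integral>\<^sup>+x. V x * indicator {a - l * N..a - l / 2} x \<partial>lborel) = ennreal l * (\<integral>\<^sup>+s. (V (a + (- l) * s) * indicator {a - l * N..a - l / 2} (a + (- l) * s)) \<partial>lborel)"
      using l0 by (subst nn_integral_real_affine[where c="- l" and t=a]) auto
    then show ?thesis using l0 by (simp add: mult.assoc[symmetric] ennreal_mult[symmetric])
  qed
  also have "ennreal ((2 + 4 * N) / (4 * \<delta>)) * (ennreal (1 / l) * (\<integral>\<^sup>+x. V x * indicator {a - l * N..a - l / 2} x \<partial>lborel)) =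
     ennreal ((2 + 4 * N) / (4 * \<delta> * l)) * (\<integral>\<^sup>+x. V x * indicator {a - l * N..a - l / 2} x \<partial>lborel)"
    using N5 \<delta> l0 by (simp add: mult.assoc[symmetric] ennreal_mult[symmetric])
  finally show ?thesis unfolding V_def .
qed

text \<open>P is fixed before the gauge. The two integrals of \<open>approx_pointwise\<close> are
  normalised to probability averages T1 and T2, Jensen's inequality moves \<open>\<theta>\<close>
  inside, and integration over the cell leads to the double integral of
  \<open>\<Xi>_modular_integral\<close>.\<close>

theorem cell_approximation:
  "\<exists>P. degree P < k \<and> (\<forall>\<theta>. modular \<theta> \<longrightarrow>
     (\<integral>\<^sup>+x. ennreal (\<theta> (\<phi> x ^ r * \<bar>F x - poly P x\<bar> / (2 * K))) * indicator {a - l..a} x \<partial>lborel) \<le>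
     ennreal ((2 + 4 * N) / (2 * \<delta>)) * (\<integral>\<^sup>+x. diff_integral \<theta> k r F t x * indicator {a - l * N..a - l / 2} x \<partial>lborel))"
proof -
  have k0: "real k \<ge> 1" using k by simp
  define k4 where "k4 = 4 * real k - 2"
  have k4: "k4 \<ge> 2" using k0 by (simp add: k4_def)
  obtain P where P: "degree P < k" and PY: "\<And>Y. Y \<in> {0..1} \<Longrightarrow> ennreal (\<phi> (a - l * Y) ^ r * \<bar>F (a - l * Y) - poly P (a - l * Y)\<bar>) \<le>
     ennreal (5 ^ r * C1) * (\<integral>\<^sup>+u. ennreal (\<Xi> (Y + real k * u / 2) u) * indicator {1..4} u \<partial>lborel) +
     ennreal (5 ^ r * C2) * strip_integral k (\<lambda>\<eta> z. \<Xi> (z + real k * \<eta> / 2) \<eta>)"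
    using approx_pointwise by blast
  have "(\<integral>\<^sup>+x. ennreal (\<theta> (\<phi> x ^ r * \<bar>F x - poly P x\<bar> / (2 * K))) * indicator {a - l..a} x \<partial>lborel) \<le>
     ennreal ((2 + 4 * N) / (2 * \<delta>)) * (\<integral>\<^sup>+x. diff_integral \<theta> k r F t x * indicator {a - l * N..a - l / 2} x \<partial>lborel)"
    if \<theta>: "modular \<theta>" for \<theta>
  proof -
    note [measurable] = modular_measurable[OF \<theta>]
    have \<theta>0: "\<theta> 0 = 0" using \<theta> by (simp add: modular_def)
    define M where "M = (\<integral>\<^sup>+u. (\<integral>\<^sup>+s. ennreal (\<theta> (\<Xi> s u)) \<partial>lborel) \<partial>lborel)"
    define w1 where "w1 u = ennreal (indicator {1..4} u / (4 - 1))" for u :: real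
    define w2 where "w2 p = ennreal (indicator {1 / real k..2} (fst p) / (2 - 1 / real k)) * ennreal (indicator {1..1 + 2 * real k} (snd p) / (1 + 2 * real k - 1))" for p :: "real \<times> real"
    have [measurable]: "w1 \<in> borel_measurable borel" unfolding w1_def[abs_def] by measurable
    have w2m[measurable]: "w2 \<in> borel_measurable (lborel \<Otimes>\<^sub>M lborel)" unfolding w2_def[abs_def] by measurable
    have w1: "(\<integral>\<^sup>+u. w1 u \<partial>lborel) = 1" unfolding w1_def by (rule lborel_mass_Icc_weight) simp
    have k1: "1 / real k < 2" using k0 by (simp add: divide_less_eq)
    have w2: "(\<integral>\<^sup>+p. w2 p \<partial>(lborel \<Otimes>\<^sub>M lborel)) = 1"
    proof -
      have "(\<integral>\<^sup>+p. w2 p \<partial>(lborel \<Otimes>\<^sub>M lborel)) = (\<integral>\<^sup>+\<eta>. (\<integral>\<^sup>+z. w2 (\<eta>, z) \<partial>lborel) \<partial>lborel)"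
        by (rule lborel.nn_integral_fst[symmetric, OF w2m])
      also have "\<dots> = (\<integral>\<^sup>+\<eta>. ennreal (indicator {1 / real k..2} \<eta> / (2 - 1 / real k)) * 1 \<partial>lborel)"
        unfolding w2_def using lborel_mass_Icc_weight[of 1 "1 + 2 * real k"] k0 by (simp add: nn_integral_cmult)
      also have "\<dots> = 1" using lborel_mass_Icc_weight[OF k1] by simp
      finally show ?thesis .
    qed
    define T1 where "T1 Y = (\<integral>\<^sup>+u. w1 u * ennreal (\<Xi> (Y + real k * u / 2) u) \<partial>lborel)" for Y
    define T2 where "T2 = (\<integral>\<^sup>+p. w2 p * ennreal (\<Xi> (snd p + real k * fst p / 2) (fst p)) \<partial>(lborel \<Otimes>\<^sub>M lborel))"
    define S1 where "S1 Y = (\<integral>\<^sup>+u. w1 u * ennreal (\<theta> (\<Xi> (Y + real k * u / 2) u)) \<partial>lborel)" for Y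
    define S2 where "S2 = (\<integral>\<^sup>+p. w2 p * ennreal (\<theta> (\<Xi> (snd p + real k * fst p / 2) (fst p))) \<partial>(lborel \<Otimes>\<^sub>M lborel))"
    have [measurable]: "S1 \<in> borel_measurable borel" unfolding S1_def[abs_def] by measurable
    have e1: "(\<integral>\<^sup>+u. ennreal (\<Xi> (Y + real k * u / 2) u) * indicator {1..4} u \<partial>lborel) = ennreal 3 * T1 Y" for Y
    proof -
      have 3: "ennreal 3 * ennreal (1 / (4 - 1)) = 1" by (subst ennreal_mult[symmetric]) simp_all
      have "ennreal 3 * T1 Y = (\<integral>\<^sup>+u. ennreal 3 * (w1 u * ennreal (\<Xi> (Y + real k * u / 2) u)) \<partial>lborel)"
        unfolding T1_def by (rule nn_integral_cmult[symmetric]) measurable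
      also have "\<dots> = (\<integral>\<^sup>+u. ennreal (\<Xi> (Y + real k * u / 2) u) * indicator {1..4} u \<partial>lborel)"
      proof (rule nn_integral_cong)
        fix u
        have "ennreal 3 * w1 u = indicator {1..4} u" using 3 by (simp add: w1_def indicator_def)
        then show "ennreal 3 * (w1 u * ennreal (\<Xi> (Y + real k * u / 2) u)) = ennreal (\<Xi> (Y + real k * u / 2) u) * indicator {1..4} u"
          by (simp only: mult.assoc[symmetric] mult.commute)
      qed
      finally show ?thesis by simp
    qed
    have e2: "strip_integral k (\<lambda>\<eta> z. \<Xi> (z + real k * \<eta> / 2) \<eta>) = ennreal k4 * T2"
    proof -
      have T2': "T2 = (\<integral>\<^sup>+\<eta>. (\<integral>\<^sup>+z. w2 (\<eta>, z) * ennreal (\<Xi> (z + real k * \<eta> / 2) \<eta>) \<partial>lborel) \<partial>lborel)"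
        unfolding T2_def by (subst lborel.nn_integral_fst[symmetric]) auto
      have "ennreal k4 * T2 = (\<integral>\<^sup>+\<eta>. (\<integral>\<^sup>+z. ennreal k4 * (w2 (\<eta>, z) * ennreal (\<Xi> (z + real k * \<eta> / 2) \<eta>)) \<partial>lborel) \<partial>lborel)"
        unfolding T2' w2_def by (simp add: nn_integral_cmult[symmetric])
      also have "\<dots> = (\<integral>\<^sup>+\<eta>. (\<integral>\<^sup>+z. (ennreal (\<Xi> (z + real k * \<eta> / 2) \<eta>) * indicator {1..1 + 2 * real k} z) * indicator {1 / real k..2} \<eta> \<partial>lborel) \<partial>lborel)"
      proof (intro nn_integral_cong)
        fix \<eta> z
        have c: "k4 * (1 / (2 - 1 / real k) * (1 / (1 + 2 * real k - 1))) = 1" using k0 k1 by (simp add: k4_def field_simps)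
        show "ennreal k4 * (w2 (\<eta>, z) * ennreal (\<Xi> (z + real k * \<eta> / 2) \<eta>)) = (ennreal (\<Xi> (z + real k * \<eta> / 2) \<eta>) * indicator {1..1 + 2 * real k} z) * indicator {1 / real k..2} \<eta>"
        proof (cases "z \<in> {1..1 + 2 * real k} \<and> \<eta> \<in> {1 / real k..2}")
          case True
          define A where "A = 1 / (2 - 1 / real k)"
          define B where "B = 1 / (1 + 2 * real k - 1)"
          have AB: "A \<ge> 0" "B \<ge> 0" "k4 * (A * B) = 1" using k0 k1 c by (auto simp: A_def B_def)
          have "w2 (\<eta>, z) = ennreal A * ennreal B" using True by (simp add: w2_def A_def B_def)
          moreover have "ennreal (k4 * (A * B)) = ennreal k4 * (ennreal A * ennreal B)" proof -
            have "k4 \<ge> 0" using k4 by simp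
            then show ?thesis using AB(1,2) by (subst ennreal_mult, simp_all, subst ennreal_mult, simp_all)
          qed
          ultimately have "ennreal k4 * w2 (\<eta>, z) = ennreal 1" using AB(3) by simp
          then show ?thesis using True c by (simp add: mult.assoc[symmetric])
        qed (auto simp: w2_def split: split_indicator)
      qed
      also have "\<dots> = strip_integral k (\<lambda>\<eta> z. \<Xi> (z + real k * \<eta> / 2) \<eta>)"
        by (simp add: nn_integral_multc)
      finally show ?thesis by simp
    qed
    have J2: "ennreal (\<theta> z) \<le> S2" if "ennreal z \<le> T2" for z
      unfolding S2_def by (rule modular_Jensen[OF \<theta> _ _ w2]) (use that in \<open>auto simp: T2_def \<Xi>_nonneg\<close>)
    have J1: "ennreal (\<theta> z) \<le> S1 Y" if "ennreal z \<le> T1 Y" for z Y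
      unfolding S1_def by (rule modular_Jensen[OF \<theta> _ _ w1]) (use that in \<open>auto simp: T1_def \<Xi>_nonneg\<close>)
    have pw: "ennreal (\<theta> (\<phi> (a - l * Y) ^ r * \<bar>F (a - l * Y) - poly P (a - l * Y)\<bar> / (2 * K))) \<le> S1 Y + S2" if Y: "Y \<in> {0..1}" for Y
    proof -
      define X0 where "X0 = \<phi> (a - l * Y) ^ r * \<bar>F (a - l * Y) - poly P (a - l * Y)\<bar>"
      have "ennreal X0 \<le> ennreal (5 ^ r * C1) * (ennreal 3 * T1 Y) + ennreal (5 ^ r * C2) * (ennreal k4 * T2)"
        unfolding X0_def using PY[OF Y] by (simp add: e1 e2)
      also have "\<dots> = ennreal (5 ^ r * C1 * 3) * T1 Y + ennreal (5 ^ r * C2 * k4) * T2"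
        using C_pos k4 by (simp add: ennreal_mult mult.assoc)
      \<comment> \<open>Bounding the sum by twice the maximum means that X0 / (2 K) lies below T1 or
        below T2, so one of the two Jensen estimates applies directly.\<close>
      also have "\<dots> \<le> ennreal K * max (T1 Y) T2 + ennreal K * max (T1 Y) T2"
      proof (intro add_mono mult_mono ennreal_leI)
        have "0 \<le> 5 ^ r * (k4 * C2)" "0 \<le> 5 ^ r * (3 * C1)" using C_pos k4 by auto
        then show "5 ^ r * C1 * 3 \<le> K" "5 ^ r * C2 * k4 \<le> K" unfolding K_def k4_def[symmetric] by (auto simp: algebra_simps)
      qed auto
      also have "\<dots> = ennreal (2 * K) * max (T1 Y) T2"
        using C_pos by (simp add: ennreal_mult mult_2[symmetric] mult.assoc)
      finally have "ennreal (1 / (2 * K)) * ennreal X0 \<le> ennreal (1 / (2 * K)) * (ennreal (2 * K) * max (T1 Y) T2)"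
        by (rule mult_left_mono) simp
      also have "\<dots> = max (T1 Y) T2" using C_pos by (simp add: mult.assoc[symmetric] ennreal_mult[symmetric])
      also have "ennreal (1 / (2 * K)) * ennreal X0 = ennreal (X0 / (2 * K))" using C_pos by (simp add: ennreal_mult'[symmetric])
      finally have "ennreal (X0 / (2 * K)) \<le> T1 Y \<or> ennreal (X0 / (2 * K)) \<le> T2" by (auto simp: max_def split: if_splits)
      then have "ennreal (\<theta> (X0 / (2 * K))) \<le> S1 Y \<or> ennreal (\<theta> (X0 / (2 * K))) \<le> S2" using J1 J2 by blast
      then show ?thesis unfolding X0_def by (auto intro: order_trans)
    qed
    have S2M: "S2 \<le> M"
    proof -
      have "S2 = (\<integral>\<^sup>+\<eta>. (\<integral>\<^sup>+z. w2 (\<eta>, z) * ennreal (\<theta> (\<Xi> (z + real k * \<eta> / 2) \<eta>)) \<partial>lborel) \<partial>lborel)"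
        unfolding S2_def by (subst lborel.nn_integral_fst[symmetric]) auto
      also have "\<dots> \<le> (\<integral>\<^sup>+\<eta>. (\<integral>\<^sup>+z. ennreal (\<theta> (\<Xi> (real k * \<eta> / 2 + 1 * z) \<eta>)) \<partial>lborel) \<partial>lborel)"
      proof (intro nn_integral_mono)
        fix \<eta> z
        have "w2 (\<eta>, z) \<le> 1 * 1" unfolding w2_def
        proof (intro mult_mono)
          have "1 \<le> 2 - 1 / real k" using k0 by (simp add: divide_le_eq)
          then show "ennreal (indicator {1 / real k..2} (fst (\<eta>, z)) / (2 - 1 / real k)) \<le> 1"
            by (auto split: split_indicator simp: divide_le_eq simp flip: ennreal_1 intro!: ennreal_leI)
          show "ennreal (indicator {1..1 + 2 * real k} (snd (\<eta>, z)) / (1 + 2 * real k - 1)) \<le> 1"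
            using k0 by (auto split: split_indicator simp: divide_le_eq simp flip: ennreal_1 intro!: ennreal_leI)
        qed auto
        then have "w2 (\<eta>, z) * ennreal (\<theta> (\<Xi> (z + real k * \<eta> / 2) \<eta>)) \<le> 1 * ennreal (\<theta> (\<Xi> (z + real k * \<eta> / 2) \<eta>))"
          by (intro mult_right_mono) auto
        then show "w2 (\<eta>, z) * ennreal (\<theta> (\<Xi> (z + real k * \<eta> / 2) \<eta>)) \<le> ennreal (\<theta> (\<Xi> (real k * \<eta> / 2 + 1 * z) \<eta>))" by (simp add: add.commute)
      qed
      also have "\<dots> = M" unfolding M_def
      proof (rule nn_integral_cong)
        fix \<eta>
        show "(\<integral>\<^sup>+z. ennreal (\<theta> (\<Xi> (real k * \<eta> / 2 + 1 * z) \<eta>)) \<partial>lborel) = (\<integral>\<^sup>+s. ennreal (\<theta> (\<Xi> s \<eta>)) \<partial>lborel)"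
          by (subst (2) nn_integral_real_affine[where c=1 and t="real k * \<eta> / 2"]) auto
      qed
      finally show ?thesis .
    qed
    have S1M: "(\<integral>\<^sup>+Y. S1 Y \<partial>lborel) \<le> M"
    proof -
      have "(\<integral>\<^sup>+Y. S1 Y \<partial>lborel) = (\<integral>\<^sup>+u. (\<integral>\<^sup>+Y. w1 u * ennreal (\<theta> (\<Xi> (Y + real k * u / 2) u)) \<partial>lborel) \<partial>lborel)"
        unfolding S1_def by (rule lborel_pair.Fubini') measurable
      also have "\<dots> \<le> (\<integral>\<^sup>+u. (\<integral>\<^sup>+Y. ennreal (\<theta> (\<Xi> (real k * u / 2 + 1 * Y) u)) \<partial>lborel) \<partial>lborel)"
      proof (intro nn_integral_mono)
        fix u Y
        have "w1 u \<le> 1" unfolding w1_def by (auto split: split_indicator simp flip: ennreal_1 intro!: ennreal_leI)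
        then have "w1 u * ennreal (\<theta> (\<Xi> (Y + real k * u / 2) u)) \<le> 1 * ennreal (\<theta> (\<Xi> (Y + real k * u / 2) u))"
          by (intro mult_right_mono) auto
        then show "w1 u * ennreal (\<theta> (\<Xi> (Y + real k * u / 2) u)) \<le> ennreal (\<theta> (\<Xi> (real k * u / 2 + 1 * Y) u))" by (simp add: add.commute)
      qed
      also have "\<dots> = M" unfolding M_def
      proof (rule nn_integral_cong)
        fix \<eta>
        show "(\<integral>\<^sup>+z. ennreal (\<theta> (\<Xi> (real k * \<eta> / 2 + 1 * z) \<eta>)) \<partial>lborel) = (\<integral>\<^sup>+s. ennreal (\<theta> (\<Xi> s \<eta>)) \<partial>lborel)"
          by (subst (2) nn_integral_real_affine[where c=1 and t="real k * \<eta> / 2"]) auto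
      qed
      finally show ?thesis .
    qed
    have "(\<integral>\<^sup>+x. ennreal (\<theta> (\<phi> x ^ r * \<bar>F x - poly P x\<bar> / (2 * K))) * indicator {a - l..a} x \<partial>lborel) =
      ennreal l * (\<integral>\<^sup>+Y. ennreal (\<theta> (\<phi> (a + (- l) * Y) ^ r * \<bar>F (a + (- l) * Y) - poly P (a + (- l) * Y)\<bar> / (2 * K))) * indicator {a - l..a} (a + (- l) * Y) \<partial>lborel)"
      using l0 by (subst nn_integral_real_affine[where c="- l" and t=a]) auto
    also have "\<dots> \<le> ennreal l * (\<integral>\<^sup>+Y. S1 Y + S2 * indicator {0..1} Y \<partial>lborel)"
    proof (intro mult_left_mono nn_integral_mono)
      fix Y
      show "ennreal (\<theta> (\<phi> (a + (- l) * Y) ^ r * \<bar>F (a + (- l) * Y) - poly P (a + (- l) * Y)\<bar> / (2 * K))) * indicator {a - l..a} (a + (- l) * Y) \<le> S1 Y + S2 * indicator {0..1} Y"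
      proof (cases "Y \<in> {0..1}")
        case False
        have "0 \<le> l * Y \<longleftrightarrow> 0 \<le> Y" "l * Y \<le> l * 1 \<longleftrightarrow> Y \<le> 1"
          using l0 by (simp add: zero_le_mult_iff, intro mult_le_cancel_left_pos)
        then have "a + (- l) * Y \<notin> {a - l..a}" using False by auto
        then show ?thesis by simp
      next
        case True
        then show ?thesis using pw[OF True] by (auto split: split_indicator)
      qed
    qed simp
    also have "\<dots> = ennreal l * ((\<integral>\<^sup>+Y. S1 Y \<partial>lborel) + S2)"
      by (simp add: nn_integral_add nn_integral_cmult_indicator)
    also have "\<dots> \<le> ennreal l * (M + M)" using S1M S2M by (intro mult_left_mono add_mono) auto
    also have "\<dots> = ennreal (2 * l) * M" using l0 by (simp add: ennreal_mult mult_2[symmetric] mult_ac)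
    also have "\<dots> \<le> ennreal (2 * l) * (ennreal ((2 + 4 * N) / (4 * \<delta> * l)) * (\<integral>\<^sup>+x. diff_integral \<theta> k r F t x * indicator {a - l * N..a - l / 2} x \<partial>lborel))"
      unfolding M_def by (intro mult_left_mono \<Xi>_modular_integral[OF \<theta>]) simp
    also have "\<dots> = ennreal ((2 * l) * ((2 + 4 * N) / (4 * \<delta> * l))) * (\<integral>\<^sup>+x. diff_integral \<theta> k r F t x * indicator {a - l * N..a - l / 2} x \<partial>lborel)"
      by (subst ennreal_mult[of "2 * l" "(2 + 4 * N) / (4 * \<delta> * l)"]) (use l0 N5 \<delta> in \<open>simp_all only: mult.assoc, auto\<close>)
    also have "(2 * l) * ((2 + 4 * N) / (4 * \<delta> * l)) = (2 + 4 * N) / (2 * \<delta>)" using l0 \<delta> by (simp add: field_simps)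
    finally show ?thesis .
  qed
  then show ?thesis using P by blast
qed

end

section \<open>Blending polynomials\<close>

lemma higher_pderiv_pcompose_shift:
  "(pderiv ^^ m) (pcompose p [:c, 1:]) = pcompose ((pderiv ^^ m) p) [:c, 1::real:]"
  by (induction m) (simp_all add: pderiv_pcompose pderiv_pCons)

lemma Lagrange_interpolation:
  fixes y :: "nat \<Rightarrow> real"
  assumes inj: "inj_on y {..<k}" and deg: "degree P < k"
  shows "P = (\<Sum>i<k. smult (poly P (y i)) (\<Prod>j\<in>{..<k} - {i}. smult (1 / (y i - y j)) [:- y j, 1:]))"
proof -
  define L where "L i = (\<Prod>j\<in>{..<k} - {i}. smult (1 / (y i - y j)) [:- y j, 1:])" for i
  have lin: "poly (smult c [:- u, 1:]) z = c * (z - u)" for c u z :: real by (simp add: algebra_simps)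
  have Lval: "poly (L i) (y m) = (if i = m then 1 else 0)" if "i < k" "m < k" for i m
  proof (cases "i = m")
    case True
    have "(\<Prod>j\<in>{..<k} - {i}. (1 / (y i - y j)) * (y m - y j)) = 1"
    proof (rule prod.neutral, rule ballI)
      fix j assume j: "j \<in> {..<k} - {i}"
      then have "y i \<noteq> y j" using inj that(1) by (auto simp: inj_on_def)
      then show "(1 / (y i - y j)) * (y m - y j) = 1" using True by simp
    qed
    then show ?thesis using True unfolding L_def poly_prod lin by simp
  next
    case False
    then have "m \<in> {..<k} - {i}" using that by auto
    then show ?thesis using False by (auto simp: L_def poly_prod intro!: prod_zero bexI[of _ m])
  qed
  have "degree (L i) \<le> k - 1" if "i < k" for i
  proof -
    have "degree (L i) \<le> (\<Sum>j\<in>{..<k} - {i}. degree (smult (1 / (y i - y j)) [:- y j, 1:]))"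
      unfolding L_def using degree_prod_sum_le[of "{..<k} - {i}" "\<lambda>j. smult (1 / (y i - y j)) [:- y j, 1:]"] by (simp add: o_def)
    also have "\<dots> \<le> (\<Sum>j\<in>{..<k} - {i}. 1)" by (intro sum_mono order_trans[OF degree_smult_le]) simp
    finally show ?thesis using that by simp
  qed
  then have dS: "degree (\<Sum>i<k. smult (poly P (y i)) (L i)) \<le> k - 1"
    by (intro degree_sum_le) (auto intro: order_trans[OF degree_smult_le])
  define R where "R = P - (\<Sum>i<k. smult (poly P (y i)) (L i))"
  have "degree R < k" unfolding R_def using deg dS by (intro degree_diff_less) auto
  moreover have "poly R (y m) = 0" if "m < k" for m
    using that by (simp add: R_def poly_sum Lval if_distrib cong: if_cong)
  ultimately have "R = 0"
  proof -
    assume dR: "degree R < k" and z: "\<And>m. m < k \<Longrightarrow> poly R (y m) = 0"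
    show "R = 0"
    proof (rule ccontr)
      assume "R \<noteq> 0"
      have "card (y ` {..<k}) \<le> card {x. poly R x = 0}" using z poly_roots_finite[OF \<open>R \<noteq> 0\<close>] by (intro card_mono) auto
      also have "\<dots> \<le> degree R" by (rule card_poly_roots_bound[OF \<open>R \<noteq> 0\<close>])
      finally show False using dR inj by (simp add: card_image)
    qed
  qed
  then show ?thesis unfolding R_def L_def by simp
qed

text \<open>A Markov-type inequality with an integral on the right. Interpolation at k equidistant
  nodes expresses every derivative by k point values; averaging over shifts of the nodes replaces
  these by integrals.\<close>

lemma pderiv_bound_unit:
  fixes k :: nat assumes k: "k \<ge> 1"
  shows "\<exists>M>0. \<forall>P :: real poly. degree P < k \<longrightarrow> (\<forall>m\<le>k. \<forall>x\<in>{0..1}.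
    ennreal \<bar>poly ((pderiv ^^ m) P) x\<bar> \<le> ennreal M * (\<integral>\<^sup>+y. ennreal \<bar>poly P y\<bar> * indicator {0..1} y \<partial>lborel))"
proof -
  have k0: "real k \<ge> 1" using k by simp
  define y where "y i = real i / real k" for i :: nat
  have inj: "inj_on y {..<k}" using k by (auto simp: inj_on_def y_def)
  define L where "L i = (\<Prod>j\<in>{..<k} - {i}. smult (1 / (y i - y j)) [:- y j, 1:])" for i
  have "\<exists>B. \<forall>x\<in>{-1..1}. \<bar>poly ((pderiv ^^ m) (L i)) x\<bar> \<le> B" for m i
  proof -
    have "compact ((\<lambda>x. poly ((pderiv ^^ m) (L i)) x) ` {-1..1})" by (intro compact_continuous_image continuous_intros) auto
    then have "bounded ((\<lambda>x. poly ((pderiv ^^ m) (L i)) x) ` {-1..1})" by (rule compact_imp_bounded)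
    then show ?thesis unfolding bounded_iff by auto
  qed
  then obtain B where B: "\<And>m i x. x \<in> {-1..1} \<Longrightarrow> \<bar>poly ((pderiv ^^ m) (L i)) x\<bar> \<le> B m i" by metis
  define M where "M = 1 + (\<Sum>m\<le>k. \<Sum>i<k. \<bar>B m i\<bar>)"
  have M: "M > 0" unfolding M_def by (intro add_pos_nonneg sum_nonneg) auto
  have BM: "B m i \<le> M" if "m \<le> k" "i < k" for m i
  proof -
    have "\<bar>B m i\<bar> \<le> (\<Sum>i<k. \<bar>B m i\<bar>)" using that by (intro member_le_sum) auto
    also have "\<dots> \<le> (\<Sum>m\<le>k. \<Sum>i<k. \<bar>B m i\<bar>)" using that by (intro member_le_sum[of m "{..k}" "\<lambda>m. \<Sum>i<k. \<bar>B m i\<bar>"]) (auto intro: sum_nonneg)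
    finally show ?thesis by (simp add: M_def)
  qed
  have "ennreal \<bar>poly ((pderiv ^^ m) P) x\<bar> \<le> ennreal (M * real k * real k) * (\<integral>\<^sup>+y. ennreal \<bar>poly P y\<bar> * indicator {0..1} y \<partial>lborel)"
    if P: "degree P < k" and m: "m \<le> k" and x: "x \<in> {0..1}" for P :: "real poly" and m x
  proof -
    have pv: "\<bar>poly ((pderiv ^^ m) P) x\<bar> \<le> (\<Sum>i<k. M * \<bar>poly P ((real i + v) / real k)\<bar>)" if v: "v \<in> {0..1}" for v
    proof -
      \<comment> \<open>The polynomial is shifted instead of the nodes: a single Lagrange basis then
        serves all v, and the evaluation point moves within [-1,1], where the basis is
        bounded.\<close>
      define Pv where "Pv = pcompose P [:v / real k, 1:]"
      have dPv: "degree Pv < k" unfolding Pv_def using P by (simp add: degree_pcompose)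
      have vk: "0 \<le> v / real k" "v / real k \<le> 1" using v k0 by (auto simp: divide_le_eq)
      define z where "z = x - v / real k"
      have z: "z \<in> {-1..1}" using x vk by (auto simp: z_def)
      have ev: "Pv = (\<Sum>i<k. smult (poly Pv (y i)) (L i))" unfolding L_def by (rule Lagrange_interpolation[OF inj dPv])
      have Pvy: "poly Pv (y i) = poly P ((real i + v) / real k)" for i
        by (simp add: Pv_def poly_pcompose y_def add_divide_distrib add.commute)
      have "poly ((pderiv ^^ m) P) x = poly ((pderiv ^^ m) Pv) z"
        unfolding Pv_def higher_pderiv_pcompose_shift by (simp add: poly_pcompose z_def)
      also have "(pderiv ^^ m) Pv = (\<Sum>i<k. smult (poly Pv (y i)) ((pderiv ^^ m) (L i)))"
      proof -
        have "(pderiv ^^ m) (\<Sum>i<k. smult (c i) (L i)) = (\<Sum>i<k. smult (c i) ((pderiv ^^ m) (L i)))" for c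
          by (simp add: higher_pderiv_sum higher_pderiv_smult)
        then show ?thesis using ev by metis
      qed
      finally have "\<bar>poly ((pderiv ^^ m) P) x\<bar> = \<bar>\<Sum>i<k. poly P ((real i + v) / real k) * poly ((pderiv ^^ m) (L i)) z\<bar>"
        by (simp add: poly_sum Pvy)
      also have "\<dots> \<le> (\<Sum>i<k. \<bar>poly P ((real i + v) / real k) * poly ((pderiv ^^ m) (L i)) z\<bar>)" by (rule sum_abs)
      also have "\<dots> \<le> (\<Sum>i<k. M * \<bar>poly P ((real i + v) / real k)\<bar>)"
      proof (rule sum_mono)
        fix i assume "i \<in> {..<k}"
        then have "\<bar>poly ((pderiv ^^ m) (L i)) z\<bar> \<le> M" using B[OF z, of m i] BM[OF m, of i] by simp
        from mult_right_mono[OF this, of "\<bar>poly P ((real i + v) / real k)\<bar>"]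
        show "\<bar>poly P ((real i + v) / real k) * poly ((pderiv ^^ m) (L i)) z\<bar> \<le> M * \<bar>poly P ((real i + v) / real k)\<bar>"
          by (simp add: abs_mult mult.commute)
      qed
      finally show ?thesis .
    qed
    \<comment> \<open>As v runs through [0,1], the point (i + v)/k runs through the i-th subinterval
      of length 1/k, so each of the k values becomes at most k times the integral over
      [0,1].\<close>
    have "ennreal \<bar>poly ((pderiv ^^ m) P) x\<bar> = (\<integral>\<^sup>+v. ennreal \<bar>poly ((pderiv ^^ m) P) x\<bar> * indicator {0..1::real} v \<partial>lborel)"
      by (simp add: nn_integral_cmult_indicator)
    also have "\<dots> \<le> (\<integral>\<^sup>+v. (\<Sum>i<k. ennreal M * (ennreal \<bar>poly P (real i / real k + (1 / real k) * v)\<bar> * indicator {0..1} (real i / real k + (1 / real k) * v))) \<partial>lborel)"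
    proof (rule nn_integral_mono)
      fix v :: real
      show "ennreal \<bar>poly ((pderiv ^^ m) P) x\<bar> * indicator {0..1} v \<le> (\<Sum>i<k. ennreal M * (ennreal \<bar>poly P (real i / real k + (1 / real k) * v)\<bar> * indicator {0..1} (real i / real k + (1 / real k) * v)))"
      proof (cases "v \<in> {0..1}")
        case True
        have "ennreal \<bar>poly ((pderiv ^^ m) P) x\<bar> \<le> ennreal (\<Sum>i<k. M * \<bar>poly P ((real i + v) / real k)\<bar>)" by (rule ennreal_leI[OF pv[OF True]])
        also have "\<dots> = (\<Sum>i<k. ennreal M * ennreal \<bar>poly P ((real i + v) / real k)\<bar>)"
          using M by (simp add: sum_ennreal[symmetric] ennreal_mult)
        also have "\<dots> = (\<Sum>i<k. ennreal M * (ennreal \<bar>poly P (real i / real k + (1 / real k) * v)\<bar> * indicator {0..1} (real i / real k + (1 / real k) * v)))"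
        proof (rule sum.cong[OF refl])
          fix i assume "i \<in> {..<k}"
          then have "real i + 1 \<le> real k" by (metis lessThan_iff Suc_leI of_nat_Suc of_nat_le_iff add.commute)
          then have "(real i + v) / real k \<in> {0..1}" using True k0 by (auto simp: divide_le_eq)
          moreover have "real i / real k + (1 / real k) * v = (real i + v) / real k" by (simp add: add_divide_distrib)
          ultimately show "ennreal M * ennreal \<bar>poly P ((real i + v) / real k)\<bar> = ennreal M * (ennreal \<bar>poly P (real i / real k + (1 / real k) * v)\<bar> * indicator {0..1} (real i / real k + (1 / real k) * v))"
            by simp
        qed
        finally show ?thesis using True by simp
      qed simp
    qed
    also have "\<dots> = (\<Sum>i<k. ennreal M * (\<integral>\<^sup>+v. (ennreal \<bar>poly P (real i / real k + (1 / real k) * v)\<bar> * indicator {0..1} (real i / real k + (1 / real k) * v)) \<partial>lborel))"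
      by (simp add: nn_integral_sum nn_integral_cmult)
    also have "\<dots> = (\<Sum>i<k. ennreal M * (ennreal (real k) * (\<integral>\<^sup>+y. ennreal \<bar>poly P y\<bar> * indicator {0..1} y \<partial>lborel)))"
    proof (rule sum.cong[OF refl])
      fix i
      have "(\<integral>\<^sup>+y. ennreal \<bar>poly P y\<bar> * indicator {0..1} y \<partial>lborel) = ennreal (1 / real k) * (\<integral>\<^sup>+v. (ennreal \<bar>poly P (real i / real k + (1 / real k) * v)\<bar> * indicator {0..1} (real i / real k + (1 / real k) * v)) \<partial>lborel)"
        using k by (subst nn_integral_real_affine[where c="1 / real k" and t="real i / real k"]) auto
      then have "ennreal (real k) * (\<integral>\<^sup>+y. ennreal \<bar>poly P y\<bar> * indicator {0..1} y \<partial>lborel) = (ennreal (real k) * ennreal (1 / real k)) * (\<integral>\<^sup>+v. (ennreal \<bar>poly P (real i / real k + (1 / real k) * v)\<bar> * indicator {0..1} (real i / real k + (1 / real k) * v)) \<partial>lborel)"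
        by (simp add: mult.assoc)
      moreover have "ennreal (real k) * ennreal (1 / real k) = 1" using k by (subst ennreal_mult[symmetric]) auto
      ultimately show "ennreal M * (\<integral>\<^sup>+v. (ennreal \<bar>poly P (real i / real k + (1 / real k) * v)\<bar> * indicator {0..1} (real i / real k + (1 / real k) * v)) \<partial>lborel)
        = ennreal M * (ennreal (real k) * (\<integral>\<^sup>+y. ennreal \<bar>poly P y\<bar> * indicator {0..1} y \<partial>lborel))" by simp
    qed
    also have "\<dots> = ennreal (M * real k * real k) * (\<integral>\<^sup>+y. ennreal \<bar>poly P y\<bar> * indicator {0..1} y \<partial>lborel)"
      using M by (simp add: ennreal_mult ennreal_of_nat_eq_real_of_nat mult_ac)
    finally show ?thesis .
  qed
  moreover have "M * real k * real k > 0" using M k0 by simp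
  ultimately show ?thesis by blast
qed

lemma higher_pderiv_affine:
  "poly ((pderiv ^^ m) (pcompose p [:c, d:])) x = d ^ m * poly ((pderiv ^^ m) p) (c + d * x)" for d :: real
proof -
  have "(pderiv ^^ m) (pcompose p [:c, d:]) = smult (d ^ m) (pcompose ((pderiv ^^ m) p) [:c, d:])"
    by (induction m) (simp_all add: pderiv_pcompose pderiv_pCons pderiv_smult mult.commute)
  then show ?thesis by (simp add: poly_pcompose mult.commute)
qed

lemma pderiv_bound:
  fixes k :: nat assumes k: "k \<ge> 1"
  obtains M where "M > 0" "\<And>P m \<alpha> \<beta> x. degree P < k \<Longrightarrow> m \<le> k \<Longrightarrow> \<alpha> < \<beta> \<Longrightarrow> x \<in> {\<alpha>..\<beta>} \<Longrightarrow>
    ennreal ((\<beta> - \<alpha>) ^ m * \<bar>poly ((pderiv ^^ m) P) x\<bar>) \<le> ennreal (M / (\<beta> - \<alpha>)) * (\<integral>\<^sup>+y. ennreal \<bar>poly P y\<bar> * indicator {\<alpha>..\<beta>} y \<partial>lborel)"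
proof -
  obtain M where M: "M > 0" "\<And>P m x. degree P < k \<Longrightarrow> m \<le> k \<Longrightarrow> x \<in> {0..1} \<Longrightarrow>
    ennreal \<bar>poly ((pderiv ^^ m) P) x\<bar> \<le> ennreal M * (\<integral>\<^sup>+y. ennreal \<bar>poly P y\<bar> * indicator {0..1} y \<partial>lborel)"
    using pderiv_bound_unit[OF k] by blast
  show ?thesis
  proof
    show "M > 0" by (rule M)
    fix P :: "real poly" and m :: nat and \<alpha> \<beta> x :: real
    assume P: "degree P < k" and m: "m \<le> k" and ab: "\<alpha> < \<beta>" and x: "x \<in> {\<alpha>..\<beta>}"
    define d where "d = \<beta> - \<alpha>"
    have d: "d > 0" using ab by (simp add: d_def)
    define z where "z = (x - \<alpha>) / d"
    have z: "z \<in> {0..1}" "\<alpha> + d * z = x" using x d by (auto simp: z_def d_def)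
    let ?P = "pcompose P [:\<alpha>, d:]"
    have "degree ?P < k" using P d by (simp add: degree_pcompose)
    from M(2)[OF this m z(1)]
    have "ennreal (d ^ m * \<bar>poly ((pderiv ^^ m) P) x\<bar>) \<le> ennreal M * (\<integral>\<^sup>+y. ennreal \<bar>poly P (\<alpha> + d * y)\<bar> * indicator {0..1} y \<partial>lborel)"
      using d by (simp add: higher_pderiv_affine z(2) abs_mult poly_pcompose mult.commute)
    also have "(\<integral>\<^sup>+y. ennreal \<bar>poly P (\<alpha> + d * y)\<bar> * indicator {0..1} y \<partial>lborel) = (\<integral>\<^sup>+y. ennreal \<bar>poly P (\<alpha> + d * y)\<bar> * indicator {\<alpha>..\<beta>} (\<alpha> + d * y) \<partial>lborel)"
    proof (rule nn_integral_cong)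
      fix y
      have "0 \<le> d * y \<longleftrightarrow> 0 \<le> y" "d * y \<le> d * 1 \<longleftrightarrow> y \<le> 1"
        using d by (simp add: zero_le_mult_iff, intro mult_le_cancel_left_pos)
      then show "ennreal \<bar>poly P (\<alpha> + d * y)\<bar> * indicator {0..1} y = ennreal \<bar>poly P (\<alpha> + d * y)\<bar> * indicator {\<alpha>..\<beta>} (\<alpha> + d * y)"
        by (auto simp: d_def split: split_indicator)
    qed
    also have "\<dots> = ennreal (1 / d) * (\<integral>\<^sup>+y. ennreal \<bar>poly P y\<bar> * indicator {\<alpha>..\<beta>} y \<partial>lborel)"
    proof -
      have "(\<integral>\<^sup>+y. ennreal \<bar>poly P y\<bar> * indicator {\<alpha>..\<beta>} y \<partial>lborel) = ennreal d * (\<integral>\<^sup>+y. ennreal \<bar>poly P (\<alpha> + d * y)\<bar> * indicator {\<alpha>..\<beta>} (\<alpha> + d * y) \<partial>lborel)"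
        using d by (subst nn_integral_real_affine[where c=d and t=\<alpha>]) auto
      moreover have "ennreal (1 / d) * ennreal d = 1" using d by (subst ennreal_mult[symmetric]) auto
      ultimately show ?thesis by (simp add: mult.assoc[symmetric])
    qed
    also have "ennreal M * (ennreal (1 / d) * (\<integral>\<^sup>+y. ennreal \<bar>poly P y\<bar> * indicator {\<alpha>..\<beta>} y \<partial>lborel)) = ennreal (M / d) * (\<integral>\<^sup>+y. ennreal \<bar>poly P y\<bar> * indicator {\<alpha>..\<beta>} y \<partial>lborel)"
    proof -
      have "ennreal (M / d) = ennreal (M * (1 / d))" by simp
      also have "\<dots> = ennreal M * ennreal (1 / d)" using M d by (intro ennreal_mult) auto
      finally show ?thesis by (simp add: mult.assoc)
    qed
    finally show "ennreal ((\<beta> - \<alpha>) ^ m * \<bar>poly ((pderiv ^^ m) P) x\<bar>) \<le> ennreal (M / (\<beta> - \<alpha>)) * (\<integral>\<^sup>+y. ennreal \<bar>poly P y\<bar> * indicator {\<alpha>..\<beta>} y \<partial>lborel)"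
      by (simp add: d_def)
  qed
qed

text \<open>A spline step of class \<open>C\<^sup>k\<close>; \<open>sstep k m\<close> is its \<open>m\<close>-th derivative.\<close>
definition sstep :: "nat \<Rightarrow> nat \<Rightarrow> real \<Rightarrow> real" where
  "sstep k m x = real (Suc k) ^ m / fact (Suc k - m) *
     (\<Sum>i\<le>Suc k. (-1) ^ i * real (Suc k choose i) * tpow (Suc k - m) (real (Suc k) * x - real i))"

section \<open>Smoothness and end behaviour of the spline step and of blends\<close>

lemma DERIV_tpow2: "(tpow (Suc (Suc n)) has_real_derivative (real (Suc (Suc n)) * tpow (Suc n) x)) (at x)"
proof (cases "x = 0")
  case False then show ?thesis by (rule DERIV_tpow)
next
  case True
  have "((\<lambda>h. tpow (Suc n) h) \<longlongrightarrow> tpow (Suc n) 0) (at 0)"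
    using continuous_on_tpow[of UNIV n] by (simp add: continuous_on_eq_continuous_at isCont_def)
  then have lim: "((\<lambda>h. tpow (Suc n) h) \<longlongrightarrow> 0) (at 0)" by (simp add: tpow_def)
  have "((\<lambda>h. (tpow (Suc (Suc n)) (0 + h) - tpow (Suc (Suc n)) 0) / h) \<longlongrightarrow> 0) (at 0)"
  proof (rule Lim_transform_eventually[OF lim])
    show "\<forall>\<^sub>F h in at 0. tpow (Suc n) h = (tpow (Suc (Suc n)) (0 + h) - tpow (Suc (Suc n)) 0) / h"
      by (auto simp: eventually_at_filter tpow_def)
  qed
  then show ?thesis unfolding DERIV_def True by (simp add: tpow_def)
qed

lemma DERIV_sstep: "m < k \<Longrightarrow> (sstep k m has_real_derivative sstep k (Suc m) x) (at x)"
proof -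
  assume m: "m < k"
  then obtain n where n: "Suc k - m = Suc (Suc n)" "Suc k - Suc m = Suc n" by (metis Suc_diff_Suc Suc_diff_le diff_Suc_Suc less_imp_le)
  let ?K = "real (Suc k)"
  have D: "((\<lambda>x. tpow (Suc (Suc n)) (?K * x - real i)) has_real_derivative (real (Suc (Suc n)) * tpow (Suc n) (?K * x - real i)) * ?K) (at x)" for i
    by (rule DERIV_chain2[OF DERIV_tpow2]) (auto intro!: derivative_eq_intros)
  have "((\<lambda>x. ?K ^ m / fact (Suc (Suc n)) * (\<Sum>i\<le>Suc k. (-1) ^ i * real (Suc k choose i) * tpow (Suc (Suc n)) (?K * x - real i))) has_real_derivative
     ?K ^ m / fact (Suc (Suc n)) * (\<Sum>i\<le>Suc k. (-1) ^ i * real (Suc k choose i) * ((real (Suc (Suc n)) * tpow (Suc n) (?K * x - real i)) * ?K))) (at x)"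
    by (intro DERIV_cmult DERIV_sum D)
  moreover have "?K ^ m / fact (Suc (Suc n)) * (\<Sum>i\<le>Suc k. (-1) ^ i * real (Suc k choose i) * ((real (Suc (Suc n)) * tpow (Suc n) (?K * x - real i)) * ?K)) = sstep k (Suc m) x"
  proof -
    have "(\<Sum>i\<le>Suc k. (-1) ^ i * real (Suc k choose i) * ((real (Suc (Suc n)) * tpow (Suc n) (?K * x - real i)) * ?K)) =
      (real (Suc (Suc n)) * ?K) * (\<Sum>i\<le>Suc k. (-1) ^ i * real (Suc k choose i) * tpow (Suc n) (?K * x - real i))"
      unfolding sum_distrib_left by (intro sum.cong) (auto simp only: mult_ac)
    moreover have "?K ^ m / fact (Suc (Suc n)) * (real (Suc (Suc n)) * ?K) = ?K ^ Suc m / fact (Suc n)"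
      by (simp add: fact_Suc[of "Suc n"] del: of_nat_Suc fact_Suc)
    ultimately show ?thesis unfolding sstep_def n by (simp only: mult.assoc[symmetric])
  qed
  ultimately show ?thesis unfolding sstep_def[abs_def] n by simp
qed

lemma continuous_on_sstep: "m \<le> k \<Longrightarrow> continuous_on S (sstep k m)"
proof -
  assume "m \<le> k"
  then obtain n where n: "Suc k - m = Suc n" by (metis Suc_diff_le)
  show ?thesis unfolding sstep_def[abs_def] n by (intro continuous_intros continuous_on_compose2[OF continuous_on_tpow]) auto
qed

lemma sstep_le_0: "x \<le> 0 \<Longrightarrow> sstep k m x = 0"
proof -
  assume "x \<le> 0"
  then have "real (Suc k) * x - real i \<le> 0" for i using mult_nonneg_nonpos[of "real (Suc k)" x] by (simp del: of_nat_Suc)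
  then have "tpow (Suc k - m) (real (Suc k) * x - real i) = 0" for i by (simp add: tpow_def not_less del: of_nat_Suc)
  then show ?thesis by (simp add: sstep_def)
qed

text \<open>Beyond 1 no power is truncated, and the sum is up to sign a difference of order k + 1 of
  a power of degree k + 1 - m: it vanishes for m > 0, and for m = 0 it equals
  \<open>fact (Suc k)\<close>, which the prefactor cancels.\<close>

lemma sstep_ge_1:
  assumes x: "x \<ge> 1" and m: "m \<le> k"
  shows "sstep k m x = (if m = 0 then 1 else 0)"
proof -
  let ?K = "real (Suc k)"
  obtain n where n: "Suc k - m = Suc n" using m by (metis Suc_diff_le)
  have "(\<Sum>i\<le>Suc k. (-1) ^ i * real (Suc k choose i) * tpow (Suc k - m) (?K * x - real i)) =
     (\<Sum>i\<le>Suc k. (-1) ^ i * real (Suc k choose i) * ((-1) ^ Suc n * (- (?K * x) + (0 + real i * 1)) ^ Suc n))"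
  proof (intro sum.cong refl)
    fix i assume "i \<in> {..Suc k}"
    then have "real i \<le> ?K" by (simp del: of_nat_Suc)
    also have "?K * 1 \<le> ?K * x" using x by (intro mult_left_mono) auto
    finally have "0 \<le> ?K * x - real i" by simp
    \<comment> \<open>\<open>m \<le> k\<close> makes the exponent positive, so truncated and full
      power also agree at the argument 0.\<close>
    then have "tpow (Suc n) (?K * x - real i) = (?K * x - real i) ^ Suc n" by (auto simp: tpow_def)
    also have "\<dots> = ((-1) * (- (?K * x) + (0 + real i * 1))) ^ Suc n" by (rule arg_cong[where f="\<lambda>z. z ^ Suc n"]) simp
    also have "\<dots> = (-1) ^ Suc n * (- (?K * x) + (0 + real i * 1)) ^ Suc n" by (rule power_mult_distrib)
    finally show "(-1) ^ i * real (Suc k choose i) * tpow (Suc k - m) (?K * x - real i) =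
      (-1) ^ i * real (Suc k choose i) * ((-1) ^ Suc n * (- (?K * x) + (0 + real i * 1)) ^ Suc n)" by (simp only: n)
  qed
  also have "\<dots> = (-1) ^ Suc n * (-1) ^ Suc k * fdiff (Suc k) 1 (\<lambda>z. (- (?K * x) + z) ^ Suc n) 0"
    unfolding fdiff_def sum_distrib_left
  proof (intro sum.cong refl)
    fix i assume "i \<in> {..Suc k}"
    then have i: "i \<le> Suc k" by simp
    have "(-1::real) ^ Suc k * (-1) ^ (Suc k - i) = (-1) ^ (i + (Suc k - i)) * (-1) ^ (Suc k - i)" using i by simp
    also have "\<dots> = (-1) ^ i * ((-1) * (-1)) ^ (Suc k - i)" by (simp only: power_add power_mult_distrib mult.assoc)
    finally have s: "(-1::real) ^ Suc k * (-1) ^ (Suc k - i) = (-1) ^ i" by simp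
    have "(-1) ^ Suc n * (-1) ^ Suc k * ((-1) ^ (Suc k - i) * real (Suc k choose i) * (- (?K * x) + (0 + real i * 1)) ^ Suc n)
       = ((-1) ^ Suc k * (-1) ^ (Suc k - i)) * real (Suc k choose i) * ((-1) ^ Suc n * (- (?K * x) + (0 + real i * 1)) ^ Suc n)"
      by (simp only: mult_ac)
    then show "(-1) ^ i * real (Suc k choose i) * ((-1) ^ Suc n * (- (?K * x) + (0 + real i * 1)) ^ Suc n) =
      (-1) ^ Suc n * (-1) ^ Suc k * ((-1) ^ (Suc k - i) * real (Suc k choose i) * (- (?K * x) + (0 + real i * 1)) ^ Suc n)"
      by (simp only: s)
  qed
  also have "fdiff (Suc k) 1 (\<lambda>z. (- (?K * x) + z) ^ Suc n) 0 = (if Suc n = Suc k then fact (Suc k) * 1 ^ Suc k else 0)"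
    using n by (intro fdiff_power) auto
  finally have eq: "(\<Sum>i\<le>Suc k. (-1) ^ i * real (Suc k choose i) * tpow (Suc k - m) (?K * x - real i)) =
    (-1) ^ Suc n * (-1) ^ Suc k * (if Suc n = Suc k then fact (Suc k) * 1 ^ Suc k else 0)" .
  show ?thesis
  proof (cases "m = 0")
    case True
    then have "Suc n = Suc k" using n by simp
    then have "(-1::real) ^ Suc n * (-1) ^ Suc k = 1" by (simp flip: power_mult_distrib)
    then show ?thesis unfolding sstep_def eq using True \<open>Suc n = Suc k\<close> by (simp del: fact_Suc)
  next
    case False
    then have "Suc n \<noteq> Suc k" using n m by auto
    then show ?thesis unfolding sstep_def eq using False by simp
  qed
qed

lemma sstep_bounded:
  obtains B where "B \<ge> 1" "\<And>m x. m \<le> k \<Longrightarrow> x \<in> {0..1} \<Longrightarrow> \<bar>sstep k m x\<bar> \<le> B"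
proof -
  have "\<exists>B. \<forall>x\<in>{0..1}. \<bar>sstep k m x\<bar> \<le> B" if "m \<le> k" for m
  proof -
    have "compact (sstep k m ` {0..1})" by (intro compact_continuous_image continuous_on_sstep that) auto
    then have "bounded (sstep k m ` {0..1})" by (rule compact_imp_bounded)
    then show ?thesis unfolding bounded_iff by auto
  qed
  then have "\<forall>m\<in>{..k}. \<exists>B. \<forall>x\<in>{0..1}. \<bar>sstep k m x\<bar> \<le> B" by auto
  from bchoice[OF this] obtain B where B0: "\<forall>m\<in>{..k}. \<forall>x\<in>{0..1}. \<bar>sstep k m x\<bar> \<le> B m" by (rule exE)
  have B: "\<bar>sstep k m x\<bar> \<le> B m" if "m \<le> k" "x \<in> {0..1}" for m x using B0 that by auto
  show ?thesis
  proof (rule that[of "1 + (\<Sum>m\<le>k. \<bar>B m\<bar>)"])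
    show "1 \<le> 1 + (\<Sum>m\<le>k. \<bar>B m\<bar>)" by (simp add: sum_nonneg)
    fix m and x :: real assume m: "m \<le> k" and x: "x \<in> {0..1}"
    have "\<bar>B m\<bar> \<le> (\<Sum>m\<le>k. \<bar>B m\<bar>)" using m by (intro member_le_sum) auto
    then show "\<bar>sstep k m x\<bar> \<le> 1 + (\<Sum>m\<le>k. \<bar>B m\<bar>)" using B[OF m x] by linarith
  qed
qed

lemma ennreal_mult3: "0 \<le> a \<Longrightarrow> 0 \<le> b \<Longrightarrow> 0 \<le> c \<Longrightarrow> ennreal (a * b * c) * J = ennreal a * (ennreal b * (ennreal c * J))"
  by (simp add: ennreal_mult mult.assoc)

lemma sum_telescope_step:
  fixes p :: "nat \<Rightarrow> real"
  assumes "i \<in> {1..n-1}"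
  shows "p 1 + (\<Sum>j\<in>{1..<i}. p (Suc j) - p j) = p i"
  using assms by (simp add: sum_Suc_diff' atLeastLessThanSuc_atLeastAtMost)

text \<open>The \<open>m\<close>-th derivative of \<open>poly q x * sstep k 0 ((x - \<alpha>) / d)\<close>, by the Leibniz rule.\<close>
definition blend :: "nat \<Rightarrow> real poly \<Rightarrow> real \<Rightarrow> real \<Rightarrow> nat \<Rightarrow> real \<Rightarrow> real" where
  "blend k q \<alpha> d m x = (\<Sum>l\<le>m. real (m choose l) * (poly ((pderiv ^^ l) q) x * ((1 / d) ^ (m - l) * sstep k (m - l) ((x - \<alpha>) / d))))"

lemma DERIV_blend:
  assumes m: "m < k" and d: "d > 0"
  shows "(blend k q \<alpha> d m has_real_derivative blend k q \<alpha> d (Suc m) x) (at x)"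
proof -
  define u where "u l = poly ((pderiv ^^ l) q) x" for l
  define v where "v l = (1 / d) ^ l * sstep k l ((x - \<alpha>) / d)" for l
  have Du: "((\<lambda>x. poly ((pderiv ^^ l) q) x) has_real_derivative u (Suc l)) (at x)" for l
    unfolding u_def by (auto intro!: derivative_eq_intros)
  have Dv: "((\<lambda>x. (1 / d) ^ l * sstep k l ((x - \<alpha>) / d)) has_real_derivative v (Suc l)) (at x)" if "l < k" for l
  proof -
    have "((\<lambda>x. (x - \<alpha>) / d) has_real_derivative (1 / d)) (at x)" using d by (auto intro!: derivative_eq_intros)
    from DERIV_cmult[OF DERIV_chain2[OF DERIV_sstep[OF that] this], of "(1 / d) ^ l"]
    show ?thesis by (rule DERIV_cong) (simp add: v_def)
  qed
  have "(blend k q \<alpha> d m has_real_derivative (\<Sum>l\<le>m. real (m choose l) * (u (Suc l) * v (m - l) + v (Suc (m - l)) * u l))) (at x)"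
    unfolding blend_def[abs_def]
  proof (rule DERIV_sum)
    fix l assume "l \<in> {..m}"
    then have "m - l < k" using m by simp
    from DERIV_cmult[OF DERIV_mult[OF Du[of l] Dv[OF this]], of "real (m choose l)"]
    show "((\<lambda>x. real (m choose l) * (poly ((pderiv ^^ l) q) x * ((1 / d) ^ (m - l) * sstep k (m - l) ((x - \<alpha>) / d)))) has_real_derivative
      real (m choose l) * (u (Suc l) * v (m - l) + v (Suc (m - l)) * u l)) (at x)" by (simp add: u_def v_def)
  qed
  moreover have "(\<Sum>l\<le>m. real (m choose l) * (u (Suc l) * v (m - l) + v (Suc (m - l)) * u l)) = blend k q \<alpha> d (Suc m) x"
  proof -
    have "blend k q \<alpha> d (Suc m) x = (\<Sum>l\<le>Suc m. real (Suc m choose l) * (u l * v (Suc m - l)))"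
      by (simp add: blend_def u_def v_def)
    also have "\<dots> = u 0 * v (Suc m) + (\<Sum>l\<le>m. real (Suc m choose Suc l) * (u (Suc l) * v (m - l)))"
      by (subst sum.atMost_Suc_shift) simp
    also have "(\<Sum>l\<le>m. real (Suc m choose Suc l) * (u (Suc l) * v (m - l))) =
      (\<Sum>l\<le>m. real (m choose l) * (u (Suc l) * v (m - l))) + (\<Sum>l\<le>m. real (m choose Suc l) * (u (Suc l) * v (m - l)))"
      by (simp add: sum.distrib[symmetric] distrib_right)
    also have "u 0 * v (Suc m) + ((\<Sum>l\<le>m. real (m choose l) * (u (Suc l) * v (m - l))) + (\<Sum>l\<le>m. real (m choose Suc l) * (u (Suc l) * v (m - l)))) =
      (\<Sum>l\<le>m. real (m choose l) * (u (Suc l) * v (m - l))) + (\<Sum>l\<le>Suc m. real (m choose l) * (u l * v (Suc m - l)))"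
    proof -
      have "(\<Sum>l\<le>Suc m. real (m choose l) * (u l * v (Suc m - l))) = u 0 * v (Suc m) + (\<Sum>l\<le>m. real (m choose Suc l) * (u (Suc l) * v (m - l)))"
        by (subst sum.atMost_Suc_shift) simp
      then show ?thesis by (simp only: add_ac)
    qed
    also have "(\<Sum>l\<le>Suc m. real (m choose l) * (u l * v (Suc m - l))) = (\<Sum>l\<le>m. real (m choose l) * (v (Suc (m - l)) * u l))"
      by (simp add: Suc_diff_le mult.commute)
    finally show ?thesis by (simp add: sum.distrib[symmetric] distrib_left)
  qed
  ultimately show ?thesis by simp
qed

lemma continuous_on_blend: "m \<le> k \<Longrightarrow> d > 0 \<Longrightarrow> continuous_on S (blend k q \<alpha> d m)"
  unfolding blend_def[abs_def]
  by (intro continuous_intros continuous_on_compose2[OF continuous_on_sstep[of _ k UNIV]]) auto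

lemma blend_left: "x \<le> \<alpha> \<Longrightarrow> d > 0 \<Longrightarrow> blend k q \<alpha> d m x = 0"
  by (simp add: blend_def sstep_le_0 divide_nonpos_pos)

lemma blend_right:
  assumes "\<alpha> + d \<le> x" "d > 0" "m \<le> k"
  shows "blend k q \<alpha> d m x = poly ((pderiv ^^ m) q) x"
proof -
  have 1: "1 \<le> (x - \<alpha>) / d" using assms by (simp add: le_divide_eq)
  have "blend k q \<alpha> d m x = (\<Sum>l\<le>m. if l = m then poly ((pderiv ^^ m) q) x else 0)"
    unfolding blend_def using assms by (intro sum.cong) (auto simp: sstep_ge_1[OF 1])
  then show ?thesis by simp
qed

lemma higher_pderiv_eq_0: "degree (p :: real poly) < k \<Longrightarrow> (pderiv ^^ k) p = 0"
proof (induction k arbitrary: p)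
  case (Suc k)
  show ?case
  proof (cases "degree p = 0")
    case True
    then have "pderiv p = 0" by (simp add: pderiv_eq_0_iff)
    then show ?thesis by (simp add: funpow_swap1 higher_pderiv_0)
  next
    case False
    then have "degree (pderiv p) < k" using Suc.prems by (simp add: degree_pderiv)
    from Suc.IH[OF this] show ?thesis by (simp add: funpow_swap1)
  qed
qed simp

text \<open>Neighbouring polynomials \<open>p i\<close>, \<open>p (i+1)\<close> are blended on the cell \<open>[X i, X (i+1)]\<close>.\<close>
theorem glue_polynomials:
  fixes k :: nat assumes k: "k \<ge> 1"
  obtains C where "C \<ge> 1"
   "\<And>(X :: nat \<Rightarrow> real) p n. n \<ge> 2 \<Longrightarrow> (\<And>i. i < n \<Longrightarrow> X i < X (Suc i)) \<Longrightarrow> (\<And>i. i \<in> {1..n-1} \<Longrightarrow> degree (p i) < k) \<Longrightarrow>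
    \<exists>D. (\<forall>m<k. \<forall>x. (D m has_real_derivative D (Suc m) x) (at x)) \<and> continuous_on UNIV (D k) \<and>
      (\<forall>x. x \<le> X 1 \<longrightarrow> D 0 x = poly (p 1) x \<and> D k x = 0) \<and>
      (\<forall>x. X (n-1) \<le> x \<longrightarrow> D 0 x = poly (p (n-1)) x \<and> D k x = 0) \<and>
      (\<forall>i\<in>{1..<n-1}. \<forall>x\<in>{X i..X (Suc i)}.
          (\<forall>y. \<bar>y - D 0 x\<bar> \<le> C * (\<bar>y - poly (p i) x\<bar> + \<bar>y - poly (p (Suc i)) x\<bar>)) \<and>
          ennreal ((X (Suc i) - X i) ^ k * \<bar>D k x\<bar>) \<le> ennreal (C / (X (Suc i) - X i)) *
             (\<integral>\<^sup>+y. ennreal \<bar>poly (p (Suc i) - p i) y\<bar> * indicator {X i..X (Suc i)} y \<partial>lborel))"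
proof -
  obtain M where M: "M > 0" "\<And>P m \<alpha> \<beta> x. degree P < k \<Longrightarrow> m \<le> k \<Longrightarrow> \<alpha> < \<beta> \<Longrightarrow> x \<in> {\<alpha>..\<beta>} \<Longrightarrow>
    ennreal ((\<beta> - \<alpha>) ^ m * \<bar>poly ((pderiv ^^ m) P) x\<bar>) \<le> ennreal (M / (\<beta> - \<alpha>)) * (\<integral>\<^sup>+y. ennreal \<bar>poly P y\<bar> * indicator {\<alpha>..\<beta>} y \<partial>lborel)"
    using pderiv_bound[OF k] by blast
  obtain B where B: "B \<ge> 1" "\<And>m x. m \<le> k \<Longrightarrow> x \<in> {0..1} \<Longrightarrow> \<bar>sstep k m x\<bar> \<le> B" using sstep_bounded[of k] by blast
  \<comment> \<open>\<open>1 + B\<close> bounds the two blending coefficients; the product collects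
    the k + 1 Leibniz terms, the binomials, the bound B for derivatives of the step and the constant
    M of the derivative inequality.\<close>
  define C where "C = 1 + B + real (Suc k) * 2 ^ k * B * M"
  have C: "C \<ge> 1" "1 + B \<le> C" "real (Suc k) * 2 ^ k * B * M \<le> C" unfolding C_def using B(1) M(1) by (auto intro!: add_nonneg_nonneg mult_nonneg_nonneg)
  show ?thesis
  proof (rule that[OF C(1)])
    fix X :: "nat \<Rightarrow> real" and p :: "nat \<Rightarrow> real poly" and n :: nat
    assume n: "n \<ge> 2" and X: "\<And>i. i < n \<Longrightarrow> X i < X (Suc i)" and p: "\<And>i. i \<in> {1..n-1} \<Longrightarrow> degree (p i) < k"
    have Xmono: "X i \<le> X j" if "i \<le> j" "j \<le> n" for i j
      using that
    proof (induction j rule: dec_induct)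
      case (step j) then show ?case using X[of j] by auto
    qed simp
    define q where "q j = p (Suc j) - p j" for j
    define d where "d j = X (Suc j) - X j" for j
    have d: "d j > 0" if "j \<in> {1..<n-1}" for j
    proof -
      have "j < n" using that by auto
      then show ?thesis using X[of j] by (simp add: d_def)
    qed
    have dq: "degree (q j) < k" if "j \<in> {1..<n-1}" for j unfolding q_def using p[of j] p[of "Suc j"] that by (intro degree_diff_less) auto
    \<comment> \<open>A telescoping sum: each jump from \<open>p j\<close> to
      \<open>p (Suc j)\<close> is switched on smoothly across its own cell. The k-th derivative is
      thus governed by differences of neighbouring polynomials.\<close>
    define D where "D m x = poly ((pderiv ^^ m) (p 1)) x + (\<Sum>j\<in>{1..<n-1}. blend k (q j) (X j) (d j) m x)" for m x
    have D1: "(D m has_real_derivative D (Suc m) x) (at x)" if "m < k" for m x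
      unfolding D_def[abs_def] using that d
      by (intro DERIV_add DERIV_sum DERIV_blend) (auto intro!: derivative_eq_intros)
    have D2: "continuous_on UNIV (D k)" unfolding D_def[abs_def] using d
      by (intro continuous_intros continuous_on_blend) auto
    have p1: "(pderiv ^^ k) (p 1) = 0" using p[of 1] n by (intro higher_pderiv_eq_0) auto
    have q0: "(pderiv ^^ k) (q j) = 0" if "j \<in> {1..<n-1}" for j using dq[OF that] by (rule higher_pderiv_eq_0)
    have tele: "poly (p 1) x + (\<Sum>j\<in>{1..<i}. poly (q j) x) = poly (p i) x" if "i \<in> {1..n-1}" for i x
      using sum_telescope_step[OF that, of "\<lambda>j. poly (p j) x"] by (simp add: q_def)
    \<comment> \<open>On the i-th cell blends of smaller index have become full polynomials, and
      those of larger index are still 0.\<close>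
    have loc: "D m x = poly ((pderiv ^^ m) (p 1)) x + (\<Sum>j\<in>{1..<i}. poly ((pderiv ^^ m) (q j)) x) + blend k (q i) (X i) (d i) m x"
      if i: "i \<in> {1..<n-1}" and x: "x \<in> {X i..X (Suc i)}" and m: "m \<le> k" for i x m
    proof -
      have eq: "{1..<n-1} = {1..<i} \<union> ({i} \<union> {i<..<n-1})" using i by auto
      have "(\<Sum>j\<in>{1..<n-1}. blend k (q j) (X j) (d j) m x) = (\<Sum>j\<in>{1..<i}. blend k (q j) (X j) (d j) m x) + (\<Sum>j\<in>{i} \<union> {i<..<n-1}. blend k (q j) (X j) (d j) m x)"
        unfolding eq by (rule sum.union_disjoint) auto
      also have "(\<Sum>j\<in>{i} \<union> {i<..<n-1}. blend k (q j) (X j) (d j) m x) = blend k (q i) (X i) (d i) m x + (\<Sum>j\<in>{i<..<n-1}. blend k (q j) (X j) (d j) m x)"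
        by (subst sum.union_disjoint) auto
      also have "(\<Sum>j\<in>{i<..<n-1}. blend k (q j) (X j) (d j) m x) = 0"
      proof (intro sum.neutral ballI blend_left)
        fix j assume j: "j \<in> {i<..<n-1}"
        then have "Suc i \<le> j" "j \<le> n" by auto
        then show "x \<le> X j" using Xmono[of "Suc i" j] x by auto
        show "d j > 0" using d[of j] j by auto
      qed
      also have "(\<Sum>j\<in>{1..<i}. blend k (q j) (X j) (d j) m x) = (\<Sum>j\<in>{1..<i}. poly ((pderiv ^^ m) (q j)) x)"
      proof (intro sum.cong refl blend_right m)
        fix j assume j: "j \<in> {1..<i}"
        then have "X (Suc j) \<le> X i" using i by (intro Xmono) auto
        then show "X j + d j \<le> x" using x by (simp add: d_def)
        show "d j > 0" using d[of j] j i by auto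
      qed
      finally show ?thesis unfolding D_def by simp
    qed
    have left: "D 0 x = poly (p 1) x \<and> D k x = 0" if "x \<le> X 1" for x
    proof -
      have "(\<Sum>j\<in>{1..<n-1}. blend k (q j) (X j) (d j) m x) = 0" for m
      proof (intro sum.neutral ballI blend_left)
        fix j assume j: "j \<in> {1..<n-1}"
        then have "1 \<le> j" "j \<le> n" by auto
        then show "x \<le> X j" using Xmono[of 1 j] that by auto
        show "d j > 0" using d[OF j] .
      qed
      then show ?thesis unfolding D_def using p1 by simp
    qed
    have right: "D 0 x = poly (p (n-1)) x \<and> D k x = 0" if "X (n-1) \<le> x" for x
    proof -
      have "(\<Sum>j\<in>{1..<n-1}. blend k (q j) (X j) (d j) m x) = (\<Sum>j\<in>{1..<n-1}. poly ((pderiv ^^ m) (q j)) x)" if "m \<le> k" for m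
      proof (intro sum.cong refl blend_right that)
        fix j assume j: "j \<in> {1..<n-1}"
        then have "X (Suc j) \<le> X (n-1)" by (intro Xmono) auto
        then show "X j + d j \<le> x" using \<open>X (n-1) \<le> x\<close> by (simp add: d_def)
        show "d j > 0" using d[OF j] .
      qed
      note * = this
      have "D 0 x = poly (p (n-1)) x" unfolding D_def using *[of 0] tele[of "n-1" x] n by simp
      moreover have "D k x = 0" unfolding D_def using *[of k] q0 p1 by simp
      ultimately show ?thesis by simp
    qed
    have mid1: "\<bar>y - D 0 x\<bar> \<le> C * (\<bar>y - poly (p i) x\<bar> + \<bar>y - poly (p (Suc i)) x\<bar>)"
      if i: "i \<in> {1..<n-1}" and x: "x \<in> {X i..X (Suc i)}" for i x y
    proof -
      define s where "s = sstep k 0 ((x - X i) / d i)"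
      have "(x - X i) / d i \<in> {0..1}" using x d[OF i] by (auto simp: d_def divide_le_eq)
      then have s: "\<bar>s\<bar> \<le> B" unfolding s_def using B(2) by simp
      have "D 0 x = poly (p i) x + poly (q i) x * s"
        using loc[OF i x, of 0] tele[of i x] i by (simp add: blend_def s_def)
      then have "y - D 0 x = (1 - s) * (y - poly (p i) x) + s * (y - poly (p (Suc i)) x)" by (simp add: q_def algebra_simps)
      also have "\<bar>\<dots>\<bar> \<le> \<bar>1 - s\<bar> * \<bar>y - poly (p i) x\<bar> + \<bar>s\<bar> * \<bar>y - poly (p (Suc i)) x\<bar>"
        by (rule order_trans[OF abs_triangle_ineq]) (simp add: abs_mult)
      also have "\<dots> \<le> C * \<bar>y - poly (p i) x\<bar> + C * \<bar>y - poly (p (Suc i)) x\<bar>"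
        using s C(2) by (intro add_mono mult_right_mono) auto
      finally show ?thesis by (simp add: distrib_left)
    qed
    have mid2: "ennreal ((X (Suc i) - X i) ^ k * \<bar>D k x\<bar>) \<le> ennreal (C / (X (Suc i) - X i)) *
             (\<integral>\<^sup>+y. ennreal \<bar>poly (p (Suc i) - p i) y\<bar> * indicator {X i..X (Suc i)} y \<partial>lborel)"
      if i: "i \<in> {1..<n-1}" and x: "x \<in> {X i..X (Suc i)}" for i x
    proof -
      define J where "J = (\<integral>\<^sup>+y. ennreal \<bar>poly (q i) y\<bar> * indicator {X i..X (Suc i)} y \<partial>lborel)"
      have di: "d i > 0" by (rule d[OF i])
      \<comment> \<open>The completed jumps and \<open>p 1\<close> have degree below k, so their
        k-th derivatives vanish.\<close>
      have "D k x = blend k (q i) (X i) (d i) k x"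
      proof -
        have "(\<Sum>j\<in>{1..<i}. poly ((pderiv ^^ k) (q j)) x) = 0" using q0 i by (intro sum.neutral) auto
        then show ?thesis using loc[OF i x, of k] p1 by simp
      qed
      then have "d i ^ k * \<bar>D k x\<bar> = \<bar>d i ^ k * blend k (q i) (X i) (d i) k x\<bar>" using di by (simp add: abs_mult)
      also have "d i ^ k * blend k (q i) (X i) (d i) k x = (\<Sum>l\<le>k. real (k choose l) * ((d i ^ l * poly ((pderiv ^^ l) (q i)) x) * sstep k (k - l) ((x - X i) / d i)))"
        unfolding blend_def sum_distrib_left
      proof (intro sum.cong refl)
        fix l assume "l \<in> {..k}"
        then have "d i ^ k = d i ^ l * d i ^ (k - l)" by (simp flip: power_add)
        then have "d i ^ k * (1 / d i) ^ (k - l) = d i ^ l" using di by (simp add: power_divide)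
        then have "(d i ^ k * (1 / d i) ^ (k - l)) * (real (k choose l) * (poly ((pderiv ^^ l) (q i)) x * sstep k (k - l) ((x - X i) / d i))) =
          d i ^ l * (real (k choose l) * (poly ((pderiv ^^ l) (q i)) x * sstep k (k - l) ((x - X i) / d i)))" by simp
        then show "d i ^ k * (real (k choose l) * (poly ((pderiv ^^ l) (q i)) x * ((1 / d i) ^ (k - l) * sstep k (k - l) ((x - X i) / d i)))) =
          real (k choose l) * ((d i ^ l * poly ((pderiv ^^ l) (q i)) x) * sstep k (k - l) ((x - X i) / d i))" by (simp only: mult_ac)
      qed
      also have "\<bar>\<dots>\<bar> \<le> (\<Sum>l\<le>k. (2 ^ k * B) * (d i ^ l * \<bar>poly ((pderiv ^^ l) (q i)) x\<bar>))"
      proof (rule order_trans[OF sum_abs sum_mono])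
        fix l
        have "real (k choose l) \<le> 2 ^ k" by (metis binomial_le_pow2 numeral_power_eq_of_nat_cancel_iff of_nat_le_iff of_nat_numeral of_nat_power)
        moreover have "(x - X i) / d i \<in> {0..1}" using x di by (auto simp: d_def divide_le_eq)
        then have "\<bar>sstep k (k - l) ((x - X i) / d i)\<bar> \<le> B" using B(2)[of "k - l"] by simp
        ultimately have "real (k choose l) * \<bar>sstep k (k - l) ((x - X i) / d i)\<bar> \<le> 2 ^ k * B" by (intro mult_mono) auto
        from mult_right_mono[OF this, of "d i ^ l * \<bar>poly ((pderiv ^^ l) (q i)) x\<bar>"]
        show "\<bar>real (k choose l) * ((d i ^ l * poly ((pderiv ^^ l) (q i)) x) * sstep k (k - l) ((x - X i) / d i))\<bar> \<le> (2 ^ k * B) * (d i ^ l * \<bar>poly ((pderiv ^^ l) (q i)) x\<bar>)"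
          using di by (simp add: abs_mult mult_ac)
      qed
      finally have "ennreal (d i ^ k * \<bar>D k x\<bar>) \<le> ennreal (\<Sum>l\<le>k. (2 ^ k * B) * (d i ^ l * \<bar>poly ((pderiv ^^ l) (q i)) x\<bar>))" by (rule ennreal_leI)
      also have "\<dots> = (\<Sum>l\<le>k. ennreal (2 ^ k * B) * ennreal (d i ^ l * \<bar>poly ((pderiv ^^ l) (q i)) x\<bar>))"
        using B(1) di by (simp add: sum_ennreal[symmetric] ennreal_mult)
      also have "\<dots> \<le> (\<Sum>l\<le>k. ennreal (2 ^ k * B) * (ennreal (M / d i) * J))"
      proof (intro sum_mono mult_left_mono)
        fix l assume "l \<in> {..k}"
        then show "ennreal (d i ^ l * \<bar>poly ((pderiv ^^ l) (q i)) x\<bar>) \<le> ennreal (M / d i) * J"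
          unfolding J_def d_def using M(2)[OF dq[OF i], of l "X i" "X (Suc i)" x] x d[OF i] by (simp add: d_def)
      qed simp
      also have "\<dots> = ennreal (real (Suc k)) * (ennreal (2 ^ k * B) * (ennreal (M / d i) * J))"
        by (simp add: ennreal_of_nat_eq_real_of_nat)
      also have "\<dots> = ennreal (real (Suc k) * (2 ^ k * B) * (M / d i)) * J"
        using B(1) M(1) di by (intro ennreal_mult3[symmetric]) auto
      also have "\<dots> \<le> ennreal (C / d i) * J"
      proof (intro mult_right_mono ennreal_leI)
        have "real (Suc k) * (2 ^ k * B) * (M / d i) = (real (Suc k) * 2 ^ k * B * M) / d i" by simp
        also have "\<dots> \<le> C / d i" using C(3) di by (intro divide_right_mono) auto
        finally show "real (Suc k) * (2 ^ k * B) * (M / d i) \<le> C / d i" .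
      qed simp
      finally show ?thesis unfolding J_def d_def q_def .
    qed
    show "\<exists>D. (\<forall>m<k. \<forall>x. (D m has_real_derivative D (Suc m) x) (at x)) \<and> continuous_on UNIV (D k) \<and>
      (\<forall>x. x \<le> X 1 \<longrightarrow> D 0 x = poly (p 1) x \<and> D k x = 0) \<and>
      (\<forall>x. X (n-1) \<le> x \<longrightarrow> D 0 x = poly (p (n-1)) x \<and> D k x = 0) \<and>
      (\<forall>i\<in>{1..<n-1}. \<forall>x\<in>{X i..X (Suc i)}.
          (\<forall>y. \<bar>y - D 0 x\<bar> \<le> C * (\<bar>y - poly (p i) x\<bar> + \<bar>y - poly (p (Suc i)) x\<bar>)) \<and>
          ennreal ((X (Suc i) - X i) ^ k * \<bar>D k x\<bar>) \<le> ennreal (C / (X (Suc i) - X i)) *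
             (\<integral>\<^sup>+y. ennreal \<bar>poly (p (Suc i) - p i) y\<bar> * indicator {X i..X (Suc i)} y \<partial>lborel))"
      by (intro exI[of _ D] conjI allI impI ballI D1 D2 mid1 mid2) (use left right in auto)
  qed
qed

section \<open>The global approximant\<close>

text \<open>Equal steps in the square root of the distance to the nearer endpoint, indexed from -1
  at i = 0 over 0 at i = n to 1 at i = 2 n.\<close>

definition knot :: "nat \<Rightarrow> nat \<Rightarrow> real" where
  "knot n i = (if i \<le> n then (real i / real n)\<^sup>2 - 1 else 1 - ((2 * real n - real i) / real n)\<^sup>2)"

lemma knot_right: "n \<ge> 1 \<Longrightarrow> n \<le> i \<Longrightarrow> knot n i = 1 - ((2 * real n - real i) / real n)\<^sup>2"
  by (cases "i = n") (auto simp: knot_def)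

lemma knot_reflect: "n \<ge> 1 \<Longrightarrow> i \<le> 2 * n \<Longrightarrow> knot n (2 * n - i) = - knot n i"
  by (cases "i < n"; cases "i = n") (auto simp: knot_def of_nat_diff)

lemma knot_ends: "n \<ge> 1 \<Longrightarrow> knot n 0 = -1" "n \<ge> 1 \<Longrightarrow> knot n (2 * n) = 1"
  by (auto simp: knot_def)

lemma knot_less_right:
  assumes n: "n \<ge> 1" and i: "n \<le> i" "i < 2 * n"
  shows "knot n i < knot n (Suc i)"
proof -
  have "real i + 1 \<le> 2 * real n" using i by linarith
  then have "((2 * real n - real (Suc i)) / real n)\<^sup>2 < ((2 * real n - real i) / real n)\<^sup>2"
    using n by (intro power_strict_mono divide_strict_right_mono) auto
  then show ?thesis using i by (simp only: knot_right[OF n i(1)] knot_right[OF n, of "Suc i"] le_SucI)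
qed

lemma knot_less:
  assumes n: "n \<ge> 1" and i: "i < 2 * n"
  shows "knot n i < knot n (Suc i)"
proof (cases "n \<le> i")
  case True then show ?thesis using knot_less_right[OF n _ i] by simp
next
  case False
  then have "knot n (2 * n - Suc i) < knot n (Suc (2 * n - Suc i))" using i by (intro knot_less_right[OF n]) auto
  moreover have "Suc (2 * n - Suc i) = 2 * n - i" using i by simp
  ultimately show ?thesis using knot_reflect[OF n, of i] knot_reflect[OF n, of "Suc i"] i by simp
qed

text \<open>Reflection reverses the order of the nodes and costs the sign \<open>(-1) ^ k\<close>;
  the left half of the interval can so be treated as a mirror image of the right half.\<close>

lemma sym_diff_reflect: "\<bar>sym_diff k h (\<lambda>x. F (- x)) x\<bar> = \<bar>sym_diff k h F (- x)\<bar>"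
proof (cases "x + real k * h / 2 \<in> {-1..1} \<and> x - real k * h / 2 \<in> {-1..1}")
  case True
  then have True': "- x + real k * h / 2 \<in> {-1..1} \<and> - x - real k * h / 2 \<in> {-1..1}" by auto
  have "sym_diff k h (\<lambda>x. F (- x)) x = (\<Sum>i=0..k. real (k choose i) * (-1) ^ (k - i) * F (- (x + (real i - real k / 2) * h)))"
    using True by (simp add: sym_diff_def)
  also have "\<dots> = (\<Sum>i=0..k. real (k choose i) * (-1) ^ i * F (- x + (real i - real k / 2) * h))"
  proof (rule sum.reindex_bij_witness[of _ "\<lambda>i. k - i" "\<lambda>i. k - i"])
    fix i assume "i \<in> {0..k}"
    then have i: "i \<le> k" by simp
    have "- x + (real (k - i) - real k / 2) * h = - (x + (real i - real k / 2) * h)" using i by (simp add: of_nat_diff algebra_simps)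
    then show "real (k choose (k - i)) * (-1) ^ (k - i) * F (- x + (real (k - i) - real k / 2) * h) =
      real (k choose i) * (-1) ^ (k - i) * F (- (x + (real i - real k / 2) * h))"
      using binomial_symmetric[OF i] by simp
  qed auto
  also have "\<dots> = (-1) ^ k * (\<Sum>i=0..k. real (k choose i) * (-1) ^ (k - i) * F (- x + (real i - real k / 2) * h))"
    unfolding sum_distrib_left
  proof (rule sum.cong[OF refl])
    fix i assume "i \<in> {0..k}"
    then have i: "i \<le> k" by simp
    have "(-1::real) ^ k * (-1) ^ (k - i) = (-1) ^ (i + (k - i)) * (-1) ^ (k - i)" using i by simp
    also have "\<dots> = (-1) ^ i * ((-1) * (-1)) ^ (k - i)" by (simp only: power_add power_mult_distrib mult.assoc)
    finally have s: "(-1::real) ^ k * (-1) ^ (k - i) = (-1) ^ i" by simp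
    have "(-1) ^ k * (real (k choose i) * (-1) ^ (k - i) * F (- x + (real i - real k / 2) * h)) =
      real (k choose i) * ((-1) ^ k * (-1) ^ (k - i)) * F (- x + (real i - real k / 2) * h)" by (simp only: mult_ac)
    then show "real (k choose i) * (-1) ^ i * F (- x + (real i - real k / 2) * h) =
      (-1) ^ k * (real (k choose i) * (-1) ^ (k - i) * F (- x + (real i - real k / 2) * h))" by (simp only: s)
  qed
  also have "\<dots> = (-1) ^ k * sym_diff k h F (- x)" unfolding sym_diff_def if_P[OF True'] ..
  finally show ?thesis by (simp add: abs_mult power_abs)
next
  case False
  then have "\<not> (- x + real k * h / 2 \<in> {-1..1} \<and> - x - real k * h / 2 \<in> {-1..1})" by auto
  then show ?thesis using False by (simp only: sym_diff_def if_False)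
qed

lemma wdiff_reflect: "wdiff k r (\<lambda>x. F (- x)) x \<tau> = wdiff k r F (- x) \<tau>"
proof -
  have "W \<delta> (- x) = W \<delta> x" for \<delta> by (simp add: W_def mult.commute)
  then show ?thesis by (simp add: wdiff_def abs_mult sym_diff_reflect)
qed

text \<open>The points that enter the estimate on the \<open>m\<close>-th cell counted from the endpoint \<open>1\<close>.\<close>
definition zone :: "real \<Rightarrow> nat \<Rightarrow> nat \<Rightarrow> real set" where
  "zone \<delta> N m = {x. \<bar>x\<bar> < 1 \<and> (real m * \<delta>)\<^sup>2 \<le> 1 - x \<and> 1 - x \<le> ((real m + 2 * real N) * \<delta>)\<^sup>2}"

lemma zone_measurable [measurable]: "zone \<delta> N m \<in> sets borel"
  unfolding zone_def by measurable

text \<open>In the variable \<open>sqrt (1 - x) / \<delta>\<close> the m-th zone is the interval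
  from m to m + 2 N, and a real number lies in at most 2 N + 1 of these.\<close>

lemma zone_overlap:
  assumes \<delta>: "\<delta> > 0"
  shows "(\<Sum>m\<in>{1..n}. indicator (zone \<delta> N m) x :: ennreal) \<le> ennreal (2 * real N + 1)"
proof -
  define \<xi> where "\<xi> = sqrt (1 - x)"
  define q where "q = nat \<lfloor>\<xi> / \<delta>\<rfloor>"
  have "{m \<in> {1..n}. x \<in> zone \<delta> N m} \<subseteq> {q - 2 * N..q}"
  proof
    fix m assume m: "m \<in> {m \<in> {1..n}. x \<in> zone \<delta> N m}"
    then have z: "(real m * \<delta>)\<^sup>2 \<le> 1 - x" "1 - x \<le> ((real m + 2 * real N) * \<delta>)\<^sup>2" by (auto simp: zone_def)
    have "real m * \<delta> \<le> \<xi>" unfolding \<xi>_def using z(1) by (rule real_le_rsqrt)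
    then have "real m \<le> \<xi> / \<delta>" using \<delta> by (simp add: le_divide_eq)
    then have 1: "m \<le> q" unfolding q_def by linarith
    have "\<xi> \<le> (real m + 2 * real N) * \<delta>" unfolding \<xi>_def using z(2) \<delta> by (intro real_le_lsqrt) auto
    then have "\<xi> / \<delta> \<le> real (m + 2 * N)" using \<delta> by (simp add: divide_le_eq)
    then have "\<lfloor>\<xi> / \<delta>\<rfloor> \<le> int (m + 2 * N)" by linarith
    then have "q \<le> m + 2 * N" unfolding q_def by linarith
    then show "m \<in> {q - 2 * N..q}" using 1 by auto
  qed
  then have "card {m \<in> {1..n}. x \<in> zone \<delta> N m} \<le> card {q - 2 * N..q}" by (intro card_mono) auto
  also have "\<dots> \<le> 2 * N + 1" by simp
  finally have c: "card {m \<in> {1..n}. x \<in> zone \<delta> N m} \<le> 2 * N + 1" .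
  have "(\<Sum>m\<in>{1..n}. indicator (zone \<delta> N m) x :: ennreal) = (\<Sum>m\<in>{1..n}. if x \<in> zone \<delta> N m then 1 else 0)"
    by (intro sum.cong refl) (simp add: indicator_def)
  also have "\<dots> = (\<Sum>m\<in>{m \<in> {1..n}. x \<in> zone \<delta> N m}. 1)" by (rule sum.inter_filter[symmetric]) simp
  also have "\<dots> = of_nat (card {m \<in> {1..n}. x \<in> zone \<delta> N m})" by simp
  also have "\<dots> \<le> of_nat (2 * N + 1)" using c by (simp only: of_nat_le_iff)
  also have "\<dots> = ennreal (2 * real N + 1)" by (simp only: ennreal_of_nat_eq_real_of_nat) simp
  finally show ?thesis .
qed

text \<open>With \<open>b = m / n\<close> and \<open>\<delta> = 1 / n\<close> the cell of the locale
  lies between the distances \<open>(b + \<delta>)\<^sup>2\<close> and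
  \<open>(b - \<delta>)\<^sup>2\<close> from 1, so it contains both cells adjacent to the i-th knot.
  The two conditions on n are those of the locale.\<close>

lemma right_cell:
  assumes k: "k \<ge> 1" and n: "n \<ge> 1" and i: "i \<in> {n..2*n-1}" and t: "24 / real n \<le> t" and nN: "8 * (1 + 4 * real k) \<le> real n"
    and F[measurable]: "F \<in> borel_measurable borel"
    and finF: "(\<integral>\<^sup>+x. ennreal \<bar>F x * \<phi> x ^ r\<bar> * indicator {-1..1} x \<partial>lborel) < \<infinity>"
  shows "\<exists>P. degree P < k \<and> (\<forall>\<theta>. modular \<theta> \<longrightarrow>
     (\<integral>\<^sup>+x. ennreal (\<theta> (\<phi> x ^ r * \<bar>F x - poly P x\<bar> / (2 * cell.K k r))) * indicator {knot n (i-1)..knot n (i+1)} x \<partial>lborel) \<le>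
     ennreal ((2 + 4 * (1 + 4 * real k)) / 2 * real n) * (\<integral>\<^sup>+x. diff_integral \<theta> k r F t x *
        indicator (zone (1 / real n) (1 + 4 * k) (2 * n - i)) x \<partial>lborel))"
proof -
  define \<delta> where "\<delta> = 1 / real n"
  define N where "N = 1 + 4 * real k"
  define m where "m = 2 * n - i"
  have m: "m \<ge> 1" "m \<le> n" "real m = 2 * real n - real i" using i n by (auto simp: m_def of_nat_diff)
  define b where "b = real m * \<delta>"
  have n0: "real n > 0" using n by simp
  have \<delta>: "\<delta> > 0" "\<delta> \<le> b" "b \<le> 1" using m n0 by (auto simp: \<delta>_def b_def divide_right_mono)
  define a where "a = 1 - (b - \<delta>)\<^sup>2"
  define l where "l = 4 * \<delta> * b"
  interpret cell k r N b \<delta> t a l F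
  proof
    show "\<delta> \<le> 1 / (8 * N)" unfolding \<delta>_def using nN by (intro divide_left_mono) (auto simp: N_def)
    show "24 * \<delta> \<le> t" using t by (simp add: \<delta>_def)
  qed (use k \<delta> finF in \<open>auto simp: N_def a_def l_def\<close>)
  obtain P where P: "degree P < k" "\<And>\<theta>. modular \<theta> \<Longrightarrow>
     (\<integral>\<^sup>+x. ennreal (\<theta> (\<phi> x ^ r * \<bar>F x - poly P x\<bar> / (2 * K))) * indicator {a - l..a} x \<partial>lborel) \<le>
     ennreal ((2 + 4 * N) / (2 * \<delta>)) * (\<integral>\<^sup>+x. diff_integral \<theta> k r F t x * indicator {a - l * N..a - l / 2} x \<partial>lborel)"
    using cell_approximation by blast
  have al: "a - l = 1 - (b + \<delta>)\<^sup>2" by (simp add: a_def l_def power2_eq_square algebra_simps)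
  have up: "knot n (i+1) = a"
  proof -
    have "(2 * real n - real (i+1)) / real n = b - \<delta>" using m n0 by (simp add: b_def \<delta>_def diff_divide_distrib[symmetric])
    then show ?thesis using knot_right[OF n, of "i+1"] i by (simp add: a_def)
  qed
  have lo: "a - l \<le> knot n (i-1)"
  \<comment> \<open>At the middle knot the left neighbour follows the mirrored formula, but that
    cell is shorter than the continuation of the right-hand formula and remains covered.\<close>
  proof (cases "i = n")
    case True
    then have b1: "b = 1" using m n0 by (simp add: b_def \<delta>_def)
    have "real (n - 1) / real n = 1 - \<delta>" using n n0 by (simp add: \<delta>_def of_nat_diff diff_divide_distrib)
    then have "knot n (i-1) = (1 - \<delta>)\<^sup>2 - 1" using True by (simp add: knot_def)
    moreover have "1 - (1 + \<delta>)\<^sup>2 \<le> (1 - \<delta>)\<^sup>2 - 1" by (simp add: power2_eq_square algebra_simps)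
    ultimately show ?thesis unfolding al b1 by simp
  next
    case False
    then have "n \<le> i - 1" "real (i - 1) = real i - 1" using i n by (auto simp: of_nat_diff)
    moreover from this have "(2 * real n - real (i-1)) / real n = b + \<delta>" using m n0 by (simp add: b_def \<delta>_def add_divide_distrib[symmetric])
    ultimately show ?thesis unfolding al using knot_right[OF n, of "i-1"] by simp
  qed
  \<comment> \<open>Parameters from 1/2 on give distance at least \<open>b\<^sup>2\<close>, the
    inner bound of the zone; completing the square in
    \<open>b\<^sup>2 + 4 * \<delta> * b * N\<close> gives the outer one.\<close>
  have zn: "{a - l * N..a - l / 2} \<subseteq> zone \<delta> (1 + 4 * k) m"
  proof
    fix x assume x: "x \<in> {a - l * N..a - l / 2}"
    define s where "s = (a - x) / l"
    have xs: "x = a - l * s" using l0 by (simp add: s_def)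
    have "l * (1/2) \<le> l * s" "l * s \<le> l * N" using x by (auto simp: xs)
    then have s: "1/2 \<le> s" "s \<le> N" using l0 by (simp_all add: mult_le_cancel_left_pos)
    have "1 - x = (b - \<delta>)\<^sup>2 + 4 * \<delta> * b * s" unfolding xs by (rule one_minus)
    also have "\<dots> \<le> b\<^sup>2 + 4 * \<delta> * b * N" using s \<delta> b0 by (intro add_mono power_mono mult_left_mono) auto
    also have "\<dots> \<le> (b + 2 * N * \<delta>)\<^sup>2" using zero_le_power2[of "N * \<delta>"] by (simp add: power2_eq_square algebra_simps)
    also have "b + 2 * N * \<delta> = (real m + 2 * real (1 + 4 * k)) * \<delta>" by (simp add: b_def N_def algebra_simps)
    finally show "x \<in> zone \<delta> (1 + 4 * k) m" unfolding zone_def using far_bounds(1,2)[OF s] by (simp add: xs b_def)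
  qed
  show ?thesis
  proof (intro exI[of _ P] conjI allI impI P(1))
    fix \<theta> assume \<theta>: "modular \<theta>"
    have "(\<integral>\<^sup>+x. ennreal (\<theta> (\<phi> x ^ r * \<bar>F x - poly P x\<bar> / (2 * K))) * indicator {knot n (i-1)..knot n (i+1)} x \<partial>lborel) \<le>
      (\<integral>\<^sup>+x. ennreal (\<theta> (\<phi> x ^ r * \<bar>F x - poly P x\<bar> / (2 * K))) * indicator {a - l..a} x \<partial>lborel)"
      using lo up by (intro nn_integral_mono mult_left_mono) (auto split: split_indicator)
    also note P(2)[OF \<theta>]
    also have "ennreal ((2 + 4 * N) / (2 * \<delta>)) * (\<integral>\<^sup>+x. diff_integral \<theta> k r F t x * indicator {a - l * N..a - l / 2} x \<partial>lborel)
      \<le> ennreal ((2 + 4 * N) / (2 * \<delta>)) * (\<integral>\<^sup>+x. diff_integral \<theta> k r F t x * indicator (zone \<delta> (1 + 4 * k) m) x \<partial>lborel)"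
      using zn by (intro mult_left_mono nn_integral_mono) (auto split: split_indicator)
    also have "(2 + 4 * N) / (2 * \<delta>) = (2 + 4 * (1 + 4 * real k)) / 2 * real n" using n0 by (simp add: N_def \<delta>_def)
    finally show "(\<integral>\<^sup>+x. ennreal (\<theta> (\<phi> x ^ r * \<bar>F x - poly P x\<bar> / (2 * cell.K k r))) * indicator {knot n (i-1)..knot n (i+1)} x \<partial>lborel) \<le>
     ennreal ((2 + 4 * (1 + 4 * real k)) / 2 * real n) * (\<integral>\<^sup>+x. diff_integral \<theta> k r F t x *
        indicator (zone (1 / real n) (1 + 4 * k) (2 * n - i)) x \<partial>lborel)" unfolding \<delta>_def m_def .
  qed
qed

text \<open>\<open>right_cell\<close> for the reflected function at the reflected knot; the zone is
  therefore evaluated at -x.\<close>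

lemma left_cell:
  assumes k: "k \<ge> 1" and n: "n \<ge> 1" and i: "i \<in> {1..<n}" and t: "24 / real n \<le> t" and nN: "8 * (1 + 4 * real k) \<le> real n"
    and F[measurable]: "F \<in> borel_measurable borel"
    and finF: "(\<integral>\<^sup>+x. ennreal \<bar>F x * \<phi> x ^ r\<bar> * indicator {-1..1} x \<partial>lborel) < \<infinity>"
  shows "\<exists>P. degree P < k \<and> (\<forall>\<theta>. modular \<theta> \<longrightarrow>
     (\<integral>\<^sup>+x. ennreal (\<theta> (\<phi> x ^ r * \<bar>F x - poly P x\<bar> / (2 * cell.K k r))) * indicator {knot n (i-1)..knot n (i+1)} x \<partial>lborel) \<le>
     ennreal ((2 + 4 * (1 + 4 * real k)) / 2 * real n) * (\<integral>\<^sup>+x. diff_integral \<theta> k r F t x *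
        indicator (zone (1 / real n) (1 + 4 * k) i) (- x) \<partial>lborel))"
proof -
  define F' where "F' x = F (- x)" for x
  have [measurable]: "F' \<in> borel_measurable borel" unfolding F'_def[abs_def] by measurable
  have refl: "(\<integral>\<^sup>+x. h x \<partial>lborel) = (\<integral>\<^sup>+x. h (- x) \<partial>lborel)" if "h \<in> borel_measurable borel" for h :: "real \<Rightarrow> ennreal"
    using nn_integral_real_affine[OF that, of "-1" 0] by simp
  have "(\<integral>\<^sup>+x. ennreal \<bar>F' x * \<phi> x ^ r\<bar> * indicator {-1..1} x \<partial>lborel) = (\<integral>\<^sup>+x. ennreal \<bar>F x * \<phi> x ^ r\<bar> * indicator {-1..1} x \<partial>lborel)"
    by (subst refl) (auto simp: F'_def intro!: nn_integral_cong split: split_indicator)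
  then have fin': "(\<integral>\<^sup>+x. ennreal \<bar>F' x * \<phi> x ^ r\<bar> * indicator {-1..1} x \<partial>lborel) < \<infinity>" using finF by simp
  define i' where "i' = 2 * n - i"
  have i': "i' \<in> {n..2*n-1}" "2 * n - i' = i" "i' - 1 = 2 * n - (i + 1)" "i' + 1 = 2 * n - (i - 1)" using i by (auto simp: i'_def)
  obtain P where P: "degree P < k" "\<And>\<theta>. modular \<theta> \<Longrightarrow>
     (\<integral>\<^sup>+x. ennreal (\<theta> (\<phi> x ^ r * \<bar>F' x - poly P x\<bar> / (2 * cell.K k r))) * indicator {knot n (i'-1)..knot n (i'+1)} x \<partial>lborel) \<le>
     ennreal ((2 + 4 * (1 + 4 * real k)) / 2 * real n) * (\<integral>\<^sup>+x. diff_integral \<theta> k r F' t x *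
        indicator (zone (1 / real n) (1 + 4 * k) i) x \<partial>lborel)"
    using right_cell[OF k n i'(1) t nN _ fin'] unfolding i'(2) by auto
  have kn: "knot n (i'-1) = - knot n (i+1)" "knot n (i'+1) = - knot n (i-1)"
    unfolding i'(3,4) using i by (intro knot_reflect[OF n]; auto)+
  define P' where "P' = pcompose P [:0, -1:]"
  show ?thesis
  proof (intro exI[of _ P'] conjI allI impI)
    show "degree P' < k" using P(1) by (simp add: P'_def degree_pcompose)
    fix \<theta> assume \<theta>: "modular \<theta>"
    note [measurable] = modular_measurable[OF \<theta>]
    have "(\<integral>\<^sup>+x. ennreal (\<theta> (\<phi> x ^ r * \<bar>F x - poly P' x\<bar> / (2 * cell.K k r))) * indicator {knot n (i-1)..knot n (i+1)} x \<partial>lborel)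
      = (\<integral>\<^sup>+x. ennreal (\<theta> (\<phi> x ^ r * \<bar>F' x - poly P x\<bar> / (2 * cell.K k r))) * indicator {knot n (i'-1)..knot n (i'+1)} x \<partial>lborel)"
      unfolding kn by (subst refl) (auto simp: F'_def P'_def poly_pcompose intro!: nn_integral_cong split: split_indicator)
    also note P(2)[OF \<theta>]
    also have "(\<integral>\<^sup>+x. diff_integral \<theta> k r F' t x * indicator (zone (1 / real n) (1 + 4 * k) i) x \<partial>lborel)
      = (\<integral>\<^sup>+x. diff_integral \<theta> k r F t x * indicator (zone (1 / real n) (1 + 4 * k) i) (- x) \<partial>lborel)"
      unfolding F'_def wdiff_reflect by (subst refl) (auto simp: wdiff_reflect)
    finally show "(\<integral>\<^sup>+x. ennreal (\<theta> (\<phi> x ^ r * \<bar>F x - poly P' x\<bar> / (2 * cell.K k r))) * indicator {knot n (i-1)..knot n (i+1)} x \<partial>lborel) \<le>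
     ennreal ((2 + 4 * (1 + 4 * real k)) / 2 * real n) * (\<integral>\<^sup>+x. diff_integral \<theta> k r F t x *
        indicator (zone (1 / real n) (1 + 4 * k) i) (- x) \<partial>lborel)" .
  qed
qed

text \<open>\<open>j \<le> 2 * n - 2\<close> excludes the cell at the endpoint, so
  \<open>2 * \<delta> \<le> b\<close> and the distance to 1 stays between
  \<open>b\<^sup>2 / 4\<close> and \<open>b\<^sup>2\<close>. Then \<open>\<phi>\<^sup>2\<close> lies
  between \<open>b\<^sup>2 / 4\<close> and \<open>2 * b\<^sup>2\<close>, and the cell length
  \<open>\<delta> * (2 * b - \<delta>)\<close> is at least \<open>\<delta> * b\<close>.\<close>

lemma cell_ratio_right:
  assumes n: "n \<ge> 1" and j: "n \<le> j" "j \<le> 2 * n - 2" and x: "x \<in> {knot n j..knot n (Suc j)}" and y: "y \<in> {knot n j..knot n (Suc j)}"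
  shows "\<phi> x \<le> 3 * \<phi> y" "\<phi> x \<le> 3/2 * (real n * (knot n (Suc j) - knot n j))"
proof -
  define \<delta> where "\<delta> = 1 / real n"
  define b where "b = (2 * real n - real j) * \<delta>"
  have n0: "real n > 0" using n by simp
  have \<delta>0: "\<delta> > 0" using n0 by (simp add: \<delta>_def)
  have j2: "real j + 2 \<le> 2 * real n" "real n \<le> real j" using j n by linarith+
  have b: "2 * \<delta> \<le> b" "b \<le> 1"
  proof -
    show "2 * \<delta> \<le> b" unfolding b_def using j2 \<delta>0 by (intro mult_right_mono) auto
    have "b \<le> real n * \<delta>" unfolding b_def using j2 \<delta>0 by (intro mult_right_mono) auto
    then show "b \<le> 1" using n0 by (simp add: \<delta>_def)
  qed
  have kj: "knot n j = 1 - b\<^sup>2" using knot_right[OF n j(1)] by (simp add: b_def \<delta>_def)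
  have kj1: "knot n (Suc j) = 1 - (b - \<delta>)\<^sup>2"
  proof -
    have "(2 * real n - real (Suc j)) / real n = b - \<delta>" by (simp add: b_def \<delta>_def diff_divide_distrib add_divide_distrib)
    then show ?thesis using knot_right[OF n, of "Suc j"] j by simp
  qed
  have half: "(b / 2)\<^sup>2 \<le> (b - \<delta>)\<^sup>2" using b \<delta>0 by (intro power_mono) auto
  have b2: "b\<^sup>2 \<le> 1" using b \<delta>0 by (simp add: power_le_one)
  have X: "0 \<le> z \<and> z < 1 \<and> b\<^sup>2 / 4 \<le> 1 - z \<and> 1 - z \<le> b\<^sup>2" if "z \<in> {knot n j..knot n (Suc j)}" for z
  proof -
    have "0 < b\<^sup>2 / 4" using b \<delta>0 by auto
    moreover have "b\<^sup>2 / 4 \<le> (b - \<delta>)\<^sup>2" using half by (simp add: power_divide)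
    moreover have "1 - b\<^sup>2 \<le> z" "z \<le> 1 - (b - \<delta>)\<^sup>2" using that by (auto simp: kj kj1)
    ultimately show ?thesis using b2 by (intro conjI; linarith)
  qed
  have ph: "\<phi> z ^ 2 = (1 - z) * (1 + z)" if "0 \<le> z" "z < 1" for z using that by (simp add: \<phi>_sq one_minus_square)
  have px: "\<phi> x ^ 2 \<le> 2 * b\<^sup>2"
  proof -
    have "\<phi> x ^ 2 \<le> b\<^sup>2 * 2" using X[OF x] by (subst ph) (auto intro!: mult_mono)
    then show ?thesis by simp
  qed
  have py: "b\<^sup>2 / 4 \<le> \<phi> y ^ 2"
  proof -
    have "(b\<^sup>2 / 4) * 1 \<le> (1 - y) * (1 + y)" using X[OF y] by (intro mult_mono) auto
    then show ?thesis using X[OF y] by (subst ph) auto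
  qed
  have p0: "\<phi> y \<ge> 0" "\<phi> x \<ge> 0" using X[OF y] X[OF x] by (auto intro!: \<phi>_nonneg)
  have "\<phi> x ^ 2 \<le> 9 * \<phi> y ^ 2" using px py zero_le_power2[of "\<phi> y"] by linarith
  then have "\<phi> x ^ 2 \<le> (3 * \<phi> y) ^ 2" by (simp add: power_mult_distrib)
  then show "\<phi> x \<le> 3 * \<phi> y" using p0 by (intro power2_le_imp_le[of "\<phi> x"]) auto
  have "\<phi> x ^ 2 \<le> 9 / 4 * b\<^sup>2" using px zero_le_power2[of b] by linarith
  then have "\<phi> x ^ 2 \<le> (3/2 * b) ^ 2" by (simp add: power_mult_distrib power_divide)
  then have "\<phi> x \<le> 3/2 * b" using b \<delta>0 by (intro power2_le_imp_le[of "\<phi> x"]) auto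
  also have "b \<le> real n * (knot n (Suc j) - knot n j)"
  proof -
    have "knot n (Suc j) - knot n j = \<delta> * (2 * b - \<delta>)" unfolding kj kj1 by (simp add: power2_eq_square algebra_simps)
    then have "real n * (knot n (Suc j) - knot n j) = (real n * \<delta>) * (2 * b - \<delta>)" by simp
    also have "\<dots> = 2 * b - \<delta>" using n0 by (simp add: \<delta>_def)
    finally show ?thesis using b \<delta>0 by simp
  qed
  finally show "\<phi> x \<le> 3/2 * (real n * (knot n (Suc j) - knot n j))" by simp
qed

lemma cell_ratio:
  assumes n: "n \<ge> 1" and j: "1 \<le> j" "j \<le> 2 * n - 2" and x: "x \<in> {knot n j..knot n (Suc j)}" and y: "y \<in> {knot n j..knot n (Suc j)}"
  shows "\<phi> x \<le> 3 * \<phi> y" "\<phi> x \<le> 3/2 * (real n * (knot n (Suc j) - knot n j))"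
proof -
  have "\<phi> x \<le> 3 * \<phi> y \<and> \<phi> x \<le> 3/2 * (real n * (knot n (Suc j) - knot n j))"
  proof (cases "n \<le> j")
    case True then show ?thesis using cell_ratio_right[OF n True j(2) x y] by simp
  next
    case False
    define j' where "j' = 2 * n - Suc j"
    have j': "n \<le> j'" "j' \<le> 2 * n - 2" "Suc j' = 2 * n - j" using False j by (auto simp: j'_def)
    have k1: "knot n j' = - knot n (Suc j)" unfolding j'_def using j n by (intro knot_reflect) auto
    have k2: "knot n (Suc j') = - knot n j" unfolding j'(3) using j n by (intro knot_reflect) auto
    have "- x \<in> {knot n j'..knot n (Suc j')}" "- y \<in> {knot n j'..knot n (Suc j')}" using x y by (auto simp: k1 k2)
    from cell_ratio_right[OF n j'(1,2) this] show ?thesis by (simp add: k1 k2)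
  qed
  then show "\<phi> x \<le> 3 * \<phi> y" "\<phi> x \<le> 3/2 * (real n * (knot n (Suc j) - knot n j))" by auto
qed

lemma knot_cover:
  assumes n: "n \<ge> 1" and x: "x \<in> {-1..1}"
  obtains j where "j < 2 * n" "x \<in> {knot n j..knot n (Suc j)}"
proof -
  define j where "j = (LEAST j. x \<le> knot n (Suc j))"
  have ex: "x \<le> knot n (Suc (2 * n - 1))" using x n knot_ends(2)[OF n] by simp
  have up: "x \<le> knot n (Suc j)" unfolding j_def by (rule LeastI[of "\<lambda>j. x \<le> knot n (Suc j)", OF ex])
  have "j \<le> 2 * n - 1" unfolding j_def by (rule Least_le[of "\<lambda>j. x \<le> knot n (Suc j)", OF ex])
  then have "j < 2 * n" using n by simp
  moreover have "knot n j \<le> x"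
  proof (cases j)
    case 0 then show ?thesis using x knot_ends(1)[OF n] by simp
  next
    case (Suc i)
    then have "\<not> x \<le> knot n (Suc i)" using not_less_Least[of i "\<lambda>j. x \<le> knot n (Suc j)"] unfolding j_def by simp
    then show ?thesis using Suc by simp
  qed
  ultimately show ?thesis using that up by auto
qed

text \<open>Both terms are bounded cell by cell through the errors of the two neighbouring
  polynomials: \<open>F - D 0\<close> directly, \<open>D k\<close> through the mean of their
  difference over the cell. Bounded overlap of the zones adds the cells up to one integral, and the
  factor n produced by each cell becomes the 1/t of the mean.\<close>

theorem global_approximation:
  fixes k r :: nat
  assumes k: "k \<ge> 1"
  obtains Ca Cb :: real where "Ca > 0" "Cb \<ge> 1"
   "\<And>F t. F \<in> borel_measurable borel \<Longrightarrow> (\<integral>\<^sup>+x. ennreal \<bar>F x * \<phi> x ^ r\<bar> * indicator {-1..1} x \<partial>lborel) < \<infinity> \<Longrightarrow> 0 < t \<Longrightarrow> t \<le> 2 \<Longrightarrow>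
    \<exists>D. (\<forall>m<k. \<forall>x. (D m has_real_derivative D (Suc m) x) (at x)) \<and> continuous_on UNIV (D k) \<and>
     (\<forall>\<theta>. modular \<theta> \<longrightarrow>
       (\<integral>\<^sup>+x. ennreal (\<theta> (\<bar>(F x - D 0 x) * \<phi> x ^ r\<bar> / Ca)) * indicator {-1..1} x \<partial>lborel) \<le>
         ennreal Cb * diff_mean \<theta> k r F t \<and>
       (\<integral>\<^sup>+x. ennreal (\<theta> (\<bar>t ^ k * (D k x * \<phi> x ^ (k + r))\<bar> / Ca)) * indicator {-1..1} x \<partial>lborel) \<le>
         ennreal Cb * diff_mean \<theta> k r F t)"
proof -
  obtain C where C: "C \<ge> 1" and glue: "\<And>(X :: nat \<Rightarrow> real) p n. n \<ge> 2 \<Longrightarrow> (\<And>i. i < n \<Longrightarrow> X i < X (Suc i)) \<Longrightarrow> (\<And>i. i \<in> {1..n-1} \<Longrightarrow> degree (p i) < k) \<Longrightarrow>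
    \<exists>D. (\<forall>m<k. \<forall>x. (D m has_real_derivative D (Suc m) x) (at x)) \<and> continuous_on UNIV (D k) \<and>
      (\<forall>x. x \<le> X 1 \<longrightarrow> D 0 x = poly (p 1) x \<and> D k x = 0) \<and>
      (\<forall>x. X (n-1) \<le> x \<longrightarrow> D 0 x = poly (p (n-1)) x \<and> D k x = 0) \<and>
      (\<forall>i\<in>{1..<n-1}. \<forall>x\<in>{X i..X (Suc i)}.
          (\<forall>y. \<bar>y - D 0 x\<bar> \<le> C * (\<bar>y - poly (p i) x\<bar> + \<bar>y - poly (p (Suc i)) x\<bar>)) \<and>
          ennreal ((X (Suc i) - X i) ^ k * \<bar>D k x\<bar>) \<le> ennreal (C / (X (Suc i) - X i)) *
             (\<integral>\<^sup>+y. ennreal \<bar>poly (p (Suc i) - p i) y\<bar> * indicator {X i..X (Suc i)} y \<partial>lborel))"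
    using glue_polynomials[OF k] by blast
  define N where "N = 1 + 4 * real k"
  define K1 where "K1 = 2 * cell.K k r"
  \<comment> \<open>A bound for \<open>t * n\<close>: with n at most
    \<open>24 / t + 1 + 8 * N\<close> and t at most 2 this is
    \<open>24 + 2 * (1 + 8 * N)\<close>.\<close>
  define C5 where "C5 = 26 + 16 * N"
  define C6 where "C6 = 3/2 * C5"
  \<comment> \<open>The first summand serves the derivative: \<open>C6 ^ k\<close> compares
    \<open>t * \<phi>\<close> with the cell length, C comes from blending, \<open>3 ^ r\<close> from
    weights at two points of a cell. The second serves \<open>F - D 0\<close>. The 2 in each makes
    room for the mean of two errors.\<close>
  define Ca where "Ca = 2 * K1 * (C6 ^ k * C * 3 ^ r) + 2 * C * K1"
  define Cb where "Cb = 2 * (((2 + 4 * N) / 2) * C5 * (2 * (2 * N + 1)))"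
  have N: "N \<ge> 5" using k by (simp add: N_def)
  have C56: "C5 \<ge> 1" "C6 \<ge> 1" using N by (auto simp: C5_def C6_def)
  have K1: "K1 > 0"
  proof -
    \<comment> \<open>A sample instance of the locale with F = 0; it provides positivity of
      \<open>K\<close>, which depends on k and r alone.\<close>
    have "cell k r N 1 (1 / (8 * N)) 3 (1 - (1 - 1 / (8 * N))\<^sup>2) (4 * (1 / (8 * N)) * 1) (\<lambda>_. 0)"
      using N k by unfold_locales (auto simp: N_def field_simps)
    from cell.C_pos(3)[OF this] show ?thesis by (simp add: K1_def)
  qed
  have "1 * 1 * 1 \<le> C6 ^ k * C * 3 ^ r" using C56 C by (intro mult_mono one_le_power) auto
  then have Cc: "C6 ^ k * C * 3 ^ r \<ge> 1" by simp
  have p1: "0 < 2 * K1 * (C6 ^ k * C * 3 ^ r)" by (rule mult_pos_pos) (use K1 Cc in linarith)+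
  have p2: "0 < 2 * C * K1" using K1 C by simp
  have Ca: "Ca > 0" "2 * C * K1 \<le> Ca" "2 * K1 * (C6 ^ k * C * 3 ^ r) \<le> Ca" unfolding Ca_def using p1 p2 by linarith+
  have Cb: "Cb \<ge> 1"
  proof -
    have "1 * 1 * 1 \<le> ((2 + 4 * N) / 2) * C5 * (2 * (2 * N + 1))" using N C56 by (intro mult_mono) auto
    then show ?thesis by (simp add: Cb_def)
  qed
  show ?thesis
  proof (rule that[OF Ca(1) Cb])
    fix F :: "real \<Rightarrow> real" and t :: real
    assume F[measurable]: "F \<in> borel_measurable borel" and finF: "(\<integral>\<^sup>+x. ennreal \<bar>F x * \<phi> x ^ r\<bar> * indicator {-1..1} x \<partial>lborel) < \<infinity>" and t: "0 < t" "t \<le> 2"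
    \<comment> \<open>The first summand ensures \<open>24 / n \<le> t\<close>, the second
      \<open>8 * (1 + 4 * k) \<le> n\<close>; with t at most 2 both are of order at most
      1/t.\<close>
    define n where "n = nat \<lceil>24 / t\<rceil> + 8 * (1 + 4 * k)"
    have n1: "n \<ge> 1" by (simp add: n_def)
    have rn: "real n = real (nat \<lceil>24 / t\<rceil>) + 8 * N" by (simp add: n_def N_def)
    have ce: "24 / t \<le> real (nat \<lceil>24 / t\<rceil>)" "real (nat \<lceil>24 / t\<rceil>) \<le> 24 / t + 1"
    proof -
      have "0 < 24 / t" using t by simp
      then show "24 / t \<le> real (nat \<lceil>24 / t\<rceil>)" "real (nat \<lceil>24 / t\<rceil>) \<le> 24 / t + 1" by linarith+
    qed
    have n0: "real n > 0" using n1 by simp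
    have tn: "24 / real n \<le> t"
    proof -
      have "24 / t \<le> real n" using ce(1) rn N by simp
      then show ?thesis using t n0 by (simp add: field_simps)
    qed
    have tn2: "t * real n \<le> C5"
    proof -
      have "t * real n \<le> t * (24 / t + 1 + 8 * N)" using ce(2) rn t by (intro mult_left_mono) auto
      also have "\<dots> = 24 + t * (1 + 8 * N)" using t by (simp add: field_simps)
      also have "\<dots> \<le> 24 + 2 * (1 + 8 * N)" using t N by (intro add_left_mono mult_right_mono) auto
      finally show ?thesis by (simp add: C5_def)
    qed
    have nN: "8 * (1 + 4 * real k) \<le> real n" using rn N_def by simp
    let ?X = "knot n"
    define V where "V \<theta> x = diff_integral \<theta> k r F t x" for \<theta> x
    \<comment> \<open>Knots of the right half are counted from the endpoint 1, knots of the left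
      half from -1 by reflection.\<close>
    define zz where "zz i x = (if i \<in> {n..2*n-1} then indicator (zone (1 / real n) (1 + 4 * k) (2 * n - i)) x else indicator (zone (1 / real n) (1 + 4 * k) i) (- x) :: ennreal)" for i :: nat and x
    define cc where "cc = ennreal ((2 + 4 * (1 + 4 * real k)) / 2 * real n)"
    have "\<forall>i\<in>{1..2*n-1}. \<exists>P. degree P < k \<and> (\<forall>\<theta>. modular \<theta> \<longrightarrow>
       (\<integral>\<^sup>+x. ennreal (\<theta> (\<phi> x ^ r * \<bar>F x - poly P x\<bar> / K1)) * indicator {?X (i-1)..?X (i+1)} x \<partial>lborel) \<le> cc * (\<integral>\<^sup>+x. V \<theta> x * zz i x \<partial>lborel))"
    proof
      fix i assume i: "i \<in> {1..2*n-1}"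
      show "\<exists>P. degree P < k \<and> (\<forall>\<theta>. modular \<theta> \<longrightarrow>
       (\<integral>\<^sup>+x. ennreal (\<theta> (\<phi> x ^ r * \<bar>F x - poly P x\<bar> / K1)) * indicator {?X (i-1)..?X (i+1)} x \<partial>lborel) \<le> cc * (\<integral>\<^sup>+x. V \<theta> x * zz i x \<partial>lborel))"
      proof (cases "n \<le> i")
        case True
        then have ii: "i \<in> {n..2*n-1}" using i by auto
        show ?thesis using True ii right_cell[OF k n1 ii tn nN F finF] unfolding cc_def V_def zz_def K1_def by simp
      next
        case False
        then have ii: "i \<in> {1..<n}" using i by auto
        show ?thesis using left_cell[OF k n1 ii tn nN F finF] False unfolding cc_def V_def zz_def K1_def by simp
      qed
    qed
    from bchoice[OF this] obtain p where p0: "\<forall>i\<in>{1..2*n-1}. degree (p i) < k \<and> (\<forall>\<theta>. modular \<theta> \<longrightarrow>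
       (\<integral>\<^sup>+x. ennreal (\<theta> (\<phi> x ^ r * \<bar>F x - poly (p i) x\<bar> / K1)) * indicator {?X (i-1)..?X (i+1)} x \<partial>lborel) \<le> cc * (\<integral>\<^sup>+x. V \<theta> x * zz i x \<partial>lborel))" by (rule exE)
    have pd: "degree (p i) < k" if "i \<in> {1..2*n-1}" for i using p0 that by blast
    define e where "e i x = \<phi> x ^ r * \<bar>F x - poly (p i) x\<bar>" for i x
    have em[measurable]: "e i \<in> borel_measurable borel" for i unfolding e_def[abs_def] by measurable
    define E where "E \<theta> i = (\<integral>\<^sup>+x. ennreal (\<theta> (e i x / K1)) * indicator {?X (i-1)..?X (i+1)} x \<partial>lborel)" for \<theta> i
    have pE: "E \<theta> i \<le> cc * (\<integral>\<^sup>+x. V \<theta> x * zz i x \<partial>lborel)" if "i \<in> {1..2*n-1}" "modular \<theta>" for i \<theta>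
      using p0 that unfolding E_def e_def by blast
    have e0: "0 \<le> e i x" if "x \<in> {-1..1}" for i x using \<phi>_nonneg[of x] that by (auto simp: e_def abs_le_iff)
    have n2: "2 * n \<ge> 2" using n1 by simp
    obtain D where D: "(\<forall>m<k. \<forall>x. (D m has_real_derivative D (Suc m) x) (at x)) \<and> continuous_on UNIV (D k) \<and>
      (\<forall>x. x \<le> ?X 1 \<longrightarrow> D 0 x = poly (p 1) x \<and> D k x = 0) \<and>
      (\<forall>x. ?X (2*n-1) \<le> x \<longrightarrow> D 0 x = poly (p (2*n-1)) x \<and> D k x = 0) \<and>
      (\<forall>i\<in>{1..<2*n-1}. \<forall>x\<in>{?X i..?X (Suc i)}.
          (\<forall>y. \<bar>y - D 0 x\<bar> \<le> C * (\<bar>y - poly (p i) x\<bar> + \<bar>y - poly (p (Suc i)) x\<bar>)) \<and>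
          ennreal ((?X (Suc i) - ?X i) ^ k * \<bar>D k x\<bar>) \<le> ennreal (C / (?X (Suc i) - ?X i)) *
             (\<integral>\<^sup>+y. ennreal \<bar>poly (p (Suc i) - p i) y\<bar> * indicator {?X i..?X (Suc i)} y \<partial>lborel))"
      by (rule exE[OF glue[of "2 * n" ?X p, OF n2 knot_less[OF n1] pd]])
    have D1: "\<forall>m<k. \<forall>x. (D m has_real_derivative D (Suc m) x) (at x)" by (rule D[THEN conjunct1])
    have D2: "continuous_on UNIV (D k)" by (rule D[THEN conjunct2, THEN conjunct1])
    note D' = D[THEN conjunct2, THEN conjunct2]
    have D3: "D 0 x = poly (p 1) x \<and> D k x = 0" if "x \<le> ?X 1" for x by (rule D'[THEN conjunct1, rule_format, OF that])
    note D'' = D'[THEN conjunct2]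
    have D4: "D 0 x = poly (p (2*n-1)) x \<and> D k x = 0" if "?X (2*n-1) \<le> x" for x by (rule D''[THEN conjunct1, rule_format, OF that])
    note Dc = D''[THEN conjunct2, THEN bspec, THEN bspec]
    have D5: "\<bar>y - D 0 x\<bar> \<le> C * (\<bar>y - poly (p i) x\<bar> + \<bar>y - poly (p (Suc i)) x\<bar>)" if "i \<in> {1..<2*n-1}" "x \<in> {?X i..?X (Suc i)}" for i x y
      by (rule Dc[OF that, THEN conjunct1, THEN spec])
    have D6: "ennreal ((?X (Suc i) - ?X i) ^ k * \<bar>D k x\<bar>) \<le> ennreal (C / (?X (Suc i) - ?X i)) *
             (\<integral>\<^sup>+y. ennreal \<bar>poly (p (Suc i) - p i) y\<bar> * indicator {?X i..?X (Suc i)} y \<partial>lborel)" if "i \<in> {1..<2*n-1}" "x \<in> {?X i..?X (Suc i)}" for i x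
      by (rule Dc[OF that, THEN conjunct2])
    have Dm[measurable]: "D m \<in> borel_measurable borel" if "m \<le> k" for m
    proof (cases "m = k")
      case True then show ?thesis using D2 by (simp add: borel_measurable_continuous_onI)
    next
      case False
      then have "m < k" using that by simp
      then have "isCont (D m) x" for x using D1 DERIV_isCont by blast
      then show ?thesis by (intro borel_measurable_continuous_onI continuous_at_imp_continuous_on) auto
    qed
    have [measurable]: "D 0 \<in> borel_measurable borel" "D k \<in> borel_measurable borel" using Dm[of 0] Dm[of k] by auto
    have Xin: "?X j \<in> {-1..1}" if "j \<le> 2 * n" for j
    proof -
      have mono: "?X a \<le> ?X b" if "a \<le> b" "b \<le> 2 * n" for a b
        using that
      proof (induction b rule: dec_induct)
        case (step b) then show ?case using knot_less[OF n1, of b] by auto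
      qed simp
      show ?thesis using mono[of 0 j] mono[of j "2*n"] that knot_ends[OF n1] by auto
    qed
    have len: "?X (Suc j) - ?X j > 0" if "j < 2 * n" for j using knot_less[OF n1 that] by simp
    have "(\<integral>\<^sup>+x. ennreal (\<theta> (\<bar>(F x - D 0 x) * \<phi> x ^ r\<bar> / Ca)) * indicator {-1..1} x \<partial>lborel) \<le>
         ennreal Cb * (ennreal (1 / t) * (\<integral>\<^sup>+x. V \<theta> x * indicator {-1<..<1} x \<partial>lborel)) \<and>
       (\<integral>\<^sup>+x. ennreal (\<theta> (\<bar>t ^ k * (D k x * \<phi> x ^ (k + r))\<bar> / Ca)) * indicator {-1..1} x \<partial>lborel) \<le>
         ennreal Cb * (ennreal (1 / t) * (\<integral>\<^sup>+x. V \<theta> x * indicator {-1<..<1} x \<partial>lborel))" if \<theta>: "modular \<theta>" for \<theta>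
    proof -
      note [measurable] = modular_measurable[OF \<theta>]
      have \<theta>0: "\<theta> 0 = 0" using \<theta> by (simp add: modular_def)
      have [measurable]: "V \<theta> \<in> borel_measurable borel" unfolding V_def[abs_def] by measurable
      define S where "S = (\<Sum>i\<in>{1..2*n-1}. E \<theta> i)"
      have half: "ennreal (\<theta> ((a + b) / (2 * K1))) \<le> ennreal (\<theta> (a / K1)) + ennreal (\<theta> (b / K1))" for a b
      proof -
        have eq: "(a + b) / (2 * K1) = (a / K1 + b / K1) / 2" using K1 by (simp add: field_simps)
        have "\<theta> ((a + b) / (2 * K1)) \<le> (\<theta> (a / K1) + \<theta> (b / K1)) / 2" unfolding eq by (rule modular_half_add[OF \<theta>])
        also have "\<dots> \<le> \<theta> (a / K1) + \<theta> (b / K1)" using modular_nonneg[OF \<theta>, of "a / K1"] modular_nonneg[OF \<theta>, of "b / K1"] by simp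
        finally show ?thesis using modular_nonneg[OF \<theta>] by (simp add: ennreal_plus[symmetric] ennreal_leI del: ennreal_plus)
      qed
      have part1: "(\<integral>\<^sup>+x. ennreal (\<theta> (\<bar>(F x - D 0 x) * \<phi> x ^ r\<bar> / Ca)) * indicator {-1..1} x \<partial>lborel) \<le> S"
      proof -
        have pw: "ennreal (\<theta> (\<bar>(F x - D 0 x) * \<phi> x ^ r\<bar> / Ca)) * indicator {-1..1} x \<le>
          (\<Sum>i\<in>{1..2*n-1}. ennreal (\<theta> (e i x / K1)) * indicator {?X (i-1)..?X (i+1)} x)" for x
        proof (cases "x \<in> {-1..1}")
          case True
          obtain j where j: "j < 2 * n" "x \<in> {?X j..?X (Suc j)}" using knot_cover[OF n1 True] by blast
          have \<phi>0: "\<phi> x \<ge> 0" using True by (intro \<phi>_nonneg) (auto simp: abs_le_iff)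
          have "1 * K1 \<le> (2 * C) * K1" using C K1 by (intro mult_right_mono) auto
          then have "K1 \<le> Ca" using Ca(2) by linarith
          then have K1Ca: "1 / Ca \<le> 1 / K1" using Ca(1) K1 by (simp add: frac_le)
          have one: "ennreal (\<theta> (\<bar>(F x - D 0 x) * \<phi> x ^ r\<bar> / Ca)) \<le> ennreal (\<theta> (e i x / K1)) * indicator {?X (i-1)..?X (i+1)} x"
            if "D 0 x = poly (p i) x" "x \<in> {?X (i-1)..?X (i+1)}" for i
          proof -
            have "\<bar>(F x - D 0 x) * \<phi> x ^ r\<bar> = e i x" using that \<phi>0 by (simp add: e_def abs_mult mult.commute)
            moreover have "e i x / Ca \<le> e i x / K1" using mult_left_mono[OF K1Ca e0[OF True, of i]] by simp
            ultimately show ?thesis using that modular_mono[OF \<theta>] by (simp add: ennreal_leI)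
          qed
          \<comment> \<open>On the two outermost cells \<open>D 0\<close> is a single polynomial, so
            one error suffices; on the inner cells two neighbouring errors enter.\<close>
          consider "j = 0" | "j = 2 * n - 1" | "j \<in> {1..<2*n-1}" using j(1) by force
          then have "ennreal (\<theta> (\<bar>(F x - D 0 x) * \<phi> x ^ r\<bar> / Ca)) \<le> (\<Sum>i\<in>{1..2*n-1}. ennreal (\<theta> (e i x / K1)) * indicator {?X (i-1)..?X (i+1)} x)"
          proof cases
            case 1
            have "?X 1 < ?X 2" using knot_less[OF n1, of 1] n1 by (simp add: numeral_2_eq_2)
            then have "x \<in> {?X (1-1)..?X (1+1)}" using j 1 by (auto simp: numeral_2_eq_2)
            moreover have "D 0 x = poly (p 1) x" using D3[of x] j 1 by auto
            ultimately have "ennreal (\<theta> (\<bar>(F x - D 0 x) * \<phi> x ^ r\<bar> / Ca)) \<le> ennreal (\<theta> (e 1 x / K1)) * indicator {?X (1-1)..?X (1+1)} x" by (intro one)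
            also have "\<dots> \<le> (\<Sum>i\<in>{1..2*n-1}. ennreal (\<theta> (e i x / K1)) * indicator {?X (i-1)..?X (i+1)} x)"
              by (rule member_le_sum) (use n1 in auto)
            finally show ?thesis .
          next
            case 2
            have s: "Suc (2 * n - 1 - 1) = 2 * n - 1" using n1 by simp
            have "?X (2*n-1-1) < ?X (2*n-1)" using knot_less[OF n1, of "2*n-1-1"] n1 unfolding s by simp
            then have "x \<in> {?X (2*n-1-1)..?X (2*n-1+1)}" using j 2 by auto
            moreover have "D 0 x = poly (p (2*n-1)) x" using D4[of x] j 2 by auto
            ultimately have "ennreal (\<theta> (\<bar>(F x - D 0 x) * \<phi> x ^ r\<bar> / Ca)) \<le> ennreal (\<theta> (e (2*n-1) x / K1)) * indicator {?X (2*n-1-1)..?X (2*n-1+1)} x" by (intro one)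
            also have "\<dots> \<le> (\<Sum>i\<in>{1..2*n-1}. ennreal (\<theta> (e i x / K1)) * indicator {?X (i-1)..?X (i+1)} x)"
              by (rule member_le_sum) (use n1 in auto)
            finally show ?thesis .
          next
            case 3
            have "?X (j-1) < ?X (Suc (j-1))" "?X (Suc j) < ?X (Suc (Suc j))" using knot_less[OF n1, of "j-1"] knot_less[OF n1, of "Suc j"] 3 by auto
            then have xj: "x \<in> {?X (j-1)..?X (j+1)}" "x \<in> {?X (Suc j-1)..?X (Suc j+1)}" using j 3 by auto
            have s2: "(\<Sum>i\<in>{j, Suc j}. h i) = h j + h (Suc j)" for h :: "nat \<Rightarrow> ennreal" by simp
            have "\<bar>(F x - D 0 x) * \<phi> x ^ r\<bar> = \<phi> x ^ r * \<bar>F x - D 0 x\<bar>" using \<phi>0 by (simp add: abs_mult mult.commute)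
            also have "\<dots> \<le> \<phi> x ^ r * (C * (\<bar>F x - poly (p j) x\<bar> + \<bar>F x - poly (p (Suc j)) x\<bar>))"
              using D5[OF 3 j(2)] \<phi>0 by (intro mult_left_mono) auto
            also have "\<dots> = C * (e j x + e (Suc j) x)" by (simp add: e_def algebra_simps)
            finally have "\<bar>(F x - D 0 x) * \<phi> x ^ r\<bar> / Ca \<le> C * (e j x + e (Suc j) x) / Ca" using Ca(1) by (intro divide_right_mono) auto
            also have "\<dots> \<le> C * (e j x + e (Suc j) x) / (2 * C * K1)"
              using Ca C K1 e0[OF True] by (intro divide_left_mono mult_nonneg_nonneg add_nonneg_nonneg mult_pos_pos) auto
            also have "\<dots> = (e j x + e (Suc j) x) / (2 * K1)" using C K1 by (simp add: field_simps)
            finally have "ennreal (\<theta> (\<bar>(F x - D 0 x) * \<phi> x ^ r\<bar> / Ca)) \<le> ennreal (\<theta> ((e j x + e (Suc j) x) / (2 * K1)))"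
              by (intro ennreal_leI modular_mono[OF \<theta>])
            also have "\<dots> \<le> ennreal (\<theta> (e j x / K1)) + ennreal (\<theta> (e (Suc j) x / K1))" by (rule half)
            also have "\<dots> = (\<Sum>i\<in>{j, Suc j}. ennreal (\<theta> (e i x / K1)) * indicator {?X (i-1)..?X (i+1)} x)" unfolding s2 using xj by simp
            also have "\<dots> \<le> (\<Sum>i\<in>{1..2*n-1}. ennreal (\<theta> (e i x / K1)) * indicator {?X (i-1)..?X (i+1)} x)"
              by (rule sum_mono2) (use 3 in auto)
            finally show ?thesis .
          qed
          then show ?thesis using True by simp
        qed simp
        have "(\<integral>\<^sup>+x. ennreal (\<theta> (\<bar>(F x - D 0 x) * \<phi> x ^ r\<bar> / Ca)) * indicator {-1..1} x \<partial>lborel) \<le>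
          (\<integral>\<^sup>+x. (\<Sum>i\<in>{1..2*n-1}. ennreal (\<theta> (e i x / K1)) * indicator {?X (i-1)..?X (i+1)} x) \<partial>lborel)"
          by (intro nn_integral_mono pw)
        also have "\<dots> = S" unfolding S_def E_def by (rule nn_integral_sum) measurable
        finally show ?thesis .
      qed
      have part2: "(\<integral>\<^sup>+x. ennreal (\<theta> (\<bar>t ^ k * (D k x * \<phi> x ^ (k + r))\<bar> / Ca)) * indicator {-1..1} x \<partial>lborel) \<le> 2 * S"
      proof -
        define g where "g j y = ennreal (\<theta> (e j y / K1)) + ennreal (\<theta> (e (Suc j) y / K1))" for j y
        have [measurable]: "g j \<in> borel_measurable borel" for j unfolding g_def[abs_def] by measurable
        define G where "G j = (\<integral>\<^sup>+y. g j y * indicator {?X j..?X (Suc j)} y \<partial>lborel)" for j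
        define ln where "ln j = ?X (Suc j) - ?X j" for j
        have ln: "ln j > 0" if "j \<in> {1..<2*n-1}" for j unfolding ln_def using that by (intro len) auto
        have cell: "ennreal (\<theta> (\<bar>t ^ k * (D k x * \<phi> x ^ (k + r))\<bar> / Ca)) \<le> ennreal (1 / ln j) * G j"
          if j: "j \<in> {1..<2*n-1}" and x: "x \<in> {?X j..?X (Suc j)}" for j x
        proof -
          have lj: "ln j > 0" by (rule ln[OF j])
          have j2: "1 \<le> j" "j \<le> 2 * n - 2" using j by auto
          have Xj: "{?X j..?X (Suc j)} \<subseteq> {-1..1}" using Xin[of j] Xin[of "Suc j"] j by auto
          have \<phi>0: "\<phi> y \<ge> 0" if "y \<in> {?X j..?X (Suc j)}" for y using Xj that by (intro \<phi>_nonneg) (auto simp: abs_le_iff)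
          define w where "w y = ennreal (indicator {?X j..?X (Suc j)} y / ln j)" for y
          have [measurable]: "w \<in> borel_measurable borel" unfolding w_def[abs_def] by measurable
          have w1: "(\<integral>\<^sup>+y. w y \<partial>lborel) = 1" unfolding w_def ln_def using lj by (intro lborel_mass_Icc_weight) (simp add: ln_def)
          \<comment> \<open>Half the sum of the two scaled errors, so that convexity of
            \<open>\<theta>\<close> separates them; the value 0 off the cell keeps the function
            nonnegative for Jensen's inequality.\<close>
          define ee where "ee y = (if y \<in> {?X j..?X (Suc j)} then (e j y + e (Suc j) y) / (2 * K1) else 0)" for y
          have [measurable]: "ee \<in> borel_measurable borel" unfolding ee_def[abs_def] by measurable
          have ee0: "0 \<le> ee y" for y using e0[of y j] e0[of y "Suc j"] Xj K1 by (auto simp: ee_def)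
          \<comment> \<open>The k factors \<open>\<phi>\<close> together with \<open>t ^ k\<close>
            are absorbed by the k-th power of the cell length:
            \<open>\<phi> \<le> 3/2 * n * ln j\<close> and \<open>t * n \<le> C5\<close>.\<close>
          have "t * \<phi> x \<le> t * (3/2 * (real n * ln j))" using cell_ratio(2)[OF n1 j2 x x] t by (intro mult_left_mono) (auto simp: ln_def)
          also have "\<dots> = (3/2 * (t * real n)) * ln j" by simp
          also have "\<dots> \<le> C6 * ln j" unfolding C6_def using tn2 lj by (intro mult_right_mono mult_left_mono) auto
          finally have "(t * \<phi> x) ^ k \<le> (C6 * ln j) ^ k" using t \<phi>0[OF x] by (intro power_mono) auto
          then have tk: "t ^ k * \<phi> x ^ k \<le> C6 ^ k * ln j ^ k" by (simp add: power_mult_distrib)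
          have "\<bar>t ^ k * (D k x * \<phi> x ^ (k + r))\<bar> = (t ^ k * \<phi> x ^ k) * (\<phi> x ^ r * \<bar>D k x\<bar>)"
            using t \<phi>0[OF x] by (simp add: abs_mult power_add)
          also have "\<dots> \<le> (C6 ^ k * ln j ^ k) * (\<phi> x ^ r * \<bar>D k x\<bar>)" using tk \<phi>0[OF x] by (intro mult_right_mono) auto
          also have "\<dots> = (C6 ^ k * \<phi> x ^ r) * (ln j ^ k * \<bar>D k x\<bar>)" by simp
          finally have "ennreal \<bar>t ^ k * (D k x * \<phi> x ^ (k + r))\<bar> \<le> ennreal (C6 ^ k * \<phi> x ^ r) * ennreal (ln j ^ k * \<bar>D k x\<bar>)"
            using C56 \<phi>0[OF x] lj by (subst ennreal_mult[symmetric]) (auto intro!: ennreal_leI)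
          also have "\<dots> \<le> ennreal (C6 ^ k * \<phi> x ^ r) * (ennreal (C / ln j) * (\<integral>\<^sup>+y. ennreal \<bar>poly (p (Suc j) - p j) y\<bar> * indicator {?X j..?X (Suc j)} y \<partial>lborel))"
            using D6[OF j x] by (intro mult_left_mono) (auto simp: ln_def)
          also have "\<dots> = (\<integral>\<^sup>+y. ennreal (C6 ^ k * \<phi> x ^ r) * (ennreal (C / ln j) * (ennreal \<bar>poly (p (Suc j) - p j) y\<bar> * indicator {?X j..?X (Suc j)} y)) \<partial>lborel)"
            by (simp add: nn_integral_cmult)
          also have "\<dots> \<le> (\<integral>\<^sup>+y. ennreal Ca * (w y * ennreal (ee y)) \<partial>lborel)"
          proof (rule nn_integral_mono)
            fix y
            show "ennreal (C6 ^ k * \<phi> x ^ r) * (ennreal (C / ln j) * (ennreal \<bar>poly (p (Suc j) - p j) y\<bar> * indicator {?X j..?X (Suc j)} y)) \<le> ennreal Ca * (w y * ennreal (ee y))"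
            proof (cases "y \<in> {?X j..?X (Suc j)}")
              case y: True
              have "\<phi> x ^ r \<le> (3 * \<phi> y) ^ r" using cell_ratio(1)[OF n1 j2 x y] \<phi>0[OF x] by (intro power_mono) auto
              then have 1: "\<phi> x ^ r \<le> 3 ^ r * \<phi> y ^ r" by (simp add: power_mult_distrib)
              have 2: "\<bar>poly (p (Suc j) - p j) y\<bar> \<le> \<bar>F y - poly (p j) y\<bar> + \<bar>F y - poly (p (Suc j)) y\<bar>" by simp
              have "\<phi> x ^ r * \<bar>poly (p (Suc j) - p j) y\<bar> \<le> (3 ^ r * \<phi> y ^ r) * (\<bar>F y - poly (p j) y\<bar> + \<bar>F y - poly (p (Suc j)) y\<bar>)"
                using 1 2 \<phi>0[OF y] by (intro mult_mono) auto
              also have "\<dots> = 3 ^ r * (e j y + e (Suc j) y)" by (simp add: e_def algebra_simps)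
              finally have 3: "\<phi> x ^ r * \<bar>poly (p (Suc j) - p j) y\<bar> \<le> 3 ^ r * (e j y + e (Suc j) y)" .
              have "(C6 ^ k * \<phi> x ^ r) * ((C / ln j) * \<bar>poly (p (Suc j) - p j) y\<bar>) = (C6 ^ k * C / ln j) * (\<phi> x ^ r * \<bar>poly (p (Suc j) - p j) y\<bar>)" by simp
              also have "\<dots> \<le> (C6 ^ k * C / ln j) * (3 ^ r * (e j y + e (Suc j) y))" using 3 C56 C lj by (intro mult_left_mono) auto
              also have "\<dots> = (2 * K1 * (C6 ^ k * C * 3 ^ r)) * ((1 / ln j) * ee y)" using y K1 lj by (simp add: ee_def field_simps)
              also have "\<dots> \<le> Ca * ((1 / ln j) * ee y)" using Ca(3) lj ee0 by (intro mult_right_mono) auto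
              finally have 4: "(C6 ^ k * \<phi> x ^ r) * ((C / ln j) * \<bar>poly (p (Suc j) - p j) y\<bar>) \<le> Ca * ((1 / ln j) * ee y)" .
              have "ennreal (C6 ^ k * \<phi> x ^ r) * (ennreal (C / ln j) * ennreal \<bar>poly (p (Suc j) - p j) y\<bar>) = ennreal ((C6 ^ k * \<phi> x ^ r) * ((C / ln j) * \<bar>poly (p (Suc j) - p j) y\<bar>))"
                using C56 C lj \<phi>0[OF x] by (subst (1 2) ennreal_mult) (auto intro!: mult_nonneg_nonneg)
              also have "\<dots> \<le> ennreal (Ca * ((1 / ln j) * ee y))" by (rule ennreal_leI[OF 4])
              also have "\<dots> = ennreal Ca * (ennreal (1 / ln j) * ennreal (ee y))"
              proof -
                have a: "0 \<le> Ca" "0 \<le> 1 / ln j" "0 \<le> 1 / ln j * ee y" using Ca(1) lj ee0[of y] by auto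
                show ?thesis by (simp only: ennreal_mult[OF a(1,3)] ennreal_mult[OF a(2) ee0])
              qed
              finally show ?thesis using y by (simp add: w_def)
            qed simp
          qed
          also have "\<dots> = ennreal Ca * (\<integral>\<^sup>+y. w y * ennreal (ee y) \<partial>lborel)" by (rule nn_integral_cmult) measurable
          finally have "ennreal (1 / Ca) * ennreal \<bar>t ^ k * (D k x * \<phi> x ^ (k + r))\<bar> \<le> ennreal (1 / Ca) * (ennreal Ca * (\<integral>\<^sup>+y. w y * ennreal (ee y) \<partial>lborel))"
            by (rule mult_left_mono) simp
          also have "ennreal (1 / Ca) * (ennreal Ca * (\<integral>\<^sup>+y. w y * ennreal (ee y) \<partial>lborel)) = (\<integral>\<^sup>+y. w y * ennreal (ee y) \<partial>lborel)"
            using Ca(1) by (simp add: mult.assoc[symmetric] ennreal_mult[symmetric])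
          also have "ennreal (1 / Ca) * ennreal \<bar>t ^ k * (D k x * \<phi> x ^ (k + r))\<bar> = ennreal (\<bar>t ^ k * (D k x * \<phi> x ^ (k + r))\<bar> / Ca)"
            using Ca(1) by (simp add: ennreal_mult'[symmetric])
          finally have "ennreal (\<theta> (\<bar>t ^ k * (D k x * \<phi> x ^ (k + r))\<bar> / Ca)) \<le> (\<integral>\<^sup>+y. w y * ennreal (\<theta> (ee y)) \<partial>lborel)"
            by (intro modular_Jensen[OF \<theta> _ _ w1]) (auto simp: ee0)
          also have "\<dots> \<le> (\<integral>\<^sup>+y. ennreal (1 / ln j) * (g j y * indicator {?X j..?X (Suc j)} y) \<partial>lborel)"
          proof (rule nn_integral_mono)
            fix y
            show "w y * ennreal (\<theta> (ee y)) \<le> ennreal (1 / ln j) * (g j y * indicator {?X j..?X (Suc j)} y)"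
            proof (cases "y \<in> {?X j..?X (Suc j)}")
              case True
              then have "ennreal (\<theta> (ee y)) \<le> g j y" unfolding ee_def g_def using half by simp
              then show ?thesis using True by (simp add: w_def mult_left_mono)
            qed (simp add: w_def)
          qed
          also have "\<dots> = ennreal (1 / ln j) * G j" unfolding G_def by (rule nn_integral_cmult) measurable
          finally show ?thesis .
        qed
        have pw: "ennreal (\<theta> (\<bar>t ^ k * (D k x * \<phi> x ^ (k + r))\<bar> / Ca)) * indicator {-1..1} x \<le>
          (\<Sum>j\<in>{1..<2*n-1}. ennreal (1 / ln j) * G j * indicator {?X j..?X (Suc j)} x)" for x
        proof (cases "x \<in> {-1..1}")
          case True
          obtain j where j: "j < 2 * n" "x \<in> {?X j..?X (Suc j)}" using knot_cover[OF n1 True] by blast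
          \<comment> \<open>\<open>D k\<close> vanishes on the two outermost cells, the only ones to
            which \<open>cell_ratio\<close> does not apply.\<close>
          consider "j = 0" | "j = 2 * n - 1" | "j \<in> {1..<2*n-1}" using j(1) by force
          then show ?thesis
          proof cases
            case 1
            then have "D k x = 0" using D3[of x] j by auto
            then show ?thesis by (simp add: \<theta>0)
          next
            case 2
            then have "D k x = 0" using D4[of x] j by auto
            then show ?thesis by (simp add: \<theta>0)
          next
            case 3
            have "ennreal (\<theta> (\<bar>t ^ k * (D k x * \<phi> x ^ (k + r))\<bar> / Ca)) * indicator {-1..1} x \<le> ennreal (1 / ln j) * G j * indicator {?X j..?X (Suc j)} x"
              using cell[OF 3 j(2)] j(2) True by simp
            also have "\<dots> \<le> (\<Sum>j\<in>{1..<2*n-1}. ennreal (1 / ln j) * G j * indicator {?X j..?X (Suc j)} x)"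
              by (rule member_le_sum[of j "{1..<2*n-1}" "\<lambda>j. ennreal (1 / ln j) * G j * indicator {?X j..?X (Suc j)} x"]) (use 3 in auto)
            finally show ?thesis .
          qed
        qed simp
        have "(\<integral>\<^sup>+x. ennreal (\<theta> (\<bar>t ^ k * (D k x * \<phi> x ^ (k + r))\<bar> / Ca)) * indicator {-1..1} x \<partial>lborel) \<le>
          (\<integral>\<^sup>+x. (\<Sum>j\<in>{1..<2*n-1}. ennreal (1 / ln j) * G j * indicator {?X j..?X (Suc j)} x) \<partial>lborel)"
          by (intro nn_integral_mono pw)
        also have "\<dots> = (\<Sum>j\<in>{1..<2*n-1}. \<integral>\<^sup>+x. ennreal (1 / ln j) * G j * indicator {?X j..?X (Suc j)} x \<partial>lborel)"
          by (rule nn_integral_sum) measurable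
        also have "\<dots> = (\<Sum>j\<in>{1..<2*n-1}. G j)"
        proof (rule sum.cong[OF refl])
          fix j assume j: "j \<in> {1..<2*n-1}"
          have "(\<integral>\<^sup>+x. ennreal (1 / ln j) * G j * indicator {?X j..?X (Suc j)} x \<partial>lborel) = ennreal (1 / ln j) * G j * ennreal (ln j)"
            using ln[OF j] by (simp add: nn_integral_cmult_indicator ln_def)
          also have "\<dots> = (ennreal (1 / ln j) * ennreal (ln j)) * G j" by (simp add: mult_ac)
          also have "ennreal (1 / ln j) * ennreal (ln j) = 1" using ln[OF j] by (subst ennreal_mult[symmetric]) auto
          finally show "(\<integral>\<^sup>+x. ennreal (1 / ln j) * G j * indicator {?X j..?X (Suc j)} x \<partial>lborel) = G j" by simp
        qed
        \<comment> \<open>Each \<open>E\<close> integrates over both cells adjacent to its knot, so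
          \<open>E\<close> at j and at its successor both dominate the integrals over the common
          cell; every \<open>E\<close> is used at most twice.\<close>
        also have "\<dots> \<le> (\<Sum>j\<in>{1..<2*n-1}. E \<theta> j + E \<theta> (Suc j))"
        proof (rule sum_mono)
          fix j assume j: "j \<in> {1..<2*n-1}"
          have xx: "?X (j-1) < ?X (Suc (j-1))" "?X (Suc j) < ?X (Suc (Suc j))" using knot_less[OF n1, of "j-1"] knot_less[OF n1, of "Suc j"] j by auto
          have "G j = (\<integral>\<^sup>+y. ennreal (\<theta> (e j y / K1)) * indicator {?X j..?X (Suc j)} y \<partial>lborel) + (\<integral>\<^sup>+y. ennreal (\<theta> (e (Suc j) y / K1)) * indicator {?X j..?X (Suc j)} y \<partial>lborel)"
            unfolding G_def g_def by (simp add: distrib_right nn_integral_add)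
          also have "\<dots> \<le> E \<theta> j + E \<theta> (Suc j)" unfolding E_def
            using xx j by (intro add_mono nn_integral_mono mult_left_mono) (auto split: split_indicator)
          finally show "G j \<le> E \<theta> j + E \<theta> (Suc j)" .
        qed
        also have "\<dots> = (\<Sum>j\<in>{1..<2*n-1}. E \<theta> j) + (\<Sum>j\<in>{1..<2*n-1}. E \<theta> (Suc j))" by (rule sum.distrib)
        also have "\<dots> \<le> S + S"
        proof (rule add_mono)
          show "(\<Sum>j\<in>{1..<2*n-1}. E \<theta> j) \<le> S" unfolding S_def by (rule sum_mono2) auto
          have "(\<Sum>j\<in>{1..<2*n-1}. E \<theta> (Suc j)) = (\<Sum>j\<in>Suc ` {1..<2*n-1}. E \<theta> j)" by (simp only: sum.reindex[OF inj_Suc] o_def)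
          also have "\<dots> \<le> S" unfolding S_def by (rule sum_mono2) auto
          finally show "(\<Sum>j\<in>{1..<2*n-1}. E \<theta> (Suc j)) \<le> S" .
        qed
        finally show ?thesis by (simp add: mult_2)
      qed
      have zm[measurable]: "zz i \<in> borel_measurable borel" for i unfolding zz_def[abs_def] by measurable
      \<comment> \<open>A point lies in at most 2 N + 1 zones counted from each endpoint, which
        gives the factor \<open>2 * (2 * N + 1)\<close>.\<close>
      have Sle: "S \<le> ennreal (((2 + 4 * N) / 2) * real n * (2 * (2 * N + 1))) * (\<integral>\<^sup>+x. V \<theta> x * indicator {-1<..<1} x \<partial>lborel)"
      proof -
        have "S \<le> (\<Sum>i\<in>{1..2*n-1}. cc * (\<integral>\<^sup>+x. V \<theta> x * zz i x \<partial>lborel))"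
          unfolding S_def using pE \<theta> by (intro sum_mono) auto
        also have "\<dots> = cc * (\<Sum>i\<in>{1..2*n-1}. (\<integral>\<^sup>+x. V \<theta> x * zz i x \<partial>lborel))" by (simp add: sum_distrib_left)
        also have "(\<Sum>i\<in>{1..2*n-1}. (\<integral>\<^sup>+x. V \<theta> x * zz i x \<partial>lborel)) = (\<integral>\<^sup>+x. (\<Sum>i\<in>{1..2*n-1}. V \<theta> x * zz i x) \<partial>lborel)"
          by (rule nn_integral_sum[symmetric]) measurable
        also have "\<dots> \<le> (\<integral>\<^sup>+x. ennreal (2 * (2 * N + 1)) * (V \<theta> x * indicator {-1<..<1} x) \<partial>lborel)"
        proof (rule nn_integral_mono)
          fix x
          show "(\<Sum>i\<in>{1..2*n-1}. V \<theta> x * zz i x) \<le> ennreal (2 * (2 * N + 1)) * (V \<theta> x * indicator {-1<..<1} x)"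
          proof (cases "x \<in> {-1<..<1}")
            case False
            then have "zz i x = 0" for i by (auto simp: zz_def zone_def indicator_def abs_less_iff)
            then show ?thesis by simp
          next
            case True
            have "(\<Sum>i\<in>{1..2*n-1}. zz i x) = (\<Sum>i\<in>{1..<n}. zz i x) + (\<Sum>i\<in>{n..2*n-1}. zz i x)"
            proof -
              have "{1..2*n-1} = {1..<n} \<union> {n..2*n-1}" using n1 by auto
              then show ?thesis by (simp only:) (rule sum.union_disjoint, auto)
            qed
            also have "(\<Sum>i\<in>{1..<n}. zz i x) = (\<Sum>i\<in>{1..<n}. indicator (zone (1 / real n) (1 + 4 * k) i) (- x))" by (intro sum.cong) (auto simp: zz_def)
            also have "\<dots> \<le> (\<Sum>i\<in>{1..n}. indicator (zone (1 / real n) (1 + 4 * k) i) (- x))" by (rule sum_mono2) auto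
            also have "\<dots> \<le> ennreal (2 * real (1 + 4 * k) + 1)" using n0 by (intro zone_overlap) simp
            also have "(\<Sum>i\<in>{n..2*n-1}. zz i x) = (\<Sum>m\<in>{1..n}. indicator (zone (1 / real n) (1 + 4 * k) m) x)"
              by (rule sum.reindex_bij_witness[of _ "\<lambda>m. 2 * n - m" "\<lambda>i. 2 * n - i"]) (use n1 in \<open>auto simp: zz_def\<close>)
            also have "\<dots> \<le> ennreal (2 * real (1 + 4 * k) + 1)" using n0 by (intro zone_overlap) simp
            also have "ennreal (2 * real (1 + 4 * k) + 1) + ennreal (2 * real (1 + 4 * k) + 1) = ennreal (2 * (2 * N + 1))"
              by (simp add: N_def ennreal_plus[symmetric] del: ennreal_plus)
            finally have "(\<Sum>i\<in>{1..2*n-1}. zz i x) \<le> ennreal (2 * (2 * N + 1))" by (simp add: add_mono)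
            then have "V \<theta> x * (\<Sum>i\<in>{1..2*n-1}. zz i x) \<le> V \<theta> x * ennreal (2 * (2 * N + 1))" by (rule mult_left_mono) simp
            then show ?thesis using True by (simp add: sum_distrib_left mult.commute)
          qed
        qed
        also have "\<dots> = ennreal (2 * (2 * N + 1)) * (\<integral>\<^sup>+x. V \<theta> x * indicator {-1<..<1} x \<partial>lborel)" by (rule nn_integral_cmult) measurable
        also have "cc * (ennreal (2 * (2 * N + 1)) * (\<integral>\<^sup>+x. V \<theta> x * indicator {-1<..<1} x \<partial>lborel)) = ennreal (((2 + 4 * N) / 2) * real n * (2 * (2 * N + 1))) * (\<integral>\<^sup>+x. V \<theta> x * indicator {-1<..<1} x \<partial>lborel)"
        proof -
          have "ennreal (((2 + 4 * N) / 2) * real n * (2 * (2 * N + 1))) = ennreal ((2 + 4 * N) / 2 * real n) * ennreal (2 * (2 * N + 1))"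
            using N n0 by (intro ennreal_mult) auto
          then show ?thesis unfolding cc_def N_def by (simp add: mult.assoc)
        qed
        finally show ?thesis by (simp add: mult_left_mono)
      qed
      have S2: "2 * S \<le> ennreal Cb * (ennreal (1 / t) * (\<integral>\<^sup>+x. V \<theta> x * indicator {-1<..<1} x \<partial>lborel))"
      proof -
        let ?V = "\<integral>\<^sup>+x. V \<theta> x * indicator {-1<..<1} x \<partial>lborel"
        have "2 * S \<le> ennreal 2 * (ennreal (((2 + 4 * N) / 2) * real n * (2 * (2 * N + 1))) * ?V)"
          using Sle by (simp add: mult_left_mono)
        also have "\<dots> = ennreal (2 * (((2 + 4 * N) / 2) * real n * (2 * (2 * N + 1)))) * ?V"
          using N n0 by (subst ennreal_mult[of 2]) (auto simp: mult.assoc)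
        also have "\<dots> \<le> ennreal (Cb * (1 / t)) * ?V"
        proof (intro mult_right_mono ennreal_leI)
          \<comment> \<open>Here the factor n of the cell estimates turns into the 1/t of the mean
            over the step.\<close>
          have "real n \<le> C5 * (1 / t)" using tn2 t by (simp add: field_simps)
          then have "2 * (((2 + 4 * N) / 2) * real n * (2 * (2 * N + 1))) \<le> 2 * (((2 + 4 * N) / 2) * (C5 * (1 / t)) * (2 * (2 * N + 1)))"
            using N by (intro mult_left_mono mult_right_mono) auto
          then show "2 * (((2 + 4 * N) / 2) * real n * (2 * (2 * N + 1))) \<le> Cb * (1 / t)" by (simp add: Cb_def)
        qed simp
        also have "\<dots> = ennreal Cb * (ennreal (1 / t) * ?V)" using Cb t by (subst ennreal_mult) (auto simp: mult.assoc)
        finally show ?thesis .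
      qed
      have "S \<le> 2 * S" by (simp add: mult_2)
      then show ?thesis using part1 part2 S2 by (meson order_trans)
    qed
    then show "\<exists>D. (\<forall>m<k. \<forall>x. (D m has_real_derivative D (Suc m) x) (at x)) \<and> continuous_on UNIV (D k) \<and>
     (\<forall>\<theta>. modular \<theta> \<longrightarrow>
       (\<integral>\<^sup>+x. ennreal (\<theta> (\<bar>(F x - D 0 x) * \<phi> x ^ r\<bar> / Ca)) * indicator {-1..1} x \<partial>lborel) \<le>
         ennreal Cb * diff_mean \<theta> k r F t \<and>
       (\<integral>\<^sup>+x. ennreal (\<theta> (\<bar>t ^ k * (D k x * \<phi> x ^ (k + r))\<bar> / Ca)) * indicator {-1..1} x \<partial>lborel) \<le>
         ennreal Cb * diff_mean \<theta> k r F t)"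
      unfolding V_def using D1 D2 by (intro exI[of _ D] conjI allI impI) blast+
  qed
qed

section \<open>Equivalence of the moduli and the K-functional\<close>

lemma continuous_antiderivative:
  fixes G :: "real \<Rightarrow> real"
  assumes "continuous_on UNIV G"
  shows "\<exists>g. \<forall>x. (g has_real_derivative G x) (at x)"
proof -
  have "\<exists>F. \<forall>x::real. -\<infinity> < ereal x \<longrightarrow> ereal x < \<infinity> \<longrightarrow> (F has_vector_derivative G x) (at x)"
    using assms by (intro einterval_antiderivative) (auto simp: continuous_on_eq_continuous_at)
  then show ?thesis by (simp add: has_real_derivative_iff_has_vector_derivative)
qed

text \<open>Prepending one antiderivative at a time shifts the chain r places down.
  \<open>E 0\<close> is then a function whose r-th derivative is \<open>D 0\<close> and whose
  derivative of order k + r is \<open>D k\<close>.\<close>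

lemma antiderivative_chain:
  fixes D :: "nat \<Rightarrow> real \<Rightarrow> real"
  assumes D: "\<forall>m<k. \<forall>x. (D m has_real_derivative D (Suc m) x) (at x)" and cont: "continuous_on UNIV (D 0)"
  shows "\<exists>E. (\<forall>j<k + r. \<forall>x. (E j has_real_derivative E (Suc j) x) (at x)) \<and> continuous_on UNIV (E 0) \<and> (\<forall>m. E (r + m) = D m)"
proof (induction r)
  case 0
  show ?case using D cont by (intro exI[of _ D]) auto
next
  case (Suc r)
  then obtain E where E: "\<forall>j<k + r. \<forall>x. (E j has_real_derivative E (Suc j) x) (at x)" "continuous_on UNIV (E 0)" "\<forall>m. E (r + m) = D m" by blast
  obtain G where G: "\<forall>x. (G has_real_derivative E 0 x) (at x)" using continuous_antiderivative[OF E(2)] by blast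
  show ?case
  proof (intro exI[of _ "case_nat G E"] conjI allI impI)
    fix j x assume "j < k + Suc r"
    then show "(case_nat G E j has_real_derivative case_nat G E (Suc j) x) (at x)" using E(1) G by (cases j) auto
  next
    show "continuous_on UNIV (case_nat G E 0)"
      using G by (auto intro!: continuous_at_imp_continuous_on DERIV_isCont)
  next
    fix m show "case_nat G E (Suc r + m) = D m" using E(3) by simp
  qed
qed

lemma higher_deriv_chain:
  fixes E :: "nat \<Rightarrow> real \<Rightarrow> real"
  assumes "\<forall>j<n. \<forall>x. (E j has_real_derivative E (Suc j) x) (at x)" "j \<le> n"
  shows "(deriv ^^ j) (E 0) = E j"
  using assms(2)
proof (induction j)
  case (Suc j)
  then have "(deriv ^^ j) (E 0) = E j" and "j < n" by auto
  then show ?case using assms(1) by (auto intro!: ext DERIV_imp_deriv)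
qed simp

lemma emeasure_lebesgue_on_Icc_finite: "emeasure (lebesgue_on {a..b::real}) (space (lebesgue_on {a..b})) < \<infinity>"
  by (simp add: emeasure_restrict_space space_restrict_space emeasure_lborel_Icc_eq)

lemma continuous_imp_Lp_space:
  assumes "continuous_on {a..b} u"
  shows "u \<in> Lp_space p {a..b}"
proof -
  have m[measurable]: "u \<in> borel_measurable (lebesgue_on {a..b})" using assms by (rule continuous_imp_measurable_on_sets_lebesgue) simp
  have "bounded (u ` {a..b})" using assms compact_continuous_image compact_imp_bounded by blast
  then obtain M where M0: "\<forall>y\<in>u ` {a..b}. norm y \<le> M" unfolding bounded_iff by blast
  then have M: "\<bar>u x\<bar> \<le> M" if "x \<in> space (lebesgue_on {a..b})" for x using that by (auto simp: space_restrict_space)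
  have "Lp_norm p {a..b} u < \<infinity>"
  proof (cases "p = \<infinity>")
    case True
    have "esssup (lebesgue_on {a..b}) (\<lambda>x. ennreal \<bar>u x\<bar>) \<le> ennreal M" by (rule esssup_I) (auto intro!: AE_I2 ennreal_leI M)
    then show ?thesis using True by (auto simp: Lp_norm_def intro: le_less_trans)
  next
    case False
    have "(\<integral>\<^sup>+x. ennreal (\<bar>u x\<bar> powr enn2real p) \<partial>lebesgue_on {a..b}) \<le> (\<integral>\<^sup>+x. ennreal (M powr enn2real p) \<partial>lebesgue_on {a..b})"
      by (intro nn_integral_mono ennreal_leI powr_mono2 M) auto
    also have "\<dots> < \<infinity>" using emeasure_lebesgue_on_Icc_finite[of a b] by (simp add: ennreal_mult_less_top)
    finally show ?thesis using False by (auto simp: Lp_norm_def ennreal_powr_def)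
  qed
  then show ?thesis by (simp add: Lp_space_def)
qed

text \<open>All functions of the chain are continuous on the whole line: the top derivative is
  bounded on [-1,1], hence in every \<open>Lp_space\<close>, and the one below it is C1, hence
  locally absolutely continuous.\<close>

lemma chain_in_B_class:
  fixes E :: "nat \<Rightarrow> real \<Rightarrow> real"
  assumes n: "n \<ge> 1" and E: "\<forall>j<n. \<forall>x. (E j has_real_derivative E (Suc j) x) (at x)" and cont: "continuous_on UNIV (E n)"
  shows "E 0 \<in> B_class p n"
proof -
  note ch = higher_deriv_chain[OF E]
  have "(deriv ^^ j) (E 0) field_differentiable at x" if "j < n - 1" for j x
  proof -
    have "(E j has_real_derivative E (Suc j) x) (at x)" "(deriv ^^ j) (E 0) = E j" using that E ch[of j] by simp_all
    then show ?thesis unfolding field_differentiable_def by metis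
  qed
  moreover have "locally_abs_continuous ((deriv ^^ (n - 1)) (E 0))"
  proof -
    have "abs_continuous_on a b (E (n - 1))" for a b
    proof (rule abs_continuous_on_C1)
      fix x show "(E (n - 1) has_real_derivative E n x) (at x)" using E[rule_format, of "n - 1" x] n by simp
      show "continuous_on {a..b} (E n)" using cont by (rule continuous_on_subset) simp
    qed
    then show ?thesis using ch[of "n - 1"] by (simp add: locally_abs_continuous_def)
  qed
  moreover have "(\<lambda>x. (deriv ^^ n) (E 0) x * \<phi> x ^ n) \<in> Lp_space p {-1..1}"
    unfolding ch[OF order_refl] \<phi>_def
    by (intro continuous_imp_Lp_space continuous_intros continuous_on_subset[OF cont]) simp
  ultimately show ?thesis using n by (auto simp: B_class_def)
qed

text \<open>On a bounded interval \<open>\<bar>v\<bar> \<le> 1 + \<bar>v\<bar> powr q\<close>. This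
  supplies the integrability from which the local polynomials are built.\<close>

lemma Lp_space_imp_integrable:
  assumes p: "1 \<le> p" and v: "v \<in> Lp_space p {a..b}"
  shows "(\<integral>\<^sup>+x. ennreal \<bar>v x\<bar> \<partial>lebesgue_on {a..b}) < \<infinity>"
proof (cases "p = \<infinity>")
  case True
  let ?s = "esssup (lebesgue_on {a..b}) (\<lambda>x. ennreal \<bar>v x\<bar>)"
  have s: "?s < \<infinity>" using v True by (simp add: Lp_space_def Lp_norm_def)
  have "(\<integral>\<^sup>+x. ennreal \<bar>v x\<bar> \<partial>lebesgue_on {a..b}) \<le> (\<integral>\<^sup>+x. ?s \<partial>lebesgue_on {a..b})"
    by (intro nn_integral_mono_AE esssup_AE)
  also have "\<dots> < \<infinity>" using s emeasure_lebesgue_on_Icc_finite[of a b] by (simp add: ennreal_mult_less_top)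
  finally show ?thesis .
next
  case False
  define q where "q = enn2real p"
  have q: "q \<ge> 1" using p False unfolding q_def by (cases p) auto
  have [measurable]: "v \<in> borel_measurable (lebesgue_on {a..b})" using v by (simp add: Lp_space_def)
  have Z: "(\<integral>\<^sup>+x. ennreal (\<bar>v x\<bar> powr q) \<partial>lebesgue_on {a..b}) < \<infinity>"
    using v False by (auto simp: Lp_space_def Lp_norm_def ennreal_powr_def q_def less_top split: if_splits)
  have "(\<integral>\<^sup>+x. ennreal \<bar>v x\<bar> \<partial>lebesgue_on {a..b}) \<le> (\<integral>\<^sup>+x. 1 + ennreal (\<bar>v x\<bar> powr q) \<partial>lebesgue_on {a..b})"
  proof (rule nn_integral_mono)
    fix x
    have "\<bar>v x\<bar> \<le> 1 + \<bar>v x\<bar> powr q"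
    proof (cases "\<bar>v x\<bar> \<le> 1")
      case False
      then have "\<bar>v x\<bar> powr 1 \<le> \<bar>v x\<bar> powr q" using q by (intro powr_mono) auto
      then show ?thesis using False by simp
    qed (simp add: add_increasing2)
    then have "ennreal \<bar>v x\<bar> \<le> ennreal (1 + \<bar>v x\<bar> powr q)" by (rule ennreal_leI)
    then show "ennreal \<bar>v x\<bar> \<le> 1 + ennreal (\<bar>v x\<bar> powr q)" by simp
  qed
  also have "\<dots> = emeasure (lebesgue_on {a..b}) (space (lebesgue_on {a..b})) + (\<integral>\<^sup>+x. ennreal (\<bar>v x\<bar> powr q) \<partial>lebesgue_on {a..b})"
    by (subst nn_integral_add) auto
  also have "\<dots> < \<infinity>" using Z emeasure_lebesgue_on_Icc_finite[of a b] by simp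
  finally show ?thesis .
qed

section \<open>Comparison of gauge integrals with the two moduli\<close>

lemma modular_wdiff_swap:
  assumes \<theta>: "modular \<theta>" and F[measurable]: "F \<in> borel_measurable borel"
  shows "(\<integral>\<^sup>+x. diff_integral \<theta> k r F t x * indicator {-1<..<1} x \<partial>lborel) =
    (\<integral>\<^sup>+\<tau>. (\<integral>\<^sup>+x. ennreal (\<theta> (wdiff k r F x \<tau>)) \<partial>lborel) * indicator {0<..t} \<tau> \<partial>lborel)"
proof -
  note [measurable] = modular_measurable[OF \<theta>]
  have 0: "\<theta> (wdiff k r F x \<tau>) = 0" if "x \<notin> {-1<..<1}" for x \<tau>
    using that \<theta> by (auto simp: wdiff_def modular_def abs_less_iff)
  have "(\<integral>\<^sup>+x. diff_integral \<theta> k r F t x * indicator {-1<..<1} x \<partial>lborel) =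
    (\<integral>\<^sup>+x. diff_integral \<theta> k r F t x \<partial>lborel)"
  proof (rule nn_integral_cong)
    fix x
    show "diff_integral \<theta> k r F t x * indicator {-1<..<1} x =
      diff_integral \<theta> k r F t x"
      by (cases "x \<in> {-1<..<1}") (simp, simp add: 0)
  qed
  also have "\<dots> = (\<integral>\<^sup>+\<tau>. (\<integral>\<^sup>+x. ennreal (\<theta> (wdiff k r F x \<tau>)) * indicator {0<..t} \<tau> \<partial>lborel) \<partial>lborel)"
    by (rule lborel_pair.Fubini'[symmetric]) measurable
  also have "\<dots> = (\<integral>\<^sup>+\<tau>. (\<integral>\<^sup>+x. ennreal (\<theta> (wdiff k r F x \<tau>)) \<partial>lborel) * indicator {0<..t} \<tau> \<partial>lborel)"
    by (intro nn_integral_cong nn_integral_multc) measurable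
  finally show ?thesis .
qed

text \<open>F is replaced by a Borel representative, \<open>D_set\<close> is absorbed into
  \<open>wdiff\<close>, and \<open>\<tau> = 0\<close> is dropped as a null set. In this form the
  averaged modulus is the quantity on the right of \<open>global_approximation\<close>.\<close>

lemma averaged_modulus_eq:
  assumes k: "k \<ge> 1" and t: "t > 0" and p: "p \<noteq> \<infinity>" and q: "enn2real p \<ge> 1"
    and F'[measurable]: "F' \<in> borel_measurable borel" and ae: "AE x in lborel. x \<in> {-1..1} \<longrightarrow> F x = F' x"
  shows "averaged_modulus k r p F t = ennreal_powr (ennreal (1 / t) *
    (\<integral>\<^sup>+x. diff_integral (\<theta>pow (enn2real p)) k r F' t x * indicator {-1<..<1} x \<partial>lborel))
    (1 / enn2real p)"
proof -
  let ?q = "enn2real p"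
  have inner: "(\<integral>\<^sup>+x\<in>D_set (real k * \<tau>). ennreal (\<bar>W (real k * \<tau>) x ^ r * sym_diff k (\<tau> * \<phi> x) F x\<bar> powr ?q) \<partial>lebesgue) =
    (\<integral>\<^sup>+x. ennreal (\<theta>pow ?q (wdiff k r F' x \<tau>)) \<partial>lborel)" if "\<tau> > 0" for \<tau>
    unfolding nn_integral_completion
  proof (rule nn_integral_cong_AE)
    show "AE x in lborel. ennreal (\<bar>W (real k * \<tau>) x ^ r * sym_diff k (\<tau> * \<phi> x) F x\<bar> powr ?q) * indicator (D_set (real k * \<tau>)) x = ennreal (\<theta>pow ?q (wdiff k r F' x \<tau>))"
      using sym_diff_cong_AE[OF k that ae]
      by eventually_elim (simp add: wdiff_eq \<theta>pow_def indicator_def)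
  qed
  have "(\<integral>\<^sup>+\<tau>\<in>{0..t}. (\<integral>\<^sup>+x\<in>D_set (real k * \<tau>). ennreal (\<bar>W (real k * \<tau>) x ^ r * sym_diff k (\<tau> * \<phi> x) F x\<bar> powr ?q) \<partial>lebesgue) \<partial>lebesgue) =
    (\<integral>\<^sup>+\<tau>. (\<integral>\<^sup>+x. ennreal (\<theta>pow ?q (wdiff k r F' x \<tau>)) \<partial>lborel) * indicator {0<..t} \<tau> \<partial>lborel)"
    unfolding nn_integral_completion[of lborel "\<lambda>\<tau>. _ \<tau> * indicator {0..t} \<tau>"]
  proof (rule nn_integral_cong_AE)
    show "AE \<tau> in lborel. (\<integral>\<^sup>+x\<in>D_set (real k * \<tau>). ennreal (\<bar>W (real k * \<tau>) x ^ r * sym_diff k (\<tau> * \<phi> x) F x\<bar> powr ?q) \<partial>lebesgue) * indicator {0..t} \<tau> =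
      (\<integral>\<^sup>+x. ennreal (\<theta>pow ?q (wdiff k r F' x \<tau>)) \<partial>lborel) * indicator {0<..t} \<tau>"
      using AE_lborel_singleton[of "0::real"]
    proof eventually_elim
      case (elim \<tau>)
      show ?case
      proof (cases "\<tau> \<in> {0<..t}")
        case True
        then show ?thesis using inner[of \<tau>] by simp
      next
        case False
        then have "\<tau> \<notin> {0..t}" using elim by auto
        then show ?thesis using False by simp
      qed
    qed
  qed
  then show ?thesis using p by (simp add: averaged_modulus_def modular_wdiff_swap[OF modular_\<theta>pow[OF q] F'])
qed

text \<open>For \<open>p = \<infinity>\<close> and a finite modulus a, \<open>wdiff\<close> is at
  most a for each step and almost every x, so the right-hand side with \<open>\<theta>pos a\<close>
  is 0. For finite p the gauge is \<open>\<theta>pow\<close>.\<close>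

lemma Lp_norm_le_averaged_modulus:
  assumes k: "k \<ge> 1" and p: "1 \<le> p" and t: "t > 0"
    and F'[measurable]: "F' \<in> borel_measurable borel" and ae: "AE x in lborel. x \<in> {-1..1} \<longrightarrow> F x = F' x"
    and u: "u \<in> borel_measurable borel" and C: "Ca > 0" "Cb \<ge> 1"
    and le: "\<And>\<theta>. modular \<theta> \<Longrightarrow> (\<integral>\<^sup>+x. ennreal (\<theta> (\<bar>u x\<bar> / Ca)) * indicator {-1..1} x \<partial>lborel) \<le>
         ennreal Cb * diff_mean \<theta> k r F' t"
  shows "Lp_norm p {-1..1} u \<le> ennreal (Ca * Cb) * averaged_modulus k r p F t"
proof (cases "p = \<infinity>")
  case False
  then have q: "1 \<le> enn2real p" using p by (cases p) auto
  show ?thesis unfolding averaged_modulus_eq[OF k t False q F' ae]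
    using le[OF modular_\<theta>pow[OF q]]
    by (intro Lp_norm_le_of_modular_pow[OF False q borel_imp_lebesgue_on[OF u] C]) (simp add: nn_integral_lebesgue_on)
next
  case True
  show ?thesis
  proof (cases "modulus k r \<infinity> F t")
    case top
    then show ?thesis using True C by (simp add: averaged_modulus_def ennreal_mult_top)
  next
    case (real a)
    have a: "a \<ge> 0" by (rule real)
    have z: "(\<integral>\<^sup>+x. ennreal (\<theta>pos a (wdiff k r F' x \<tau>)) \<partial>lborel) = 0" if \<tau>: "\<tau> \<in> {0<..t}" for \<tau>
    proof -
      have Dm: "D_set (real k * \<tau>) \<in> sets lebesgue" using \<tau> k D_set_borel[of "real k * \<tau>"] by auto
      have le_a: "esssup (lebesgue_on (D_set (real k * \<tau>))) (\<lambda>x. ennreal \<bar>W (real k * \<tau>) x ^ r * sym_diff k (\<tau> * \<phi> x) F x\<bar>) \<le> ennreal a"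
        using SUP_upper[OF \<tau>, of "\<lambda>h. Lp_norm \<infinity> (D_set (real k * h)) (\<lambda>x. W (real k * h) x ^ r * sym_diff k (h * \<phi> x) F x)"] real
        by (simp add: modulus_def Lp_norm_def)
      have "AE x in lebesgue_on (D_set (real k * \<tau>)). ennreal \<bar>W (real k * \<tau>) x ^ r * sym_diff k (\<tau> * \<phi> x) F x\<bar> \<le> ennreal a"
        using esssup_AE by (rule AE_mp) (auto intro!: AE_I2 order_trans[OF _ le_a])
      then have 1: "AE x in lebesgue. x \<in> D_set (real k * \<tau>) \<longrightarrow> ennreal \<bar>W (real k * \<tau>) x ^ r * sym_diff k (\<tau> * \<phi> x) F x\<bar> \<le> ennreal a"
        using Dm by (simp add: AE_restrict_space_iff)
      have "\<tau> > 0" using \<tau> by simp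
      note 2 = AE_completion[OF sym_diff_cong_AE[OF k this ae]]
      have "AE x in lebesgue. ennreal (\<theta>pos a (wdiff k r F' x \<tau>)) = 0"
        using 1 2 by eventually_elim (use a in \<open>auto simp: \<theta>pos_def wdiff_eq indicator_def\<close>)
      then have "(\<integral>\<^sup>+x. ennreal (\<theta>pos a (wdiff k r F' x \<tau>)) \<partial>lebesgue) = 0" by (subst nn_integral_cong_AE[where v="\<lambda>_. 0"]) auto
      then show ?thesis by (simp add: nn_integral_completion)
    qed
    have "(\<integral>\<^sup>+\<tau>. (\<integral>\<^sup>+x. ennreal (\<theta>pos a (wdiff k r F' x \<tau>)) \<partial>lborel) * indicator {0<..t} \<tau> \<partial>lborel) = (\<integral>\<^sup>+\<tau>. 0 \<partial>(lborel :: real measure))"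
    proof (rule nn_integral_cong)
      fix \<tau> show "(\<integral>\<^sup>+x. ennreal (\<theta>pos a (wdiff k r F' x \<tau>)) \<partial>lborel) * indicator {0<..t} \<tau> = 0"
        using z[of \<tau>] by (cases "\<tau> \<in> {0<..t}") auto
    qed
    then have "(\<integral>\<^sup>+x. ennreal (\<theta>pos a (\<bar>u x\<bar> / Ca)) * indicator {-1..1} x \<partial>lborel) = 0"
      using le[OF modular_\<theta>pos[OF a]] by (simp add: modular_wdiff_swap[OF modular_\<theta>pos[OF a] F'])
    then have "Lp_norm \<infinity> {-1..1} u \<le> ennreal (Ca * a)"
      by (intro Lp_norm_le_of_modular_pos[OF borel_imp_lebesgue_on[OF u] C(1) a]) (simp add: nn_integral_lebesgue_on)
    also have "\<dots> \<le> ennreal (Ca * Cb * a)"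
    proof (rule ennreal_leI)
      have "(Ca * a) * 1 \<le> (Ca * a) * Cb" using C a by (intro mult_left_mono) auto
      then show "Ca * a \<le> Ca * Cb * a" by (simp add: mult_ac)
    qed
    also have "\<dots> = ennreal (Ca * Cb) * ennreal a" using C a by (intro ennreal_mult) auto
    finally show ?thesis using True real by (simp add: averaged_modulus_def)
  qed
qed

lemma ennreal_inverse_mult_le_iff:
  assumes c: "(c :: real) > 0"
  shows "ennreal (1 / c) * x \<le> y \<longleftrightarrow> x \<le> ennreal c * y"
proof -
  have 1: "ennreal c * ennreal (1 / c) = 1" using c by (subst ennreal_mult[symmetric]) auto
  show ?thesis
  proof
    assume "ennreal (1 / c) * x \<le> y"
    then have "ennreal c * (ennreal (1 / c) * x) \<le> ennreal c * y" by (rule mult_left_mono) simp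
    then show "x \<le> ennreal c * y" by (simp only: mult.assoc[symmetric] 1 mult_1)
  next
    assume "x \<le> ennreal c * y"
    then have "ennreal (1 / c) * x \<le> ennreal (1 / c) * (ennreal c * y)" by (rule mult_left_mono) simp
    then show "ennreal (1 / c) * x \<le> y" by (simp only: mult.assoc[symmetric] mult.commute[of "ennreal (1 / c)"] 1 mult_1)
  qed
qed

text \<open>\<open>Lp_norm_le_modular\<close> for v and its multiple with constant 1/c, which covers
  all p at once.\<close>

lemma Lp_norm_cmult_le:
  assumes p: "1 \<le> p" and c: "c > 0" and v: "v \<in> borel_measurable (lebesgue_on A)"
  shows "ennreal c * Lp_norm p A v \<le> Lp_norm p A (\<lambda>x. c * v x)"
proof -
  have "Lp_norm p A v \<le> ennreal (1 / c * 1) * Lp_norm p A (\<lambda>x. c * v x)"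
    using c v by (intro Lp_norm_le_modular[OF p v]) (auto simp: abs_mult mult.commute)
  then have "Lp_norm p A v \<le> ennreal (1 / c) * Lp_norm p A (\<lambda>x. c * v x)" by simp
  then show ?thesis using c ennreal_inverse_mult_le_iff[of "1 / c"] by simp
qed

text \<open>The infimum is tested with one competitor, the r-fold antiderivative of the blended
  approximant of \<open>f\<^sup>(\<^sup>r\<^sup>)\<close>; each of the two terms is bounded
  separately by the averaged modulus.\<close>

theorem K_functional_le_averaged_modulus:
  assumes k: "k \<ge> 1" and p: "1 \<le> p"
  shows "\<exists>C>0. \<forall>f\<in>B_class p r. \<forall>t::real. 0 < t \<and> t \<le> 2 \<longrightarrow>
    K_functional k r p ((deriv ^^ r) f) (t ^ k) \<le> ennreal C * averaged_modulus k r p ((deriv ^^ r) f) t"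
proof -
  obtain Ca Cb :: real where C: "Ca > 0" "Cb \<ge> 1"
   and ga: "\<And>F t. F \<in> borel_measurable borel \<Longrightarrow> (\<integral>\<^sup>+x. ennreal \<bar>F x * \<phi> x ^ r\<bar> * indicator {-1..1} x \<partial>lborel) < \<infinity> \<Longrightarrow> 0 < t \<Longrightarrow> t \<le> 2 \<Longrightarrow>
    \<exists>D. (\<forall>m<k. \<forall>x. (D m has_real_derivative D (Suc m) x) (at x)) \<and> continuous_on UNIV (D k) \<and>
     (\<forall>\<theta>. modular \<theta> \<longrightarrow>
       (\<integral>\<^sup>+x. ennreal (\<theta> (\<bar>(F x - D 0 x) * \<phi> x ^ r\<bar> / Ca)) * indicator {-1..1} x \<partial>lborel) \<le>
         ennreal Cb * diff_mean \<theta> k r F t \<and>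
       (\<integral>\<^sup>+x. ennreal (\<theta> (\<bar>t ^ k * (D k x * \<phi> x ^ (k + r))\<bar> / Ca)) * indicator {-1..1} x \<partial>lborel) \<le>
         ennreal Cb * diff_mean \<theta> k r F t)"
    using global_approximation[OF k, of r] by blast
  have "K_functional k r p F (t ^ k) \<le> ennreal (2 * (Ca * Cb)) * averaged_modulus k r p F t"
    if f: "f \<in> B_class p r" and t: "0 < t" "t \<le> 2" and F_def: "F = (deriv ^^ r) f" for f t F
  proof -
    have FL: "(\<lambda>x. F x * \<phi> x ^ r) \<in> Lp_space p {-1..1}" using B_class_weighted[OF f] F_def by simp
    then have Fm[measurable]: "(\<lambda>x. F x * \<phi> x ^ r) \<in> borel_measurable (lebesgue_on {-1..1})" by (simp add: Lp_space_def)
    obtain F' where F'[measurable]: "F' \<in> borel_measurable borel" and ae: "AE x in lborel. x \<in> {-1..1} \<longrightarrow> F x = F' x"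
      using Borel_representative[OF Fm] by blast
    have ae2: "AE x in lebesgue_on {-1..1}. F x = F' x"
      using AE_completion[OF ae] by (simp add: AE_restrict_space_iff)
    have "(\<integral>\<^sup>+x. ennreal \<bar>F' x * \<phi> x ^ r\<bar> * indicator {-1..1} x \<partial>lborel) = (\<integral>\<^sup>+x. ennreal \<bar>F' x * \<phi> x ^ r\<bar> \<partial>lebesgue_on {-1..1})"
      by (simp add: nn_integral_lebesgue_on)
    also have "\<dots> = (\<integral>\<^sup>+x. ennreal \<bar>F x * \<phi> x ^ r\<bar> \<partial>lebesgue_on {-1..1})"
      using ae2 by (intro nn_integral_cong_AE) (auto elim: eventually_mono)
    also have "\<dots> < \<infinity>" by (rule Lp_space_imp_integrable[OF p FL])
    finally have fin: "(\<integral>\<^sup>+x. ennreal \<bar>F' x * \<phi> x ^ r\<bar> * indicator {-1..1} x \<partial>lborel) < \<infinity>" .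
    obtain D where D: "(\<forall>m<k. \<forall>x. (D m has_real_derivative D (Suc m) x) (at x)) \<and> continuous_on UNIV (D k) \<and>
     (\<forall>\<theta>. modular \<theta> \<longrightarrow>
       (\<integral>\<^sup>+x. ennreal (\<theta> (\<bar>(F' x - D 0 x) * \<phi> x ^ r\<bar> / Ca)) * indicator {-1..1} x \<partial>lborel) \<le>
         ennreal Cb * diff_mean \<theta> k r F' t \<and>
       (\<integral>\<^sup>+x. ennreal (\<theta> (\<bar>t ^ k * (D k x * \<phi> x ^ (k + r))\<bar> / Ca)) * indicator {-1..1} x \<partial>lborel) \<le>
         ennreal Cb * diff_mean \<theta> k r F' t)"
      by (rule exE[OF ga[OF F' fin t]])
    note D1 = D[THEN conjunct1] and D2 = D[THEN conjunct2, THEN conjunct1] and D3 = D[THEN conjunct2, THEN conjunct2, THEN spec, THEN mp]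
    have cont0: "continuous_on UNIV (D 0)" using D1 k by (auto intro!: continuous_at_imp_continuous_on DERIV_isCont)
    have [measurable]: "D 0 \<in> borel_measurable borel" "D k \<in> borel_measurable borel" using cont0 D2 by (auto intro: borel_measurable_continuous_onI)
    \<comment> \<open>\<open>E 0\<close> is the competitor; its r-th derivative is the approximant
      \<open>D 0\<close>.\<close>
    obtain E where E1: "\<forall>j<k + r. \<forall>x. (E j has_real_derivative E (Suc j) x) (at x)" and E2: "\<forall>m. E (r + m) = D m"
      using antiderivative_chain[OF D1 cont0, of r] by blast
    have E0: "(deriv ^^ r) (E 0) = D 0" using higher_deriv_chain[OF E1, of r] E2[rule_format, of 0] by simp
    have Ek: "(deriv ^^ (k + r)) (E 0) = D k" using higher_deriv_chain[OF E1 order_refl] E2[rule_format, of k] by (simp add: add.commute)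
    have "E (k + r) = D k" using E2[rule_format, of k] by (simp add: add.commute)
    then have B: "E 0 \<in> B_class p (k + r)" using k D2 by (intro chain_in_B_class E1) auto
    let ?A = "averaged_modulus k r p F t"
    have "K_functional k r p F (t ^ k) \<le> Lp_norm p {-1..1} (\<lambda>x. (F x - D 0 x) * \<phi> x ^ r) + ennreal (t ^ k) * Lp_norm p {-1..1} (\<lambda>x. D k x * \<phi> x ^ (k + r))"
      unfolding K_functional_def using INF_lower[OF B, of "\<lambda>g. Lp_norm p {-1..1} (\<lambda>x. (F x - (deriv ^^ r) g x) * \<phi> x ^ r) +
        ennreal (t ^ k) * Lp_norm p {-1..1} (\<lambda>x. (deriv ^^ (k + r)) g x * \<phi> x ^ (k + r))"] by (simp only: E0 Ek)
    also have "\<dots> \<le> ennreal (Ca * Cb) * ?A + ennreal (Ca * Cb) * ?A"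
    proof (rule add_mono)
      have m: "(\<lambda>x. (F' x - D 0 x) * \<phi> x ^ r) \<in> borel_measurable (lebesgue_on {-1..1})" by (intro borel_imp_lebesgue_on) measurable
      have "Lp_norm p {-1..1} (\<lambda>x. (F x - D 0 x) * \<phi> x ^ r) = Lp_norm p {-1..1} (\<lambda>x. (F' x - D 0 x) * \<phi> x ^ r)"
        by (rule Lp_norm_cong_AE(2)[symmetric, OF _ _ m]) (use ae2 in \<open>auto elim: eventually_mono\<close>)
      also have "\<dots> \<le> ennreal (Ca * Cb) * ?A"
        by (rule Lp_norm_le_averaged_modulus[OF k p t(1) F' ae _ C D3[THEN conjunct1]]) measurable
      finally show "Lp_norm p {-1..1} (\<lambda>x. (F x - D 0 x) * \<phi> x ^ r) \<le> ennreal (Ca * Cb) * ?A" .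
      have "ennreal (t ^ k) * Lp_norm p {-1..1} (\<lambda>x. D k x * \<phi> x ^ (k + r)) \<le> Lp_norm p {-1..1} (\<lambda>x. t ^ k * (D k x * \<phi> x ^ (k + r)))"
        using t by (intro Lp_norm_cmult_le[OF p] borel_imp_lebesgue_on) auto
      also have "\<dots> \<le> ennreal (Ca * Cb) * ?A"
        by (rule Lp_norm_le_averaged_modulus[OF k p t(1) F' ae _ C D3[THEN conjunct2]]) measurable
      finally show "ennreal (t ^ k) * Lp_norm p {-1..1} (\<lambda>x. D k x * \<phi> x ^ (k + r)) \<le> ennreal (Ca * Cb) * ?A" .
    qed
    also have "\<dots> = ennreal (2 * (Ca * Cb)) * ?A"
    proof -
      have "0 \<le> Ca * Cb" using C by simp
      then have "ennreal (2 * (Ca * Cb)) = ennreal (Ca * Cb) + ennreal (Ca * Cb)" by (simp only: mult_2 ennreal_plus)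
      then show ?thesis by (simp only: distrib_right)
    qed
    finally show ?thesis .
  qed
  then show ?thesis using C by (intro exI[of _ "2 * (Ca * Cb)"]) auto
qed

text \<open>A mean does not exceed a supremum: the q-th power of the norm for each single step is at
  most the q-th power of the modulus, and the interval of steps has length t.\<close>

lemma averaged_modulus_le_modulus:
  assumes k: "k \<ge> 1" and p: "1 \<le> p" and t: "t > 0"
  shows "averaged_modulus k r p F t \<le> modulus k r p F t"
proof (cases "p = \<infinity>")
  case True
  then show ?thesis by (simp add: averaged_modulus_def)
next
  case False
  define q where "q = enn2real p"
  have q: "1 \<le> q" using p False unfolding q_def by (cases p) auto
  show ?thesis
  proof (cases "modulus k r p F t")
    case (real m)
    define J where "J \<tau> = (\<integral>\<^sup>+x\<in>D_set (real k * \<tau>). ennreal (\<bar>W (real k * \<tau>) x ^ r * sym_diff k (\<tau> * \<phi> x) F x\<bar> powr q) \<partial>lebesgue)" for \<tau>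
    have J: "J \<tau> \<le> ennreal (m powr q)" if \<tau>: "\<tau> \<in> {0<..t}" for \<tau>
    proof -
      have Dm: "D_set (real k * \<tau>) \<in> sets lebesgue" using \<tau> k D_set_borel[of "real k * \<tau>"] by auto
      have "ennreal_powr (J \<tau>) (1 / q) \<le> ennreal m"
        using SUP_upper[OF \<tau>, of "\<lambda>h. Lp_norm p (D_set (real k * h)) (\<lambda>x. W (real k * h) x ^ r * sym_diff k (h * \<phi> x) F x)"] real False
        unfolding J_def using Dm by (simp add: modulus_def Lp_norm_def q_def nn_integral_restrict_space)
      then have fin: "J \<tau> \<noteq> \<infinity>" and "enn2real (J \<tau>) powr (1 / q) \<le> m" using real
        by (auto simp: ennreal_powr_def top_unique split: if_splits)
      then have "(enn2real (J \<tau>) powr (1 / q)) powr q \<le> m powr q" using q by (intro powr_mono2) auto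
      then have "enn2real (J \<tau>) \<le> m powr q" using q by (simp add: powr_powr)
      then show ?thesis using fin by (metis ennreal_enn2real ennreal_leI infinity_ennreal_def less_top)
    qed
    have "(\<integral>\<^sup>+\<tau>\<in>{0..t}. J \<tau> \<partial>lebesgue) \<le> (\<integral>\<^sup>+\<tau>. ennreal (m powr q) * indicator {0..t} \<tau> \<partial>lborel)"
      unfolding nn_integral_completion
    proof (rule nn_integral_mono_AE)
      show "AE \<tau> in lborel. J \<tau> * indicator {0..t} \<tau> \<le> ennreal (m powr q) * indicator {0..t} \<tau>"
        using AE_lborel_singleton[of "0::real"] by eventually_elim (use J in \<open>auto simp: indicator_def\<close>)
    qed
    also have "\<dots> = ennreal (m powr q) * ennreal t" using t by (simp add: nn_integral_cmult_indicator)
    finally have "ennreal (1 / t) * (\<integral>\<^sup>+\<tau>\<in>{0..t}. J \<tau> \<partial>lebesgue) \<le> ennreal (1 / t) * (ennreal (m powr q) * ennreal t)" by (rule mult_left_mono) simp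
    also have "\<dots> = ennreal (m powr q)" using t by (subst ennreal_mult[symmetric], simp, simp, subst ennreal_mult[symmetric]) auto
    finally have "ennreal_powr (ennreal (1 / t) * (\<integral>\<^sup>+\<tau>\<in>{0..t}. J \<tau> \<partial>lebesgue)) (1 / q) \<le> ennreal_powr (ennreal (m powr q)) (1 / q)"
      using q by (intro ennreal_powr_mono) auto
    also have "\<dots> = ennreal m" using q real by (simp add: ennreal_powr_def powr_powr)
    finally show ?thesis using False real unfolding averaged_modulus_def J_def q_def by simp
  qed simp
qed

lemma modulus_le_K_functional:
  assumes k: "k \<ge> 1" and p: "1 \<le> p" and t: "t > 0" and f: "f \<in> B_class p r"
  shows "modulus k r p ((deriv ^^ r) f) t \<le> ennreal (32 * real (k + 1) ^ 2 * (2 * real k) ^ k) * K_functional k r p ((deriv ^^ r) f) (t ^ k)"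
proof -
  let ?C = "32 * real (k + 1) ^ 2 * (2 * real k) ^ k"
  have C: "?C > 0" using k by simp
  have bound: "modulus k r p ((deriv ^^ r) f) t \<le> ennreal ?C *
      (Lp_norm p {-1..1} (\<lambda>x. ((deriv ^^ r) f x - (deriv ^^ r) g x) * \<phi> x ^ r) + ennreal (t ^ k) * Lp_norm p {-1..1} (\<lambda>x. (deriv ^^ (k + r)) g x * \<phi> x ^ (k + r)))"
    if g: "g \<in> B_class p (k + r)" for g
    unfolding modulus_def
  proof (rule SUP_least)
    fix h assume h: "h \<in> {0<..t}"
    have h0: "h > 0" and "h ^ k \<le> t ^ k" using h by (auto intro: power_mono)
    have "Lp_norm p (D_set (real k * h)) (\<lambda>x. W (real k * h) x ^ r * sym_diff k (h * \<phi> x) ((deriv ^^ r) f) x) \<le> ennreal ?C *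
      (Lp_norm p {-1..1} (\<lambda>x. ((deriv ^^ r) f x - (deriv ^^ r) g x) * \<phi> x ^ r) + ennreal (h ^ k) * Lp_norm p {-1..1} (\<lambda>x. (deriv ^^ (k + r)) g x * \<phi> x ^ (k + r)))"
      by (rule modulus_le_K_functional_term[OF k p h0 f g])
    also have "\<dots> \<le> ennreal ?C *
      (Lp_norm p {-1..1} (\<lambda>x. ((deriv ^^ r) f x - (deriv ^^ r) g x) * \<phi> x ^ r) + ennreal (t ^ k) * Lp_norm p {-1..1} (\<lambda>x. (deriv ^^ (k + r)) g x * \<phi> x ^ (k + r)))"
      using \<open>h ^ k \<le> t ^ k\<close> by (intro mult_left_mono add_left_mono mult_right_mono ennreal_leI) auto
    finally show "Lp_norm p (D_set (real k * h)) (\<lambda>x. W (real k * h) x ^ r * sym_diff k (h * \<phi> x) ((deriv ^^ r) f) x) \<le> ennreal ?C *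
      (Lp_norm p {-1..1} (\<lambda>x. ((deriv ^^ r) f x - (deriv ^^ r) g x) * \<phi> x ^ r) + ennreal (t ^ k) * Lp_norm p {-1..1} (\<lambda>x. (deriv ^^ (k + r)) g x * \<phi> x ^ (k + r)))" .
  qed
  \<comment> \<open>With the constant moved to the left, the claim says that a fixed value is a
    lower bound for all competitors, and the infimum can be taken.\<close>
  have "ennreal (1 / ?C) * modulus k r p ((deriv ^^ r) f) t \<le> K_functional k r p ((deriv ^^ r) f) (t ^ k)"
    unfolding K_functional_def by (intro INF_greatest iffD2[OF ennreal_inverse_mult_le_iff[OF C]] bound)
  then show ?thesis by (rule iffD1[OF ennreal_inverse_mult_le_iff[OF C]])
qed

theorem theorem2p7:
  fixes k r :: nat and p :: ennreal
  assumes "k \<ge> 1" and "1 \<le> p"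
  shows "\<exists>c1 c2 :: real. c1 > 0 \<and> c2 > 0 \<and>
    (\<forall>f \<in> B_class p r. \<forall>t::real. 0 < t \<and> t \<le> 2 / real k \<longrightarrow>
       ennreal c1 * K_functional k r p ((deriv ^^ r) f) (t ^ k)
         \<le> averaged_modulus k r p ((deriv ^^ r) f) t \<and>
       averaged_modulus k r p ((deriv ^^ r) f) t \<le> modulus k r p ((deriv ^^ r) f) t \<and>
       modulus k r p ((deriv ^^ r) f) t
         \<le> ennreal c2 * K_functional k r p ((deriv ^^ r) f) (t ^ k))"
proof -
  obtain C where C: "C > 0" and K: "\<And>f t. f \<in> B_class p r \<Longrightarrow> 0 < t \<Longrightarrow> t \<le> 2 \<Longrightarrow>
      K_functional k r p ((deriv ^^ r) f) (t ^ k) \<le> ennreal C * averaged_modulus k r p ((deriv ^^ r) f) t"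
    using K_functional_le_averaged_modulus[OF assms] by blast
  have lower: "ennreal (1 / C) * K_functional k r p ((deriv ^^ r) f) (t ^ k) \<le> averaged_modulus k r p ((deriv ^^ r) f) t"
    if "f \<in> B_class p r" "0 < t" "t \<le> 2 / real k" for f t
  proof -
    \<comment> \<open>The lower estimate holds for all t up to 2, which includes the range up to
      2/k.\<close>
    have "2 / real k \<le> 2" using assms(1) by (simp add: divide_le_eq)
    then show ?thesis unfolding ennreal_inverse_mult_le_iff[OF C] using that by (intro K) auto
  qed
  show ?thesis
    using C assms lower averaged_modulus_le_modulus[OF assms] modulus_le_K_functional[OF assms]
    by (intro exI[of _ "1 / C"] exI[of _ "32 * real (k + 1) ^ 2 * (2 * real k) ^ k"]) auto
qed

end
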